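(* Let $\Gamma=\bigsqcup_{x\in\Delta}\Lambda x$ be an infinite finitely generated virtually abelian group, where $\Lambda$ is a finite-index normal subgroup identified with $\mathbb{Z}^m$, $m\ge1$, and $\Delta\ni\mathrm{id}$ is a set of coset representatives. Let $\mu$ be a probability measure on $\Gamma$ with finite second moment such that the support of $\mu$ generates $\Gamma$ as a semigroup, and let $(G,c)$ be the corresponding weighted diagram. If $\mu$ has period $q$, then $$\left\|q^{-1}\sum_{i=0}^{q-1}\mu_{qn+i}-\mathcal{N}_{qn,\Sigma,\zeta_c}\right\|_{\mathrm{TV}}\to0\quad\text{as }n\to\infty,$$ where the covariance matrix $\Sigma$ is given by $$\langle v_1,\Sigma v_2\rangle=\sum_{e\in E(G)}u_1(e)u_2(e)c(e)-\sum_{e\in E(G)}u_1(e)c(e)\sum_{e\in E(G)}u_2(e)c(e),$$ with $u_i$ the unique harmonic part of $\widehat v_i$ for $v_i\in\mathbb{R}^m$, $i=1,2$.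
   Context: $\mu_n=\mu^{*n}$. The period of $\mu$ is the greatest common divisor of $\{n\ge1:\mu_n(\mathrm{id})>0\}$. Finite second moment: $\sum_\gamma|\gamma|^2\mu(\gamma)<\infty$ for a word metric $|\cdot|$. $\|\cdot\|_{\mathrm{TV}}$ is half of the $\ell^1$-norm. Weighted diagram. Let $S=\operatorname{supp}\mu$. $G$ is the multi-digraph with vertex set $V(G)=\Lambda\backslash\Gamma$ (finite, identified with $\Delta$; write $[\gamma]=\Lambda\gamma$) and edge set $E(G)=\{([\gamma],s):[\gamma]\in\Lambda\backslash\Gamma,\ s\in S\cup S^{-1}\}$; the edge $e=([\gamma],s)$ has origin $oe=[\gamma]$, terminus $te=[\gamma s]$, and reverse edge $\bar e=([\gamma s],s^{-1})$. Put $p(e)=\mu(s)$, let $\pi$ be the uniform distribution on $V(G)$ (the stationary distribution of the induced irreducible Markov chain), and $c(e)=\pi(oe)p(e)$. Harmonic forms. A $1$-form is $\omega:E(G)\to\mathbb{R}$ with $\omega(\bar e)=-\omega(e)$; $\ell^2_c(G,\mathbb{R})$ is the space of $1$-forms with $\sum_e\omega(e)^2c(e)<\infty$. For $f:V(G)\to\mathbb{R}$, $df(e)=f(te)-f(oe)$. For $\omega\in\ell^2_c(G,\mathbb{R})$, $d^*\omega(x)=-\frac1{\pi(x)}\sum_{e:oe=x}c(e)\omega(e)$ and $\chi_c(\omega)=\sum_{e}\omega(e)c(e)$. $\omega$ is harmonic if $d^*\omega+\chi_c(\omega)=0$ on $V(G)$. Each $\omega\in\ell_c^2(G,\mathbb{R})$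 is $\omega=u+df$ with a unique harmonic $u$, called its harmonic part. Potentials. $\Phi:\Gamma\to\mathbb{Z}^m$ is $\Phi(vx)=v$ for $v\in\Lambda=\mathbb{Z}^m$, $x\in\Delta$; for $e=([\gamma],s)$, $\Phi_e=\Phi(\gamma s)-\Phi(\gamma)$ (independent of the representative $\gamma$). For $v\in\mathbb{R}^m$, $\widehat v(e)=\langle v,\Phi_e\rangle$ (standard inner product), which lies in $\ell_c^2(G,\mathbb{R})$. $\zeta_c=\sum_{e\in E(G)}c(e)\Phi_e\in\mathbb{R}^m$. Gaussian. For a positive definite $m\times m$ matrix $\Sigma$, $\xi_\Sigma(v)=(2\pi)^{-m/2}(\det\Sigma)^{-1/2}\exp(-\frac12\langle v,\Sigma^{-1}v\rangle)$, $v\in\mathbb{R}^m$, and for $\gamma\in\Gamma$ $$\mathcal{N}_{n,\Sigma,\zeta_c}(\gamma)=\pi([\gamma])\,\frac{1}{\sum_{w\in\mathbb{Z}^m}\xi_{n\Sigma}(w)}\,\xi_{n\Sigma}(\Phi(\gamma)-n\zeta_c).$$ *)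

theory Defs
  imports "HOL-Probability.Probability" "HOL-Algebra.Generated_Groups"
begin

section \<open>Random walks on groups\<close>

definition word_prod :: "('a, 'b) monoid_scheme \<Rightarrow> 'a list \<Rightarrow> 'a" where
  "word_prod G ws = foldr (mult G) ws (one G)"

definition finitely_generated_group :: "('a, 'b) monoid_scheme \<Rightarrow> bool" where
  "finitely_generated_group G \<longleftrightarrow>
     (\<exists>A. finite A \<and> A \<subseteq> carrier G \<and> generate G A = carrier G)"

definition semigroup_generates :: "('a, 'b) monoid_scheme \<Rightarrow> 'a set \<Rightarrow> bool" where
  "semigroup_generates G A \<longleftrightarrow>
     {word_prod G ws | ws. ws \<noteq> [] \<and> set ws \<subseteq> A} = carrier G"

definition word_length :: "('a, 'b) monoid_scheme \<Rightarrow> 'a set \<Rightarrow> 'a \<Rightarrow> nat" where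
  "word_length G A g =
     (LEAST n. \<exists>ws. length ws = n \<and> set ws \<subseteq> A \<union> m_inv G ` A \<and> word_prod G ws = g)"

text \<open>Word metrics of different finite generating sets are bi-Lipschitz equivalent, so the
  condition does not depend on the choice of \<open>A\<close>.\<close>

definition finite_second_moment :: "('a, 'b) monoid_scheme \<Rightarrow> 'a pmf \<Rightarrow> bool" where
  "finite_second_moment G \<mu> \<longleftrightarrow>
     (\<exists>A. finite A \<and> A \<subseteq> carrier G \<and> generate G A = carrier G \<and>
          (\<lambda>g. (real (word_length G A g))\<^sup>2 * pmf \<mu> g) summable_on carrier G)"

fun conv_power :: "('a, 'b) monoid_scheme \<Rightarrow> 'a pmf \<Rightarrow> nat \<Rightarrow> 'a pmf" where
  "conv_power G \<mu> 0 = return_pmf (one G)"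
| "conv_power G \<mu> (Suc n) = map_pmf (\<lambda>(x, y). mult G x y) (pair_pmf (conv_power G \<mu> n) \<mu>)"

definition period :: "('a, 'b) monoid_scheme \<Rightarrow> 'a pmf \<Rightarrow> nat" where
  "period G \<mu> = Gcd {n. 1 \<le> n \<and> pmf (conv_power G \<mu> n) (one G) > 0}"

text \<open>Valued in \<^typ>\<open>ennreal\<close>, so that convergence of the norm to 0 includes that the
  \<open>\<ell>\<^sup>1\<close>-norm is eventually finite (a real \<^const>\<open>infsum\<close> is 0 on non-summable functions).\<close>

definition tv_norm :: "'a set \<Rightarrow> ('a \<Rightarrow> real) \<Rightarrow> ennreal" where
  "tv_norm A f = (\<Sum>\<^sub>\<infinity>x\<in>A. ennreal \<bar>f x\<bar>) / 2"


section \<open>The weighted diagram\<close>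

text \<open>Vertices are the right cosets \<open>[\<gamma>] = \<Lambda>\<gamma>\<close>. An edge is a pair \<open>([\<gamma>], s)\<close>.\<close>

definition diag_V :: "('a, 'b) monoid_scheme \<Rightarrow> 'a set \<Rightarrow> 'a set set" where
  "diag_V G L = rcosets\<^bsub>G\<^esub> L"

definition diag_E :: "('a, 'b) monoid_scheme \<Rightarrow> 'a set \<Rightarrow> 'a pmf \<Rightarrow> ('a set \<times> 'a) set" where
  "diag_E G L \<mu> = diag_V G L \<times> (set_pmf \<mu> \<union> m_inv G ` set_pmf \<mu>)"

definition edge_org :: "'a set \<times> 'a \<Rightarrow> 'a set" where
  "edge_org e = fst e"

definition edge_ter :: "('a, 'b) monoid_scheme \<Rightarrow> 'a set \<times> 'a \<Rightarrow> 'a set" where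
  "edge_ter G e = fst e #>\<^bsub>G\<^esub> snd e"

definition edge_rev :: "('a, 'b) monoid_scheme \<Rightarrow> 'a set \<times> 'a \<Rightarrow> 'a set \<times> 'a" where
  "edge_rev G e = (edge_ter G e, m_inv G (snd e))"

definition vertex_weight :: "('a, 'b) monoid_scheme \<Rightarrow> 'a set \<Rightarrow> 'a set \<Rightarrow> real" where
  "vertex_weight G L x = 1 / real (card (diag_V G L))"

definition edge_weight ::
    "('a, 'b) monoid_scheme \<Rightarrow> 'a set \<Rightarrow> 'a pmf \<Rightarrow> 'a set \<times> 'a \<Rightarrow> real" where
  "edge_weight G L \<mu> e = vertex_weight G L (edge_org e) * pmf \<mu> (snd e)"


section \<open>Harmonic forms\<close>

definition l2_form ::
    "('a, 'b) monoid_scheme \<Rightarrow> 'a set \<Rightarrow> 'a pmf \<Rightarrow> ('a set \<times> 'a \<Rightarrow> real) \<Rightarrow> bool" where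
  "l2_form G L \<mu> \<omega> \<longleftrightarrow>
     (\<forall>e\<in>diag_E G L \<mu>. \<omega> (edge_rev G e) = - \<omega> e) \<and>
     (\<lambda>e. (\<omega> e)\<^sup>2 * edge_weight G L \<mu> e) summable_on diag_E G L \<mu>"

definition form_d ::
    "('a, 'b) monoid_scheme \<Rightarrow> ('a set \<Rightarrow> real) \<Rightarrow> 'a set \<times> 'a \<Rightarrow> real" where
  "form_d G f e = f (edge_ter G e) - f (edge_org e)"

definition form_d_star ::
    "('a, 'b) monoid_scheme \<Rightarrow> 'a set \<Rightarrow> 'a pmf \<Rightarrow> ('a set \<times> 'a \<Rightarrow> real) \<Rightarrow> 'a set \<Rightarrow> real" where
  "form_d_star G L \<mu> \<omega> x =
     - (1 / vertex_weight G L x) *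
       (\<Sum>\<^sub>\<infinity>e\<in>{e \<in> diag_E G L \<mu>. edge_org e = x}. edge_weight G L \<mu> e * \<omega> e)"

definition form_chi ::
    "('a, 'b) monoid_scheme \<Rightarrow> 'a set \<Rightarrow> 'a pmf \<Rightarrow> ('a set \<times> 'a \<Rightarrow> real) \<Rightarrow> real" where
  "form_chi G L \<mu> \<omega> = (\<Sum>\<^sub>\<infinity>e\<in>diag_E G L \<mu>. \<omega> e * edge_weight G L \<mu> e)"

definition harmonic_form ::
    "('a, 'b) monoid_scheme \<Rightarrow> 'a set \<Rightarrow> 'a pmf \<Rightarrow> ('a set \<times> 'a \<Rightarrow> real) \<Rightarrow> bool" where
  "harmonic_form G L \<mu> \<omega> \<longleftrightarrow>
     l2_form G L \<mu> \<omega> \<and> (\<forall>x\<in>diag_V G L. form_d_star G L \<mu> \<omega> x + form_chi G L \<mu> \<omega> = 0)"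

text \<open>Forms are functions on the edge set only; the \<^const>\<open>extensional\<close> condition fixes their
  irrelevant values elsewhere, which makes the description unique.\<close>

definition harmonic_part ::
    "('a, 'b) monoid_scheme \<Rightarrow> 'a set \<Rightarrow> 'a pmf \<Rightarrow> ('a set \<times> 'a \<Rightarrow> real)
       \<Rightarrow> 'a set \<times> 'a \<Rightarrow> real" where
  "harmonic_part G L \<mu> \<omega> =
     (THE u. u \<in> extensional (diag_E G L \<mu>) \<and> harmonic_form G L \<mu> u \<and>
             (\<exists>f. \<forall>e\<in>diag_E G L \<mu>. \<omega> e = u e + form_d G f e))"


section \<open>Potentials\<close>

definition int_vec_group :: "(int ^ 'm) monoid" where
  "int_vec_group = \<lparr>carrier = UNIV, mult = (+), one = 0\<rparr>"

definition real_vec :: "int ^ 'm \<Rightarrow> real ^ 'm" where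
  "real_vec v = (\<chi> i. of_int (v $ i))"

definition coset_representatives ::
    "('a, 'b) monoid_scheme \<Rightarrow> 'a set \<Rightarrow> 'a set \<Rightarrow> bool" where
  "coset_representatives G L D \<longleftrightarrow>
     D \<subseteq> carrier G \<and> carrier G = (\<Union>x\<in>D. L #>\<^bsub>G\<^esub> x) \<and>
     disjoint_family_on (\<lambda>x. L #>\<^bsub>G\<^esub> x) D"

text \<open>In what follows \<open>\<iota>\<close> is the identification of \<open>\<int>\<^sup>m\<close> with the subgroup \<open>\<Lambda>\<close>.\<close>

definition potential ::
    "('a, 'b) monoid_scheme \<Rightarrow> (int ^ 'm \<Rightarrow> 'a) \<Rightarrow> 'a set \<Rightarrow> 'a \<Rightarrow> int ^ 'm" where
  "potential G \<iota> D g = (THE v. \<exists>x\<in>D. g = mult G (\<iota> v) x)"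

text \<open>The value on an edge \<open>([\<gamma>], s)\<close> does not depend on the representative \<open>\<gamma>\<close>.\<close>

definition edge_potential ::
    "('a, 'b) monoid_scheme \<Rightarrow> (int ^ 'm \<Rightarrow> 'a) \<Rightarrow> 'a set \<Rightarrow> 'a set \<times> 'a \<Rightarrow> real ^ 'm" where
  "edge_potential G \<iota> D e =
     (let g = (SOME g. g \<in> edge_org e)
      in real_vec (potential G \<iota> D (mult G g (snd e)) - potential G \<iota> D g))"

definition hat_form ::
    "('a, 'b) monoid_scheme \<Rightarrow> (int ^ 'm \<Rightarrow> 'a) \<Rightarrow> 'a set \<Rightarrow> real ^ 'm \<Rightarrow> 'a set \<times> 'a \<Rightarrow> real" where
  "hat_form G \<iota> D v e = inner v (edge_potential G \<iota> D e)"

definition drift ::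
    "('a, 'b) monoid_scheme \<Rightarrow> 'a set \<Rightarrow> 'a pmf \<Rightarrow> (int ^ 'm \<Rightarrow> 'a) \<Rightarrow> 'a set \<Rightarrow> real ^ 'm" where
  "drift G L \<mu> \<iota> D =
     (\<Sum>\<^sub>\<infinity>e\<in>diag_E G L \<mu>. edge_weight G L \<mu> e *\<^sub>R edge_potential G \<iota> D e)"


section \<open>Gaussians\<close>

definition pos_def_matrix :: "real ^ 'm ^ 'm \<Rightarrow> bool" where
  "pos_def_matrix M \<longleftrightarrow> transpose M = M \<and> (\<forall>v. v \<noteq> 0 \<longrightarrow> 0 < inner v (M *v v))"

definition gauss_density :: "real ^ 'm ^ 'm \<Rightarrow> real ^ 'm \<Rightarrow> real" where
  "gauss_density M v =
     (2 * pi) powr (- (real CARD('m) / 2)) * det M powr (- (1 / 2)) *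
     exp (- (1 / 2) * inner v (matrix_inv M *v v))"

definition gauss_group ::
    "('a, 'b) monoid_scheme \<Rightarrow> 'a set \<Rightarrow> (int ^ 'm \<Rightarrow> 'a) \<Rightarrow> 'a set \<Rightarrow>
       nat \<Rightarrow> real ^ 'm ^ 'm \<Rightarrow> real ^ 'm \<Rightarrow> 'a \<Rightarrow> real" where
  "gauss_group G L \<iota> D n M z g =
     vertex_weight G L (L #>\<^bsub>G\<^esub> g) *
     (1 / (\<Sum>\<^sub>\<infinity>w\<in>(UNIV :: (int ^ 'm) set). gauss_density (real n *\<^sub>R M) (real_vec w))) *
     gauss_density (real n *\<^sub>R M) (real_vec (potential G \<iota> D g) - real n *\<^sub>R z)"

end

theory Submission
  imports Defs "HOL-Real_Asymp.Real_Asymp"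
begin

text \<open>Subtracting from the potential the solution of a Poisson equation on the finite quotient makes the
  increments of the walk centred in every coset; this corrector is exactly what turns \<open>hat_form v\<close> into
  its harmonic part, and it does not matter at scale \<open>\<surd>n\<close>. A perturbation of the transfer operator then
  gives the central limit theorem with covariance \<open>\<Sigma>\<close>. To pass to total variation, the convolution
  powers are shown to be almost invariant in \<open>\<ell>\<^sup>1\<close>, at rate \<open>1 / \<surd>n\<close>, under translations by \<open>r \<int>\<^sup>m\<close> and
  under the time shift by the period \<open>q\<close>: such a power dominates a multiple of a lazy step, whose
  binomial iterates are smooth. Time smoothness makes the average over one period equidistributed over
  the cosets of \<open>r \<int>\<^sup>m\<close>, jointly with the central limit theorem, and space smoothness makes it close to
  its own Gaussian mollification on each coset, where characteristic functions identify the limit.\<close>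

section \<open>Gaussian sums over lattices\<close>

text \<open>The central limit theorem sees characteristic functions only at frequencies of order
  \<open>1 / sqrt n\<close>. At frequencies of order one the twisted transfer operator may have
  eigenvalues of modulus one: the walk can be periodic, and at a given time it can avoid whole
  classes modulo a sublattice. Almost invariance is what excludes oscillations there, and its proof
  shapes the rest. An increment can be traded for standing still only if both have positive
  probability at one common time. Parity may forbid this for a given translation, but not for its
  \<open>r\<close>-th power when \<open>r\<close> is a return time; hence \<open>r \<int>^m\<close>.
  The price is that the masses of the classes modulo \<open>r \<int>^m\<close> have to be found
  separately, and at a single time they need not be equal; the mean over one period repairs this.
  The rate fits the scale: a translation of length \<open>\<delta> sqrt n\<close> costs
  \<open>O(\<delta>)\<close>, so \<open>\<delta>\<close> can be fixed before the mollifier is made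
  much narrower than it. The Poisson equation is solved over two subgroups: over \<open>L\<close>
  for the corrector and for the fluctuation of the variance, over \<open>r \<int>^m\<close> for the
  equidistribution.\<close>

definition gauss :: "real \<Rightarrow> 'e::euclidean_space \<Rightarrow> real" where
  "gauss s y = exp (- (norm y)\<^sup>2 / (2 * s\<^sup>2)) / (sqrt (2 * pi) * s) ^ DIM('e)"

lemma gauss_pos: "s > 0 \<Longrightarrow> gauss s y > 0"
  by (simp add: gauss_def)

lemma gauss_nonneg: "s > 0 \<Longrightarrow> gauss s y \<ge> 0"
  using gauss_pos[of s y] by simp

lemma borel_measurable_gauss [measurable]: "gauss s \<in> borel_measurable borel"
  unfolding gauss_def by measurable

lemma gauss_eq_prod:
  fixes y :: "'e::euclidean_space"
  assumes "s > 0"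
  shows "gauss s y = (\<Prod>b\<in>Basis. normal_density 0 s (y \<bullet> b))"
proof -
  have "(norm y)\<^sup>2 = (\<Sum>b\<in>Basis. (y \<bullet> b)\<^sup>2)"
    by (subst power2_norm_eq_inner, subst euclidean_inner) (simp add: power2_eq_square)
  then have "exp (- (norm y)\<^sup>2 / (2 * s\<^sup>2)) = (\<Prod>b\<in>Basis. exp (- (y \<bullet> b)\<^sup>2 / (2 * s\<^sup>2)))"
    by (simp add: exp_sum[symmetric] sum_negf sum_divide_distrib)
  then show ?thesis
    using assms by (simp add: gauss_def normal_density_def prod_dividef real_sqrt_mult)
qed

lemma nn_integral_gauss:
  assumes "s > 0"
  shows "(\<integral>\<^sup>+ y. gauss s (y :: 'e::euclidean_space) \<partial>lborel) = 1"
proof -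
  have 1: "(\<integral>\<^sup>+ x. ennreal (normal_density 0 s x) \<partial>lborel) = 1"
    using assms prob_space.emeasure_space_1[OF prob_space_normal_density[of s 0]]
    by (simp add: emeasure_density)
  have "(\<integral>\<^sup>+ y. gauss s (y :: 'e) \<partial>lborel)
      = (\<integral>\<^sup>+ y. (\<Prod>b\<in>Basis. ennreal (normal_density 0 s ((y :: 'e) \<bullet> b))) \<partial>lborel)"
    using assms by (simp add: gauss_eq_prod prod_ennreal)
  also have "\<dots> = 1"
    by (subst nn_integral_lborel_prod) (simp_all add: 1)
  finally show ?thesis .
qed

lemma integrable_gauss: "s > 0 \<Longrightarrow> integrable lborel (gauss s :: 'e::euclidean_space \<Rightarrow> real)"
  by (rule integrableI_nn_integral_finite[where x=1]) (auto simp: nn_integral_gauss gauss_nonneg)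

lemma borel_measurable_cis [measurable]: "cis \<in> borel_measurable borel"
  by (intro borel_measurable_continuous_onI continuous_intros)

text \<open>The substitution \<open>x = s x'\<close> reduces this to the characteristic function of
  the standard normal law.\<close>

lemma normal_density_fourier:
  assumes "s > 0"
  shows "(\<integral>x. normal_density 0 s x *\<^sub>R cis (x * y) \<partial>lborel) = of_real (exp (- s\<^sup>2 * y\<^sup>2 / 2))"
proof -
  have "char std_normal_distribution (s * y) = of_real (exp (- (s * y)\<^sup>2 / 2))"
    by (simp add: char_std_normal_distribution)
  then have std: "(\<integral>x. std_normal_density x *\<^sub>R cis (s * y * x) \<partial>lborel) = of_real (exp (- (s * y)\<^sup>2 / 2))"
    by (simp add: char_def integral_density cis_conv_exp mult_ac)
  have "(\<integral>x. normal_density 0 s x *\<^sub>R cis (x * y) \<partial>lborel)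
      = s *\<^sub>R (\<integral>x. normal_density 0 s (0 + s * x) *\<^sub>R cis ((0 + s * x) * y) \<partial>lborel)"
    using assms lborel_integral_real_affine[of s "\<lambda>x. normal_density 0 s x *\<^sub>R cis (x * y)" 0] by simp
  also have "\<dots> = (\<integral>x. s *\<^sub>R (normal_density 0 s (0 + s * x) *\<^sub>R cis ((0 + s * x) * y)) \<partial>lborel)"
    by (subst integral_scaleR_right) simp
  also have "\<dots> = (\<integral>x. std_normal_density x *\<^sub>R cis (s * y * x) \<partial>lborel)"
    using assms
    by (intro Bochner_Integration.integral_cong)
       (auto simp: normal_density_def real_sqrt_mult power_mult_distrib mult_ac)
  finally show ?thesis
    by (simp add: std power_mult_distrib)
qed

lemma prod_cis: "finite A \<Longrightarrow> (\<Prod>a\<in>A. cis (f a)) = cis (\<Sum>a\<in>A. f a)"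
  by (induction rule: finite_induct) (auto simp: cis_mult)

text \<open>Density and phase both factor over the coordinates, and \<open>lborel\<close> is the
  image of a finite product of real Lebesgue measures, so the integral is a product of
  one-dimensional ones.\<close>

lemma gauss_fourier:
  fixes y :: "'e::euclidean_space"
  assumes "s > 0"
  shows "(\<integral>t. gauss s t *\<^sub>R cis (t \<bullet> y) \<partial>lborel) = of_real (exp (- s\<^sup>2 * (norm y)\<^sup>2 / 2))"
proof -
  let ?f = "\<lambda>b x. normal_density 0 s x *\<^sub>R cis (x * (y \<bullet> b))"
  interpret product_sigma_finite "\<lambda>_ :: 'e. lborel :: real measure"
    by standard
  have int: "integrable lborel (?f b)" for b
    by (rule Bochner_Integration.integrable_bound[OF integrable_normal_density[OF assms, of 0]]) (auto simp: assms)
  have prod: "gauss s t *\<^sub>R cis (t \<bullet> y) = (\<Prod>b\<in>Basis. ?f b (t \<bullet> b))" for t :: 'e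
    unfolding gauss_eq_prod[OF assms] euclidean_inner[of t y] prod_cis[OF finite_Basis, symmetric]
    by (simp add: scaleR_conv_of_real prod.distrib of_real_prod)
  have "(\<integral>t. gauss s t *\<^sub>R cis (t \<bullet> y) \<partial>lborel)
      = (\<integral>g. (\<Prod>b\<in>Basis. ?f b ((\<Sum>b\<in>Basis. g b *\<^sub>R b) \<bullet> b)) \<partial>(\<Pi>\<^sub>M b\<in>(Basis::'e set). lborel))"
    unfolding prod by (subst lborel_eq, subst integral_distr) auto
  also have "\<dots> = (\<integral>g. (\<Prod>b\<in>Basis. ?f b (g b)) \<partial>(\<Pi>\<^sub>M b\<in>(Basis::'e set). lborel))"
    by (intro Bochner_Integration.integral_cong prod.cong) auto
  also have "\<dots> = (\<Prod>b\<in>Basis. \<integral>x. ?f b x \<partial>lborel)"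
    using int by (subst product_integral_prod) auto
  also have "\<dots> = (\<Prod>b\<in>Basis. of_real (exp (- s\<^sup>2 * (y \<bullet> b)\<^sup>2 / 2)))"
    by (simp only: normal_density_fourier[OF assms])
  also have "\<dots> = of_real (exp (\<Sum>b\<in>Basis. - s\<^sup>2 * (y \<bullet> b)\<^sup>2 / 2))"
    by (simp add: exp_sum of_real_prod)
  also have "(\<Sum>b\<in>Basis. - s\<^sup>2 * (y \<bullet> b)\<^sup>2 / 2) = - s\<^sup>2 * (norm y)\<^sup>2 / 2"
    by (subst power2_norm_eq_inner, subst euclidean_inner[of y y])
       (simp add: power2_eq_square sum_distrib_left sum_negf sum_divide_distrib)
  finally show ?thesis .
qed

section \<open>Lattices, their fundamental cells and Riemann sums of Gaussians\<close>

lemma real_vec_add: "real_vec (v + w) = real_vec v + real_vec w"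
  by (simp add: real_vec_def vec_eq_iff)

lemma real_vec_diff: "real_vec (v - w) = real_vec v - real_vec w"
  by (simp add: real_vec_def vec_eq_iff)

text \<open>Young's inequality with a free parameter, from expanding the square of
  \<open>sqrt \<eta> y - u / sqrt \<eta>\<close>. A small \<open>\<eta>\<close> brings the
  coefficient of the norm of \<open>y\<close> close to one at the expense of that of the bounded
  vector \<open>u\<close>.\<close>

lemma norm_add_square_le:
  fixes y u :: "'e::real_inner"
  assumes "\<eta> > 0"
  shows "(norm (y + u))\<^sup>2 \<le> (1 + \<eta>) * (norm y)\<^sup>2 + (1 + 1 / \<eta>) * (norm u)\<^sup>2"
proof -
  have "0 \<le> (norm (sqrt \<eta> *\<^sub>R y - (1 / sqrt \<eta>) *\<^sub>R u))\<^sup>2"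
    by simp
  also have "\<dots> = \<eta> * (norm y)\<^sup>2 - 2 * (y \<bullet> u) + (1 / \<eta>) * (norm u)\<^sup>2"
    using assms unfolding power2_norm_eq_inner
    by (simp add: inner_diff_left inner_diff_right inner_commute field_simps power2_eq_square)
  finally show ?thesis
    unfolding power2_norm_eq_inner
    by (simp add: inner_add_left inner_add_right inner_commute algebra_simps)
qed

text \<open>The lattice is the image of the integer vectors under \<open>H\<close>, and
  \<open>cell\<close> is its half-open fundamental parallelepiped. All anisotropy sits in
  \<open>H\<close>: with \<open>H\<close> a whitening map of the covariance, every Gaussian can be
  taken isotropic.\<close>

locale euclidean_lattice =
  fixes H :: "real ^ 'm \<Rightarrow> real ^ 'm"
  assumes linear_H: "linear H" and inj_H: "inj H"
begin

definition pos :: "int ^ 'm \<Rightarrow> real ^ 'm" where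
  "pos v = H (real_vec v)"

definition cell :: "(real ^ 'm) set" where
  "cell = H ` {x. \<forall>i. 0 \<le> x $ i \<and> x $ i < 1}"

definition covol :: real where
  "covol = measure lborel cell"

lemma pos_diff: "pos (v - w) = pos v - pos w"
  by (simp add: pos_def real_vec_diff linear_diff[OF linear_H])

lemma obtain_inverse:
  obtains K where "linear K" "\<And>x. K (H x) = x" "\<And>y. H (K y) = y"
  using linear_injective_isomorphism[OF linear_H inj_H] by blast

lemma measurable_cell [measurable]: "cell \<in> sets borel"
proof -
  obtain K where K: "linear K" "\<And>x. K (H x) = x" "\<And>y. H (K y) = y"
    using obtain_inverse by blast
  have [measurable]: "K \<in> borel_measurable borel"
    using K(1) by (intro borel_measurable_continuous_onI linear_continuous_on linear_conv_bounded_linear[THEN iffD1])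
  have "cell = {y. \<forall>i. 0 \<le> K y $ i \<and> K y $ i < 1}"
    unfolding cell_def using K by (auto simp: image_iff) metis
  also have "\<dots> \<in> sets borel"
    by measurable
  finally show ?thesis .
qed

lemma obtain_cell_bound:
  obtains \<rho> where "\<rho> > 0" "\<And>u. u \<in> cell \<Longrightarrow> norm u \<le> \<rho>"
proof -
  have "bounded (H ` cbox 0 1)"
    by (intro bounded_linear_image linear_conv_bounded_linear[THEN iffD1] linear_H bounded_cbox)
  moreover have "cell \<subseteq> H ` cbox 0 1"
    unfolding cell_def by (intro image_mono) (auto simp: mem_box_cart less_imp_le)
  ultimately have "bounded cell"
    by (rule bounded_subset)
  then show ?thesis
    using that unfolding bounded_pos by blast
qed

lemma emeasure_cell: "emeasure lborel cell = ennreal covol"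
proof -
  obtain \<rho> where "\<And>u. u \<in> cell \<Longrightarrow> norm u \<le> \<rho>"
    using obtain_cell_bound by blast
  then have "cell \<subseteq> cball 0 \<rho>"
    by auto
  then have "emeasure lborel cell \<le> emeasure lborel (cball (0 :: real ^ 'm) \<rho>)"
    by (intro emeasure_mono) auto
  also have "\<dots> < \<infinity>"
    by (rule emeasure_lborel_cball_finite)
  finally show ?thesis
    unfolding covol_def by (intro emeasure_eq_ennreal_measure) auto
qed

text \<open>In the coordinates given by the inverse of \<open>H\<close>, the lattice point is the
  vector of integer parts; this is why \<open>cell\<close> is half-open.\<close>

lemma tiling: "\<exists>!v. y - pos v \<in> cell"
proof -
  obtain K where K: "linear K" "\<And>x. K (H x) = x" "\<And>y. H (K y) = y"
    using obtain_inverse by blast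
  have iff: "y - pos v \<in> cell \<longleftrightarrow> (\<forall>i. v $ i = \<lfloor>K y $ i\<rfloor>)" for v
  proof -
    have "y - pos v = H (K y - real_vec v)"
      by (simp add: pos_def linear_diff[OF linear_H] K)
    then have "y - pos v \<in> cell \<longleftrightarrow> (\<forall>i. 0 \<le> (K y - real_vec v) $ i \<and> (K y - real_vec v) $ i < 1)"
      unfolding cell_def using inj_H by (auto simp: inj_image_mem_iff)
    also have "\<dots> \<longleftrightarrow> (\<forall>i. v $ i = \<lfloor>K y $ i\<rfloor>)"
      unfolding real_vec_def by (intro all_cong1) (auto simp: floor_eq_iff, linarith+)
    finally show ?thesis .
  qed
  show ?thesis
    unfolding iff by (rule ex1I[of _ "\<chi> i. \<lfloor>K y $ i\<rfloor>"]) (auto simp: vec_eq_iff)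
qed

text \<open>The indicators of the translated cells sum to one; Tonelli and the translation
  invariance of Lebesgue measure turn this into a splitting of the integral.\<close>

lemma nn_integral_tiling:
  fixes f :: "real ^ 'm \<Rightarrow> ennreal"
  assumes [measurable]: "f \<in> borel_measurable borel"
  shows "(\<integral>\<^sup>+y. f y \<partial>lborel) =
    (\<integral>\<^sup>+v. (\<integral>\<^sup>+y. f (y + pos v) * indicator cell y \<partial>lborel) \<partial>count_space UNIV)"
proof -
  interpret pair_sigma_finite "count_space (UNIV :: (int ^ 'm) set)" "lborel :: (real ^ 'm) measure"
    by (intro pair_sigma_finite.intro sigma_finite_measure_count_space sigma_finite_lborel)
  have one: "f y = (\<integral>\<^sup>+v. f y * indicator cell (y - pos v) \<partial>count_space UNIV)" for y
  proof -
    obtain v0 where v0: "y - pos v0 \<in> cell" "\<forall>v. y - pos v \<in> cell \<longrightarrow> v = v0"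
      using tiling[of y] unfolding Ex1_def by (elim exE conjE) (rule that)
    have zero: "indicator cell (y - pos v) = (0 :: ennreal)" if "v \<noteq> v0" for v
      using v0(2)[rule_format, of v] that unfolding indicator_def
      by (cases "y - pos v \<in> cell") (simp_all only: of_bool_eq, blast)
    have "(\<integral>\<^sup>+v. f y * indicator cell (y - pos v) \<partial>count_space UNIV)
        = (\<Sum>v\<in>{v0}. f y * indicator cell (y - pos v))"
      by (rule nn_integral_count_space') (simp_all add: zero)
    also have "\<dots> = f y"
      using v0(1) by (simp add: indicator_def)
    finally show ?thesis
      by (rule sym)
  qed
  have [measurable]: "(\<lambda>(v, y). f y * indicator cell (y - pos v))
      \<in> borel_measurable (count_space UNIV \<Otimes>\<^sub>M (lborel :: (real ^ 'm) measure))"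
    by (rule measurable_pair_measure_countable1) auto
  have shift: "(\<integral>\<^sup>+y. f y * indicator cell (y - pos v) \<partial>lborel)
      = (\<integral>\<^sup>+y. f (y + pos v) * indicator cell y \<partial>lborel)" for v
  proof -
    have "(\<integral>\<^sup>+y. f y * indicator cell (y - pos v) \<partial>lborel)
        = (\<integral>\<^sup>+y. f y * indicator cell (y - pos v) \<partial>distr lborel borel ((+) (pos v)))"
      by (simp add: lborel_distr_plus)
    also have "\<dots> = (\<integral>\<^sup>+y. f (pos v + y) * indicator cell y \<partial>lborel)"
      by (subst nn_integral_distr) auto
    finally show ?thesis
      by (simp add: add.commute)
  qed
  have "(\<integral>\<^sup>+y. f y \<partial>lborel) = (\<integral>\<^sup>+y. (\<integral>\<^sup>+v. f y * indicator cell (y - pos v) \<partial>count_space UNIV) \<partial>lborel)"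
    using one by simp
  also have "\<dots> = (\<integral>\<^sup>+v. (\<integral>\<^sup>+y. f y * indicator cell (y - pos v) \<partial>lborel) \<partial>count_space UNIV)"
    by (rule Fubini') measurable
  finally show ?thesis
    unfolding shift .
qed

text \<open>A null cell would, through its countably many translates, make the whole space
  null.\<close>

lemma covol_pos: "covol > 0"
proof (rule ccontr)
  assume "\<not> covol > 0"
  then have "emeasure lborel cell = 0"
    by (simp add: emeasure_cell ennreal_neg)
  then have "(\<integral>\<^sup>+y. 1 \<partial>(lborel :: (real ^ 'm) measure)) = 0"
    by (subst nn_integral_tiling) auto
  then show False
    by (simp add: emeasure_lborel_UNIV)
qed

lemma nn_integral_cell_const: "(\<integral>\<^sup>+y. ennreal c * indicator cell y \<partial>lborel) = ennreal c * ennreal covol"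
  by (subst nn_integral_cmult) (auto simp: emeasure_cell)

text \<open>A Harnack-type comparison, uniform in \<open>y\<close>: moving the argument by a bounded
  \<open>u\<close> is paid for by widening the Gaussian by the factor
  \<open>sqrt (1 + \<eta>)\<close>. The constant tends to one when \<open>\<eta>\<close> shrinks
  slowly enough for \<open>\<eta> s^2\<close> to diverge.\<close>

lemma gauss_shift_upper:
  fixes y u :: "'e::euclidean_space"
  assumes "s > 0" "\<eta> > 0" "norm u \<le> \<rho>"
  shows "gauss s y \<le> exp (\<rho>\<^sup>2 / (2 * \<eta> * s\<^sup>2)) * sqrt (1 + \<eta>) ^ DIM('e) * gauss (s * sqrt (1 + \<eta>)) (y + u)"
proof -
  have r: "\<rho>\<^sup>2 \<ge> (norm u)\<^sup>2"
    using assms by (intro power_mono) auto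
  have "(norm (y + u))\<^sup>2 \<le> (1 + \<eta>) * (norm y)\<^sup>2 + (1 + 1 / \<eta>) * (norm u)\<^sup>2"
    by (rule norm_add_square_le) fact
  also have "\<dots> \<le> (1 + \<eta>) * (norm y)\<^sup>2 + (1 + 1 / \<eta>) * \<rho>\<^sup>2"
    using r assms by (intro add_mono mult_left_mono) auto
  also have "\<dots> = (1 + \<eta>) * ((norm y)\<^sup>2 + \<rho>\<^sup>2 / \<eta>)"
    using assms by (simp add: field_simps)
  finally have "(norm (y + u))\<^sup>2 / (1 + \<eta>) \<le> (norm y)\<^sup>2 + \<rho>\<^sup>2 / \<eta>"
    using assms by (simp add: divide_le_eq mult.commute)
  then have "((norm (y + u))\<^sup>2 / (1 + \<eta>)) / (2 * s\<^sup>2) \<le> ((norm y)\<^sup>2 + \<rho>\<^sup>2 / \<eta>) / (2 * s\<^sup>2)"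
    using assms by (intro divide_right_mono) auto
  then have *: "- (norm y)\<^sup>2 / (2 * s\<^sup>2) \<le> \<rho>\<^sup>2 / (2 * \<eta> * s\<^sup>2) + - (norm (y + u))\<^sup>2 / (2 * (s * sqrt (1 + \<eta>))\<^sup>2)"
    using assms by (simp add: add_divide_distrib power_mult_distrib mult_ac)
  have eq: "exp (\<rho>\<^sup>2 / (2 * \<eta> * s\<^sup>2)) * sqrt (1 + \<eta>) ^ DIM('e) * gauss (s * sqrt (1 + \<eta>)) (y + u)
      = exp (\<rho>\<^sup>2 / (2 * \<eta> * s\<^sup>2) + - (norm (y + u))\<^sup>2 / (2 * (s * sqrt (1 + \<eta>))\<^sup>2)) / (sqrt (2 * pi) * s) ^ DIM('e)"
    using assms unfolding gauss_def exp_add by (simp add: power_mult_distrib field_simps)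
  show ?thesis
    unfolding eq unfolding gauss_def using * assms by (intro divide_right_mono) auto
qed

text \<open>The upper bound read backwards: it is applied at \<open>y + u\<close> with displacement
  \<open>- u\<close> and initial width \<open>s / sqrt (1 + \<eta>)\<close>.\<close>

lemma gauss_shift_lower:
  fixes y u :: "'e::euclidean_space"
  assumes "s > 0" "\<eta> > 0" "norm u \<le> \<rho>"
  shows "gauss (s / sqrt (1 + \<eta>)) (y + u) \<le>
    exp ((1 + 1 / \<eta>) * \<rho>\<^sup>2 / (2 * s\<^sup>2)) * sqrt (1 + \<eta>) ^ DIM('e) * gauss s y"
proof -
  have "gauss (s / sqrt (1 + \<eta>)) (y + u) \<le> exp (\<rho>\<^sup>2 / (2 * \<eta> * (s / sqrt (1 + \<eta>))\<^sup>2)) * sqrt (1 + \<eta>) ^ DIM('e)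
      * gauss (s / sqrt (1 + \<eta>) * sqrt (1 + \<eta>)) ((y + u) + (- u))"
    using assms by (intro gauss_shift_upper) auto
  also have "\<rho>\<^sup>2 / (2 * \<eta> * (s / sqrt (1 + \<eta>))\<^sup>2) = (1 + 1 / \<eta>) * \<rho>\<^sup>2 / (2 * s\<^sup>2)"
    using assms by (simp add: power_divide field_simps)
  finally show ?thesis
    using assms by simp
qed

lemma nn_integral_gauss_shift:
  assumes "s > 0"
  shows "(\<integral>\<^sup>+y. gauss s (y - b :: real ^ 'm) \<partial>lborel) = 1"
proof -
  have "(\<integral>\<^sup>+y. gauss s (y - b :: real ^ 'm) \<partial>lborel)
      = (\<integral>\<^sup>+y. gauss s (y - b) \<partial>distr lborel borel ((+) b))"
    by (simp add: lborel_distr_plus)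
  also have "\<dots> = (\<integral>\<^sup>+y. gauss s (y :: real ^ 'm) \<partial>lborel)"
    by (subst nn_integral_distr) auto
  finally show ?thesis
    using nn_integral_gauss[OF assms] by simp
qed

text \<open>Each lattice value times the covolume is the integral of a constant over a cell, and on
  the cell this constant is dominated by the wider Gaussian; the cells then reassemble to an
  integral of total mass one.\<close>

lemma lattice_sum_gauss_le:
  assumes "s > 0" "\<eta> > 0" and \<rho>: "\<And>u. u \<in> cell \<Longrightarrow> norm u \<le> \<rho>"
  shows "(\<integral>\<^sup>+v. ennreal (gauss s (pos v - b) * covol) \<partial>count_space UNIV)
    \<le> ennreal (exp (\<rho>\<^sup>2 / (2 * \<eta> * s\<^sup>2)) * sqrt (1 + \<eta>) ^ CARD('m))"
proof -
  define C where "C = exp (\<rho>\<^sup>2 / (2 * \<eta> * s\<^sup>2)) * sqrt (1 + \<eta>) ^ CARD('m)"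
  have C: "C \<ge> 0"
    using assms by (simp add: C_def)
  define s' where "s' = s * sqrt (1 + \<eta>)"
  have s': "s' > 0"
    using assms by (simp add: s'_def)
  have "(\<integral>\<^sup>+v. ennreal (gauss s (pos v - b) * covol) \<partial>count_space UNIV)
      = (\<integral>\<^sup>+v. (\<integral>\<^sup>+y. ennreal (gauss s (pos v - b)) * indicator cell y \<partial>lborel) \<partial>count_space UNIV)"
    using assms covol_pos by (simp add: nn_integral_cell_const ennreal_mult gauss_nonneg)
  also have "\<dots> \<le> (\<integral>\<^sup>+v. (\<integral>\<^sup>+y. ennreal (C * gauss s' (y + pos v - b)) * indicator cell y \<partial>lborel) \<partial>count_space UNIV)"
  proof (intro nn_integral_mono)
    fix v :: "int ^ 'm" and y :: "real ^ 'm"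
    show "ennreal (gauss s (pos v - b)) * indicator cell y
        \<le> ennreal (C * gauss s' (y + pos v - b)) * indicator cell y"
      using gauss_shift_upper[OF assms(1,2) \<rho>, of y "pos v - b"]
      by (cases "y \<in> cell") (auto simp: C_def s'_def algebra_simps intro!: ennreal_leI)
  qed
  also have "\<dots> = (\<integral>\<^sup>+y. ennreal (C * gauss s' (y - b)) \<partial>lborel)"
    by (subst nn_integral_tiling) auto
  also have "\<dots> = ennreal C"
    using C s' nn_integral_gauss_shift[OF s', of b]
    by (simp add: ennreal_mult gauss_nonneg nn_integral_cmult)
  finally show ?thesis
    by (simp add: C_def)
qed

lemma lattice_sum_gauss_ge:
  assumes "s > 0" "\<eta> > 0" and \<rho>: "\<And>u. u \<in> cell \<Longrightarrow> norm u \<le> \<rho>"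
  shows "1 \<le> ennreal (exp ((1 + 1 / \<eta>) * \<rho>\<^sup>2 / (2 * s\<^sup>2)) * sqrt (1 + \<eta>) ^ CARD('m))
    * (\<integral>\<^sup>+v. ennreal (gauss s (pos v - b) * covol) \<partial>count_space UNIV)"
proof -
  define C where "C = exp ((1 + 1 / \<eta>) * \<rho>\<^sup>2 / (2 * s\<^sup>2)) * sqrt (1 + \<eta>) ^ CARD('m)"
  have C: "C \<ge> 0"
    using assms by (simp add: C_def)
  define s' where "s' = s / sqrt (1 + \<eta>)"
  have s': "s' > 0"
    using assms by (simp add: s'_def)
  have "1 = (\<integral>\<^sup>+y. ennreal (gauss s' (y - b)) \<partial>lborel)"
    using nn_integral_gauss_shift[OF s', of b] by simp
  also have "\<dots> = (\<integral>\<^sup>+v. (\<integral>\<^sup>+y. ennreal (gauss s' (y + pos v - b)) * indicator cell y \<partial>lborel) \<partial>count_space UNIV)"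
    by (subst nn_integral_tiling) auto
  also have "\<dots> \<le> (\<integral>\<^sup>+v. (\<integral>\<^sup>+y. ennreal (C * gauss s (pos v - b)) * indicator cell y \<partial>lborel) \<partial>count_space UNIV)"
  proof (intro nn_integral_mono)
    fix v :: "int ^ 'm" and y :: "real ^ 'm"
    show "ennreal (gauss s' (y + pos v - b)) * indicator cell y
        \<le> ennreal (C * gauss s (pos v - b)) * indicator cell y"
      using gauss_shift_lower[OF assms(1,2) \<rho>, of y "pos v - b"]
      by (cases "y \<in> cell") (auto simp: C_def s'_def algebra_simps intro!: ennreal_leI)
  qed
  also have "\<dots> = (\<integral>\<^sup>+v. ennreal C * ennreal (gauss s (pos v - b) * covol) \<partial>count_space UNIV)"
    unfolding nn_integral_cell_const using assms C covol_pos
    by (simp add: ennreal_mult gauss_nonneg mult.assoc)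
  also have "\<dots> = ennreal C * (\<integral>\<^sup>+v. ennreal (gauss s (pos v - b) * covol) \<partial>count_space UNIV)"
    by (intro nn_integral_cmult) auto
  finally show ?thesis
    by (simp add: C_def)
qed

lemma integrable_lattice_gauss:
  assumes "s > 0"
  shows "integrable (count_space UNIV) (\<lambda>v. gauss s (pos v - b))"
proof -
  obtain \<rho> where \<rho>: "\<And>u. u \<in> cell \<Longrightarrow> norm u \<le> \<rho>"
    using obtain_cell_bound by blast
  have "integrable (count_space UNIV) (\<lambda>v. gauss s (pos v - b) * covol)"
    using lattice_sum_gauss_le[OF assms zero_less_one \<rho>, of b] assms covol_pos
    by (intro integrableI_bounded) (simp_all add: gauss_nonneg le_less_trans[OF _ ennreal_less_top])
  then show ?thesis
    using covol_pos by simp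
qed

text \<open>A Riemann sum, with the cells as mesh, of the integral of the Gaussian centred at
  \<open>b\<close>; hence the factor \<open>covol\<close> and the limit one as \<open>s\<close>
  grows.\<close>

definition gsum :: "real \<Rightarrow> real ^ 'm \<Rightarrow> real" where
  "gsum s b = (\<integral>v. gauss s (pos v - b) * covol \<partial>count_space UNIV)"

lemma nn_integral_gsum:
  assumes "s > 0"
  shows "(\<integral>\<^sup>+v. ennreal (gauss s (pos v - b) * covol) \<partial>count_space UNIV) = ennreal (gsum s b)"
  unfolding gsum_def using assms covol_pos integrable_lattice_gauss[OF assms]
  by (intro nn_integral_eq_integral) (auto simp: gauss_nonneg)

lemma gsum_nonneg: "s > 0 \<Longrightarrow> gsum s b \<ge> 0"
  unfolding gsum_def using covol_pos by (intro integral_nonneg_AE) (auto simp: gauss_nonneg)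

text \<open>Uniformity in the centre \<open>b\<close> is what allows the centres to move with
  \<open>n\<close> in the application.\<close>

lemma uniform_limit_gsum:
  assumes "\<epsilon> > 0"
  shows "eventually (\<lambda>s. \<forall>b. \<bar>gsum s b - 1\<bar> < \<epsilon>) at_top"
proof -
  obtain \<rho> where \<rho>: "\<rho> > 0" "\<And>u. u \<in> cell \<Longrightarrow> norm u \<le> \<rho>"
    using obtain_cell_bound by blast
  \<comment> \<open>Taking \<open>\<eta> = 1 / s\<close> makes both exponents of order
    \<open>1 / s\<close>, while the widening factor still tends to one.\<close>
  define U where "U = (\<lambda>s::real. exp (\<rho>\<^sup>2 / (2 * (1/s) * s\<^sup>2)) * sqrt (1 + 1/s) ^ CARD('m))"
  define W where "W = (\<lambda>s::real. exp ((1 + 1 / (1/s)) * \<rho>\<^sup>2 / (2 * s\<^sup>2)) * sqrt (1 + 1/s) ^ CARD('m))"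
  have s1: "((\<lambda>s. 1/s) \<longlongrightarrow> (0::real)) at_top"
    by real_asymp
  have sq: "((\<lambda>s. sqrt (1 + 1/s) ^ CARD('m)) \<longlongrightarrow> sqrt (1 + 0) ^ CARD('m)) (at_top :: real filter)"
    by (intro tendsto_intros s1)
  have "((\<lambda>s. exp (\<rho>\<^sup>2 / (2 * (1/s) * s\<^sup>2))) \<longlongrightarrow> exp 0) at_top"
    by (intro tendsto_exp) real_asymp
  then have U: "(U \<longlongrightarrow> 1) at_top"
    unfolding U_def using tendsto_mult[OF _ sq] by fastforce
  have "((\<lambda>s. exp ((1 + 1 / (1/s)) * \<rho>\<^sup>2 / (2 * s\<^sup>2))) \<longlongrightarrow> exp 0) at_top"
    by (intro tendsto_exp) real_asymp
  then have "(W \<longlongrightarrow> 1) at_top"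
    unfolding W_def using tendsto_mult[OF _ sq] by fastforce
  then have W: "((\<lambda>s. 1 / W s) \<longlongrightarrow> 1) at_top"
    using tendsto_divide[OF tendsto_const[of 1]] by fastforce
  have ev: "eventually (\<lambda>s. U s < 1 + \<epsilon>) at_top" "eventually (\<lambda>s. 1 / W s > 1 - \<epsilon>) at_top"
    using order_tendstoD(2)[OF U, of "1 + \<epsilon>"] order_tendstoD(1)[OF W, of "1 - \<epsilon>"] assms by auto
  show ?thesis
    using ev eventually_gt_at_top[of 0]
  proof eventually_elim
    case (elim s)
    have Wpos: "W s > 0" and Upos: "U s > 0"
      using elim by (simp_all add: W_def U_def add_pos_pos)
    show ?case
    proof
      fix b
      have "ennreal (gsum s b) \<le> ennreal (U s)"
        using lattice_sum_gauss_le[OF _ _ \<rho>(2), of s "1/s" b] elim by (simp add: nn_integral_gsum U_def)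
      then have 1: "gsum s b \<le> U s"
        using Upos by (simp add: ennreal_le_iff)
      have "1 \<le> ennreal (W s) * ennreal (gsum s b)"
        using lattice_sum_gauss_ge[OF _ _ \<rho>(2), of s "1/s" b] elim by (simp add: nn_integral_gsum W_def)
      then have "1 \<le> W s * gsum s b"
        using Wpos gsum_nonneg[of s b] elim by (simp add: ennreal_mult[symmetric] ennreal_le_iff flip: ennreal_1)
      then have "1 / W s \<le> gsum s b"
        using Wpos by (simp add: field_simps)
      then show "\<bar>gsum s b - 1\<bar> < \<epsilon>"
        using 1 elim by linarith
    qed
  qed
qed

section \<open>Convolution of summable functions on the integer vectors\<close>

abbreviation cs :: "(int ^ 'm) measure" where "cs \<equiv> count_space UNIV"

lemma integrable_cs_shift:
  fixes f :: "int ^ 'm \<Rightarrow> real"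
  assumes "integrable cs f"
  shows "integrable cs (\<lambda>v. f (v - w))"
proof -
  have "bij (\<lambda>v :: int ^ 'm. v - w)"
    by (rule bij_betw_byWitness[where f'="\<lambda>v. v + w"]) auto
  then show ?thesis
    using assms by (rule integrable_bij_count_space[THEN iffD2])
qed

lemma integral_cs_shift:
  fixes f :: "int ^ 'm \<Rightarrow> real"
  shows "(\<integral>v. f (v - w) \<partial>cs) = (\<integral>v. f v \<partial>cs)"
proof -
  have "bij (\<lambda>v :: int ^ 'm. v - w)"
    by (rule bij_betw_byWitness[where f'="\<lambda>v. v + w"]) auto
  then show ?thesis
    by (rule integral_bij_count_space)
qed

lemma integral_cs_reflect:
  fixes f :: "int ^ 'm \<Rightarrow> real"
  shows "(\<integral>w. f (v - w) \<partial>cs) = (\<integral>v. f v \<partial>cs)"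
proof -
  have "bij (\<lambda>w :: int ^ 'm. v - w)"
    by (rule bij_betw_byWitness[where f'="\<lambda>w. v - w"]) auto
  then show ?thesis
    by (rule integral_bij_count_space)
qed

lemma pair_cs: "pair_sigma_finite cs cs"
  by (intro pair_sigma_finite.intro sigma_finite_measure_count_space)

lemma measurable_cs_pair [measurable]: "f \<in> borel_measurable (cs \<Otimes>\<^sub>M cs)"
  by (rule measurable_pair_measure_countable1) auto

text \<open>The second argument \<open>W\<close> is the smoothing weight over which the
  displacements of \<open>F\<close> are averaged.\<close>

definition conv :: "(int ^ 'm \<Rightarrow> real) \<Rightarrow> (int ^ 'm \<Rightarrow> real) \<Rightarrow> int ^ 'm \<Rightarrow> real" where
  "conv F W v = (\<integral>w. W w * F (v - w) \<partial>cs)"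

lemma integrable_conv_pair:
  fixes F W :: "int ^ 'm \<Rightarrow> real"
  assumes F: "integrable cs F" and W: "integrable cs W"
  shows "integrable (cs \<Otimes>\<^sub>M cs) (\<lambda>(w, v). W w * F (v - w))"
proof -
  interpret pair_sigma_finite cs cs by (rule pair_cs)
  have eq: "(\<integral>v. norm (W w * F (v - w)) \<partial>cs) = \<bar>W w\<bar> * (\<integral>v. \<bar>F v\<bar> \<partial>cs)" for w
    using integral_cs_shift[of "\<lambda>v. \<bar>F v\<bar>" w] by (simp add: abs_mult)
  show ?thesis
  proof (rule Fubini_integrable)
    show "integrable cs (\<lambda>w. \<integral>v. norm (case (w, v) of (w, v) \<Rightarrow> W w * F (v - w)) \<partial>cs)"
      unfolding prod.case eq using W by simp
    show "AE w in cs. integrable cs (\<lambda>v. case (w, v) of (w, v) \<Rightarrow> W w * F (v - w))"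
      using integrable_cs_shift[OF F] by simp
  qed simp
qed

lemma integrable_conv:
  assumes F: "integrable cs F" and W: "integrable cs W"
  shows "integrable cs (conv F W)" "(\<integral>v. conv F W v \<partial>cs) = (\<integral>v. F v \<partial>cs) * (\<integral>v. W v \<partial>cs)"
proof -
  interpret pair_sigma_finite cs cs by (rule pair_cs)
  note int = integrable_conv_pair[OF assms]
  show "integrable cs (conv F W)"
    using integrable_snd[OF int] by (simp add: conv_def[abs_def])
  have "(\<integral>v. conv F W v \<partial>cs) = (\<integral>w. (\<integral>v. W w * F (v - w) \<partial>cs) \<partial>cs)"
    unfolding conv_def by (rule Fubini_integral[OF int])
  then show "(\<integral>v. conv F W v \<partial>cs) = (\<integral>v. F v \<partial>cs) * (\<integral>v. W v \<partial>cs)"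
    by (simp add: integral_cs_shift)
qed

text \<open>The difference is the \<open>W\<close>-average of \<open>F (v - w) - F v\<close>, so
  Tonelli bounds it by the average of the translation errors. The majorant \<open>R\<close> is left
  free so that short and long displacements can be estimated differently.\<close>

lemma conv_diff_le:
  assumes F: "integrable cs F" and W: "integrable cs W" "\<And>w. W w \<ge> 0"
    and R: "integrable cs R" "\<And>w. W w * (\<integral>v. \<bar>F (v - w) - F v\<bar> \<partial>cs) \<le> R w"
  shows "(\<integral>v. \<bar>conv F W v - (\<integral>w. W w \<partial>cs) * F v\<bar> \<partial>cs) \<le> (\<integral>w. R w \<partial>cs)"
proof -
  interpret pair_sigma_finite cs cs by (rule pair_cs)
  have Fs: "integrable cs (\<lambda>v. F (v - w) - F v)" for w
    using integrable_cs_shift[OF F] F by auto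
  have Ws: "integrable cs (\<lambda>w. W w * F (v - w))" for v
  proof -
    \<comment> \<open>A summable function is bounded by its norm, which makes the convolution
      integral converge at every single \<open>v\<close>.\<close>
    have "\<bar>F v\<bar> \<le> (\<integral>v. \<bar>F v\<bar> \<partial>cs)" for v
    proof -
      have "(\<integral>x. \<bar>F x\<bar> * indicator {v} x \<partial>cs) \<le> (\<integral>v. \<bar>F v\<bar> \<partial>cs)"
        using F by (intro integral_mono integrable_abs Bochner_Integration.integrable_bound[OF F])
          (auto simp: indicator_def)
      also have "(\<lambda>x. \<bar>F x\<bar> * indicator {v} x) = (\<lambda>x. indicator {v} x * \<bar>F v\<bar>)"
        by (auto simp: indicator_def)
      finally show ?thesis
        by simp
    qed
    then have "\<bar>W w * F (v - w)\<bar> \<le> W w * (\<integral>v. \<bar>F v\<bar> \<partial>cs)" for w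
      using W(2) by (simp add: abs_mult mult_left_mono)
    then have bound: "norm (W w * F (v - w)) \<le> norm (W w * (\<integral>v. \<bar>F v\<bar> \<partial>cs))" for w
      using order.trans[OF _ abs_ge_self] unfolding real_norm_def by blast
    show ?thesis
    proof (rule Bochner_Integration.integrable_bound)
      show "integrable cs (\<lambda>w. W w * (\<integral>v. \<bar>F v\<bar> \<partial>cs))"
        using W(1) by simp
      show "AE w in cs. norm (W w * F (v - w)) \<le> norm (W w * (\<integral>v. \<bar>F v\<bar> \<partial>cs))"
        by (rule AE_I2) (rule bound)
    qed simp
  qed
  have "ennreal (\<integral>v. \<bar>conv F W v - (\<integral>w. W w \<partial>cs) * F v\<bar> \<partial>cs)
      = (\<integral>\<^sup>+v. ennreal \<bar>conv F W v - (\<integral>w. W w \<partial>cs) * F v\<bar> \<partial>cs)"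
    using integrable_conv[OF F W(1)] F by (intro nn_integral_eq_integral[symmetric]) auto
  also have "\<dots> = (\<integral>\<^sup>+v. ennreal (norm (\<integral>w. W w * (F (v - w) - F v) \<partial>cs)) \<partial>cs)"
    using Ws W(1) by (intro nn_integral_cong) (simp add: conv_def right_diff_distrib Bochner_Integration.integral_diff)
  also have "\<dots> \<le> (\<integral>\<^sup>+v. (\<integral>\<^sup>+w. ennreal (norm (W w * (F (v - w) - F v))) \<partial>cs) \<partial>cs)"
    using Ws W(1) by (intro nn_integral_mono integral_norm_bound_ennreal) (auto simp: right_diff_distrib)
  also have "\<dots> = (\<integral>\<^sup>+w. (\<integral>\<^sup>+v. ennreal (norm (W w * (F (v - w) - F v))) \<partial>cs) \<partial>cs)"
    by (rule Fubini') measurable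
  also have "\<dots> = (\<integral>\<^sup>+w. ennreal (W w * (\<integral>v. \<bar>F (v - w) - F v\<bar> \<partial>cs)) \<partial>cs)"
  proof (intro nn_integral_cong)
    fix w
    have "(\<integral>\<^sup>+v. ennreal (norm (W w * (F (v - w) - F v))) \<partial>cs) = ennreal (\<integral>v. norm (W w * (F (v - w) - F v)) \<partial>cs)"
      using Fs by (intro nn_integral_eq_integral) auto
    then show "(\<integral>\<^sup>+v. ennreal (norm (W w * (F (v - w) - F v))) \<partial>cs) = ennreal (W w * (\<integral>v. \<bar>F (v - w) - F v\<bar> \<partial>cs))"
      using W(2) by (simp add: abs_mult)
  qed
  also have "\<dots> \<le> (\<integral>\<^sup>+w. ennreal (R w) \<partial>cs)"
    using R by (intro nn_integral_mono ennreal_leI) auto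
  also have "\<dots> = ennreal (\<integral>w. R w \<partial>cs)"
  proof (rule nn_integral_eq_integral[OF R(1)])
    have "0 \<le> R w" for w
      by (rule order.trans[OF _ R(2)]) (use W(2) in simp)
    then show "AE w in cs. 0 \<le> R w" by simp
  qed
  finally show ?thesis
  proof (subst (asm) ennreal_le_iff)
    have "0 \<le> R w" for w
      by (rule order.trans[OF _ R(2)]) (use W(2) in simp)
    then show "0 \<le> (\<integral>w. R w \<partial>cs)" by simp
  qed
qed

text \<open>The mollifier is itself a Fourier integral with weight
  \<open>gauss (1 / \<epsilon>)\<close>; inserting it and exchanging sum and integral leaves the
  characteristic function of \<open>F\<close>. The recentring by \<open>b\<close> cancels between
  the two phases; it is inserted so that the characteristic function can have a limit.\<close>

lemma conv_gauss_fourier: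
  assumes F: "integrable cs F" and pos: "\<epsilon> > 0" "a > 0"
  shows "complex_of_real (conv F (\<lambda>w. gauss (\<epsilon> * a) (pos w) * covol) v) =
    of_real (covol / (sqrt (2 * pi) * \<epsilon> * a) ^ CARD('m)) *
      (\<integral>t. gauss (1 / \<epsilon>) t *\<^sub>R ((\<integral>w. F w *\<^sub>R cis (t \<bullet> ((1 / a) *\<^sub>R (pos w - b))) \<partial>cs)
           * cis (- (t \<bullet> ((1 / a) *\<^sub>R (pos v - b))))) \<partial>lborel)"
proof -
  interpret pair_sigma_finite cs "lborel :: (real ^ 'm) measure"
    by (intro pair_sigma_finite.intro sigma_finite_measure_count_space sigma_finite_lborel)
  \<comment> \<open>\<open>K\<close> is the value of the discretised mollifier at the origin, that
    is, the prefactor missing from the transform in \<open>gauss_fourier\<close>.\<close>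
  define K where "K = covol / (sqrt (2 * pi) * \<epsilon> * a) ^ CARD('m)"
  let ?f = "\<lambda>w t. gauss (1 / \<epsilon>) t *\<^sub>R (F w *\<^sub>R cis (t \<bullet> ((1 / a) *\<^sub>R (pos w - pos v))))"
  have g: "complex_of_real (gauss (\<epsilon> * a) (pos v - pos w) * covol)
      = of_real K * (\<integral>t. gauss (1 / \<epsilon>) t *\<^sub>R cis (t \<bullet> ((1 / a) *\<^sub>R (pos w - pos v))) \<partial>lborel)" for w
  proof -
    have norm_eq: "norm ((1 / a) *\<^sub>R (pos w - pos v)) = norm (pos v - pos w) / a"
      using pos by (simp add: norm_minus_commute del: scaleR_diff_right)
    have "exp (- (norm (pos v - pos w))\<^sup>2 / (2 * (\<epsilon> * a)\<^sup>2))
        = exp (- (1 / \<epsilon>)\<^sup>2 * (norm ((1 / a) *\<^sub>R (pos w - pos v)))\<^sup>2 / 2)"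
      unfolding norm_eq using pos by (simp add: power_mult_distrib power_divide field_simps)
    then show ?thesis
      using pos by (subst gauss_fourier) (auto simp: gauss_def K_def mult_ac simp del: scaleR_diff_right)
  qed
  have int: "integrable (cs \<Otimes>\<^sub>M lborel) (\<lambda>(w, t). ?f w t)"
  proof (rule Fubini_integrable)
    show "(\<lambda>(w, t). ?f w t) \<in> borel_measurable (cs \<Otimes>\<^sub>M lborel)"
      by (rule measurable_pair_measure_countable1) auto
    have "(\<integral>t. norm (?f w t) \<partial>lborel) = \<bar>F w\<bar> * (\<integral>t. gauss (1 / \<epsilon>) (t :: real ^ 'm) \<partial>lborel)" for w
      using pos by (simp add: abs_mult gauss_nonneg mult.commute)
    then show "integrable cs (\<lambda>w. \<integral>t. norm (case (w, t) of (w, t) \<Rightarrow> ?f w t) \<partial>lborel)"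
      unfolding prod.case using F by simp
    have "integrable lborel (\<lambda>t. ?f w t)" for w
    proof (rule Bochner_Integration.integrable_bound)
      show "integrable lborel (\<lambda>t :: real ^ 'm. F w * gauss (1 / \<epsilon>) t)"
        using pos by (intro integrable_mult_right integrable_gauss) simp
      show "AE t in lborel. norm (?f w t) \<le> norm (F w * gauss (1 / \<epsilon>) t)"
        by (rule AE_I2) (simp only: norm_scaleR norm_cis real_norm_def abs_mult mult_1_right mult.commute order.refl)
    qed measurable
    then show "AE w in cs. integrable lborel (\<lambda>t. case (w, t) of (w, t) \<Rightarrow> ?f w t)"
      by simp
  qed
  have "conv F (\<lambda>w. gauss (\<epsilon> * a) (pos w) * covol) v
      = (\<integral>w. F w * (gauss (\<epsilon> * a) (pos v - pos w) * covol) \<partial>cs)"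
    unfolding conv_def
    by (subst integral_cs_reflect[symmetric, where v=v]) (simp add: pos_diff mult.commute)
  then have "complex_of_real (conv F (\<lambda>w. gauss (\<epsilon> * a) (pos w) * covol) v)
      = (\<integral>w. complex_of_real (F w * (gauss (\<epsilon> * a) (pos v - pos w) * covol)) \<partial>cs)"
    by (simp only: integral_complex_of_real)
  also have "\<dots> = (\<integral>w. of_real K * (\<integral>t. ?f w t \<partial>lborel) \<partial>cs)"
  proof (intro Bochner_Integration.integral_cong refl)
    fix w
    have "(\<integral>t. ?f w t \<partial>lborel) = (\<integral>t. F w *\<^sub>R (gauss (1 / \<epsilon>) t *\<^sub>R cis (t \<bullet> ((1 / a) *\<^sub>R (pos w - pos v)))) \<partial>lborel)"
      by (simp add: mult.commute)
    also have "\<dots> = F w *\<^sub>R (\<integral>t. gauss (1 / \<epsilon>) t *\<^sub>R cis (t \<bullet> ((1 / a) *\<^sub>R (pos w - pos v))) \<partial>lborel)"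
      by (rule integral_scaleR_right)
    finally show "complex_of_real (F w * (gauss (\<epsilon> * a) (pos v - pos w) * covol)) = of_real K * (\<integral>t. ?f w t \<partial>lborel)"
      unfolding of_real_mult[of "F w"] g by (simp add: scaleR_conv_of_real mult_ac)
  qed
  also have "\<dots> = of_real K * (\<integral>w. (\<integral>t. ?f w t \<partial>lborel) \<partial>cs)"
    by simp
  also have "(\<integral>w. (\<integral>t. ?f w t \<partial>lborel) \<partial>cs) = (\<integral>t. (\<integral>w. ?f w t \<partial>cs) \<partial>lborel)"
    by (rule Fubini_integral[OF int, symmetric])
  also have "\<dots> = (\<integral>t. gauss (1 / \<epsilon>) t *\<^sub>R ((\<integral>w. F w *\<^sub>R cis (t \<bullet> ((1 / a) *\<^sub>R (pos w - b))) \<partial>cs)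
           * cis (- (t \<bullet> ((1 / a) *\<^sub>R (pos v - b))))) \<partial>lborel)"
  proof (intro Bochner_Integration.integral_cong refl)
    fix t
    have "cis (t \<bullet> ((1 / a) *\<^sub>R (pos w - pos v)))
        = cis (t \<bullet> ((1 / a) *\<^sub>R (pos w - b))) * cis (- (t \<bullet> ((1 / a) *\<^sub>R (pos v - b))))" for w
      unfolding cis_mult by (simp add: inner_diff_right diff_divide_distrib)
    then have "(\<integral>w. ?f w t \<partial>cs) = (\<integral>w. gauss (1 / \<epsilon>) t *\<^sub>R ((F w *\<^sub>R cis (t \<bullet> ((1 / a) *\<^sub>R (pos w - b))))
           * cis (- (t \<bullet> ((1 / a) *\<^sub>R (pos v - b))))) \<partial>cs)"
      by simp
    then show "(\<integral>w. ?f w t \<partial>cs) = gauss (1 / \<epsilon>) t *\<^sub>R ((\<integral>w. F w *\<^sub>R cis (t \<bullet> ((1 / a) *\<^sub>R (pos w - b))) \<partial>cs)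
           * cis (- (t \<bullet> ((1 / a) *\<^sub>R (pos v - b)))))"
      by (simp only: integral_scaleR_right integral_mult_left_zero)
  qed
  finally show ?thesis
    by (simp add: K_def)
qed

text \<open>The precisions \<open>\<epsilon>^2\<close> and \<open>1\<close> of the two factors add;
  the power of \<open>\<epsilon> / sqrt (1 + \<epsilon>^2)\<close> corrects the
  normalisation.\<close>

lemma gauss_mult_std:
  fixes t :: "'e::euclidean_space"
  assumes "\<epsilon> > 0"
  shows "gauss (1 / \<epsilon>) t * exp (- (norm t)\<^sup>2 / 2)
    = (\<epsilon> / sqrt (1 + \<epsilon>\<^sup>2)) ^ DIM('e) * gauss (1 / sqrt (1 + \<epsilon>\<^sup>2)) t"
proof -
  have p: "1 + \<epsilon>\<^sup>2 > 0"
    by (simp add: add_pos_nonneg)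
  have "exp (- (norm t)\<^sup>2 / (2 * (1 / \<epsilon>)\<^sup>2)) * exp (- (norm t)\<^sup>2 / 2) = exp (- (norm t)\<^sup>2 / (2 * (1 / sqrt (1 + \<epsilon>\<^sup>2))\<^sup>2))"
    unfolding exp_add[symmetric] using assms p by (simp add: power_divide field_simps)
  then show ?thesis
    using assms p by (simp add: gauss_def power_divide power_mult_distrib field_simps)
qed

text \<open>The same inversion applied to the expected limit \<open>p exp (- |t|^2 / 2)\<close>: the
  unit variance of the limit and the variance \<open>\<epsilon>^2\<close> of the mollifier add up,
  whence the width \<open>sqrt (1 + \<epsilon>^2) a\<close>.\<close>

lemma gauss_target_fourier:
  assumes "\<epsilon> > 0" "a > 0"
  shows "complex_of_real (p * covol * gauss (sqrt (1 + \<epsilon>\<^sup>2) * a) (y :: real ^ 'm)) =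
    of_real (covol / (sqrt (2 * pi) * \<epsilon> * a) ^ CARD('m)) *
      (\<integral>t. gauss (1 / \<epsilon>) t *\<^sub>R (of_real (p * exp (- (norm t)\<^sup>2 / 2)) * cis (- (t \<bullet> ((1 / a) *\<^sub>R y)))) \<partial>lborel)"
proof -
  define l where "l = sqrt (1 + \<epsilon>\<^sup>2)"
  have l: "l > 0"
    by (simp add: l_def add_pos_nonneg)
  have "(\<integral>t. gauss (1 / \<epsilon>) t *\<^sub>R (of_real (p * exp (- (norm t)\<^sup>2 / 2)) * cis (- (t \<bullet> ((1 / a) *\<^sub>R y)))) \<partial>lborel)
     = (\<integral>t. (p * (\<epsilon> / l) ^ CARD('m)) *\<^sub>R (gauss (1 / l) t *\<^sub>R cis (t \<bullet> (- ((1 / a) *\<^sub>R y)))) \<partial>lborel)"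
  proof (intro Bochner_Integration.integral_cong refl)
    fix t :: "real ^ 'm"
    have "gauss (1 / \<epsilon>) t *\<^sub>R (of_real (p * exp (- (norm t)\<^sup>2 / 2)) * cis (- (t \<bullet> ((1 / a) *\<^sub>R y))))
        = (p * (gauss (1 / \<epsilon>) t * exp (- (norm t)\<^sup>2 / 2))) *\<^sub>R cis (t \<bullet> (- ((1 / a) *\<^sub>R y)))"
      by (simp add: scaleR_conv_of_real mult_ac)
    then show "gauss (1 / \<epsilon>) t *\<^sub>R (of_real (p * exp (- (norm t)\<^sup>2 / 2)) * cis (- (t \<bullet> ((1 / a) *\<^sub>R y))))
        = (p * (\<epsilon> / l) ^ CARD('m)) *\<^sub>R (gauss (1 / l) t *\<^sub>R cis (t \<bullet> (- ((1 / a) *\<^sub>R y))))"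
      unfolding gauss_mult_std[OF assms(1)] by (simp add: l_def)
  qed
  also have "\<dots> = of_real (p * (\<epsilon> / l) ^ CARD('m) * exp (- (1 / l)\<^sup>2 * (norm (- ((1 / a) *\<^sub>R y)))\<^sup>2 / 2))"
    using l by (simp only: integral_scaleR_right gauss_fourier divide_pos_pos zero_less_one)
      (simp add: scaleR_conv_of_real)
  also have "- (1 / l)\<^sup>2 * (norm (- ((1 / a) *\<^sub>R y)))\<^sup>2 / 2 = - (norm y)\<^sup>2 / (2 * (l * a)\<^sup>2)"
    using assms l by (simp add: power_mult_distrib power_divide)
  finally show ?thesis
    using assms l unfolding l_def[symmetric] gauss_def
    by (simp add: power_mult_distrib power_divide mult_ac)
qed

text \<open>\<open>F\<close> plays the role of a finite measure on the lattice, seen from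
  \<open>b\<close> at scale \<open>a\<close>. It is not normalised: the value at
  \<open>t = 0\<close> records its mass.\<close>

definition chf :: "(int ^ 'm \<Rightarrow> real) \<Rightarrow> real \<Rightarrow> real ^ 'm \<Rightarrow> real ^ 'm \<Rightarrow> complex" where
  "chf F a b t = (\<integral>w. F w *\<^sub>R cis (t \<bullet> ((1 / a) *\<^sub>R (pos w - b))) \<partial>cs)"

lemma measurable_chf [measurable]: "chf F a b \<in> borel_measurable borel"
proof -
  interpret pair_sigma_finite cs "lborel :: (real ^ 'm) measure"
    by (intro pair_sigma_finite.intro sigma_finite_measure_count_space sigma_finite_lborel)
  have "(\<lambda>(w, t). F w *\<^sub>R cis (t \<bullet> ((1 / a) *\<^sub>R (pos w - b)))) \<in> borel_measurable (cs \<Otimes>\<^sub>M lborel)"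
    by (rule measurable_pair_measure_countable1) auto
  then have "(\<lambda>(t, w). F w *\<^sub>R cis (t \<bullet> ((1 / a) *\<^sub>R (pos w - b)))) \<in> borel_measurable (lborel \<Otimes>\<^sub>M cs)"
    by (subst measurable_pair_swap_iff) (simp add: split_def)
  then have "(\<lambda>t. \<integral>w. F w *\<^sub>R cis (t \<bullet> ((1 / a) *\<^sub>R (pos w - b))) \<partial>cs) \<in> borel_measurable lborel"
    by (rule sigma_finite_measure.borel_measurable_lebesgue_integral[OF sigma_finite_measure_count_space])
  then show ?thesis
    by (simp add: chf_def[abs_def])
qed

lemma norm_chf_le:
  assumes "\<And>v. F v \<ge> 0"
  shows "norm (chf F a b t) \<le> (\<integral>v. F v \<partial>cs)"
proof -
  have "norm (chf F a b t) \<le> (\<integral>w. norm (F w *\<^sub>R cis (t \<bullet> ((1 / a) *\<^sub>R (pos w - b)))) \<partial>cs)"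
    unfolding chf_def by (rule integral_norm_bound)
  then show ?thesis
    using assms by (simp only: norm_scaleR norm_cis mult_1_right real_norm_def abs_of_nonneg)
qed

text \<open>The factor \<open>gauss (1 / \<epsilon>)\<close> is, up to a constant, the Fourier transform of the mollifier. It turns
  pointwise convergence of \<open>chf\<close> into \<open>fdist \<longrightarrow> 0\<close> by dominated convergence.\<close>

definition fdist :: "real \<Rightarrow> real \<Rightarrow> (int ^ 'm \<Rightarrow> real) \<Rightarrow> real \<Rightarrow> real ^ 'm \<Rightarrow> real" where
  "fdist \<epsilon> p F a b = (\<integral>t. gauss (1 / \<epsilon>) t * norm (chf F a b t - of_real (p * exp (- (norm t)\<^sup>2 / 2))) \<partial>lborel)"

text \<open>Both terms are integrals against the same weight \<open>gauss (1 / \<epsilon>)\<close>,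
  so only the distance of the characteristic functions remains. In \<open>a\<close> the prefactor
  has the order \<open>a ^ - CARD('m)\<close> of the target density itself, so a small
  \<open>fdist\<close> means a small relative error in the bulk.\<close>

lemma conv_gauss_diff_le:
  assumes F: "integrable cs F" "\<And>v. F v \<ge> 0" and pos: "\<epsilon> > 0" "a > 0"
  shows "\<bar>conv F (\<lambda>w. gauss (\<epsilon> * a) (pos w) * covol) v
      - p * covol * gauss (sqrt (1 + \<epsilon>\<^sup>2) * a) (pos v - b)\<bar>
    \<le> covol / (sqrt (2 * pi) * \<epsilon> * a) ^ CARD('m) * fdist \<epsilon> p F a b"
proof -
  define K where "K = covol / (sqrt (2 * pi) * \<epsilon> * a) ^ CARD('m)"
  have K: "K \<ge> 0"
    using covol_pos pos by (simp add: K_def)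
  let ?c = "\<lambda>t. cis (- (t \<bullet> ((1 / a) *\<^sub>R (pos v - b))))"
  let ?e = "\<lambda>t::real^'m. complex_of_real (p * exp (- (norm t)\<^sup>2 / 2))"
  have g: "integrable lborel (gauss (1 / \<epsilon>) :: real ^ 'm \<Rightarrow> real)"
    using pos by (intro integrable_gauss) simp
  have g0: "gauss (1 / \<epsilon>) (t :: real ^ 'm) \<ge> 0" for t
    using pos by (intro gauss_nonneg) simp
  have i1: "integrable lborel (\<lambda>t. gauss (1 / \<epsilon>) t *\<^sub>R (chf F a b t * ?c t))"
  proof (rule Bochner_Integration.integrable_bound)
    show "integrable lborel (\<lambda>t :: real ^ 'm. gauss (1 / \<epsilon>) t * (\<integral>v. F v \<partial>cs))"
      using g by simp
    show "AE t in lborel. norm (gauss (1 / \<epsilon>) t *\<^sub>R (chf F a b t * ?c t)) \<le> norm (gauss (1 / \<epsilon>) t * (\<integral>v. F v \<partial>cs))"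
      using norm_chf_le[OF F(2)] g0 F(2)
      by (intro AE_I2) (simp add: norm_mult mult_left_mono del: scaleR_diff_right)
  qed measurable
  have i2: "integrable lborel (\<lambda>t. gauss (1 / \<epsilon>) t *\<^sub>R (?e t * ?c t))"
  proof (rule Bochner_Integration.integrable_bound)
    show "integrable lborel (\<lambda>t :: real ^ 'm. gauss (1 / \<epsilon>) t * p)"
      using g by simp
    have "\<bar>p\<bar> * exp (- (norm t)\<^sup>2 / 2) \<le> \<bar>p\<bar>" for t :: "real ^ 'm"
      by (intro mult_left_le) auto
    then show "AE t in lborel. norm (gauss (1 / \<epsilon>) t *\<^sub>R (?e t * ?c t)) \<le> norm (gauss (1 / \<epsilon>) t * p)"
      using g0 by (intro AE_I2) (simp add: norm_mult mult_left_mono abs_mult del: scaleR_diff_right)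
  qed measurable
  have "complex_of_real (conv F (\<lambda>w. gauss (\<epsilon> * a) (pos w) * covol) v
      - p * covol * gauss (sqrt (1 + \<epsilon>\<^sup>2) * a) (pos v - b))
    = of_real K * (\<integral>t. gauss (1 / \<epsilon>) t *\<^sub>R (chf F a b t * ?c t) \<partial>lborel)
      - of_real K * (\<integral>t. gauss (1 / \<epsilon>) t *\<^sub>R (?e t * ?c t) \<partial>lborel)"
    unfolding of_real_diff conv_gauss_fourier[OF F(1) pos, where b=b] gauss_target_fourier[OF pos] K_def chf_def ..
  also have "\<dots> = of_real K * (\<integral>t. gauss (1 / \<epsilon>) t *\<^sub>R (chf F a b t * ?c t) - gauss (1 / \<epsilon>) t *\<^sub>R (?e t * ?c t) \<partial>lborel)"
    unfolding Bochner_Integration.integral_diff[OF i1 i2] by (simp only: right_diff_distrib)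
  finally have eq: "complex_of_real (conv F (\<lambda>w. gauss (\<epsilon> * a) (pos w) * covol) v
      - p * covol * gauss (sqrt (1 + \<epsilon>\<^sup>2) * a) (pos v - b)) = \<dots>" .
  have "\<bar>conv F (\<lambda>w. gauss (\<epsilon> * a) (pos w) * covol) v
      - p * covol * gauss (sqrt (1 + \<epsilon>\<^sup>2) * a) (pos v - b)\<bar>
     = K * norm (\<integral>t. gauss (1 / \<epsilon>) t *\<^sub>R (chf F a b t * ?c t) - gauss (1 / \<epsilon>) t *\<^sub>R (?e t * ?c t) \<partial>lborel)"
    unfolding norm_of_real[symmetric, where 'a=complex] eq norm_mult using K by simp
  also have "\<dots> \<le> K * (\<integral>t. norm (gauss (1 / \<epsilon>) t *\<^sub>R (chf F a b t * ?c t) - gauss (1 / \<epsilon>) t *\<^sub>R (?e t * ?c t)) \<partial>lborel)"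
    by (intro mult_left_mono integral_norm_bound K)
  also have "(\<lambda>t. norm (gauss (1 / \<epsilon>) t *\<^sub>R (chf F a b t * ?c t) - gauss (1 / \<epsilon>) t *\<^sub>R (?e t * ?c t)))
      = (\<lambda>t. gauss (1 / \<epsilon>) t * norm (chf F a b t - ?e t))"
  proof
    fix t
    have "gauss (1 / \<epsilon>) t *\<^sub>R (chf F a b t * ?c t) - gauss (1 / \<epsilon>) t *\<^sub>R (?e t * ?c t)
      = gauss (1 / \<epsilon>) t *\<^sub>R ((chf F a b t - ?e t) * ?c t)"
      by (simp only: scaleR_diff_right left_diff_distrib)
    then show "norm (gauss (1 / \<epsilon>) t *\<^sub>R (chf F a b t * ?c t) - gauss (1 / \<epsilon>) t *\<^sub>R (?e t * ?c t))
      = gauss (1 / \<epsilon>) t * norm (chf F a b t - ?e t)"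
      using g0 by (simp only: norm_scaleR norm_mult norm_cis mult_1_right real_norm_def abs_of_nonneg)
  qed
  finally show ?thesis
    by (simp add: K_def fdist_def)
qed

text \<open>The square root of a Gaussian is again Gaussian, wider by \<open>sqrt 2\<close>;
  dividing by \<open>s ^ DIM('e)\<close> first makes the constant independent of \<open>s\<close>.
  In this form square roots of densities can be summed over the lattice.\<close>

lemma sqrt_gauss:
  fixes y :: "'e::euclidean_space"
  assumes "s > 0"
  shows "sqrt (gauss s y / s ^ DIM('e)) = (2 * sqrt pi) ^ DIM('e) / sqrt (sqrt (2 * pi) ^ DIM('e)) * gauss (sqrt 2 * s) y"
proof -
  have e: "sqrt (exp (- (norm y)\<^sup>2 / (2 * s\<^sup>2))) = exp (- (norm y)\<^sup>2 / (2 * (sqrt 2 * s)\<^sup>2))"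
    by (rule real_sqrt_unique) (simp_all add: power2_eq_square[of "exp _"] exp_add[symmetric] power_mult_distrib)
  have "sqrt (gauss s y / s ^ DIM('e)) = sqrt (exp (- (norm y)\<^sup>2 / (2 * s\<^sup>2))) / (sqrt (sqrt (2 * pi) ^ DIM('e)) * sqrt ((s ^ DIM('e))\<^sup>2))"
    unfolding gauss_def by (simp add: real_sqrt_divide real_sqrt_mult power_mult_distrib power2_eq_square)
  also have "\<dots> = exp (- (norm y)\<^sup>2 / (2 * (sqrt 2 * s)\<^sup>2)) / (sqrt (sqrt (2 * pi) ^ DIM('e)) * s ^ DIM('e))"
    using assms unfolding e by simp
  also have "\<dots> = (2 * sqrt pi) ^ DIM('e) / sqrt (sqrt (2 * pi) ^ DIM('e)) * gauss (sqrt 2 * s) y"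
  proof -
    have "sqrt (2 * pi) * (sqrt 2 * s) = (2 * sqrt pi) * s"
      by (simp add: real_sqrt_mult)
    then have "gauss (sqrt 2 * s) y = exp (- (norm y)\<^sup>2 / (2 * (sqrt 2 * s)\<^sup>2)) / ((2 * sqrt pi) ^ DIM('e) * s ^ DIM('e))"
      by (simp only: gauss_def power_mult_distrib[of "2 * sqrt pi"])
    then show ?thesis
      using assms by (simp add: field_simps)
  qed
  finally show ?thesis .
qed

text \<open>One has \<open>|U - V| = U - V + 2 max 0 (V - U)\<close>, and a deficit bounded by both
  \<open>V\<close> and \<open>\<eta>\<close> is at most their geometric mean.\<close>

lemma diff_le_sqrt:
  fixes U V \<eta> :: real
  assumes "U \<ge> 0" "V \<ge> 0" "\<eta> \<ge> 0" "\<bar>U - V\<bar> \<le> \<eta>"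
  shows "\<bar>U - V\<bar> \<le> U - V + 2 * sqrt (V * \<eta>)"
proof (cases "U \<ge> V")
  case False
  have "V - U \<le> min V \<eta>"
    using assms by auto
  also have "min V \<eta> \<le> sqrt (V * \<eta>)"
  proof (rule real_le_rsqrt)
    show "(min V \<eta>)\<^sup>2 \<le> V * \<eta>"
      using assms unfolding power2_eq_square by (intro mult_mono) auto
  qed
  finally show ?thesis
    using False by simp
qed (use assms in simp)

text \<open>Scheffe's argument made quantitative: \<open>U - V\<close> sums to a difference of
  masses, and the deficit is at most the square root of the target times the pointwise error, which
  is a multiple of a Gaussian and hence summable.\<close>

lemma conv_gauss_l1_le:
  assumes F: "integrable cs F" "\<And>v. F v \<ge> 0" and pos: "\<epsilon> > 0" "a > 0" and "p \<ge> 0"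
  defines "l \<equiv> sqrt (1 + \<epsilon>\<^sup>2)"
  shows "(\<integral>v. \<bar>conv F (\<lambda>w. gauss (\<epsilon> * a) (pos w) * covol) v - p * covol * gauss (l * a) (pos v - b)\<bar> \<partial>cs)
    \<le> (\<integral>v. F v \<partial>cs) * gsum (\<epsilon> * a) 0 - p * gsum (l * a) b
      + 2 * sqrt (p * (l / (sqrt (2 * pi) * \<epsilon>)) ^ CARD('m) * fdist \<epsilon> p F a b)
          * ((2 * sqrt pi) ^ CARD('m) / sqrt (sqrt (2 * pi) ^ CARD('m))) * gsum (sqrt 2 * (l * a)) b"
proof -
  let ?W = "\<lambda>w. gauss (\<epsilon> * a) (pos w) * covol"
  let ?V = "\<lambda>v. p * covol * gauss (l * a) (pos v - b)"
  define D where "D = sqrt (p * (l / (sqrt (2 * pi) * \<epsilon>)) ^ CARD('m) * fdist \<epsilon> p F a b)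
          * ((2 * sqrt pi) ^ CARD('m) / sqrt (sqrt (2 * pi) ^ CARD('m)))"
  have l: "l > 0"
    by (simp add: l_def add_pos_nonneg)
  have la: "l * a > 0" "\<epsilon> * a > 0"
    using l pos by auto
  have W: "integrable cs ?W" "(\<integral>w. ?W w \<partial>cs) = gsum (\<epsilon> * a) 0"
    using integrable_lattice_gauss[OF la(2), of 0] by (simp_all add: gsum_def)
  note U = integrable_conv[OF F(1) W(1)]
  have V: "integrable cs ?V" "(\<integral>v. ?V v \<partial>cs) = p * gsum (l * a) b"
    using integrable_lattice_gauss[OF la(1), of b] by (simp_all add: gsum_def mult_ac)
  have U0: "conv F ?W v \<ge> 0" for v
    unfolding conv_def using F(2) covol_pos la
    by (intro integral_nonneg_AE) (auto simp: gauss_nonneg)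
  have fd: "fdist \<epsilon> p F a b \<ge> 0"
    unfolding fdist_def using pos by (intro integral_nonneg_AE AE_I2) (auto simp: gauss_nonneg)
  have ptw: "\<bar>conv F ?W v - ?V v\<bar> \<le> conv F ?W v - ?V v + 2 * (D * (gauss (sqrt 2 * (l * a)) (pos v - b) * covol))" for v
  proof -
    let ?\<eta> = "covol / (sqrt (2 * pi) * \<epsilon> * a) ^ CARD('m) * fdist \<epsilon> p F a b"
    have "\<bar>conv F ?W v - ?V v\<bar> \<le> conv F ?W v - ?V v + 2 * sqrt (?V v * ?\<eta>)"
      using conv_gauss_diff_le[OF F pos, of v p b] U0 covol_pos fd pos l \<open>p \<ge> 0\<close>
      by (intro diff_le_sqrt) (auto simp: l_def gauss_nonneg)
    \<comment> \<open>The factor \<open>a ^ - CARD('m)\<close> of the pointwise error supplies the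
      denominator asked for by \<open>sqrt_gauss\<close>, so that no power of \<open>a\<close> is
      left over.\<close>
    also have "?V v * ?\<eta> = covol\<^sup>2 * (p * (l / (sqrt (2 * pi) * \<epsilon>)) ^ CARD('m) * fdist \<epsilon> p F a b)
        * (gauss (l * a) (pos v - b) / (l * a) ^ DIM(real ^ 'm))"
      using l pos by (simp add: power_mult_distrib power_divide power2_eq_square mult_ac)
    also have "sqrt \<dots> = D * (gauss (sqrt 2 * (l * a)) (pos v - b) * covol)"
      unfolding real_sqrt_mult[of "_ * _" "_ / _"] sqrt_gauss[OF la(1)]
      using covol_pos by (simp add: D_def real_sqrt_mult[of "covol\<^sup>2"])
    finally show ?thesis .
  qed
  have "(\<integral>v. \<bar>conv F ?W v - ?V v\<bar> \<partial>cs)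
      \<le> (\<integral>v. conv F ?W v - ?V v + 2 * (D * (gauss (sqrt 2 * (l * a)) (pos v - b) * covol)) \<partial>cs)"
    using U(1) V(1) integrable_lattice_gauss[of "sqrt 2 * (l * a)" b] la
    by (intro integral_mono ptw integrable_abs Bochner_Integration.integrable_diff Bochner_Integration.integrable_add
        integrable_mult_right integrable_mult_left) auto
  also have "\<dots> = (\<integral>v. conv F ?W v \<partial>cs) - (\<integral>v. ?V v \<partial>cs) + 2 * (D * gsum (sqrt 2 * (l * a)) b)"
    using U(1) V(1) integrable_lattice_gauss[of "sqrt 2 * (l * a)" b] la
    by (subst Bochner_Integration.integral_add) (simp_all add: gsum_def)
  finally show ?thesis
    unfolding U(2) V(2) W(2) by (simp add: D_def mult.assoc)
qed

text \<open>Displacements shorter than \<open>\<delta> a\<close> are controlled by almost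
  invariance. The longer ones have small weight because the mollifier lives at scale
  \<open>\<epsilon> a\<close>, and for them the trivial bound by twice the mass is enough.\<close>

lemma gauss_smoothing_le:
  assumes F: "integrable cs F" "\<And>v. F v \<ge> 0" and pos: "\<epsilon> > 0" "a > 0" "\<delta> > 0" "\<epsilon>' \<ge> 0"
    and smooth: "\<And>w. norm (pos w) \<le> \<delta> * a \<Longrightarrow> (\<integral>v. \<bar>F (v - w) - F v\<bar> \<partial>cs) \<le> \<epsilon>'"
  shows "(\<integral>v. \<bar>conv F (\<lambda>w. gauss (\<epsilon> * a) (pos w) * covol) v - gsum (\<epsilon> * a) 0 * F v\<bar> \<partial>cs)
    \<le> \<epsilon>' * gsum (\<epsilon> * a) 0
      + 2 * (\<integral>v. F v \<partial>cs) * (sqrt 2 ^ CARD('m) * exp (- \<delta>\<^sup>2 / (4 * \<epsilon>\<^sup>2))) * gsum (sqrt 2 * (\<epsilon> * a)) 0"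
proof -
  let ?W = "\<lambda>w. gauss (\<epsilon> * a) (pos w) * covol"
  let ?T = "\<integral>v. F v \<partial>cs"
  define C where "C = sqrt 2 ^ CARD('m) * exp (- \<delta>\<^sup>2 / (4 * \<epsilon>\<^sup>2))"
  let ?R = "\<lambda>w. \<epsilon>' * (gauss (\<epsilon> * a) (pos w) * covol) + 2 * ?T * C * (gauss (sqrt 2 * (\<epsilon> * a)) (pos w) * covol)"
  have ea: "\<epsilon> * a > 0" "sqrt 2 * (\<epsilon> * a) > 0"
    using pos by auto
  have T0: "?T \<ge> 0"
    using F(2) by simp
  have C0: "C \<ge> 0"
    by (simp add: C_def)
  \<comment> \<open>Half of the Gaussian exponent pays for the factor
    \<open>exp (- \<delta>^2 / (4 \<epsilon>^2))\<close>; the other half is kept as a wider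
    Gaussian, so that the tail is again a lattice sum.\<close>
  have tail: "gauss (\<epsilon> * a) (pos w) \<le> C * gauss (sqrt 2 * (\<epsilon> * a)) (pos w)" if "norm (pos w) > \<delta> * a" for w
  proof -
    have "(\<delta> * a)\<^sup>2 \<le> (norm (pos w))\<^sup>2"
      using that pos by (intro power_mono) auto
    then have "(\<delta> * a)\<^sup>2 / (4 * (\<epsilon> * a)\<^sup>2) \<le> (norm (pos w))\<^sup>2 / (4 * (\<epsilon> * a)\<^sup>2)"
      using pos by (intro divide_right_mono) auto
    moreover have "(\<delta> * a)\<^sup>2 / (4 * (\<epsilon> * a)\<^sup>2) = \<delta>\<^sup>2 / (4 * \<epsilon>\<^sup>2)"
      using pos by (simp add: power_mult_distrib)
    ultimately have "- (norm (pos w))\<^sup>2 / (2 * (\<epsilon> * a)\<^sup>2) \<le> - \<delta>\<^sup>2 / (4 * \<epsilon>\<^sup>2) + - (norm (pos w))\<^sup>2 / (2 * (sqrt 2 * (\<epsilon> * a))\<^sup>2)"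
      by (simp add: power_mult_distrib)
    then have "exp (- (norm (pos w))\<^sup>2 / (2 * (\<epsilon> * a)\<^sup>2)) \<le> exp (- \<delta>\<^sup>2 / (4 * \<epsilon>\<^sup>2)) * exp (- (norm (pos w))\<^sup>2 / (2 * (sqrt 2 * (\<epsilon> * a))\<^sup>2))"
      unfolding exp_add[symmetric] by simp
    then have "exp (- (norm (pos w))\<^sup>2 / (2 * (\<epsilon> * a)\<^sup>2)) / (sqrt (2 * pi) * (\<epsilon> * a)) ^ CARD('m)
       \<le> (exp (- \<delta>\<^sup>2 / (4 * \<epsilon>\<^sup>2)) * exp (- (norm (pos w))\<^sup>2 / (2 * (sqrt 2 * (\<epsilon> * a))\<^sup>2))) / (sqrt (2 * pi) * (\<epsilon> * a)) ^ CARD('m)"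
      using pos by (intro divide_right_mono) auto
    also have "\<dots> = C * gauss (sqrt 2 * (\<epsilon> * a)) (pos w)"
    proof -
      have "sqrt (2 * pi) * (sqrt 2 * (\<epsilon> * a)) = sqrt 2 * (sqrt (2 * pi) * (\<epsilon> * a))"
        by simp
      then have "(sqrt (2 * pi) * (sqrt 2 * (\<epsilon> * a))) ^ CARD('m) = sqrt 2 ^ CARD('m) * (sqrt (2 * pi) * (\<epsilon> * a)) ^ CARD('m)"
        by (simp only: power_mult_distrib[of "sqrt 2"])
      then show ?thesis
        by (simp add: gauss_def C_def)
    qed
    finally show ?thesis
      by (simp add: gauss_def)
  qed
  have crude: "(\<integral>v. \<bar>F (v - w) - F v\<bar> \<partial>cs) \<le> 2 * ?T" for w
  proof -
    have "(\<integral>v. \<bar>F (v - w) - F v\<bar> \<partial>cs) \<le> (\<integral>v. F (v - w) + F v \<partial>cs)"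
      using F integrable_cs_shift[OF F(1)]
      by (intro integral_mono) (auto simp: abs_le_iff add_nonneg_nonneg)
    also have "\<dots> = 2 * ?T"
      using F integrable_cs_shift[OF F(1)] by (simp add: integral_cs_shift)
    finally show ?thesis .
  qed
  have W: "integrable cs ?W" "(\<integral>w. ?W w \<partial>cs) = gsum (\<epsilon> * a) 0"
    using integrable_lattice_gauss[OF ea(1), of 0] by (simp_all add: gsum_def)
  have W2: "integrable cs (\<lambda>w. gauss (sqrt 2 * (\<epsilon> * a)) (pos w) * covol)"
    "(\<integral>w. gauss (sqrt 2 * (\<epsilon> * a)) (pos w) * covol \<partial>cs) = gsum (sqrt 2 * (\<epsilon> * a)) 0"
    using integrable_lattice_gauss[OF ea(2), of 0] by (simp_all add: gsum_def)
  have R: "integrable cs ?R"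
    using W W2 by (intro Bochner_Integration.integrable_add integrable_mult_right)
  have "(\<integral>v. \<bar>conv F ?W v - (\<integral>w. ?W w \<partial>cs) * F v\<bar> \<partial>cs) \<le> (\<integral>w. ?R w \<partial>cs)"
  proof (rule conv_diff_le[OF F(1) W(1) _ R])
    fix w
    show W0: "0 \<le> ?W w"
      using ea covol_pos by (simp add: gauss_nonneg)
    have g2: "0 \<le> gauss (sqrt 2 * (\<epsilon> * a)) (pos w) * covol"
      using ea covol_pos by (simp add: gauss_nonneg)
    show "?W w * (\<integral>v. \<bar>F (v - w) - F v\<bar> \<partial>cs) \<le> ?R w"
    proof (cases "norm (pos w) \<le> \<delta> * a")
      case True
      then have "?W w * (\<integral>v. \<bar>F (v - w) - F v\<bar> \<partial>cs) \<le> ?W w * \<epsilon>'"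
        by (intro mult_left_mono smooth W0)
      moreover have "0 \<le> 2 * ?T * C * (gauss (sqrt 2 * (\<epsilon> * a)) (pos w) * covol)"
        using T0 C0 g2 by (intro mult_nonneg_nonneg[of "2 * ?T * C"]) auto
      ultimately show ?thesis
        by (simp only: mult.commute[of \<epsilon>'])
    next
      case False
      then have "?W w * (\<integral>v. \<bar>F (v - w) - F v\<bar> \<partial>cs) \<le> (C * gauss (sqrt 2 * (\<epsilon> * a)) (pos w) * covol) * (2 * ?T)"
        using W0 crude tail[of w] C0 ea covol_pos
        by (intro mult_mono[of "gauss (\<epsilon> * a) (pos w) * covol"] mult_right_mono mult_nonneg_nonneg gauss_nonneg) auto
      moreover have "0 \<le> \<epsilon>' * ?W w"
        by (rule mult_nonneg_nonneg[OF pos(4) W0])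
      ultimately show ?thesis
        by (simp only: mult_ac)
    qed
  qed
  also have "(\<integral>w. ?R w \<partial>cs) = \<epsilon>' * gsum (\<epsilon> * a) 0 + 2 * ?T * C * gsum (sqrt 2 * (\<epsilon> * a)) 0"
    unfolding Bochner_Integration.integral_add[OF integrable_mult_right[OF W(1)] integrable_mult_right[OF W2(1)]]
      integral_mult_right_zero W(2) W2(2) ..
  finally show ?thesis
    unfolding W(2) C_def .
qed

text \<open>\<open>gauss a\<close> divided by \<open>l ^ CARD('m)\<close> lies below both Gaussians,
  and the distance of two numbers is at most their sum minus twice a common lower bound.\<close>

lemma gauss_rescale_le:
  assumes "a > 0" "l \<ge> 1"
  shows "(\<integral>v. \<bar>covol * gauss (l * a) (pos v - b) - covol * gauss a (pos v - b)\<bar> \<partial>cs)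
    \<le> gsum (l * a) b + (1 - 2 / l ^ CARD('m)) * gsum a b"
proof -
  define c where "c = 1 / l ^ CARD('m)"
  have c: "0 < c" "c \<le> 1"
    using assms by (auto simp: c_def one_le_power)
  have la: "l * a > 0"
    using assms by simp
  have ptw: "\<bar>covol * gauss (l * a) y - covol * gauss a y\<bar> \<le> gauss (l * a) y * covol + (1 - 2 * c) * (gauss a y * covol)" for y :: "real ^ 'm"
  proof -
    have "(norm y)\<^sup>2 / (2 * (l * a)\<^sup>2) \<le> (norm y)\<^sup>2 / (2 * a\<^sup>2)"
    proof (rule divide_left_mono)
      have "1 * a\<^sup>2 \<le> l\<^sup>2 * a\<^sup>2"
        using assms by (intro mult_right_mono) auto
      then show "2 * a\<^sup>2 \<le> 2 * (l * a)\<^sup>2"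
        by (simp add: power_mult_distrib)
    qed (use assms in auto)
    then have "exp (- (norm y)\<^sup>2 / (2 * a\<^sup>2)) \<le> exp (- (norm y)\<^sup>2 / (2 * (l * a)\<^sup>2))"
      by simp
    then have "exp (- (norm y)\<^sup>2 / (2 * a\<^sup>2)) / (sqrt (2 * pi) * (l * a)) ^ CARD('m)
        \<le> exp (- (norm y)\<^sup>2 / (2 * (l * a)\<^sup>2)) / (sqrt (2 * pi) * (l * a)) ^ CARD('m)"
      using assms by (intro divide_right_mono) auto
    moreover have "exp (- (norm y)\<^sup>2 / (2 * a\<^sup>2)) / (sqrt (2 * pi) * (l * a)) ^ CARD('m) = c * gauss a y"
      by (simp add: gauss_def c_def power_mult_distrib mult_ac)
    ultimately have 1: "c * gauss a y \<le> gauss (l * a) y"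
      by (simp add: gauss_def)
    have 2: "c * gauss a y \<le> gauss a y"
      using c assms by (intro mult_left_le_one_le) (auto simp: gauss_nonneg)
    have "\<bar>gauss (l * a) y - gauss a y\<bar> \<le> gauss (l * a) y + (1 - 2 * c) * gauss a y"
      using 1 2 by (simp add: abs_le_iff algebra_simps)
    then have "\<bar>gauss (l * a) y - gauss a y\<bar> * covol \<le> (gauss (l * a) y + (1 - 2 * c) * gauss a y) * covol"
      using covol_pos by (intro mult_right_mono) auto
    then show ?thesis
      using covol_pos unfolding right_diff_distrib[symmetric] abs_mult
      by (simp add: distrib_left distrib_right mult_ac)
  qed
  have i: "integrable cs (\<lambda>v. gauss (l * a) (pos v - b) * covol)" "integrable cs (\<lambda>v. gauss a (pos v - b) * covol)"
    using integrable_lattice_gauss[OF la] integrable_lattice_gauss[OF assms(1)] by auto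
  have "(\<integral>v. \<bar>covol * gauss (l * a) (pos v - b) - covol * gauss a (pos v - b)\<bar> \<partial>cs)
    \<le> (\<integral>v. gauss (l * a) (pos v - b) * covol + (1 - 2 * c) * (gauss a (pos v - b) * covol) \<partial>cs)"
    using i by (intro integral_mono ptw integrable_abs Bochner_Integration.integrable_diff Bochner_Integration.integrable_add
        integrable_mult_right) (auto simp: mult.commute)
  also have "\<dots> = gsum (l * a) b + (1 - 2 * c) * gsum a b"
    unfolding Bochner_Integration.integral_add[OF i(1) integrable_mult_right[OF i(2)]] gsum_def by simp
  finally show ?thesis
    by (simp add: c_def)
qed

lemma tendsto_gsum:
  assumes "filterlim a at_top sequentially" "c > 0"
  shows "(\<lambda>n. gsum (c * a n) (b n)) \<longlonglongrightarrow> 1"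
proof (rule tendstoI)
  fix e :: real assume "e > 0"
  have "filterlim (\<lambda>n. c * a n) at_top sequentially"
    using assms by (intro filterlim_tendsto_pos_mult_at_top[OF tendsto_const])
  then have "eventually (\<lambda>n. \<forall>b. \<bar>gsum (c * a n) b - 1\<bar> < e) sequentially"
    by (rule eventually_compose_filterlim[OF uniform_limit_gsum[OF \<open>e > 0\<close>]])
  then show "eventually (\<lambda>n. dist (gsum (c * a n) (b n)) 1 < e) sequentially"
    by (auto simp: dist_real_def elim: eventually_mono)
qed

lemma tendsto_fdist:
  fixes F :: "nat \<Rightarrow> int ^ 'm \<Rightarrow> real" and a :: "nat \<Rightarrow> real" and b :: "nat \<Rightarrow> real ^ 'm"
  assumes F: "\<And>n. integrable cs (F n)" "\<And>n v. F n v \<ge> 0" and "\<epsilon> > 0"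
    and T: "(\<lambda>n. \<integral>v. F n v \<partial>cs) \<longlonglongrightarrow> p"
    and chf: "\<And>t. (\<lambda>n. chf (F n) (a n) (b n) t) \<longlonglongrightarrow> of_real (p * exp (- (norm t)\<^sup>2 / 2))"
  shows "(\<lambda>n. fdist \<epsilon> p (F n) (a n) (b n)) \<longlonglongrightarrow> 0"
proof -
  obtain B where B: "\<And>n. \<bar>\<integral>v. F n v \<partial>cs\<bar> \<le> B"
    using convergent_imp_Bseq[OF convergentI[OF T]] unfolding Bseq_def by auto
  have g0: "gauss (1 / \<epsilon>) (t :: real ^ 'm) \<ge> 0" for t
    using assms by (intro gauss_nonneg) simp
  let ?s = "\<lambda>n t. gauss (1 / \<epsilon>) t * norm (chf (F n) (a n) (b n) t - of_real (p * exp (- (norm t)\<^sup>2 / 2)))"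
  have "(\<lambda>n. \<integral>t. ?s n t \<partial>lborel) \<longlonglongrightarrow> (\<integral>t. 0 \<partial>(lborel :: (real ^ 'm) measure))"
  proof (rule integral_dominated_convergence)
    show "integrable lborel (\<lambda>t :: real ^ 'm. gauss (1 / \<epsilon>) t * (B + \<bar>p\<bar>))"
      using \<open>\<epsilon> > 0\<close> by (intro integrable_mult_left integrable_gauss) simp
    show "AE t in lborel. (\<lambda>n. ?s n t) \<longlonglongrightarrow> 0"
    proof (rule AE_I2)
      fix t :: "real ^ 'm"
      have "(\<lambda>n. norm (chf (F n) (a n) (b n) t - of_real (p * exp (- (norm t)\<^sup>2 / 2)))) \<longlonglongrightarrow> 0"
        using LIM_zero[OF chf[of t]] by (rule tendsto_norm_zero)
      then show "(\<lambda>n. ?s n t) \<longlonglongrightarrow> 0"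
        by (rule tendsto_mult_right_zero)
    qed
    show "AE t in lborel. norm (?s n t) \<le> gauss (1 / \<epsilon>) t * (B + \<bar>p\<bar>)" for n
    proof (rule AE_I2)
      fix t :: "real ^ 'm"
      have "norm (of_real (p * exp (- (norm t)\<^sup>2 / 2)) :: complex) \<le> \<bar>p\<bar>"
        unfolding norm_of_real abs_mult by (intro mult_left_le) auto
      moreover have "norm (chf (F n) (a n) (b n) t) \<le> B"
        using norm_chf_le[of "F n" "a n" "b n" t, OF F(2)] B[of n] by linarith
      ultimately have "norm (chf (F n) (a n) (b n) t - of_real (p * exp (- (norm t)\<^sup>2 / 2))) \<le> B + \<bar>p\<bar>"
        using norm_triangle_ineq4[of "chf (F n) (a n) (b n) t" "of_real (p * exp (- (norm t)\<^sup>2 / 2))"] by linarith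
      then show "norm (?s n t) \<le> gauss (1 / \<epsilon>) t * (B + \<bar>p\<bar>)"
        using g0[of t] by (simp only: real_norm_def abs_mult abs_of_nonneg abs_norm_cancel mult_left_mono)
    qed
  qed measurable
  then show ?thesis
    by (simp add: fdist_def)
qed

lemma chf_0: "chf F a b 0 = of_real (\<integral>v. F v \<partial>cs)"
  unfolding chf_def by (simp add: scaleR_conv_of_real)

text \<open>Mollify \<open>F n\<close> by a Gaussian of width \<open>\<epsilon> a n\<close>. The hypothesis \<open>smooth\<close> makes the error small in
  \<open>\<ell>\<^sup>1\<close>; the mollified density is controlled pointwise by Fourier inversion, and pointwise closeness
  to a Gaussian of the same total mass gives closeness in \<open>\<ell>\<^sup>1\<close>.\<close>

theorem lattice_local_limit:
  fixes F :: "nat \<Rightarrow> int ^ 'm \<Rightarrow> real" and a :: "nat \<Rightarrow> real" and b :: "nat \<Rightarrow> real ^ 'm"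
  assumes F: "\<And>n. integrable cs (F n)" "\<And>n v. F n v \<ge> 0"
    and a: "filterlim a at_top sequentially"
    and chf: "\<And>t. (\<lambda>n. chf (F n) (a n) (b n) t) \<longlonglongrightarrow> of_real (p * exp (- (norm t)\<^sup>2 / 2))"
    and smooth: "\<And>\<epsilon>. \<epsilon> > 0 \<Longrightarrow> \<exists>\<delta>>0. \<forall>\<^sub>F n in sequentially. \<forall>w. norm (pos w) \<le> \<delta> * a n \<longrightarrow>
      (\<integral>v. \<bar>F n (v - w) - F n v\<bar> \<partial>cs) \<le> \<epsilon>"
  shows "(\<lambda>n. \<integral>v. \<bar>F n v - p * covol * gauss (a n) (pos v - b n)\<bar> \<partial>cs) \<longlonglongrightarrow> 0"
proof (rule LIMSEQ_I)
  fix e :: real assume e: "e > 0"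
  have "(\<lambda>n. complex_of_real (\<integral>v. F n v \<partial>cs)) \<longlonglongrightarrow> of_real p"
    using chf[of 0] by (simp add: chf_0)
  then have T: "(\<lambda>n. \<integral>v. F n v \<partial>cs) \<longlonglongrightarrow> p"
    by (simp only: tendsto_of_real_iff)
  have p: "p \<ge> 0"
    by (rule LIMSEQ_le_const[OF T]) (use F(2) in simp)
  obtain \<delta> where \<delta>: "\<delta> > 0" and ev: "\<forall>\<^sub>F n in sequentially. \<forall>w. norm (pos w) \<le> \<delta> * a n \<longrightarrow>
      (\<integral>v. \<bar>F n (v - w) - F n v\<bar> \<partial>cs) \<le> e / 2"
    using smooth[of "e / 2"] e by auto
  \<comment> \<open>The part of the error that survives as \<open>n\<close> grows: the long
    displacements and the excess width of the mollified Gaussian. Since \<open>\<delta>\<close> is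
    already fixed, it vanishes with \<open>\<epsilon>\<close>.\<close>
  define g where "g = (\<lambda>\<epsilon>::real. 2 * p * (sqrt 2 ^ CARD('m) * exp (- \<delta>\<^sup>2 / (4 * \<epsilon>\<^sup>2)))
      + p * (1 + (1 - 2 / sqrt (1 + \<epsilon>\<^sup>2) ^ CARD('m))))"
  have "((\<lambda>\<epsilon>. exp (- \<delta>\<^sup>2 / (4 * \<epsilon>\<^sup>2))) \<longlongrightarrow> 0) (at_right (0::real))"
    using \<delta> by real_asymp
  moreover have "((\<lambda>\<epsilon>. sqrt (1 + \<epsilon>\<^sup>2) ^ CARD('m)) \<longlongrightarrow> sqrt (1 + 0\<^sup>2) ^ CARD('m)) (at_right (0::real))"
    by (intro tendsto_intros)
  ultimately have "(g \<longlongrightarrow> 2 * p * (sqrt 2 ^ CARD('m) * 0) + p * (1 + (1 - 2 / sqrt (1 + 0\<^sup>2) ^ CARD('m)))) (at_right 0)"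
    unfolding g_def by (intro tendsto_intros) auto
  then have "(g \<longlongrightarrow> 0) (at_right 0)"
    by simp
  then have "eventually (\<lambda>\<epsilon>. g \<epsilon> < e / 2) (at_right 0)"
    using e by (intro order_tendstoD(2)) auto
  then have "eventually (\<lambda>\<epsilon>. g \<epsilon> < e / 2 \<and> \<epsilon> > 0) (at_right 0)"
    using eventually_at_right_less[of "0::real"] by (rule eventually_conj)
  then obtain \<epsilon> where \<epsilon>: "\<epsilon> > 0" "g \<epsilon> < e / 2"
    using eventually_happens'[OF trivial_limit_at_right_real] by (metis (mono_tags, lifting))
  define l where "l = sqrt (1 + \<epsilon>\<^sup>2)"
  have l: "l \<ge> 1"
    by (simp add: l_def)
  define T' where "T' = (\<lambda>n. \<integral>v. F n v \<partial>cs)"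
  define D where "D = (2 * sqrt pi) ^ CARD('m) / sqrt (sqrt (2 * pi) ^ CARD('m))"
  define C where "C = sqrt 2 ^ CARD('m) * exp (- \<delta>\<^sup>2 / (4 * \<epsilon>\<^sup>2))"
  \<comment> \<open>The terms bound, in order, the normalisation of the discretised mollifier, the
    smoothing error, the Fourier comparison, and the return from width \<open>l a\<close> to width
    \<open>a\<close>.\<close>
  define B where "B = (\<lambda>n. \<bar>1 - gsum (\<epsilon> * a n) 0\<bar> * T' n
     + (e / 2 * gsum (\<epsilon> * a n) 0 + 2 * T' n * C * gsum (sqrt 2 * \<epsilon> * a n) 0)
     + (T' n * gsum (\<epsilon> * a n) 0 - p * gsum (l * a n) (b n)
        + 2 * sqrt (p * (l / (sqrt (2 * pi) * \<epsilon>)) ^ CARD('m) * fdist \<epsilon> p (F n) (a n) (b n)) * D * gsum (sqrt 2 * l * a n) (b n))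
     + p * (gsum (l * a n) (b n) + (1 - 2 / l ^ CARD('m)) * gsum (1 * a n) (b n)))"
  have "B \<longlonglongrightarrow> \<bar>1 - 1\<bar> * p
     + (e / 2 * 1 + 2 * p * C * 1)
     + (p * 1 - p * 1
        + 2 * sqrt (p * (l / (sqrt (2 * pi) * \<epsilon>)) ^ CARD('m) * 0) * D * 1)
     + p * (1 + (1 - 2 / l ^ CARD('m)) * 1)"
    unfolding B_def T'_def using l \<epsilon>
    by (intro tendsto_intros T tendsto_gsum[OF a] tendsto_fdist[OF F _ T chf]) auto
  also have "\<bar>1 - 1\<bar> * p
     + (e / 2 * 1 + 2 * p * C * 1)
     + (p * 1 - p * 1
        + 2 * sqrt (p * (l / (sqrt (2 * pi) * \<epsilon>)) ^ CARD('m) * 0) * D * 1)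
     + p * (1 + (1 - 2 / l ^ CARD('m)) * 1) = e / 2 + g \<epsilon>"
    by (simp add: g_def C_def l_def)
  finally have lim: "B \<longlonglongrightarrow> e / 2 + g \<epsilon>" .
  have "eventually (\<lambda>n. B n < e) sequentially"
    using \<epsilon>(2) by (intro order_tendstoD(2)[OF lim]) simp
  moreover have "eventually (\<lambda>n. a n > 0) sequentially"
    using a by (simp add: filterlim_at_top_dense)
  ultimately have "eventually (\<lambda>n. norm ((\<integral>v. \<bar>F n v - p * covol * gauss (a n) (pos v - b n)\<bar> \<partial>cs) - 0) < e) sequentially"
    using ev
  proof eventually_elim
    case (elim n)
    define U where "U = conv (F n) (\<lambda>w. gauss (\<epsilon> * a n) (pos w) * covol)"
    define V where "V = (\<lambda>v. p * covol * gauss (l * a n) (pos v - b n))"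
    define G where "G = (\<lambda>v. p * covol * gauss (a n) (pos v - b n))"
    define S where "S = gsum (\<epsilon> * a n) 0"
    have int: "integrable cs U" "integrable cs V" "integrable cs G" "integrable cs (F n)"
      using elim \<epsilon> l integrable_lattice_gauss[of "\<epsilon> * a n" 0] F
      unfolding U_def V_def G_def
      by (auto intro!: integrable_conv(1) integrable_lattice_gauss)
    have "(\<integral>v. \<bar>F n v - G v\<bar> \<partial>cs) \<le> (\<integral>v. \<bar>1 - S\<bar> * F n v + \<bar>U v - S * F n v\<bar> + \<bar>U v - V v\<bar> + \<bar>V v - G v\<bar> \<partial>cs)"
    proof (rule integral_mono)
      show "\<bar>F n v - G v\<bar> \<le> \<bar>1 - S\<bar> * F n v + \<bar>U v - S * F n v\<bar> + \<bar>U v - V v\<bar> + \<bar>V v - G v\<bar>" for v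
      proof -
        have "\<bar>(1 - S) * F n v\<bar> = \<bar>1 - S\<bar> * F n v"
          using F(2) by (simp add: abs_mult)
        moreover have "F n v - G v = (1 - S) * F n v - (U v - S * F n v) + (U v - V v) + (V v - G v)"
          by (simp add: algebra_simps)
        ultimately show ?thesis
          by linarith
      qed
    qed (use int in auto)
    also have "\<dots> = \<bar>1 - S\<bar> * T' n + (\<integral>v. \<bar>U v - S * F n v\<bar> \<partial>cs) + (\<integral>v. \<bar>U v - V v\<bar> \<partial>cs) + (\<integral>v. \<bar>V v - G v\<bar> \<partial>cs)"
      using int unfolding T'_def by (simp add: Bochner_Integration.integral_add)
    also have "\<dots> \<le> B n"
      unfolding B_def
    proof (intro add_mono)
      show "\<bar>1 - S\<bar> * T' n \<le> \<bar>1 - gsum (\<epsilon> * a n) 0\<bar> * T' n"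
        by (simp add: S_def)
      show "(\<integral>v. \<bar>U v - S * F n v\<bar> \<partial>cs) \<le> e / 2 * gsum (\<epsilon> * a n) 0 + 2 * T' n * C * gsum (sqrt 2 * \<epsilon> * a n) 0"
        unfolding U_def S_def T'_def C_def mult.assoc[of "sqrt 2" \<epsilon>]
        using elim e by (intro gauss_smoothing_le F \<epsilon> \<delta>) auto
      show "(\<integral>v. \<bar>U v - V v\<bar> \<partial>cs) \<le> T' n * gsum (\<epsilon> * a n) 0 - p * gsum (l * a n) (b n)
        + 2 * sqrt (p * (l / (sqrt (2 * pi) * \<epsilon>)) ^ CARD('m) * fdist \<epsilon> p (F n) (a n) (b n)) * D * gsum (sqrt 2 * l * a n) (b n)"
        unfolding U_def V_def T'_def l_def D_def mult.assoc[of "sqrt 2" "sqrt _"]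
        using elim by (intro conv_gauss_l1_le F \<epsilon> p) auto
      have "(\<integral>v. \<bar>V v - G v\<bar> \<partial>cs) = (\<integral>v. p * \<bar>covol * gauss (l * a n) (pos v - b n) - covol * gauss (a n) (pos v - b n)\<bar> \<partial>cs)"
        using p by (intro Bochner_Integration.integral_cong) (simp_all add: V_def G_def mult.assoc right_diff_distrib[symmetric] abs_mult)
      also have "\<dots> \<le> p * (gsum (l * a n) (b n) + (1 - 2 / l ^ CARD('m)) * gsum (1 * a n) (b n))"
        using gauss_rescale_le[of "a n" l "b n"] elim l p
        by (simp add: mult_left_mono)
      finally show "(\<integral>v. \<bar>V v - G v\<bar> \<partial>cs) \<le> p * (gsum (l * a n) (b n) + (1 - 2 / l ^ CARD('m)) * gsum (1 * a n) (b n))" .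
    qed
    finally show ?case
      using elim by (simp add: G_def)
  qed
  then show "\<exists>no. \<forall>n\<ge>no. norm ((\<integral>v. \<bar>F n v - p * covol * gauss (a n) (pos v - b n)\<bar> \<partial>cs) - 0) < e"
    by (simp add: eventually_sequentially)
qed

end

section \<open>Smoothing by powers of a Markov operator\<close>

text \<open>The ball of radius \<open>b\<close> in the bounded functions on \<open>X\<close>,
  extended by zero. The radius is carried explicitly because the recursion below feeds back
  functions of smaller radius.\<close>

definition bnd :: "'x set \<Rightarrow> real \<Rightarrow> ('x \<Rightarrow> real) \<Rightarrow> bool" where
  "bnd X b f \<longleftrightarrow> (\<forall>x. \<bar>f x\<bar> \<le> b) \<and> (\<forall>x. x \<notin> X \<longrightarrow> f x = 0)"

text \<open>A linear operator of norm at most one on the bounded functions on \<open>X\<close>.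
  Linearity is asked on these only, because Bochner integrals are additive on integrable functions
  only.\<close>

definition contraction_op :: "'x set \<Rightarrow> (('x \<Rightarrow> real) \<Rightarrow> 'x \<Rightarrow> real) \<Rightarrow> bool" where
  "contraction_op X S \<longleftrightarrow> (\<forall>b f. bnd X b f \<longrightarrow> bnd X b (S f)) \<and>
    (\<forall>b b' f g r s. bnd X b f \<longrightarrow> bnd X b' g \<longrightarrow>
       S (\<lambda>x. r * f x + s * g x) = (\<lambda>x. r * S f x + s * S g x))"

lemma bnd_nonneg: "bnd X b f \<Longrightarrow> 0 \<le> b"
  unfolding bnd_def by (meson abs_ge_zero order_trans)

lemma bnd_lin: "bnd X b f \<Longrightarrow> bnd X b' g \<Longrightarrow> bnd X (\<bar>r\<bar> * b + \<bar>s\<bar> * b') (\<lambda>x. r * f x + s * g x)"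
  unfolding bnd_def
  by (auto intro!: order.trans[OF abs_triangle_ineq] add_mono mult_left_mono simp: abs_mult)

lemma contraction_op_bnd: "contraction_op X S \<Longrightarrow> bnd X b f \<Longrightarrow> bnd X b (S f)"
  by (simp add: contraction_op_def)

lemma contraction_op_lin: "contraction_op X S \<Longrightarrow> bnd X b f \<Longrightarrow> bnd X b' g \<Longrightarrow>
    S (\<lambda>x. r * f x + s * g x) = (\<lambda>x. r * S f x + s * S g x)"
  unfolding contraction_op_def by blast

lemma contraction_op_comp:
  assumes "contraction_op X S" "contraction_op X S'"
  shows "contraction_op X (\<lambda>f. S (S' f))"
  unfolding contraction_op_def
proof (intro conjI allI impI)
  fix b b' f g r s
  assume f: "bnd X b f" and g: "bnd X b' g"
  show "S (S' (\<lambda>x. r * f x + s * g x)) = (\<lambda>x. r * S (S' f) x + s * S (S' g) x)"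
    unfolding contraction_op_lin[OF assms(2) f g]
    by (rule contraction_op_lin[OF assms(1) contraction_op_bnd[OF assms(2) f] contraction_op_bnd[OF assms(2) g]])
qed (use assms in \<open>simp add: contraction_op_def\<close>)

lemma contraction_op_funpow: "contraction_op X S \<Longrightarrow> contraction_op X (S ^^ n)"
proof (induction n)
  case 0
  then show ?case by (simp add: contraction_op_def)
next
  case (Suc n)
  then show ?case
    using contraction_op_comp[of X S "S ^^ n"] by (simp add: comp_def)
qed

lemma contraction_op_sum:
  assumes S: "contraction_op X S" and f: "\<And>i. i \<in> A \<Longrightarrow> bnd X b (f i)" and "finite A"
  shows "S (\<lambda>x. \<Sum>i\<in>A. r i * f i x) = (\<lambda>x. \<Sum>i\<in>A. r i * S (f i) x)
    \<and> bnd X (\<Sum>i\<in>A. \<bar>r i\<bar> * b) (\<lambda>x. \<Sum>i\<in>A. r i * f i x)"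
  using \<open>finite A\<close> f
proof (induction A rule: finite_induct)
  case empty
  have z: "bnd X 0 (\<lambda>x. 0)"
    by (simp add: bnd_def)
  show ?case
    using contraction_op_lin[OF S z z, of 0 0] z by simp
next
  case (insert j A)
  have j: "bnd X b (f j)" and A: "bnd X (\<Sum>i\<in>A. \<bar>r i\<bar> * b) (\<lambda>x. \<Sum>i\<in>A. r i * f i x)"
    "S (\<lambda>x. \<Sum>i\<in>A. r i * f i x) = (\<lambda>x. \<Sum>i\<in>A. r i * S (f i) x)"
    using insert by auto
  show ?case
    using contraction_op_lin[OF S j A(1), of "r j" 1] bnd_lin[OF j A(1), of "r j" 1] insert.hyps
    by (simp add: A(2))
qed

definition avg_op :: "(('x \<Rightarrow> real) \<Rightarrow> 'x \<Rightarrow> real) \<Rightarrow> ('x \<Rightarrow> real) \<Rightarrow> 'x \<Rightarrow> real" where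
  "avg_op t f = (\<lambda>x. (f x + t f x) / 2)"

lemma contraction_op_avg:
  assumes "contraction_op X t"
  shows "contraction_op X (avg_op t)"
  unfolding contraction_op_def
proof (intro conjI allI impI)
  fix b f assume f: "bnd X b f"
  show "bnd X b (avg_op t f)"
    using bnd_lin[OF f contraction_op_bnd[OF assms f], of "1/2" "1/2"] by (simp add: avg_op_def add_divide_distrib)
next
  fix b b' f g r s assume f: "bnd X b f" and g: "bnd X b' g"
  show "avg_op t (\<lambda>x. r * f x + s * g x) = (\<lambda>x. r * avg_op t f x + s * avg_op t g x)"
    unfolding avg_op_def contraction_op_lin[OF assms f g] by (simp add: algebra_simps add_divide_distrib)
qed

lemma avg_op_funpow:
  assumes t: "contraction_op X t" and f: "bnd X b f"
  shows "(avg_op t ^^ j) f = (\<lambda>x. \<Sum>i\<le>j. (real (j choose i) / 2 ^ j) * (t ^^ i) f x)"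
proof (induction j)
  case 0
  show ?case by simp
next
  case (Suc j)
  have tf: "bnd X b ((t ^^ i) f)" for i
    using contraction_op_bnd[OF contraction_op_funpow[OF t] f] .
  have s: "t (\<lambda>x. \<Sum>i\<le>j. (real (j choose i) / 2 ^ j) * (t ^^ i) f x)
      = (\<lambda>x. \<Sum>i\<le>j. (real (j choose i) / 2 ^ j) * (t ^^ Suc i) f x)"
    using contraction_op_sum[OF t tf, of "{..j}" "\<lambda>i. real (j choose i) / 2 ^ j"] by simp
  show ?case
  proof
    fix x
    have "(avg_op t ^^ Suc j) f x = ((\<Sum>i\<le>j. (real (j choose i) / 2 ^ j) * (t ^^ i) f x)
        + (\<Sum>i\<le>j. (real (j choose i) / 2 ^ j) * (t ^^ Suc i) f x)) / 2"
    proof -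
      have "(avg_op t ^^ Suc j) f x = ((avg_op t ^^ j) f x + t ((avg_op t ^^ j) f) x) / 2"
        by (simp add: avg_op_def[of t "(avg_op t ^^ j) f"])
      then show ?thesis
        unfolding Suc s .
    qed
    also have "(\<Sum>i\<le>j. (real (j choose i) / 2 ^ j) * (t ^^ i) f x)
        = f x / 2 ^ j + (\<Sum>i\<le>j. (real (j choose Suc i) / 2 ^ j) * (t ^^ Suc i) f x)"
    proof -
      have "(\<Sum>i\<le>j. (real (j choose i) / 2 ^ j) * (t ^^ i) f x) = (\<Sum>i\<le>Suc j. (real (j choose i) / 2 ^ j) * (t ^^ i) f x)"
        by simp
      then show ?thesis
        by (simp only: sum.atMost_Suc_shift) simp
    qed
    also have "(f x / 2 ^ j + (\<Sum>i\<le>j. (real (j choose Suc i) / 2 ^ j) * (t ^^ Suc i) f x)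
        + (\<Sum>i\<le>j. (real (j choose i) / 2 ^ j) * (t ^^ Suc i) f x)) / 2
       = f x / 2 ^ Suc j + (\<Sum>i\<le>j. (real (Suc j choose Suc i) / 2 ^ Suc j) * (t ^^ Suc i) f x)"
    proof -
      have "(\<Sum>i\<le>j. (real (Suc j choose Suc i) / 2 ^ Suc j) * (t ^^ Suc i) f x)
          = ((\<Sum>i\<le>j. (real (j choose Suc i) / 2 ^ j) * (t ^^ Suc i) f x)
              + (\<Sum>i\<le>j. (real (j choose i) / 2 ^ j) * (t ^^ Suc i) f x)) / 2"
        unfolding sum.distrib[symmetric] sum_divide_distrib
        by (intro sum.cong) (simp_all add: field_simps)
      then show ?thesis
        by (simp add: add_divide_distrib)
    qed
    also have "\<dots> = (\<Sum>i\<le>Suc j. (real (Suc j choose i) / 2 ^ Suc j) * (t ^^ i) f x)"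
      by (subst sum.atMost_Suc_shift) simp
    finally show "(avg_op t ^^ Suc j) f x = \<dots>" .
  qed
qed

text \<open>The mean absolute deviation of a symmetric binomial variable is at most its standard
  deviation; the pointwise bound of \<open>|d|\<close> by the mean of \<open>d^2 / sqrt N\<close>
  and \<open>sqrt N\<close> does the work of Cauchy-Schwarz.\<close>

lemma sum_Bernstein_deviation:
  assumes "N > 0"
  shows "(\<Sum>i\<le>N. Bernstein N i (1/2) * \<bar>real N - 2 * real i\<bar>) \<le> sqrt (real N)"
proof -
  have sq: "(\<Sum>i\<le>N. Bernstein N i (1/2) * (real N - 2 * real i)\<^sup>2) = real N"
  proof -
    have "(\<Sum>i\<le>N. Bernstein N i (1/2) * (real N - 2 * real i)\<^sup>2)
      = (\<Sum>i\<le>N. (real N)\<^sup>2 * Bernstein N i (1/2) - (4 * real N - 4) * (real i * Bernstein N i (1/2))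
          + 4 * (real i * (real i - 1) * Bernstein N i (1/2)))"
      by (intro sum.cong) (auto simp: power2_eq_square algebra_simps)
    also have "\<dots> = real N"
      unfolding sum.distrib sum_subtractf sum_distrib_left[symmetric] sum_Bernstein sum_k_Bernstein sum_kk_Bernstein
      by (simp add: power2_eq_square algebra_simps)
    finally show ?thesis .
  qed
  have sN: "sqrt (real N) > 0" "sqrt (real N) * sqrt (real N) = real N"
    using assms by auto
  have ptw: "\<bar>d\<bar> \<le> (d\<^sup>2 / sqrt (real N) + sqrt (real N)) / 2" for d
  proof -
    have "0 \<le> (\<bar>d\<bar> - sqrt (real N))\<^sup>2 / sqrt (real N)"
      using sN by simp
    also have "\<dots> = d\<^sup>2 / sqrt (real N) + sqrt (real N) - 2 * \<bar>d\<bar>"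
      using sN by (simp add: power2_diff field_simps power2_eq_square)
    finally show ?thesis by simp
  qed
  have "(\<Sum>i\<le>N. Bernstein N i (1/2) * \<bar>real N - 2 * real i\<bar>)
      \<le> (\<Sum>i\<le>N. Bernstein N i (1/2) * (((real N - 2 * real i)\<^sup>2 / sqrt (real N) + sqrt (real N)) / 2))"
    by (intro sum_mono mult_left_mono ptw Bernstein_nonneg) auto
  also have "\<dots> = (\<Sum>i\<le>N. (1 / (2 * sqrt (real N))) * (Bernstein N i (1/2) * (real N - 2 * real i)\<^sup>2) + (sqrt (real N) / 2) * Bernstein N i (1/2))"
    by (intro sum.cong) (auto simp: field_simps)
  also have "\<dots> = (1 / (2 * sqrt (real N))) * real N + sqrt (real N) / 2"
    unfolding sum.distrib sum_distrib_left[symmetric] sq sum_Bernstein by simp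
  also have "\<dots> = sqrt (real N)"
    using sN by (simp add: field_simps)
  finally show ?thesis .
qed

text \<open>With \<open>Q\<close> the lazy operator, the coefficient of \<open>t^i\<close> in
  \<open>(1 - t) Q^j\<close> is a difference of neighbouring binomial coefficients. Written through
  row \<open>N = j + 1\<close> it is a multiple of \<open>N - 2 i\<close>, divided by
  \<open>N\<close>; the mean absolute deviation of order \<open>sqrt N\<close> leaves
  \<open>1 / sqrt N\<close>.\<close>

lemma avg_op_funpow_diff:
  assumes t: "contraction_op X t" and f: "bnd X b f"
  shows "\<bar>(avg_op t ^^ j) f x - t ((avg_op t ^^ j) f) x\<bar> \<le> 2 * b / sqrt (real j + 1)"
proof -
  define N where "N = Suc j"
  have N: "N > 0" "real N = real j + 1"
    by (auto simp: N_def)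
  have tf: "bnd X b ((t ^^ i) f)" for i
    using contraction_op_bnd[OF contraction_op_funpow[OF t] f] .
  have tf_le: "\<bar>(t ^^ i) f x\<bar> \<le> b" for i
    using tf[of i] by (simp add: bnd_def)
  have b: "b \<ge> 0"
    using bnd_nonneg[OF f] .
  have ch1: "real (j choose i) = real (N choose i) * (real N - real i) / real N" if "i \<le> N" for i
  proof -
    have "(N - i) * (N choose i) = N * (j choose i)"
      using binomial_absorb_comp[of N i] by (simp add: N_def)
    then have "real (N - i) * real (N choose i) = real N * real (j choose i)"
      by (metis of_nat_mult)
    then show ?thesis
      using N that by (simp add: of_nat_diff field_simps)
  qed
  have ch2: "real (j choose i) = real (N choose Suc i) * real (Suc i) / real N" for i
  proof -
    have "Suc i * (N choose Suc i) = N * (j choose i)"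
      by (metis N_def binomial_absorption diff_Suc_1)
    then have "real (Suc i) * real (N choose Suc i) = real N * real (j choose i)"
      by (metis of_nat_mult)
    then show ?thesis
      using N by (simp add: field_simps)
  qed
  have "(avg_op t ^^ j) f x = (\<Sum>i\<le>N. (real (j choose i) / 2 ^ j) * (t ^^ i) f x)"
    unfolding avg_op_funpow[OF t f] by (simp add: N_def)
  also have "\<dots> = (\<Sum>i\<le>N. (real (N choose i) * (real N - real i) / real N / 2 ^ j) * (t ^^ i) f x)"
    by (intro sum.cong) (simp_all add: ch1)
  finally have 1: "(avg_op t ^^ j) f x = \<dots>" .
  have "t ((avg_op t ^^ j) f) x = (\<Sum>i\<le>j. (real (j choose i) / 2 ^ j) * (t ^^ Suc i) f x)"
    using contraction_op_sum[OF t tf, of "{..j}" "\<lambda>i. real (j choose i) / 2 ^ j"]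
    by (simp add: avg_op_funpow[OF t f])
  also have "\<dots> = (\<Sum>i\<le>N. (real (N choose i) * real i / real N / 2 ^ j) * (t ^^ i) f x)"
    unfolding N_def sum.atMost_Suc_shift ch2[unfolded N_def] by simp
  finally have 2: "t ((avg_op t ^^ j) f) x = \<dots>" .
  have "(avg_op t ^^ j) f x - t ((avg_op t ^^ j) f) x
      = (\<Sum>i\<le>N. (2 / real N) * (Bernstein N i (1/2) * (real N - 2 * real i) * (t ^^ i) f x))"
    unfolding 1 2 sum_subtractf[symmetric]
  proof (intro sum.cong refl)
    fix i assume "i \<in> {..N}"
    then have "Bernstein N i (1/2) = real (N choose i) / 2 ^ N"
      by (simp add: Bernstein_def power_add[symmetric] power_divide)
    also have "\<dots> = real (N choose i) / (2 * 2 ^ j)"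
      by (simp add: N_def)
    finally have B: "Bernstein N i (1/2) = real (N choose i) / (2 * 2 ^ j)" .
    show "real (N choose i) * (real N - real i) / real N / 2 ^ j * (t ^^ i) f x - real (N choose i) * real i / real N / 2 ^ j * (t ^^ i) f x
      = 2 / real N * (Bernstein N i (1/2) * (real N - 2 * real i) * (t ^^ i) f x)"
      unfolding B using N(1) by (simp add: field_simps)
  qed
  also have "\<bar>\<dots>\<bar> \<le> (\<Sum>i\<le>N. (2 / real N) * ((Bernstein N i (1/2) * \<bar>real N - 2 * real i\<bar>) * b))"
  proof (rule order.trans[OF sum_abs], rule sum_mono)
    fix i
    have "\<bar>2 / real N * (Bernstein N i (1/2) * (real N - 2 * real i) * (t ^^ i) f x)\<bar>
        = 2 / real N * ((Bernstein N i (1/2) * \<bar>real N - 2 * real i\<bar>) * \<bar>(t ^^ i) f x\<bar>)"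
      using Bernstein_nonneg[of "1/2" N i] by (simp add: abs_mult)
    also have "\<dots> \<le> 2 / real N * ((Bernstein N i (1/2) * \<bar>real N - 2 * real i\<bar>) * b)"
      by (intro mult_left_mono tf_le mult_nonneg_nonneg Bernstein_nonneg) auto
    finally show "\<bar>2 / real N * (Bernstein N i (1/2) * (real N - 2 * real i) * (t ^^ i) f x)\<bar> \<le> \<dots>" .
  qed
  also have "\<dots> = 2 / real N * ((\<Sum>i\<le>N. Bernstein N i (1/2) * \<bar>real N - 2 * real i\<bar>) * b)"
    by (simp add: sum_distrib_left sum_distrib_right)
  also have "\<dots> \<le> 2 / real N * (sqrt (real N) * b)"
    by (intro mult_left_mono mult_right_mono sum_Bernstein_deviation b N) auto
  also have "\<dots> = 2 * b / sqrt (real N)"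
    using N by (simp add: field_simps)
  finally show ?thesis
    using N by simp
qed

text \<open>One step of the recursion in \<open>smoothing_bound\<close>: with weight
  \<open>c\<close> the counter \<open>A\<close> advances by one. Convexity of the square reduces the
  claim to a rational inequality, and crediting only half of the mean advance \<open>c\<close>
  absorbs the loss due to convexity.\<close>

lemma inverse_sqrt_interpolation:
  fixes A c :: real
  assumes "A \<ge> 1" "0 < c" "c \<le> 1"
  shows "c / sqrt (A + 1) + (1 - c) / sqrt A \<le> 1 / sqrt (A + c / 2)"
proof (rule power2_le_imp_le)
  let ?x = "1 / sqrt (A + 1)" and ?y = "1 / sqrt A"
  have "(c * ?x + (1 - c) * ?y)\<^sup>2 \<le> c * ?x\<^sup>2 + (1 - c) * ?y\<^sup>2"
  proof -
    have "c * ?x\<^sup>2 + (1 - c) * ?y\<^sup>2 - (c * ?x + (1 - c) * ?y)\<^sup>2 = c * (1 - c) * (?x - ?y)\<^sup>2"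
      by (simp only: power2_eq_square) algebra
    also have "\<dots> \<ge> 0"
      using assms by simp
    finally show ?thesis by simp
  qed
  also have "\<dots> = c / (A + 1) + (1 - c) / A"
    using assms by (simp add: power_divide)
  also have "\<dots> = (A + 1 - c) / (A * (A + 1))"
    using assms by (simp add: field_simps)
  also have "\<dots> \<le> 1 / (A + c / 2)"
  proof -
    have "(A + 1 - c) * (A + c / 2) = A * (A + 1) - c * (A - 1 + c) / 2"
      by (simp add: field_simps power2_eq_square)
    also have "\<dots> \<le> A * (A + 1)"
      using assms by simp
    finally have "A + 1 - c \<le> A * (A + 1) / (A + c / 2)"
      using assms by (simp add: pos_le_divide_eq)
    then have "(A + 1 - c) / (A * (A + 1)) \<le> (A * (A + 1) / (A + c / 2)) / (A * (A + 1))"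
      using assms by (intro divide_right_mono) auto
    then show ?thesis
      using assms by simp
  qed
  also have "\<dots> = (1 / sqrt (A + c / 2))\<^sup>2"
    using assms by (simp add: power_divide)
  finally show "(c / sqrt (A + 1) + (1 - c) / sqrt A)\<^sup>2 \<le> (1 / sqrt (A + c / 2))\<^sup>2"
    by simp
qed (use assms in simp)

text \<open>The recursion \<open>T = c Q + R\<close> is driven by the intermediate powers of the lazy operator
  \<open>Q = (1 + t) / 2\<close>: this is why the bound is proved for all \<open>Q\<^sup>j T\<^sup>n\<close> at once.\<close>

theorem smoothing_bound:
  assumes T: "contraction_op X T" and t: "contraction_op X t"
    and comm: "\<And>b f. bnd X b f \<Longrightarrow> T (t f) = t (T f)"
    and dom: "\<And>b f. bnd X b f \<Longrightarrow> bnd X ((1 - c) * b) (\<lambda>x. T f x - c * avg_op t f x)"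
    and c: "0 < c" "c \<le> 1" and f: "bnd X b f"
  shows "\<bar>(T ^^ n) f x - t ((T ^^ n) f) x\<bar> \<le> 2 * b / sqrt (1 + c * real n / 2)"
proof -
  let ?Q = "avg_op t"
  note Q = contraction_op_avg[OF t]
  have commQ: "T (?Q g) = ?Q (T g)" if g: "bnd X b g" for b g
    using contraction_op_lin[OF T g contraction_op_bnd[OF t g], of "1/2" "1/2"] comm[OF g]
    by (simp add: avg_op_def add_divide_distrib)
  have commTQ: "(T ^^ n) (?Q g) = ?Q ((T ^^ n) g)" if g: "bnd X b g" for b g n
  proof (induction n)
    case (Suc n)
    then show ?case
      using commQ[OF contraction_op_bnd[OF contraction_op_funpow[OF T] g], of n] by simp
  qed simp
  \<comment> \<open>The induction feeds back two functions: \<open>Q f\<close>, with exponent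
    \<open>j + 1\<close>, and the remainder \<open>R\<close>, with the smaller radius
    \<open>(1 - c) b\<close>; so \<open>j\<close>, \<open>b\<close> and \<open>f\<close> all have to
    vary.\<close>
  have "\<bar>(?Q ^^ j) ((T ^^ n) f) x - t ((?Q ^^ j) ((T ^^ n) f)) x\<bar> \<le> 2 * b / sqrt (real j + 1 + c * real n / 2)"
    if "bnd X b f" for j b f
    using that
  proof (induction n arbitrary: j b f)
    case 0
    then show ?case
      using avg_op_funpow_diff[OF t 0, of j x] by simp
  next
    case (Suc n)
    note f = \<open>bnd X b f\<close>
    define R where "R = (\<lambda>x. T f x - c * ?Q f x)"
    have R: "bnd X ((1 - c) * b) R"
      unfolding R_def by (rule dom[OF f])
    have Qf: "bnd X b (?Q f)"
      by (rule contraction_op_bnd[OF Q f])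
    let ?S = "\<lambda>g. (?Q ^^ j) ((T ^^ n) g)"
    have S: "contraction_op X ?S"
      by (rule contraction_op_comp[OF contraction_op_funpow[OF Q] contraction_op_funpow[OF T]])
    define U where "U = (\<lambda>g. ?S g x - t (?S g) x)"
    have tS: "contraction_op X (\<lambda>g. t (?S g))"
      by (rule contraction_op_comp[OF t S])
    have "T f = (\<lambda>x. c * ?Q f x + 1 * R x)"
      by (simp add: R_def)
    then have UT: "U (T f) = c * U (?Q f) + U R"
      unfolding U_def using contraction_op_lin[OF S Qf R, of c 1] contraction_op_lin[OF tS Qf R, of c 1]
      by (simp add: algebra_simps)
    have SQ: "?S (?Q f) = (?Q ^^ Suc j) ((T ^^ n) f)"
      unfolding commTQ[OF f] by (simp add: funpow_swap1)
    define A where "A = real j + 1 + c * real n / 2"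
    have A: "A \<ge> 1"
      using c by (simp add: A_def)
    have b: "b \<ge> 0"
      using bnd_nonneg[OF f] .
    have 1: "\<bar>U (?Q f)\<bar> \<le> 2 * b / sqrt (A + 1)"
      using Suc.IH[OF f, of "Suc j"] unfolding U_def SQ A_def by (simp add: algebra_simps)
    have 2: "\<bar>U R\<bar> \<le> 2 * ((1 - c) * b) / sqrt A"
      using Suc.IH[OF R, of j] unfolding U_def A_def .
    have "\<bar>U (T f)\<bar> \<le> c * \<bar>U (?Q f)\<bar> + \<bar>U R\<bar>"
      unfolding UT using abs_triangle_ineq[of "c * U (?Q f)" "U R"] c by (simp add: abs_mult)
    also have "\<dots> \<le> c * (2 * b / sqrt (A + 1)) + 2 * ((1 - c) * b) / sqrt A"
      using c by (intro add_mono mult_left_mono 1 2) auto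
    also have "\<dots> = 2 * b * (c / sqrt (A + 1) + (1 - c) / sqrt A)"
      by (simp add: distrib_left mult_ac)
    also have "\<dots> \<le> 2 * b * (1 / sqrt (A + c / 2))"
      using b by (intro mult_left_mono inverse_sqrt_interpolation A c) auto
    also have "A + c / 2 = real j + 1 + c * real (Suc n) / 2"
      by (simp add: A_def algebra_simps)
    finally show ?case
      unfolding U_def by (simp add: funpow_swap1)
  qed
  from this[OF f, of 0] show ?thesis
    by simp
qed

section \<open>Smoothness of the walk in space and time\<close>

text \<open>The least difference \<open>d\<close> of two elements divides every \<open>n\<close> in
  \<open>S\<close>: with \<open>k = n div d\<close> positive, the elements \<open>k (B + d)\<close>
  and \<open>n + k B\<close> differ by \<open>n mod d\<close>, so a nonzero remainder would be a
  smaller difference.\<close>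

lemma semigroup_gcd_difference:
  fixes S :: "nat set"
  assumes "S \<noteq> {}" "0 \<notin> S" and add: "\<And>a b. a \<in> S \<Longrightarrow> b \<in> S \<Longrightarrow> a + b \<in> S"
  shows "Gcd S > 0" "\<exists>B\<in>S. B + Gcd S \<in> S"
proof -
  have mult: "k * a \<in> S" if "a \<in> S" "k > 0" for a k
    using that(2) by (induction k rule: nat_induct_non_zero) (use that(1) add in auto)
  obtain s where s: "s \<in> S" "s > 0"
    using assms by (metis ex_in_conv gr0I)
  define P where "P = (\<lambda>d::nat. d > 0 \<and> (\<exists>B\<in>S. B + d \<in> S))"
  have "P s"
    using s add unfolding P_def by blast
  define d where "d = (LEAST d. P d)"
  have d: "P d" "\<And>d'. P d' \<Longrightarrow> d \<le> d'"
    unfolding d_def using \<open>P s\<close> by (auto intro: LeastI Least_le)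
  obtain B where B: "B \<in> S" "B + d \<in> S" and d0: "d > 0"
    using d(1) unfolding P_def by blast
  have "d dvd n" if n: "n \<in> S" for n
  proof (rule ccontr)
    assume "\<not> d dvd n"
    then have r: "n mod d > 0"
      by (simp add: mod_greater_zero_iff_not_dvd)
    have "P (n mod d)"
    proof (cases "n div d = 0")
      case True
      then have "n mod d = n"
        by (metis d0 div_eq_0_iff mod_less neq0_conv)
      then show ?thesis
        using r s add n unfolding P_def by auto
    next
      case False
      have "(n div d) * (B + d) \<in> S"
        using False B by (intro mult) auto
      moreover have "(n div d) * (B + d) + n mod d = n + (n div d) * B"
        using div_mult_mod_eq[of n d] by (simp add: algebra_simps)
      moreover have "n + (n div d) * B \<in> S"
        using False B n by (intro add mult) auto
      ultimately show ?thesis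
        unfolding P_def using r by metis
    qed
    then have "d \<le> n mod d"
      by (rule d(2))
    then show False
      using d0 by (metis mod_less_divisor not_le)
  qed
  then have "d dvd Gcd S"
    by (simp add: Gcd_greatest)
  moreover have "Gcd S dvd d"
    using B by (metis Gcd_dvd dvd_add_right_iff)
  ultimately have "Gcd S = d"
    using dvd_antisym by blast
  then show "Gcd S > 0" "\<exists>B\<in>S. B + Gcd S \<in> S"
    using d0 B by auto
qed

lemma integral_pmf_mono_density:
  fixes p r :: "'a pmf" and h :: "'a \<Rightarrow> real"
  assumes "\<And>x. h x \<ge> 0" "\<And>x. h x \<le> B" "\<And>x. c * pmf r x \<le> pmf p x" "c \<ge> 0"
  shows "c * (\<integral>x. h x \<partial>r) \<le> (\<integral>x. h x \<partial>p)"
proof -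
  have int: "integrable (measure_pmf s) h" for s :: "'a pmf"
    by (rule measure_pmf.integrable_const_bound[where B=B]) (use assms in auto)
  have "ennreal (c * (\<integral>x. h x \<partial>r)) = ennreal c * (\<integral>\<^sup>+x. ennreal (h x) \<partial>r)"
    using assms int by (subst nn_integral_eq_integral) (auto simp: ennreal_mult)
  also have "\<dots> = (\<integral>\<^sup>+x. ennreal c * (ennreal (pmf r x) * ennreal (h x)) \<partial>count_space UNIV)"
    by (simp add: nn_integral_measure_pmf nn_integral_cmult)
  also have "\<dots> \<le> (\<integral>\<^sup>+x. ennreal (pmf p x) * ennreal (h x) \<partial>count_space UNIV)"
    using assms by (intro nn_integral_mono) (simp add: ennreal_mult[symmetric] mult.assoc[symmetric] ennreal_leI mult_right_mono)
  also have "\<dots> = ennreal (\<integral>x. h x \<partial>p)"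
    using assms int by (subst nn_integral_eq_integral[symmetric]) (auto simp: nn_integral_measure_pmf)
  finally show ?thesis
    using assms by (subst (asm) ennreal_le_iff) auto
qed

text \<open>The measure \<open>p - c r\<close> is positive of mass \<open>1 - c\<close>; positivity
  is used on the two functions \<open>b - f\<close> and \<open>b + f\<close>.\<close>

lemma integral_pmf_domination:
  fixes p r :: "'a pmf" and f :: "'a \<Rightarrow> real"
  assumes "\<And>x. \<bar>f x\<bar> \<le> b" "\<And>x. c * pmf r x \<le> pmf p x" "c \<ge> 0"
  shows "\<bar>(\<integral>x. f x \<partial>p) - c * (\<integral>x. f x \<partial>r)\<bar> \<le> (1 - c) * b"
proof -
  have int: "integrable (measure_pmf s) f" for s :: "'a pmf"
    by (rule measure_pmf.integrable_const_bound[where B=b]) (use assms in auto)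
  have f: "0 \<le> b + f x" "f x \<le> b" for x
    using assms(1)[of x] by (auto simp: abs_le_iff)
  have "c * (\<integral>x. b - f x \<partial>r) \<le> (\<integral>x. b - f x \<partial>p)"
    using f by (intro integral_pmf_mono_density[where B="2 * b"] assms(2,3)) (simp_all add: algebra_simps)
  moreover have "c * (\<integral>x. b + f x \<partial>r) \<le> (\<integral>x. b + f x \<partial>p)"
    using f by (intro integral_pmf_mono_density[where B="2 * b"] assms(2,3)) (simp_all add: algebra_simps)
  ultimately show ?thesis
    using int by (simp add: abs_le_iff algebra_simps)
qed

lemma integral_bind_pmf_bounded:
  fixes f :: "'c \<Rightarrow> real"
  assumes "\<And>x. norm (f x) \<le> B"
  shows "(\<integral>z. f z \<partial>bind_pmf p k) = (\<integral>x. (\<integral>z. f z \<partial>k x) \<partial>p)"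
  unfolding measure_pmf_bind
  by (rule integral_bind[where K="count_space UNIV" and B'=1 and B=B])
    (use assms measure_pmf_in_subprob_algebra in \<open>auto simp: measure_pmf.emeasure_space_1 measure_pmf.finite_measure_axioms\<close>)

lemma integral_map_pair_pmf:
  fixes f :: "'c \<Rightarrow> real"
  assumes "\<And>x. norm (f x) \<le> B"
  shows "(\<integral>z. f z \<partial>map_pmf (\<lambda>(x, y). h x y) (pair_pmf p r)) = (\<integral>x. (\<integral>y. f (h x y) \<partial>r) \<partial>p)"
proof -
  have "map_pmf (\<lambda>(x, y). h x y) (pair_pmf p r) = bind_pmf p (\<lambda>x. map_pmf (h x) r)"
    by (simp add: pair_pmf_def map_bind_pmf map_pmf_def bind_assoc_pmf bind_return_pmf)
  then show ?thesis
    by (simp add: integral_bind_pmf_bounded[OF assms])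
qed

lemma abs_integral_pmf_le:
  fixes f :: "'b \<Rightarrow> real"
  assumes "\<And>x. \<bar>f x\<bar> \<le> b"
  shows "\<bar>\<integral>x. f x \<partial>measure_pmf p\<bar> \<le> b"
proof -
  have int: "integrable (measure_pmf p) f"
    by (rule measure_pmf.integrable_const_bound[where B=b]) (use assms in auto)
  have "f x \<le> b" "- b \<le> f x" for x
    using assms[of x] by (auto simp: abs_le_iff)
  then have "(\<integral>x. f x \<partial>measure_pmf p) \<le> b" "- b \<le> (\<integral>x. f x \<partial>measure_pmf p)"
    by (auto intro!: measure_pmf.integral_le_const measure_pmf.integral_ge_const int)
  then show ?thesis
    by linarith
qed

section \<open>Convolution powers of a measure on a group\<close>

locale group_walk = group G for G (structure) +
  fixes \<mu> :: "'a pmf"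
  assumes set_pmf_subset: "set_pmf \<mu> \<subseteq> carrier G"
begin

abbreviation cp :: "nat \<Rightarrow> 'a pmf" where "cp \<equiv> conv_power G \<mu>"

lemma set_cp_subset: "set_pmf (cp n) \<subseteq> carrier G"
  by (induction n) (use set_pmf_subset in \<open>auto simp: set_map_pmf set_pair_pmf\<close>)

lemma cp_carrier: "g \<in> set_pmf (cp n) \<Longrightarrow> g \<in> carrier G"
  using set_cp_subset by blast

lemma pmf_cp_outside: "g \<notin> carrier G \<Longrightarrow> pmf (cp n) g = 0"
  using set_cp_subset[of n] by (auto simp: set_pmf_iff)

lemma integral_cp_cong:
  assumes "\<And>x. x \<in> carrier G \<Longrightarrow> f x = g x"
  shows "(\<integral>x. f x \<partial>cp n) = (\<integral>x. g x \<partial>cp n)"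
  by (intro integral_cong_AE) (auto simp: AE_measure_pmf_iff assms cp_carrier)

lemma integral_mu_cong:
  assumes "\<And>x. x \<in> carrier G \<Longrightarrow> f x = g x"
  shows "(\<integral>x. f x \<partial>\<mu>) = (\<integral>x. g x \<partial>\<mu>)"
  by (intro integral_cong_AE) (use assms set_pmf_subset in \<open>auto simp: AE_measure_pmf_iff\<close>)

lemma cp_1: "cp (Suc 0) = \<mu>"
proof -
  have "cp (Suc 0) = map_pmf (\<lambda>y. \<one> \<otimes> y) \<mu>"
    by (simp add: pair_return_pmf1 pmf.map_comp comp_def)
  also have "\<dots> = map_pmf (\<lambda>y. y) \<mu>"
    by (intro map_pmf_cong) (use set_pmf_subset in auto)
  finally show ?thesis
    by simp
qed

lemma integral_cp_Suc:
  fixes f :: "'a \<Rightarrow> real"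
  assumes "\<And>x. norm (f x) \<le> B"
  shows "(\<integral>z. f z \<partial>cp (Suc n)) = (\<integral>x. (\<integral>y. f (x \<otimes> y) \<partial>\<mu>) \<partial>cp n)"
  using integral_map_pair_pmf[OF assms] by simp

lemma cp_add: "cp (m + n) = map_pmf (\<lambda>(x, y). x \<otimes> y) (pair_pmf (cp m) (cp n))"
proof (induction n)
  case 0
  have "map_pmf (\<lambda>(x, y). x \<otimes> y) (pair_pmf (cp m) (cp 0)) = map_pmf (\<lambda>x. x \<otimes> \<one>) (cp m)"
    by (simp add: pair_return_pmf2 pmf.map_comp comp_def)
  also have "\<dots> = map_pmf (\<lambda>x. x) (cp m)"
    by (intro map_pmf_cong) (auto simp: cp_carrier)
  finally show ?case
    by simp
next
  case (Suc n)
  have "cp (m + Suc n) = map_pmf (\<lambda>(x, y). x \<otimes> y) (pair_pmf (cp (m + n)) \<mu>)"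
    by simp
  also have "\<dots> = bind_pmf (cp m) (\<lambda>x. bind_pmf (cp n) (\<lambda>y. map_pmf (\<lambda>z. (x \<otimes> y) \<otimes> z) \<mu>))"
    unfolding Suc by (simp add: pair_pmf_def map_pmf_def bind_assoc_pmf bind_return_pmf)
  also have "\<dots> = bind_pmf (cp m) (\<lambda>x. bind_pmf (cp n) (\<lambda>y. map_pmf (\<lambda>z. x \<otimes> (y \<otimes> z)) \<mu>))"
    by (intro bind_pmf_cong map_pmf_cong refl) (use set_pmf_subset in \<open>auto simp: m_assoc cp_carrier\<close>)
  also have "\<dots> = map_pmf (\<lambda>(x, y). x \<otimes> y) (pair_pmf (cp m) (cp (Suc n)))"
    by (simp add: pair_pmf_def map_pmf_def bind_assoc_pmf bind_return_pmf)
  finally show ?case .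
qed

lemma integral_cp_add:
  fixes f :: "'a \<Rightarrow> real"
  assumes "\<And>x. norm (f x) \<le> B"
  shows "(\<integral>z. f z \<partial>cp (m + n)) = (\<integral>x. (\<integral>y. f (x \<otimes> y) \<partial>cp n) \<partial>cp m)"
  unfolding cp_add by (rule integral_map_pair_pmf[OF assms])

lemma pmf_cp_add_ge: "pmf (cp m) g * pmf (cp n) h \<le> pmf (cp (m + n)) (g \<otimes> h)"
proof -
  have "pmf (cp m) g * pmf (cp n) h = measure (pair_pmf (cp m) (cp n)) {(g, h)}"
    by (simp add: pmf_pair[symmetric] measure_pmf_single)
  also have "\<dots> \<le> measure (pair_pmf (cp m) (cp n)) ((\<lambda>(x, y). x \<otimes> y) -` {g \<otimes> h})"
    by (intro measure_pmf.finite_measure_mono) auto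
  also have "\<dots> = pmf (cp (m + n)) (g \<otimes> h)"
    unfolding cp_add by (simp add: pmf_map)
  finally show ?thesis .
qed

lemma pmf_cp_add_pos: "pmf (cp m) g > 0 \<Longrightarrow> pmf (cp n) h > 0 \<Longrightarrow> pmf (cp (m + n)) (g \<otimes> h) > 0"
  using pmf_cp_add_ge[of m g n h] by (meson less_le_trans mult_pos_pos)

lemma pmf_cp_word:
  assumes "set ws \<subseteq> set_pmf \<mu>"
  shows "pmf (cp (length ws)) (word_prod G ws) > 0"
  using assms
proof (induction ws)
  case Nil
  then show ?case by (simp add: word_prod_def)
next
  case (Cons a ws)
  have "pmf (cp (Suc 0)) a > 0"
    unfolding cp_1 using Cons.prems by (simp add: pmf_positive)
  from pmf_cp_add_pos[OF this, of "length ws" "word_prod G ws"] show ?case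
    using Cons by (simp add: word_prod_def)
qed

text \<open>Convolution on the right: the state \<open>x\<close> is followed by \<open>n\<close>
  further steps. It commutes with left translations, which is what lets these play the part of
  \<open>t\<close> in \<open>smoothing_bound\<close>.\<close>

definition Pn :: "nat \<Rightarrow> ('a \<Rightarrow> real) \<Rightarrow> 'a \<Rightarrow> real" where
  "Pn n f x = (if x \<in> carrier G then \<integral>g. f (x \<otimes> g) \<partial>cp n else 0)"

lemma Pn_carrier: "x \<in> carrier G \<Longrightarrow> Pn n f x = (\<integral>g. f (x \<otimes> g) \<partial>cp n)"
  by (simp add: Pn_def)

lemma integrable_bnd: "bnd X b f \<Longrightarrow> integrable (measure_pmf p) (\<lambda>x. f (h x))"
  by (rule measure_pmf.integrable_const_bound[where B=b]) (auto simp: bnd_def)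

lemma contraction_op_Pn: "contraction_op (carrier G) (Pn n)"
  unfolding contraction_op_def
proof (intro conjI allI impI)
  fix b f assume f: "bnd (carrier G) b f"
  have "\<bar>\<integral>g. f (x \<otimes> g) \<partial>cp n\<bar> \<le> b" for x
    by (intro abs_integral_pmf_le) (use f in \<open>simp add: bnd_def\<close>)
  then show "bnd (carrier G) b (Pn n f)"
    using bnd_nonneg[OF f] by (auto simp: bnd_def Pn_def)
next
  fix b b' f g r s assume "bnd (carrier G) b f" "bnd (carrier G) b' g"
  then have "integrable (cp n) (\<lambda>y. f (x \<otimes> y))" "integrable (cp n) (\<lambda>y. g (x \<otimes> y))" for x
    by (auto intro: integrable_bnd)
  then show "Pn n (\<lambda>x. r * f x + s * g x) = (\<lambda>x. r * Pn n f x + s * Pn n g x)"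
    by (auto simp: Pn_def)
qed

lemma Pn_Pn:
  assumes "bnd (carrier G) b f"
  shows "Pn m (Pn n f) = Pn (m + n) f"
proof
  fix x
  show "Pn m (Pn n f) x = Pn (m + n) f x"
  proof (cases "x \<in> carrier G")
    case x: True
    have "Pn m (Pn n f) x = (\<integral>g. (\<integral>h. f (x \<otimes> (g \<otimes> h)) \<partial>cp n) \<partial>cp m)"
      unfolding Pn_carrier[OF x]
      by (intro integral_cp_cong) (simp add: Pn_carrier x, intro integral_cp_cong, simp add: m_assoc x)
    also have "\<dots> = Pn (m + n) f x"
      unfolding Pn_carrier[OF x] by (subst integral_cp_add[where B=b]) (use assms in \<open>auto simp: bnd_def\<close>)
    finally show ?thesis .
  qed (simp add: Pn_def)
qed

lemma Pn_funpow:
  assumes "bnd (carrier G) b f"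
  shows "(Pn K ^^ n) f = Pn (K * n) f"
proof (induction n)
  case 0
  show ?case
    using assms by (auto simp: Pn_def bnd_def fun_eq_iff)
next
  case (Suc n)
  then show ?case
    using Pn_Pn[OF assms, of K "K * n"] by simp
qed

text \<open>The power \<open>cp K\<close> dominates, at every state \<open>x\<close>,
  \<open>c\<close> times the law that stands still or moves by \<open>\<kappa> x\<close> with equal
  probability, so \<open>smoothing_bound\<close> applies to \<open>Pn K\<close>. The operator
  \<open>t\<close> is abstract because it is a translation in one application and a time shift in
  the other; for the translation the increment law \<open>\<kappa>\<close> depends on
  \<open>x\<close>.\<close>

lemma walk_smoothing:
  fixes t :: "('a \<Rightarrow> real) \<Rightarrow> 'a \<Rightarrow> real" and \<kappa> :: "'a \<Rightarrow> 'a pmf"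
  assumes K: "K > 0" and c: "0 < c" "c \<le> 1"
    and t: "contraction_op (carrier G) t"
    and t_eq: "\<And>f x. x \<in> carrier G \<Longrightarrow> t f x = (\<integral>g. f (x \<otimes> g) \<partial>\<kappa> x)"
    and t_out: "\<And>f x. x \<notin> carrier G \<Longrightarrow> t f x = 0"
    and comm: "\<And>b f n. bnd (carrier G) b f \<Longrightarrow> Pn n (t f) = t (Pn n f)"
    and dom_one: "c \<le> pmf (cp K) \<one>"
    and dom: "\<And>x g. x \<in> carrier G \<Longrightarrow> c * pmf (\<kappa> x) g \<le> pmf (cp K) g"
    and f: "bnd (carrier G) b f"
  shows "\<bar>(\<integral>g. f g \<partial>cp N) - (\<integral>g. t f g \<partial>cp N)\<bar> \<le> b * (2 * sqrt (2 * real K / c)) / sqrt (real N + 1)"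
proof -
  define n where "n = N div K"
  define r where "r = N mod K"
  have N: "N = K * n + r"
    by (simp add: n_def r_def)
  \<comment> \<open>The \<open>N mod K\<close> surplus steps are applied to \<open>f\<close>
    beforehand, which does not enlarge its bound.\<close>
  have rf: "bnd (carrier G) b (Pn r f)"
    by (rule contraction_op_bnd[OF contraction_op_Pn f])
  have b: "b \<ge> 0"
    using bnd_nonneg[OF f] .
  have domination: "bnd (carrier G) ((1 - c) * b) (\<lambda>x. Pn K f x - c * avg_op t f x)"
    if f: "bnd (carrier G) b f" for b f
    unfolding bnd_def
  proof (intro conjI allI impI)
    fix x
    have b: "b \<ge> 0"
      using bnd_nonneg[OF f] .
    show "\<bar>Pn K f x - c * avg_op t f x\<bar> \<le> (1 - c) * b"
    proof (cases "x \<in> carrier G")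
      case x: True
      define r where "r = bind_pmf (bernoulli_pmf (1/2)) (\<lambda>B. if B then return_pmf \<one> else \<kappa> x)"
      have "c * pmf r g \<le> pmf (cp K) g" for g
      proof -
        have "c * pmf r g = (c * indicator {\<one>} g + c * pmf (\<kappa> x) g) / 2"
          by (simp add: r_def pmf_bind integral_bernoulli_pmf pmf_return indicator_def algebra_simps)
        moreover have "c * indicator {\<one>} g \<le> pmf (cp K) g"
          using dom_one by (simp add: indicator_def)
        ultimately show ?thesis
          using dom[OF x, of g] by simp
      qed
      then have "\<bar>(\<integral>g. f (x \<otimes> g) \<partial>cp K) - c * (\<integral>g. f (x \<otimes> g) \<partial>r)\<bar> \<le> (1 - c) * b"
        using f c by (intro integral_pmf_domination) (auto simp: bnd_def)
      moreover have "(\<integral>g. f (x \<otimes> g) \<partial>r) = avg_op t f x"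
      proof -
        have "(\<integral>g. f (x \<otimes> g) \<partial>r) = (\<integral>B. (\<integral>g. f (x \<otimes> g) \<partial>(if B then return_pmf \<one> else \<kappa> x)) \<partial>bernoulli_pmf (1/2))"
          unfolding r_def by (rule integral_bind_pmf_bounded[where B=b]) (use f in \<open>simp add: bnd_def\<close>)
        also have "\<dots> = avg_op t f x"
          using x by (simp add: integral_bernoulli_pmf avg_op_def t_eq)
        finally show ?thesis .
      qed
      ultimately show ?thesis
        using x by (simp add: Pn_carrier)
    next
      case False
      then show ?thesis
        using f c b by (simp add: Pn_def avg_op_def t_out bnd_def)
    qed
    show "Pn K f x - c * avg_op t f x = 0" if "x \<notin> carrier G"
      using that f by (simp add: Pn_def avg_op_def t_out bnd_def)
  qed
  have Pn_one: "Pn N f \<one> = (\<integral>g. f g \<partial>cp N)" for f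
    unfolding Pn_carrier[OF one_closed] by (rule integral_cp_cong) simp
  have "\<bar>(Pn K ^^ n) (Pn r f) \<one> - t ((Pn K ^^ n) (Pn r f)) \<one>\<bar> \<le> 2 * b / sqrt (1 + c * real n / 2)"
    by (rule smoothing_bound[OF contraction_op_Pn t comm domination c rf])
  also have "(Pn K ^^ n) (Pn r f) = Pn N f"
    unfolding Pn_funpow[OF rf] N Pn_Pn[OF f] ..
  also have "t (Pn N f) = Pn N (t f)"
    by (rule comm[OF f, symmetric])
  finally have 1: "\<bar>(\<integral>g. f g \<partial>cp N) - (\<integral>g. t f g \<partial>cp N)\<bar> \<le> 2 * b / sqrt (1 + c * real n / 2)"
    unfolding Pn_one .
  have "real N + 1 \<le> real K * (real n + 1)"
  proof -
    have "r < K"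
      using K by (simp add: r_def)
    then have "N + 1 \<le> K * (n + 1)"
      by (simp add: N)
    then show ?thesis
      by (metis of_nat_1 of_nat_add of_nat_le_iff of_nat_mult)
  qed
  then have "(real N + 1) * (c / (2 * real K)) \<le> real K * (real n + 1) * (c / (2 * real K))"
    using c by (intro mult_right_mono) auto
  also have "\<dots> = c / 2 + c * real n / 2"
    using K by (simp add: field_simps)
  also have "\<dots> \<le> 1 + c * real n / 2"
    using c by simp
  finally have "2 * b / sqrt (1 + c * real n / 2) \<le> 2 * b / sqrt ((real N + 1) * (c / (2 * real K)))"
    using b c K by (intro divide_left_mono real_sqrt_le_mono mult_pos_pos real_sqrt_gt_zero) (auto simp: add_pos_nonneg)
  also have "\<dots> = b * (2 * sqrt (2 * real K / c)) / sqrt (real N + 1)"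
    by (simp add: real_sqrt_mult real_sqrt_divide mult_ac)
  finally show ?thesis
    using 1 by linarith
qed

text \<open>Left translation by \<open>a\<close> moves \<open>x\<close> by the right increment
  \<open>inv x \<otimes> a \<otimes> x\<close>; hence one time \<open>K\<close> and one constant
  \<open>c\<close> have to serve all conjugates of \<open>a\<close> of this form.\<close>

lemma walk_translation_smoothing:
  assumes a: "a \<in> carrier G" and K: "K > 0" and c: "c > 0"
    and one: "c \<le> pmf (cp K) \<one>"
    and conj: "\<And>x. x \<in> carrier G \<Longrightarrow> c \<le> pmf (cp K) (inv x \<otimes> a \<otimes> x)"
  shows "\<exists>C\<ge>0. \<forall>N b f. bnd (carrier G) b f \<longrightarrow>
    \<bar>(\<integral>g. f g \<partial>cp N) - (\<integral>g. f (a \<otimes> g) \<partial>cp N)\<bar> \<le> b * C / sqrt (real N + 1)"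
proof (intro exI conjI allI impI)
  fix N b f assume f: "bnd (carrier G) b f"
  define t where "t = (\<lambda>(f :: 'a \<Rightarrow> real) x. if x \<in> carrier G then f (a \<otimes> x) else 0)"
  have c1: "c \<le> 1"
    using one pmf_le_1[of "cp K" \<one>] by linarith
  have t: "contraction_op (carrier G) t"
    unfolding contraction_op_def
  proof (intro conjI allI impI)
    show "bnd (carrier G) b (t f)" if "bnd (carrier G) b f" for b f
      using that bnd_nonneg[OF that] by (simp add: t_def bnd_def)
  qed (simp add: t_def fun_eq_iff)
  have "\<bar>(\<integral>g. f g \<partial>cp N) - (\<integral>g. t f g \<partial>cp N)\<bar> \<le> b * (2 * sqrt (2 * real K / c)) / sqrt (real N + 1)"
  proof (rule walk_smoothing[OF K c c1 t _ _ _ one _ f, where \<kappa> = "\<lambda>x. return_pmf (inv x \<otimes> a \<otimes> x)"])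
    show "t f x = (\<integral>g. f (x \<otimes> g) \<partial>return_pmf (inv x \<otimes> a \<otimes> x))" if "x \<in> carrier G" for f x
      using that a by (simp add: t_def m_assoc[symmetric])
    show "Pn n (t f) = t (Pn n f)" for n b f
    proof
      fix x
      show "Pn n (t f) x = t (Pn n f) x"
        using a by (auto simp: Pn_def t_def m_assoc intro!: integral_cp_cong)
    qed
    show "c * pmf (return_pmf (inv x \<otimes> a \<otimes> x)) g \<le> pmf (cp K) g" if "x \<in> carrier G" for x g
      using conj[OF that] by (auto simp: indicator_def)
  qed (simp add: t_def)
  moreover have "(\<integral>g. t f g \<partial>cp N) = (\<integral>g. f (a \<otimes> g) \<partial>cp N)"
    by (intro integral_cp_cong) (simp add: t_def)
  ultimately show "\<bar>(\<integral>g. f g \<partial>cp N) - (\<integral>g. f (a \<otimes> g) \<partial>cp N)\<bar> \<le> b * (2 * sqrt (2 * real K / c)) / sqrt (real N + 1)"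
    by simp
qed (use c in simp)

text \<open>The first \<open>B\<close> of the \<open>K = B + q\<close> steps may return to the
  identity, so \<open>cp K\<close> dominates a multiple of \<open>cp q\<close>. It also charges the
  identity, which supplies the lazy half.\<close>

lemma walk_time_smoothing:
  assumes q: "K = B + q" "K > 0" and pos: "pmf (cp B) \<one> > 0" "pmf (cp K) \<one> > 0"
  shows "\<exists>C\<ge>0. \<forall>N b f. bnd (carrier G) b f \<longrightarrow>
    \<bar>(\<integral>g. f g \<partial>cp N) - (\<integral>g. f g \<partial>cp (N + q))\<bar> \<le> b * C / sqrt (real N + 1)"
proof (intro exI conjI allI impI)
  fix N b f assume f: "bnd (carrier G) b f"
  define c where "c = min (pmf (cp B) \<one>) (pmf (cp K) \<one>)"
  have c: "c > 0" "c \<le> 1" "c \<le> pmf (cp K) \<one>" "c \<le> pmf (cp B) \<one>"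
    using pos pmf_le_1[of "cp K" \<one>] by (auto simp: c_def)
  have "\<bar>(\<integral>g. f g \<partial>cp N) - (\<integral>g. Pn q f g \<partial>cp N)\<bar> \<le> b * (2 * sqrt (2 * real K / c)) / sqrt (real N + 1)"
  proof (rule walk_smoothing[OF q(2) c(1,2) contraction_op_Pn _ _ _ c(3) _ f, where \<kappa> = "\<lambda>x. cp q"])
    show "Pn n (Pn q f) = Pn q (Pn n f)" if "bnd (carrier G) b f" for n b f
      unfolding Pn_Pn[OF that] by (simp add: add.commute)
    show "c * pmf (cp q) g \<le> pmf (cp K) g" if "x \<in> carrier G" for x g
    proof (cases "g \<in> carrier G")
      case True
      have "c * pmf (cp q) g \<le> pmf (cp B) \<one> * pmf (cp q) g"
        using c by (intro mult_right_mono) auto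
      also have "\<dots> \<le> pmf (cp K) (\<one> \<otimes> g)"
        unfolding q by (rule pmf_cp_add_ge)
      finally show ?thesis
        using True by simp
    qed (simp add: pmf_cp_outside)
  qed (simp_all add: Pn_def)
  moreover have "(\<integral>g. Pn q f g \<partial>cp N) = (\<integral>g. f g \<partial>cp (N + q))"
  proof -
    have "(\<integral>g. f g \<partial>cp (N + q)) = (\<integral>g. (\<integral>h. f (g \<otimes> h) \<partial>cp q) \<partial>cp N)"
      by (rule integral_cp_add[where B=b]) (use f in \<open>simp add: bnd_def\<close>)
    also have "\<dots> = (\<integral>g. Pn q f g \<partial>cp N)"
      by (intro integral_cp_cong) (simp add: Pn_carrier)
    finally show ?thesis ..
  qed
  ultimately show "\<bar>(\<integral>g. f g \<partial>cp N) - (\<integral>g. f g \<partial>cp (N + q))\<bar> \<le> b * (2 * sqrt (2 * real K / min (pmf (cp B) \<one>) (pmf (cp K) \<one>))) / sqrt (real N + 1)"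
    by (simp add: c_def)
qed (use pos in simp)

end

locale irreducible_walk = group_walk +
  assumes generates: "semigroup_generates G (set_pmf \<mu>)"
begin

lemma reachable:
  assumes "g \<in> carrier G"
  shows "\<exists>n>0. pmf (cp n) g > 0"
proof -
  obtain ws where "g = word_prod G ws" "ws \<noteq> []" "set ws \<subseteq> set_pmf \<mu>"
    using assms generates unfolding semigroup_generates_def by blast
  then show ?thesis
    using pmf_cp_word[of ws] by (intro exI[of _ "length ws"]) auto
qed

lemma period_difference:
  shows "period G \<mu> > 0"
    "\<exists>B. pmf (cp B) \<one> > 0 \<and> pmf (cp (B + period G \<mu>)) \<one> > 0"
proof -
  let ?S = "{n. 1 \<le> n \<and> pmf (cp n) \<one> > 0}"
  have ne: "?S \<noteq> {}" "0 \<notin> ?S"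
    using reachable[of \<one>] by (auto simp: Suc_le_eq)
  have add: "a + b \<in> ?S" if "a \<in> ?S" "b \<in> ?S" for a b
    using that pmf_cp_add_pos[of a \<one> b \<one>] by auto
  show "period G \<mu> > 0" "\<exists>B. pmf (cp B) \<one> > 0 \<and> pmf (cp (B + period G \<mu>)) \<one> > 0"
    using semigroup_gcd_difference[OF ne add] unfolding period_def by auto
qed

lemma time_smoothing:
  "\<exists>C\<ge>0. \<forall>N b f. bnd (carrier G) b f \<longrightarrow>
    \<bar>(\<integral>g. f g \<partial>cp N) - (\<integral>g. f g \<partial>cp (N + period G \<mu>))\<bar> \<le> b * C / sqrt (real N + 1)"
proof -
  obtain B where B: "pmf (cp B) \<one> > 0" "pmf (cp (B + period G \<mu>)) \<one> > 0"
    using period_difference(2) by blast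
  show ?thesis
    by (rule walk_time_smoothing[OF refl _ B]) (use period_difference(1) in simp)
qed

text \<open>If \<open>a\<close> is reached in \<open>N a\<close> steps, its \<open>r\<close>-th
  power is reached in \<open>r N a\<close> steps. All these times are multiples of the return time
  \<open>r\<close>, so waiting by returns of length \<open>r\<close> brings them to the common value
  \<open>r L\<close>.\<close>

lemma common_return_time:
  assumes "finite A" "A \<subseteq> carrier G"
  shows "\<exists>r>0. \<exists>K>0. pmf (cp K) \<one> > 0 \<and> (\<forall>a\<in>A. pmf (cp K) (a [^] (r :: nat)) > 0)"
proof -
  obtain r where r: "r > 0" "pmf (cp r) \<one> > 0"
    using reachable[OF one_closed] by blast
  have mult1: "pmf (cp (r * k)) \<one> > 0" for k
  proof (induction k)
    case (Suc k)
    then show ?case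
      using pmf_cp_add_pos[OF r(2) Suc] by simp
  qed simp
  have "\<forall>a\<in>A. \<exists>n>0. pmf (cp n) a > 0"
    using reachable assms by blast
  then obtain N where N: "\<And>a. a \<in> A \<Longrightarrow> N a > 0" "\<And>a. a \<in> A \<Longrightarrow> pmf (cp (N a)) a > 0"
    by metis
  \<comment> \<open>\<open>L\<close> dominates every \<open>N a\<close>; the successor keeps it
    positive when \<open>A\<close> is empty.\<close>
  define L where "L = Suc (\<Sum>a\<in>A. N a)"
  have "pmf (cp (r * L)) (a [^] r) > 0" if a: "a \<in> A" for a
  proof -
    have ac: "a \<in> carrier G"
      using a assms by blast
    have "pmf (cp (N a * k)) (a [^] k) > 0" for k
    proof (induction k)
      case (Suc k)
      then show ?case
        using pmf_cp_add_pos[OF Suc N(2)[OF a]] by (simp add: add.commute)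
    qed simp
    then have *: "pmf (cp (N a * r)) (a [^] r) > 0" .
    have "N a \<le> L"
      unfolding L_def using member_le_sum[OF a, of N] assms by simp
    then have "r * L = N a * r + r * (L - N a)"
      by (simp add: algebra_simps diff_mult_distrib2)
    then show ?thesis
      using pmf_cp_add_pos[OF * mult1[of "L - N a"]] ac by simp
  qed
  then show ?thesis
    using r(1) mult1[of L] by (intro exI[of _ r] conjI exI[of _ "r * L"] ballI) (auto simp: L_def)
qed

end

context group_walk
begin

lemma cp_Suc_left: "cp (Suc n) = map_pmf (\<lambda>(x, y). x \<otimes> y) (pair_pmf \<mu> (cp n))"
  using cp_add[of "Suc 0" n] unfolding cp_1 add_Suc add_0 .

end

section \<open>The right action of a group on the cosets of a subgroup\<close>

context group
begin

lemma rcosets_act: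
  assumes "subgroup N G" "c \<in> rcosets N" "g \<in> carrier G"
  shows "c #> g \<in> rcosets N"
  using assms subgroup.subset[OF assms(1)] unfolding RCOSETS_def
  by (auto simp: coset_mult_assoc intro!: bexI[of _ "_ \<otimes> _"])

lemma rcosets_act_mult:
  assumes "subgroup N G" "c \<in> rcosets N" "g \<in> carrier G" "h \<in> carrier G"
  shows "(c #> g) #> h = c #> (g \<otimes> h)"
  using subgroup.rcosets_carrier[OF assms(1) is_group assms(2)] assms(3,4)
  by (rule coset_mult_assoc)

lemma rcosets_act_one:
  assumes "subgroup N G" "c \<in> rcosets N"
  shows "c #> \<one> = c"
  using subgroup.rcosets_carrier[OF assms(1) is_group assms(2)] by (rule coset_mult_one)

lemma rcosets_act_bij:
  assumes N: "subgroup N G" and g: "g \<in> carrier G"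
  shows "bij_betw (\<lambda>c. c #> g) (rcosets N) (rcosets N)"
proof (rule bij_betw_byWitness[where f'="\<lambda>c. c #> inv g"])
  show "\<forall>c\<in>rcosets N. c #> g #> inv g = c" "\<forall>c\<in>rcosets N. c #> inv g #> g = c"
    using g by (auto simp: rcosets_act_mult[OF N] rcosets_act_one[OF N])
qed (use g rcosets_act[OF N] in auto)

lemma rcosets_act_trans:
  assumes N: "subgroup N G" "c \<in> rcosets N" "d \<in> rcosets N"
  shows "\<exists>g\<in>carrier G. c #> g = d"
proof -
  obtain x y where "x \<in> carrier G" "c = N #> x" "y \<in> carrier G" "d = N #> y"
    using assms unfolding RCOSETS_def by auto
  then show ?thesis
    using subgroup.subset[OF N(1)]
    by (intro bexI[of _ "inv x \<otimes> y"]) (auto simp: coset_mult_assoc m_assoc[symmetric])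
qed

lemma rcosets_nonempty: "subgroup N G \<Longrightarrow> rcosets N \<noteq> {}"
  unfolding RCOSETS_def by auto

end

section \<open>The Poisson equation on a coset space\<close>

text \<open>The walk acts on the right cosets of \<open>N\<close> by multiplication from the right.
  The locale is instantiated twice: with \<open>L\<close>, and with the sublattice of multiples of
  \<open>r\<close>.\<close>

locale coset_walk = irreducible_walk +
  fixes N :: "'a set"
  assumes subgroup_N: "subgroup N G" and finite_cosets: "finite (rcosets N)"
begin

abbreviation C :: "'a set set" where "C \<equiv> rcosets N"

lemma C_act: "c \<in> C \<Longrightarrow> g \<in> carrier G \<Longrightarrow> c #> g \<in> C"
  using rcosets_act[OF subgroup_N] .

lemma card_C: "card C > 0"
  using finite_cosets rcosets_nonempty[OF subgroup_N] by (simp add: card_gt_0_iff)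

definition step :: "('a set \<Rightarrow> real) \<Rightarrow> 'a set \<Rightarrow> real" where
  "step h c = (\<integral>s. h (c #> s) \<partial>\<mu>)"

text \<open>The step itself may be periodic, but the walk at an independent geometric time charges every coset,
  so its operator is a strict contraction on functions of mean zero.\<close>

definition resolvent_pmf :: "'a set \<Rightarrow> 'a set pmf" where
  "resolvent_pmf c = bind_pmf (geometric_pmf (1/2)) (\<lambda>n. map_pmf (\<lambda>g. c #> g) (cp n))"

definition resolvent :: "('a set \<Rightarrow> real) \<Rightarrow> 'a set \<Rightarrow> real" where
  "resolvent h c = (if c \<in> C then \<integral>d. h d \<partial>resolvent_pmf c else 0)"

lemma step_eq_sum:
  assumes "c \<in> C"
  shows "step h c = (\<Sum>d\<in>C. h d * pmf (map_pmf (\<lambda>s. c #> s) \<mu>) d)"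
proof -
  have "step h c = (\<integral>d. h d \<partial>map_pmf (\<lambda>s. c #> s) \<mu>)"
    by (simp add: step_def)
  also have "\<dots> = (\<Sum>d\<in>C. h d * pmf (map_pmf (\<lambda>s. c #> s) \<mu>) d)"
    using finite_cosets by (rule integral_measure_pmf_real) (use assms set_pmf_subset C_act in auto)
  finally show ?thesis .
qed

lemma integrable_C:
  assumes "c \<in> C"
  shows "integrable (measure_pmf \<mu>) (\<lambda>s. h (c #> s) :: real)"
proof (rule measure_pmf.integrable_const_bound[where B="\<Sum>d\<in>C. \<bar>h d\<bar>"])
  have "\<bar>h d\<bar> \<le> (\<Sum>d\<in>C. \<bar>h d\<bar>)" if "d \<in> C" for d
    using that finite_cosets by (intro member_le_sum) auto
  then show "AE s in \<mu>. norm (h (c #> s)) \<le> (\<Sum>d\<in>C. \<bar>h d\<bar>)"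
    using assms set_pmf_subset C_act by (auto simp: AE_measure_pmf_iff)
qed simp

text \<open>Right multiplication by a fixed element permutes the cosets, so the uniform distribution
  is stationary.\<close>

lemma sum_step: "(\<Sum>c\<in>C. step h c) = (\<Sum>c\<in>C. h c)"
proof -
  have "(\<Sum>c\<in>C. step h c) = (\<integral>s. (\<Sum>c\<in>C. h (c #> s)) \<partial>\<mu>)"
    unfolding step_def using integrable_C by (intro Bochner_Integration.integral_sum[symmetric]) auto
  also have "\<dots> = (\<integral>s. (\<Sum>c\<in>C. h c) \<partial>\<mu>)"
    by (intro integral_mu_cong sum.reindex_bij_betw rcosets_act_bij subgroup_N)
  finally show ?thesis
    by simp
qed

text \<open>The geometric time either stops at once or, after one step, starts afresh from the coset
  reached; \<open>cp_Suc_left\<close> splits this step off at the beginning of the walk.\<close>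

lemma resolvent_pmf_unfold:
  assumes c: "c \<in> C"
  shows "resolvent_pmf c = bind_pmf (bernoulli_pmf (1/2))
    (\<lambda>b. if b then return_pmf c else bind_pmf \<mu> (\<lambda>s. resolvent_pmf (c #> s)))"
proof -
  have "resolvent_pmf c = bind_pmf (bernoulli_pmf (1/2)) (\<lambda>b. bind_pmf (if b then return_pmf 0 else map_pmf Suc (geometric_pmf (1/2)))
      (\<lambda>n. map_pmf (\<lambda>g. c #> g) (cp n)))"
    unfolding resolvent_pmf_def by (subst geometric_bind_pmf_unfold) (simp_all add: bind_assoc_pmf)
  also have "\<dots> = bind_pmf (bernoulli_pmf (1/2)) (\<lambda>b. if b then return_pmf c else bind_pmf \<mu> (\<lambda>s. resolvent_pmf (c #> s)))"
  proof (intro bind_pmf_cong refl)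
    fix b
    show "bind_pmf (if b then return_pmf 0 else map_pmf Suc (geometric_pmf (1/2))) (\<lambda>n. map_pmf (\<lambda>g. c #> g) (cp n))
      = (if b then return_pmf c else bind_pmf \<mu> (\<lambda>s. resolvent_pmf (c #> s)))"
    proof (cases b)
      case True
      then show ?thesis
        by (simp add: bind_return_pmf rcosets_act_one[OF subgroup_N c])
    next
      case False
      have "map_pmf (\<lambda>g. c #> g) (cp (Suc n)) = bind_pmf \<mu> (\<lambda>s. map_pmf (\<lambda>g. c #> s #> g) (cp n))" for n
      proof -
        have "map_pmf (\<lambda>g. c #> g) (cp (Suc n)) = bind_pmf \<mu> (\<lambda>s. map_pmf (\<lambda>g. c #> (s \<otimes> g)) (cp n))"
          unfolding cp_Suc_left by (simp add: pair_pmf_def map_pmf_def bind_assoc_pmf bind_return_pmf)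
        also have "\<dots> = bind_pmf \<mu> (\<lambda>s. map_pmf (\<lambda>g. c #> s #> g) (cp n))"
          by (intro bind_pmf_cong map_pmf_cong refl)
            (use set_pmf_subset cp_carrier in \<open>auto simp: rcosets_act_mult[OF subgroup_N c]\<close>)
        finally show ?thesis .
      qed
      then show ?thesis
        using False unfolding resolvent_pmf_def
        by (simp add: bind_map_pmf del: conv_power.simps) (rule bind_commute_pmf)
    qed
  qed
  finally show ?thesis .
qed

lemma set_resolvent_pmf: "c \<in> C \<Longrightarrow> set_pmf (resolvent_pmf c) \<subseteq> C"
  using C_act cp_carrier by (auto simp: resolvent_pmf_def)

text \<open>In operator form \<open>R = (1 + P R) / 2\<close>, with \<open>P\<close> the step:
  \<open>R\<close> is the inverse of \<open>2 - P\<close>.\<close>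

lemma resolvent_unfold:
  assumes h: "bnd C b h" and c: "c \<in> C"
  shows "resolvent h c = (h c + step (resolvent h) c) / 2"
proof -
  have le: "norm (h d) \<le> b" for d
    using h by (simp add: bnd_def)
  have "resolvent h c = (\<integral>d. h d \<partial>resolvent_pmf c)"
    using c by (simp add: resolvent_def)
  also have "\<dots> = (h c + (\<integral>d. h d \<partial>bind_pmf \<mu> (\<lambda>s. resolvent_pmf (c #> s)))) / 2"
    unfolding resolvent_pmf_unfold[OF c]
    by (subst integral_bind_pmf_bounded[OF le]) (simp add: integral_bernoulli_pmf)
  also have "(\<integral>d. h d \<partial>bind_pmf \<mu> (\<lambda>s. resolvent_pmf (c #> s))) = step (resolvent h) c"
    unfolding step_def integral_bind_pmf_bounded[OF le]
    by (intro integral_mu_cong) (simp add: resolvent_def C_act c)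
  finally show ?thesis .
qed

lemma sum_resolvent:
  assumes "bnd C b h"
  shows "(\<Sum>c\<in>C. resolvent h c) = (\<Sum>c\<in>C. h c)"
proof -
  have "(\<Sum>c\<in>C. resolvent h c) = (\<Sum>c\<in>C. (h c + step (resolvent h) c) / 2)"
    using resolvent_unfold[OF assms] by (intro sum.cong) auto
  also have "\<dots> = ((\<Sum>c\<in>C. h c) + (\<Sum>c\<in>C. resolvent h c)) / 2"
    by (simp add: sum_divide_distrib[symmetric] sum.distrib sum_step)
  finally show ?thesis
    by simp
qed

text \<open>Doeblin's argument: irreducibility gives all entries of the resolvent matrix a common
  lower bound \<open>e\<close>. The part \<open>k = e card C\<close> of the uniform law, which kills
  functions of mean zero, can be split off, and mass \<open>1 - k\<close> is left.\<close>

lemma resolvent_contraction: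
  "\<exists>\<rho><1. \<rho> \<ge> 0 \<and> (\<forall>b h. bnd C b h \<longrightarrow> (\<Sum>c\<in>C. h c) = 0 \<longrightarrow> bnd C (\<rho> * b) (resolvent h))"
proof -
  have pos: "pmf (resolvent_pmf c) d > 0" if "c \<in> C" "d \<in> C" for c d
  proof -
    obtain g where g: "g \<in> carrier G" "c #> g = d"
      using rcosets_act_trans[OF subgroup_N \<open>c \<in> C\<close> \<open>d \<in> C\<close>] by blast
    obtain n where n: "pmf (cp n) g > 0"
      using reachable[OF g(1)] by blast
    have "d \<in> set_pmf (resolvent_pmf c)"
      unfolding resolvent_pmf_def
      using n g(2) by (auto simp: set_pmf_iff intro!: bexI[of _ n] imageI)
    then show ?thesis
      by (rule pmf_positive)
  qed
  define e where "e = Min ((\<lambda>(c, d). pmf (resolvent_pmf c) d) ` (C \<times> C))"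
  have fin: "finite ((\<lambda>(c, d). pmf (resolvent_pmf c) d) ` (C \<times> C))"
    "(\<lambda>(c, d). pmf (resolvent_pmf c) d) ` (C \<times> C) \<noteq> {}"
    using finite_cosets rcosets_nonempty[OF subgroup_N] by auto
  have e_le: "e \<le> pmf (resolvent_pmf c) d" if "c \<in> C" "d \<in> C" for c d
    unfolding e_def using that fin by (intro Min_le) auto
  have e_pos: "e > 0"
    unfolding e_def using fin pos by (subst Min_gr_iff) auto
  define k where "k = e * real (card C)"
  have k: "k > 0"
    using e_pos card_C by (simp add: k_def)
  have dom: "k * pmf (pmf_of_set C) d \<le> pmf (resolvent_pmf c) d" if "c \<in> C" for c d
    using e_le[OF that, of d] finite_cosets rcosets_nonempty[OF subgroup_N] card_C
    by (cases "d \<in> C") (auto simp: k_def)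
  have k1: "k \<le> 1"
  proof -
    obtain c where c: "c \<in> C"
      using rcosets_nonempty[OF subgroup_N] by blast
    have "k = (\<Sum>d\<in>C. k * pmf (pmf_of_set C) d)"
      using finite_cosets rcosets_nonempty[OF subgroup_N] by (simp add: sum_distrib_left[symmetric] sum_pmf_eq_1)
    also have "\<dots> \<le> (\<Sum>d\<in>C. pmf (resolvent_pmf c) d)"
      by (intro sum_mono dom c)
    also have "\<dots> = 1"
      by (rule sum_pmf_eq_1[OF finite_cosets set_resolvent_pmf[OF c]])
    finally show ?thesis .
  qed
  have "bnd C ((1 - k) * b) (resolvent h)" if h: "bnd C b h" "(\<Sum>c\<in>C. h c) = 0" for b h
    unfolding bnd_def
  proof (intro conjI allI impI)
    fix c
    show "\<bar>resolvent h c\<bar> \<le> (1 - k) * b"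
    proof (cases "c \<in> C")
      case c: True
      have "\<bar>(\<integral>d. h d \<partial>resolvent_pmf c) - k * (\<integral>d. h d \<partial>pmf_of_set C)\<bar> \<le> (1 - k) * b"
        using h k by (intro integral_pmf_domination dom c) (auto simp: bnd_def)
      moreover have "(\<integral>d. h d \<partial>pmf_of_set C) = 0"
        using finite_cosets rcosets_nonempty[OF subgroup_N] h(2) by (simp add: integral_pmf_of_set)
      ultimately show ?thesis
        using c by (simp add: resolvent_def)
    next
      case False
      then show ?thesis
        using k1 bnd_nonneg[OF h(1)] by (simp add: resolvent_def)
    qed
  qed (simp add: resolvent_def)
  then show ?thesis
    using k k1 by (intro exI[of _ "1 - k"]) auto
qed

text \<open>The resolvent identity reads \<open>R f - P R f = f - R f\<close>. Summed over the
  iterates of \<open>R\<close> on \<open>\<phi>\<close>, the right-hand side telescopes to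
  \<open>\<phi>\<close>; so \<open>h\<close> is the Neumann series starting with the first power of
  \<open>R\<close>, and the contraction makes it converge.\<close>

theorem poisson_equation:
  assumes mean: "(\<Sum>c\<in>C. \<phi> c) = 0"
  shows "\<exists>h. \<forall>c\<in>C. h c - step h c = \<phi> c"
proof -
  obtain \<rho> where \<rho>: "\<rho> < 1" "\<rho> \<ge> 0"
    and contr: "\<And>b h. bnd C b h \<Longrightarrow> (\<Sum>c\<in>C. h c) = 0 \<Longrightarrow> bnd C (\<rho> * b) (resolvent h)"
    using resolvent_contraction by blast
  define f where "f = (\<lambda>j. (resolvent ^^ j) (\<lambda>c. if c \<in> C then \<phi> c else 0))"
  define B where "B = (\<Sum>d\<in>C. \<bar>\<phi> d\<bar>)"
  have "\<bar>\<phi> d\<bar> \<le> B" if "d \<in> C" for d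
    unfolding B_def using that finite_cosets by (intro member_le_sum) auto
  then have f0: "bnd C B (f 0)"
    by (auto simp: bnd_def f_def B_def sum_nonneg)
  have fS: "f (Suc j) = resolvent (f j)" for j
    by (simp add: f_def)
  have f: "bnd C (\<rho> ^ j * B) (f j) \<and> (\<Sum>c\<in>C. f j c) = 0" for j
  proof (induction j)
    case 0
    then show ?case
      using f0 mean by (simp add: f_def)
  next
    case (Suc j)
    then show ?case
      using contr[of "\<rho> ^ j * B" "f j"] sum_resolvent[of "\<rho> ^ j * B" "f j"] unfolding fS by (simp add: mult.assoc)
  qed
  have f_le: "norm (f j c) \<le> \<rho> ^ j * B" for j c
    using f[of j] by (simp add: bnd_def)
  have sm: "summable (\<lambda>j. f j c)" for c
    using \<rho> by (intro summable_comparison_test'[OF summable_mult2[OF summable_geometric[of \<rho>], of B]] f_le) auto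
  define h where "h = (\<lambda>c. \<Sum>j. f (Suc j) c)"
  have h_sums: "(\<lambda>j. f (Suc j) c) sums h c" for c
    unfolding h_def using sm[of c] by (intro summable_sums summable_Suc_iff[of "\<lambda>j. f j c", THEN iffD2])
  have "h c - step h c = \<phi> c" if c: "c \<in> C" for c
  proof -
    have "(\<lambda>j. \<Sum>d\<in>C. f (Suc j) d * pmf (map_pmf (\<lambda>s. c #> s) \<mu>) d) sums (\<Sum>d\<in>C. h d * pmf (map_pmf (\<lambda>s. c #> s) \<mu>) d)"
      by (intro sums_sum sums_mult2 h_sums)
    then have "(\<lambda>j. step (f (Suc j)) c) sums step h c"
      by (simp only: step_eq_sum[OF c])
    then have "(\<lambda>j. f (Suc j) c - step (f (Suc j)) c) sums (h c - step h c)"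
      by (intro sums_diff h_sums)
    moreover have "f (Suc j) c - step (f (Suc j)) c = f j c - f (Suc j) c" for j
    proof -
      have "f (Suc j) c = (f j c + step (f (Suc j)) c) / 2"
        using resolvent_unfold[of "\<rho> ^ j * B" "f j" c] f[of j] c unfolding fS by blast
      then show ?thesis
        by simp
    qed
    ultimately have "(\<lambda>j. f j c - f (Suc j) c) sums (h c - step h c)"
      by simp
    moreover have "(\<lambda>j. f j c - f (Suc j) c) sums (f 0 c - 0)"
      by (rule telescope_sums'[OF summable_LIMSEQ_zero[OF sm]])
    ultimately have "h c - step h c = f 0 c - 0"
      by (rule sums_unique2)
    then show ?thesis
      using c by (simp add: f_def)
  qed
  then show ?thesis
    by blast
qed

text \<open>A harmonic function is fixed by the resolvent; after subtraction of its mean the strict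
  contraction forces it to vanish. This is the source of the uniqueness of harmonic parts.\<close>

lemma harmonic_constant:
  assumes harm: "\<And>c. c \<in> C \<Longrightarrow> step h c = h c" and c: "c \<in> C" and d: "d \<in> C"
  shows "h c = h d"
proof -
  obtain \<rho> where \<rho>: "\<rho> < 1" "\<rho> \<ge> 0"
    and contr: "\<And>b h. bnd C b h \<Longrightarrow> (\<Sum>c\<in>C. h c) = 0 \<Longrightarrow> bnd C (\<rho> * b) (resolvent h)"
    using resolvent_contraction by blast
  define m where "m = (\<Sum>c\<in>C. h c) / real (card C)"
  define f where "f = (\<lambda>c. if c \<in> C then h c - m else 0)"
  define B where "B = Max ((\<lambda>d. \<bar>f d\<bar>) ` C)"
  have fin: "finite ((\<lambda>d. \<bar>f d\<bar>) ` C)" "(\<lambda>d. \<bar>f d\<bar>) ` C \<noteq> {}"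
    using finite_cosets rcosets_nonempty[OF subgroup_N] by auto
  obtain c0 where c0: "c0 \<in> C" "B = \<bar>f c0\<bar>"
    using Max_in[OF fin] unfolding B_def by auto
  have "\<bar>f d\<bar> \<le> B" if "d \<in> C" for d
    unfolding B_def using that fin by (intro Max_ge) auto
  then have fB: "bnd C B f"
    using c0 by (auto simp: bnd_def f_def)
  have mean: "(\<Sum>c\<in>C. f c) = 0"
    using card_C by (simp add: f_def sum_subtractf m_def)
  have step_f: "(\<integral>s. f (c #> s) \<partial>\<mu>) = f c" if "c \<in> C" for c
  proof -
    have "(\<integral>s. f (c #> s) \<partial>\<mu>) = (\<integral>s. h (c #> s) - m \<partial>\<mu>)"
      by (intro integral_mu_cong) (simp add: f_def C_act that)
    also have "\<dots> = h c - m"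
      using harm[OF that] integrable_C[OF that] by (simp add: step_def)
    finally show ?thesis
      using that by (simp add: f_def)
  qed
  have cp_f: "(\<integral>g. f (c #> g) \<partial>cp n) = f c" if "c \<in> C" for c n
  proof (induction n)
    case 0
    then show ?case
      by (simp add: rcosets_act_one[OF subgroup_N that])
  next
    case (Suc n)
    have "(\<integral>g. f (c #> g) \<partial>cp (Suc n)) = (\<integral>x. (\<integral>y. f (c #> (x \<otimes> y)) \<partial>\<mu>) \<partial>cp n)"
      by (rule integral_cp_Suc[where B=B]) (use fB in \<open>simp add: bnd_def\<close>)
    also have "\<dots> = (\<integral>x. f (c #> x) \<partial>cp n)"
    proof (rule integral_cp_cong)
      fix x assume x: "x \<in> carrier G"
      have "(\<integral>y. f (c #> (x \<otimes> y)) \<partial>\<mu>) = (\<integral>y. f ((c #> x) #> y) \<partial>\<mu>)"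
        by (intro integral_mu_cong) (simp add: rcosets_act_mult[OF subgroup_N that x])
      then show "(\<integral>y. f (c #> (x \<otimes> y)) \<partial>\<mu>) = f (c #> x)"
        using step_f[OF C_act[OF that x]] by simp
    qed
    finally show ?case
      using Suc by simp
  qed
  have res: "resolvent f c = f c" if "c \<in> C" for c
  proof -
    have "(\<integral>d. f d \<partial>resolvent_pmf c) = (\<integral>n. (\<integral>g. f (c #> g) \<partial>cp n) \<partial>geometric_pmf (1/2))"
      unfolding resolvent_pmf_def
      by (subst integral_bind_pmf_bounded[where B=B]) (use fB in \<open>simp_all add: bnd_def\<close>)
    then show ?thesis
      using that by (simp add: resolvent_def cp_f)
  qed
  have "\<bar>f c0\<bar> \<le> \<rho> * B"
    using contr[OF fB mean] res[OF c0(1)] unfolding bnd_def by metis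
  then have "(1 - \<rho>) * B \<le> 0"
    using c0 by (simp add: algebra_simps)
  then have "B \<le> 0"
    using \<rho> by (simp add: mult_le_0_iff)
  moreover have "\<bar>f c\<bar> \<le> B" "\<bar>f d\<bar> \<le> B"
    using fB by (auto simp: bnd_def)
  ultimately have "f c = 0" "f d = 0"
    by auto
  then show ?thesis
    using c d by (simp add: f_def)
qed

end

section \<open>The central limit theorem\<close>

text \<open>The bound \<open>|1 - z - exp (- z)| \<le> z^2\<close> and telescoping of powers leave
  an error \<open>k y^2\<close>, which is the convergent \<open>k y\<close> times the vanishing
  \<open>y\<close>.\<close>

lemma tendsto_one_minus_power:
  fixes y :: "nat \<Rightarrow> real" and k :: "nat \<Rightarrow> nat"
  assumes y: "y \<longlonglongrightarrow> 0" "\<And>n. y n \<ge> 0" and lim: "(\<lambda>n. real (k n) * y n) \<longlonglongrightarrow> l"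
  shows "(\<lambda>n. (1 - y n) ^ k n) \<longlonglongrightarrow> exp (- l)"
proof -
  have e: "\<bar>(1 - z) - exp (- z)\<bar> \<le> z\<^sup>2" if "z \<ge> 0" for z :: real
  proof -
    have "(1 - z + z\<^sup>2) * (1 + z) \<ge> 1"
      using that by (simp add: power2_eq_square algebra_simps)
    then have "1 / (1 + z) \<le> 1 - z + z\<^sup>2"
      using that by (simp add: divide_le_eq add_pos_nonneg)
    moreover have "exp (- z) \<le> 1 / (1 + z)"
      using exp_ge_add_one_self[of z] that by (simp add: exp_minus field_simps)
    ultimately show ?thesis
      using exp_ge_add_one_self[of "- z"] by (simp add: abs_le_iff)
  qed
  have "(\<lambda>n. (real (k n) * y n) * y n) \<longlonglongrightarrow> l * 0"
    by (intro tendsto_mult lim y)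
  then have lim0: "(\<lambda>n. (real (k n) * y n) * y n) \<longlonglongrightarrow> 0"
    by simp
  have "eventually (\<lambda>n. y n < 1) sequentially"
    using y(1) by (rule order_tendstoD) simp
  then have "eventually (\<lambda>n. norm ((1 - y n) ^ k n - exp (- (real (k n) * y n))) \<le> (real (k n) * y n) * y n) sequentially"
  proof eventually_elim
    case (elim n)
    have "exp (- (real (k n) * y n)) = exp (- y n) ^ k n"
      by (simp add: exp_of_nat_mult[symmetric])
    then have "norm ((1 - y n) ^ k n - exp (- (real (k n) * y n))) \<le> real (k n) * norm ((1 - y n) - exp (- y n))"
      using elim y(2)[of n] by (simp only:) (intro norm_power_diff, auto)
    also have "\<dots> \<le> real (k n) * (y n)\<^sup>2"
      using e[OF y(2)] by (intro mult_left_mono) auto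
    finally show ?case
      by (simp add: power2_eq_square mult_ac)
  qed
  then have "(\<lambda>n. (1 - y n) ^ k n - exp (- (real (k n) * y n))) \<longlonglongrightarrow> 0"
    by (rule Lim_null_comparison[OF _ lim0])
  moreover have "(\<lambda>n. exp (- (real (k n) * y n))) \<longlonglongrightarrow> exp (- l)"
    by (intro tendsto_intros lim)
  ultimately show ?thesis
    using tendsto_add by fastforce
qed

lemma norm_cis_minus_one_le: "norm (cis x - 1) \<le> \<bar>x\<bar>"
  using iexp_approx1[of x 0] by (simp add: cis_conv_exp)

lemma integrable_pmf_bounded:
  fixes f :: "'c \<Rightarrow> 'd::{banach, second_countable_topology}"
  assumes "\<And>x. norm (f x) \<le> B"
  shows "integrable (measure_pmf p) f"
  by (rule measure_pmf.integrable_const_bound[where B=B]) (use assms in auto)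

lemma integral_pmf_const: "(\<integral>x. c \<partial>measure_pmf p) = (c :: real)"
  by simp

lemma norm_integral_pmf_le:
  fixes f :: "'c \<Rightarrow> 'd::{banach, second_countable_topology}"
  assumes f: "\<And>x. x \<in> set_pmf p \<Longrightarrow> norm (f x) \<le> h x" and h: "integrable (measure_pmf p) h"
  shows "norm (\<integral>x. f x \<partial>measure_pmf p) \<le> (\<integral>x. h x \<partial>measure_pmf p)"
proof -
  have "integrable (measure_pmf p) (\<lambda>x. norm (f x))"
  proof (rule Bochner_Integration.integrable_bound[OF h])
    show "AE x in p. norm (norm (f x)) \<le> norm (h x)"
    proof (rule AE_pmfI)
      fix x assume "x \<in> set_pmf p"
      from f[OF this] show "norm (norm (f x)) \<le> norm (h x)"
        by simp
    qed
  qed simp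
  then have "(\<integral>x. norm (f x) \<partial>measure_pmf p) \<le> (\<integral>x. h x \<partial>measure_pmf p)"
    by (intro integral_mono_AE h) (auto simp: AE_measure_pmf_iff f)
  then show ?thesis
    using integral_norm_bound[of "measure_pmf p" f] by linarith
qed

text \<open>The Taylor remainder is bounded by the minimum of a quadratic and a cubic term. The
  quadratic one is an integrable majorant, the cubic one tends to zero pointwise, and dominated
  convergence gives \<open>o(\<theta>^2)\<close> from the second moment.\<close>

lemma char_second_order:
  fixes X :: "'c \<Rightarrow> real"
  assumes int: "integrable (measure_pmf p) (\<lambda>x. (X x)\<^sup>2)" and mean: "(\<integral>x. X x \<partial>measure_pmf p) = 0"
    and \<theta>: "\<theta> \<longlonglongrightarrow> (0 :: real)"
  shows "\<exists>\<delta>. \<delta> \<longlonglongrightarrow> 0 \<and> (\<forall>n. norm ((\<integral>x. cis (\<theta> n * X x) \<partial>measure_pmf p)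
      - of_real (1 - (\<theta> n)\<^sup>2 * (\<integral>x. (X x)\<^sup>2 \<partial>measure_pmf p) / 2)) \<le> (\<theta> n)\<^sup>2 * \<delta> n)"
proof (intro exI conjI allI)
  have int1: "integrable (measure_pmf p) X"
    by (rule measure_pmf.square_integrable_imp_integrable[OF _ int]) simp
  let ?g = "\<lambda>n x. min (6 * (X x)\<^sup>2) (\<bar>\<theta> n\<bar> * \<bar>X x\<bar> ^ 3)"
  have "(\<lambda>n. \<integral>x. ?g n x \<partial>measure_pmf p) \<longlonglongrightarrow> (\<integral>x. 0 \<partial>measure_pmf p)"
  proof (rule integral_dominated_convergence)
    show "integrable (measure_pmf p) (\<lambda>x. 6 * (X x)\<^sup>2)"
      using int by simp
    show "AE x in p. (\<lambda>n. ?g n x) \<longlonglongrightarrow> 0"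
    proof (rule AE_I2)
      fix x
      have "(\<lambda>n. ?g n x) \<longlonglongrightarrow> min (6 * (X x)\<^sup>2) (\<bar>0\<bar> * \<bar>X x\<bar> ^ 3)"
        by (intro tendsto_intros \<theta>)
      then show "(\<lambda>n. ?g n x) \<longlonglongrightarrow> 0"
        by simp
    qed
  qed (auto simp: min_def)
  then have "(\<lambda>n. (1/6) * (\<integral>x. ?g n x \<partial>measure_pmf p)) \<longlonglongrightarrow> (1/6) * 0"
    by (intro tendsto_mult tendsto_const) simp
  then show "(\<lambda>n. (1/6) * (\<integral>x. ?g n x \<partial>measure_pmf p)) \<longlonglongrightarrow> 0"
    by simp
  fix n
  have "char (distr p borel X) (\<theta> n) = (\<integral>x. cis (\<theta> n * X x) \<partial>measure_pmf p)"
    by (simp add: char_def integral_distr cis_conv_exp)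
  moreover have "norm (char (distr p borel X) (\<theta> n) - (1 - (\<theta> n)\<^sup>2 * (\<integral>x. (X x)\<^sup>2 \<partial>measure_pmf p) / 2))
      \<le> ((\<theta> n)\<^sup>2 / 6) * (\<integral>x. ?g n x \<partial>measure_pmf p)"
    using prob_space.char_approx3'[OF prob_space_measure_pmf _ int1 int mean _ refl, of "\<integral>x. (X x)\<^sup>2 \<partial>measure_pmf p" "\<theta> n"]
    by (simp add: mean)
  ultimately show "norm ((\<integral>x. cis (\<theta> n * X x) \<partial>measure_pmf p)
      - of_real (1 - (\<theta> n)\<^sup>2 * (\<integral>x. (X x)\<^sup>2 \<partial>measure_pmf p) / 2)) \<le> (\<theta> n)\<^sup>2 * ((1/6) * (\<integral>x. ?g n x \<partial>measure_pmf p))"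
    by simp
qed

context group_walk
begin

lemma integral_cp_Suc_complex:
  fixes f :: "'a \<Rightarrow> complex"
  assumes f: "\<And>x. norm (f x) \<le> B"
  shows "(\<integral>z. f z \<partial>cp (Suc n)) = (\<integral>x. (\<integral>y. f (x \<otimes> y) \<partial>\<mu>) \<partial>cp n)"
proof -
  have int: "integrable (measure_pmf p) f" "integrable (measure_pmf p) (\<lambda>y. f (x \<otimes> y))" for p x
    by (rule integrable_pmf_bounded[where B=B], rule f)+
  have "norm (\<integral>y. f (x \<otimes> y) \<partial>\<mu>) \<le> (\<integral>y. B \<partial>\<mu>)" for x
    by (intro norm_integral_pmf_le f) simp
  then have int2: "integrable (cp n) (\<lambda>x. \<integral>y. f (x \<otimes> y) \<partial>\<mu>)"
    by (intro integrable_pmf_bounded[where B=B]) simp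
  show ?thesis
  proof (rule complex_eqI)
    have "Re (\<integral>z. f z \<partial>cp (Suc n)) = (\<integral>z. Re (f z) \<partial>cp (Suc n))"
      by (simp only: integral_Re[OF int(1)])
    also have "\<dots> = (\<integral>x. (\<integral>y. Re (f (x \<otimes> y)) \<partial>\<mu>) \<partial>cp n)"
      by (rule integral_cp_Suc[where B=B]) (use f abs_Re_le_cmod order.trans in \<open>fastforce\<close>)
    also have "\<dots> = Re (\<integral>x. (\<integral>y. f (x \<otimes> y) \<partial>\<mu>) \<partial>cp n)"
      by (simp only: integral_Re[OF int(2)] integral_Re[OF int2])
    finally show "Re (\<integral>z. f z \<partial>cp (Suc n)) = \<dots>" .
    have "Im (\<integral>z. f z \<partial>cp (Suc n)) = (\<integral>z. Im (f z) \<partial>cp (Suc n))"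
      by (simp only: integral_Im[OF int(1)])
    also have "\<dots> = (\<integral>x. (\<integral>y. Im (f (x \<otimes> y)) \<partial>\<mu>) \<partial>cp n)"
      by (rule integral_cp_Suc[where B=B]) (use f abs_Im_le_cmod order.trans in \<open>fastforce\<close>)
    also have "\<dots> = Im (\<integral>x. (\<integral>y. f (x \<otimes> y) \<partial>\<mu>) \<partial>cp n)"
      by (simp only: integral_Im[OF int(2)] integral_Im[OF int2])
    finally show "Im (\<integral>z. f z \<partial>cp (Suc n)) = \<dots>" .
  qed
qed

end

context coset_walk
begin

lemma coset_in_C: "x \<in> carrier G \<Longrightarrow> N #> x \<in> C"
  unfolding RCOSETS_def by auto

lemma coset_mult: "x \<in> carrier G \<Longrightarrow> s \<in> carrier G \<Longrightarrow> N #> (x \<otimes> s) = (N #> x) #> s"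
  using coset_mult_assoc[OF subgroup.subset[OF subgroup_N]] by simp

text \<open>The second-order weight \<open>1 + \<theta>\<^sup>2 h / 2\<close> replaces the variance of the step from \<open>c\<close> by the average
  variance \<open>v\<close>, up to \<open>o(\<theta>\<^sup>2)\<close>.\<close>

lemma perturbed_step_expansion:
  fixes \<Xi> :: "'a set \<Rightarrow> 'a \<Rightarrow> real" and h :: "'a set \<Rightarrow> real"
  assumes c: "c \<in> C" and sq: "integrable (measure_pmf \<mu>) (\<lambda>s. (\<Xi> c s)\<^sup>2)" and mean: "(\<integral>s. \<Xi> c s \<partial>\<mu>) = 0"
    and h: "\<And>d. \<bar>h d\<bar> \<le> Hb" and poisson: "h c - step h c = v - (\<integral>s. (\<Xi> c s)\<^sup>2 \<partial>\<mu>)"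
    and \<theta>: "\<theta> \<longlonglongrightarrow> (0 :: real)"
  shows "\<exists>\<delta>. \<delta> \<longlonglongrightarrow> 0 \<and> (\<forall>n. norm ((\<integral>s. cis (\<theta> n * \<Xi> c s) * of_real (1 + (\<theta> n)\<^sup>2 / 2 * h (c #> s)) \<partial>\<mu>)
      - of_real ((1 - (\<theta> n)\<^sup>2 * v / 2) * (1 + (\<theta> n)\<^sup>2 / 2 * h c))) \<le> (\<theta> n)\<^sup>2 * \<delta> n)"
proof -
  let ?\<sigma> = "\<integral>s. (\<Xi> c s)\<^sup>2 \<partial>\<mu>"
  have int1: "integrable (measure_pmf \<mu>) (\<Xi> c)"
    by (rule measure_pmf.square_integrable_imp_integrable[OF _ sq]) simp
  obtain \<delta> where \<delta>: "\<delta> \<longlonglongrightarrow> 0" "\<And>n. norm ((\<integral>s. cis (\<theta> n * \<Xi> c s) \<partial>\<mu>) - of_real (1 - (\<theta> n)\<^sup>2 * ?\<sigma> / 2)) \<le> (\<theta> n)\<^sup>2 * \<delta> n"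
    using char_second_order[OF sq mean \<theta>] by blast
  define D where "D = (\<lambda>n. \<delta> n + (Hb / 2 * (\<integral>s. \<bar>\<Xi> c s\<bar> \<partial>\<mu>)) * \<bar>\<theta> n\<bar> + \<bar>v\<bar> * Hb / 4 * (\<theta> n)\<^sup>2)"
  have "D \<longlonglongrightarrow> 0 + (Hb / 2 * (\<integral>s. \<bar>\<Xi> c s\<bar> \<partial>\<mu>)) * \<bar>0\<bar> + \<bar>v\<bar> * Hb / 4 * 0\<^sup>2"
    unfolding D_def by (intro tendsto_intros \<delta> \<theta>)
  then have D: "D \<longlonglongrightarrow> 0"
    by simp
  have "norm ((\<integral>s. cis (\<theta> n * \<Xi> c s) * of_real (1 + (\<theta> n)\<^sup>2 / 2 * h (c #> s)) \<partial>\<mu>)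
      - of_real ((1 - (\<theta> n)\<^sup>2 * v / 2) * (1 + (\<theta> n)\<^sup>2 / 2 * h c))) \<le> (\<theta> n)\<^sup>2 * D n" for n
  proof -
    let ?t = "\<theta> n"
    have i1: "integrable (measure_pmf \<mu>) (\<lambda>s. cis (?t * \<Xi> c s))"
      by (rule integrable_pmf_bounded[where B=1]) simp
    have i2: "integrable (measure_pmf \<mu>) (\<lambda>s. (cis (?t * \<Xi> c s) - 1) * of_real (h (c #> s)))"
    proof (rule integrable_pmf_bounded[where B="2 * Hb"])
      fix s
      have "norm (cis (?t * \<Xi> c s) - 1) \<le> 2"
        using norm_triangle_ineq4[of "cis (?t * \<Xi> c s)" 1] by simp
      then show "norm ((cis (?t * \<Xi> c s) - 1) * of_real (h (c #> s))) \<le> 2 * Hb"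
        unfolding norm_mult norm_of_real using h[of "c #> s"] by (intro mult_mono) auto
    qed
    have i3: "integrable (measure_pmf \<mu>) (\<lambda>s. complex_of_real (h (c #> s)))"
      by (rule integrable_pmf_bounded[where B=Hb]) (use h in simp)
    have "(\<integral>s. cis (?t * \<Xi> c s) * of_real (1 + ?t\<^sup>2 / 2 * h (c #> s)) \<partial>\<mu>)
        = (\<integral>s. cis (?t * \<Xi> c s) + of_real (?t\<^sup>2 / 2) * ((cis (?t * \<Xi> c s) - 1) * of_real (h (c #> s)))
              + of_real (?t\<^sup>2 / 2) * of_real (h (c #> s)) \<partial>\<mu>)"
      by (intro Bochner_Integration.integral_cong) (auto simp: algebra_simps)
    also have "\<dots> = (\<integral>s. cis (?t * \<Xi> c s) \<partial>\<mu>)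
        + of_real (?t\<^sup>2 / 2) * (\<integral>s. (cis (?t * \<Xi> c s) - 1) * of_real (h (c #> s)) \<partial>\<mu>)
        + of_real (?t\<^sup>2 / 2) * of_real (step h c)"
      unfolding step_def integral_complex_of_real[symmetric]
      using i1 i2 i3 by (simp add: Bochner_Integration.integral_add)
    finally have eq1: "(\<integral>s. cis (?t * \<Xi> c s) * of_real (1 + ?t\<^sup>2 / 2 * h (c #> s)) \<partial>\<mu>) = \<dots>" .
    have st: "step h c = h c - v + ?\<sigma>"
      using poisson by simp
    have "(1 - ?t\<^sup>2 * v / 2) * (1 + ?t\<^sup>2 / 2 * h c) = (1 - ?t\<^sup>2 * ?\<sigma> / 2) + ?t\<^sup>2 / 2 * step h c - ?t ^ 4 * v * h c / 4"
      unfolding st by (simp add: field_simps power2_eq_square[of "\<theta> n"] power4_eq_xxxx)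
    then have eq2: "complex_of_real ((1 - ?t\<^sup>2 * v / 2) * (1 + ?t\<^sup>2 / 2 * h c))
        = of_real (1 - ?t\<^sup>2 * ?\<sigma> / 2) + of_real (?t\<^sup>2 / 2) * of_real (step h c) - of_real (?t ^ 4 * v * h c / 4)"
      by (simp only: of_real_add of_real_diff of_real_mult)
    have eq: "(\<integral>s. cis (?t * \<Xi> c s) * of_real (1 + ?t\<^sup>2 / 2 * h (c #> s)) \<partial>\<mu>)
      - of_real ((1 - ?t\<^sup>2 * v / 2) * (1 + ?t\<^sup>2 / 2 * h c))
      = ((\<integral>s. cis (?t * \<Xi> c s) \<partial>\<mu>) - of_real (1 - ?t\<^sup>2 * ?\<sigma> / 2))
        + of_real (?t\<^sup>2 / 2) * (\<integral>s. (cis (?t * \<Xi> c s) - 1) * of_real (h (c #> s)) \<partial>\<mu>)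
        + of_real (?t ^ 4 * v * h c / 4)"
      unfolding eq1 eq2 by (simp only: algebra_simps)
    have b2: "norm (\<integral>s. (cis (?t * \<Xi> c s) - 1) * of_real (h (c #> s)) \<partial>\<mu>) \<le> (\<integral>s. (\<bar>?t\<bar> * Hb) * \<bar>\<Xi> c s\<bar> \<partial>\<mu>)"
    proof (rule norm_integral_pmf_le)
      fix s
      have "norm (cis (?t * \<Xi> c s) - 1) * \<bar>h (c #> s)\<bar> \<le> \<bar>?t * \<Xi> c s\<bar> * Hb"
        by (intro mult_mono norm_cis_minus_one_le h) auto
      then show "norm ((cis (?t * \<Xi> c s) - 1) * of_real (h (c #> s))) \<le> (\<bar>?t\<bar> * Hb) * \<bar>\<Xi> c s\<bar>"
        by (simp add: norm_mult abs_mult mult_ac)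
    qed (use int1 in simp)
    have "norm ((\<integral>s. cis (?t * \<Xi> c s) * of_real (1 + ?t\<^sup>2 / 2 * h (c #> s)) \<partial>\<mu>)
      - of_real ((1 - ?t\<^sup>2 * v / 2) * (1 + ?t\<^sup>2 / 2 * h c)))
     \<le> ?t\<^sup>2 * \<delta> n + ?t\<^sup>2 / 2 * (\<integral>s. (\<bar>?t\<bar> * Hb) * \<bar>\<Xi> c s\<bar> \<partial>\<mu>) + ?t ^ 4 * \<bar>v\<bar> * Hb / 4"
      unfolding eq
    proof (intro norm_triangle_le add_mono)
      show "norm ((\<integral>s. cis (?t * \<Xi> c s) \<partial>\<mu>) - of_real (1 - ?t\<^sup>2 * ?\<sigma> / 2)) \<le> ?t\<^sup>2 * \<delta> n"
        by (rule \<delta>)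
      show "norm (of_real (?t\<^sup>2 / 2) * (\<integral>s. (cis (?t * \<Xi> c s) - 1) * of_real (h (c #> s)) \<partial>\<mu>)) \<le> ?t\<^sup>2 / 2 * (\<integral>s. (\<bar>?t\<bar> * Hb) * \<bar>\<Xi> c s\<bar> \<partial>\<mu>)"
        unfolding norm_mult norm_of_real by (intro mult_mono b2) auto
      have "?t ^ 4 * \<bar>v\<bar> * \<bar>h c\<bar> \<le> ?t ^ 4 * \<bar>v\<bar> * Hb"
        by (intro mult_left_mono h) auto
      then show "norm (complex_of_real (?t ^ 4 * v * h c / 4)) \<le> ?t ^ 4 * \<bar>v\<bar> * Hb / 4"
        unfolding norm_of_real by (simp add: abs_mult)
    qed
    also have "\<dots> = ?t\<^sup>2 * D n"
      by (simp add: D_def algebra_simps power2_eq_square power4_eq_xxxx)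
    finally show ?thesis .
  qed
  then show ?thesis
    using D by blast
qed

text \<open>The function \<open>1 + \<theta>^2 h / 2\<close> on the cosets is an approximate
  eigenvector of the twisted transfer operator with eigenvalue \<open>1 - \<theta>^2 v / 2\<close>,
  up to \<open>o(\<theta>^2)\<close>. Since \<open>k \<theta>^2\<close> stays bounded, the errors of
  \<open>k\<close> steps add up to \<open>o(1)\<close>, and the eigenvector itself tends to
  one.\<close>

theorem walk_central_limit:
  fixes \<Psi> :: "'a \<Rightarrow> real" and \<Xi> :: "'a set \<Rightarrow> 'a \<Rightarrow> real"
  assumes incr: "\<And>x s. x \<in> carrier G \<Longrightarrow> s \<in> carrier G \<Longrightarrow> \<Psi> (x \<otimes> s) - \<Psi> x - d = \<Xi> (N #> x) s"
    and sq: "\<And>c. c \<in> C \<Longrightarrow> integrable (measure_pmf \<mu>) (\<lambda>s. (\<Xi> c s)\<^sup>2)"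
    and mean: "\<And>c. c \<in> C \<Longrightarrow> (\<integral>s. \<Xi> c s \<partial>\<mu>) = 0"
    and \<theta>: "\<theta> \<longlonglongrightarrow> 0" and k: "(\<lambda>n. real (k n) * (\<theta> n)\<^sup>2) \<longlonglongrightarrow> \<tau>"
  defines "v \<equiv> (\<Sum>c\<in>C. \<integral>s. (\<Xi> c s)\<^sup>2 \<partial>\<mu>) / real (card C)"
  shows "(\<lambda>n. \<integral>g. cis (\<theta> n * (\<Psi> g - real (k n) * d)) \<partial>cp (k n)) \<longlonglongrightarrow> of_real (exp (- (v * \<tau> / 2)))"
proof -
  have "(\<Sum>c\<in>C. v - (\<integral>s. (\<Xi> c s)\<^sup>2 \<partial>\<mu>)) = 0"
    using card_C by (simp add: sum_subtractf v_def)
  then obtain h0 where h0: "\<And>c. c \<in> C \<Longrightarrow> h0 c - step h0 c = v - (\<integral>s. (\<Xi> c s)\<^sup>2 \<partial>\<mu>)"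
    using poisson_equation[of "\<lambda>c. v - (\<integral>s. (\<Xi> c s)\<^sup>2 \<partial>\<mu>)"] by blast
  define h where "h = (\<lambda>c. if c \<in> C then h0 c else 0)"
  have h: "h c - step h c = v - (\<integral>s. (\<Xi> c s)\<^sup>2 \<partial>\<mu>)" if "c \<in> C" for c
  proof -
    have "step h c = step h0 c"
      unfolding step_def by (intro integral_mu_cong) (simp add: h_def C_act that)
    then show ?thesis
      using h0[OF that] that by (simp add: h_def)
  qed
  define Hb where "Hb = (\<Sum>d\<in>C. \<bar>h0 d\<bar>)"
  have hb: "\<bar>h d\<bar> \<le> Hb" for d
  proof (cases "d \<in> C")
    case True
    then show ?thesis
      unfolding Hb_def h_def using member_le_sum[OF True, of "\<lambda>d. \<bar>h0 d\<bar>"] finite_cosets by simp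
  qed (simp add: h_def Hb_def sum_nonneg)
  have Hb0: "Hb \<ge> 0"
    using hb[of undefined] by linarith
  have v0: "v \<ge> 0"
    unfolding v_def by (intro divide_nonneg_nonneg sum_nonneg integral_nonneg_AE) auto
  let ?I = "\<lambda>n c. (\<integral>s. cis (\<theta> n * \<Xi> c s) * of_real (1 + (\<theta> n)\<^sup>2 / 2 * h (c #> s)) \<partial>\<mu>)"
  let ?L = "\<lambda>n. 1 - (\<theta> n)\<^sup>2 * v / 2"
  let ?w = "\<lambda>n c. 1 + (\<theta> n)\<^sup>2 / 2 * h c"
  have "\<forall>c\<in>C. \<exists>\<delta>. \<delta> \<longlonglongrightarrow> 0 \<and> (\<forall>n. norm (?I n c - of_real (?L n * ?w n c)) \<le> (\<theta> n)\<^sup>2 * \<delta> n)"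
  proof
    fix c assume c: "c \<in> C"
    show "\<exists>\<delta>. \<delta> \<longlonglongrightarrow> 0 \<and> (\<forall>n. norm (?I n c - of_real (?L n * ?w n c)) \<le> (\<theta> n)\<^sup>2 * \<delta> n)"
      using c sq[OF c] mean[OF c] hb h[OF c] \<theta> by (rule perturbed_step_expansion)
  qed
  from bchoice[OF this] obtain \<delta> where \<delta>_all: "\<forall>c\<in>C. \<delta> c \<longlonglongrightarrow> 0 \<and>
      (\<forall>n. norm (?I n c - of_real (?L n * ?w n c)) \<le> (\<theta> n)\<^sup>2 * \<delta> c n)"
    by (elim exE) (rule that)
  have \<delta>: "\<delta> c \<longlonglongrightarrow> 0" "norm (?I n c - of_real (?L n * ?w n c)) \<le> (\<theta> n)\<^sup>2 * \<delta> c n"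
    if "c \<in> C" for c n
    using \<delta>_all that by (simp_all only:)
  define \<Delta> where "\<Delta> = (\<lambda>n. \<Sum>c\<in>C. \<bar>\<delta> c n\<bar>)"
  have "\<Delta> \<longlonglongrightarrow> (\<Sum>c\<in>C. \<bar>0\<bar>)"
    unfolding \<Delta>_def by (intro tendsto_intros \<delta>)
  then have \<Delta>: "\<Delta> \<longlonglongrightarrow> 0"
    by simp
  have \<Delta>_le: "norm (?I n c - of_real (?L n * ?w n c)) \<le> (\<theta> n)\<^sup>2 * \<Delta> n" if "c \<in> C" for n c
  proof -
    have "\<bar>\<delta> c n\<bar> \<le> \<Delta> n"
      unfolding \<Delta>_def using member_le_sum[OF that, of "\<lambda>c. \<bar>\<delta> c n\<bar>"] finite_cosets by simp
    then have "(\<theta> n)\<^sup>2 * \<delta> c n \<le> (\<theta> n)\<^sup>2 * \<Delta> n"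
      by (intro mult_left_mono) auto
    then show ?thesis
      using \<delta>(2)[OF that, of n] by (rule order_trans[rotated])
  qed
  define a where "a = (\<lambda>n j. \<integral>g. cis (\<theta> n * (\<Psi> g - real j * d)) * of_real (?w n (N #> g)) \<partial>cp j)"
  have w_le: "norm (complex_of_real (?w n c)) \<le> 1 + (\<theta> n)\<^sup>2 / 2 * Hb" for n c
  proof -
    have "(\<theta> n)\<^sup>2 / 2 * \<bar>h c\<bar> \<le> (\<theta> n)\<^sup>2 / 2 * Hb"
      by (intro mult_left_mono hb) auto
    moreover have "\<bar>?w n c\<bar> \<le> 1 + (\<theta> n)\<^sup>2 / 2 * \<bar>h c\<bar>"
      using abs_triangle_ineq[of 1 "(\<theta> n)\<^sup>2 / 2 * h c"] by (simp add: abs_mult)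
    ultimately show ?thesis
      unfolding norm_of_real by linarith
  qed
  \<comment> \<open>One more step multiplies the weighted characteristic function by the approximate
    eigenvalue; the error is uniform over the current coset and therefore over
    \<open>j\<close>.\<close>
  have rec: "norm (a n (Suc j) - of_real (?L n) * a n j) \<le> (\<theta> n)\<^sup>2 * \<Delta> n" for n j
  proof -
    let ?f = "\<lambda>g. cis (\<theta> n * (\<Psi> g - real (Suc j) * d)) * of_real (?w n (N #> g))"
    let ?c = "\<lambda>x. cis (\<theta> n * (\<Psi> x - real j * d))"
    have ci: "integrable (cp j) (\<lambda>x. ?c x * of_real (?w n (N #> x)))"
      by (rule integrable_pmf_bounded[where B="1 + (\<theta> n)\<^sup>2 / 2 * Hb"]) (use w_le[of n] in \<open>simp only: norm_mult norm_cis mult_1\<close>)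
    have "norm (?I n c) \<le> (\<integral>s. 1 + (\<theta> n)\<^sup>2 / 2 * Hb \<partial>\<mu>)" for c
      by (rule norm_integral_pmf_le) (use w_le[of n] in \<open>simp_all only: norm_mult norm_cis mult_1 measure_pmf.integrable_const\<close>)
    then have ci2: "integrable (cp j) (\<lambda>x. ?c x * ?I n (N #> x))"
      by (intro integrable_pmf_bounded[where B="1 + (\<theta> n)\<^sup>2 / 2 * Hb"]) (simp add: norm_mult)
    have "a n (Suc j) = (\<integral>x. (\<integral>s. ?f (x \<otimes> s) \<partial>\<mu>) \<partial>cp j)"
      unfolding a_def by (rule integral_cp_Suc_complex[where B="1 + (\<theta> n)\<^sup>2 / 2 * Hb"])
        (use w_le[of n] in \<open>simp only: norm_mult norm_cis mult_1\<close>)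
    also have "\<dots> = (\<integral>x. ?c x * ?I n (N #> x) \<partial>cp j)"
    proof (intro integral_cong_AE)
      show "AE x in cp j. (\<integral>s. ?f (x \<otimes> s) \<partial>\<mu>) = ?c x * ?I n (N #> x)"
      proof (rule AE_pmfI)
        fix x assume "x \<in> set_pmf (cp j)"
        then have x: "x \<in> carrier G"
          by (rule cp_carrier)
        have "(\<integral>s. ?f (x \<otimes> s) \<partial>\<mu>) = (\<integral>s. ?c x * (cis (\<theta> n * \<Xi> (N #> x) s) * of_real (?w n ((N #> x) #> s))) \<partial>\<mu>)"
        proof (intro integral_cong_AE)
          show "AE s in \<mu>. ?f (x \<otimes> s) = ?c x * (cis (\<theta> n * \<Xi> (N #> x) s) * of_real (?w n ((N #> x) #> s)))"
          proof (rule AE_pmfI)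
            fix s assume "s \<in> set_pmf \<mu>"
            then have s: "s \<in> carrier G"
              using set_pmf_subset by blast
            have "\<theta> n * (\<Psi> (x \<otimes> s) - real (Suc j) * d) = \<theta> n * (\<Psi> x - real j * d) + \<theta> n * \<Xi> (N #> x) s"
              unfolding incr[OF x s, symmetric] by (simp add: algebra_simps)
            then show "?f (x \<otimes> s) = ?c x * (cis (\<theta> n * \<Xi> (N #> x) s) * of_real (?w n ((N #> x) #> s)))"
              unfolding coset_mult[OF x s] by (simp only: cis_mult[symmetric] mult.assoc)
          qed
        qed simp_all
        then show "(\<integral>s. ?f (x \<otimes> s) \<partial>\<mu>) = ?c x * ?I n (N #> x)"
          by simp
      qed
    qed simp_all
    finally have "a n (Suc j) - of_real (?L n) * a n j
        = (\<integral>x. ?c x * ?I n (N #> x) \<partial>cp j) - (\<integral>x. of_real (?L n) * (?c x * of_real (?w n (N #> x))) \<partial>cp j)"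
      unfolding a_def by simp
    also have "\<dots> = (\<integral>x. ?c x * ?I n (N #> x) - of_real (?L n) * (?c x * of_real (?w n (N #> x))) \<partial>cp j)"
      using ci ci2 by (intro Bochner_Integration.integral_diff[symmetric] integrable_mult_right)
    finally have eq: "a n (Suc j) - of_real (?L n) * a n j = \<dots>" .
    have "norm (a n (Suc j) - of_real (?L n) * a n j) \<le> (\<integral>x. (\<theta> n)\<^sup>2 * \<Delta> n \<partial>cp j)"
      unfolding eq
    proof (rule norm_integral_pmf_le)
      fix x assume "x \<in> set_pmf (cp j)"
      then have x: "N #> x \<in> C"
        using cp_carrier coset_in_C by blast
      have "?c x * ?I n (N #> x) - of_real (?L n) * (?c x * of_real (?w n (N #> x)))
        = ?c x * (?I n (N #> x) - of_real (?L n * ?w n (N #> x)))"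
        by (simp only: of_real_mult right_diff_distrib mult_ac)
      then show "norm (?c x * ?I n (N #> x) - of_real (?L n) * (?c x * of_real (?w n (N #> x)))) \<le> (\<theta> n)\<^sup>2 * \<Delta> n"
        using \<Delta>_le[OF x, of n] by (simp only: norm_mult norm_cis mult_1)
    qed simp
    then show ?thesis
      unfolding integral_pmf_const .
  qed
  have "(\<lambda>n. (\<theta> n)\<^sup>2 * v / 2) \<longlonglongrightarrow> 0\<^sup>2 * v / 2"
    by (intro tendsto_intros \<theta>) simp
  then have y0: "(\<lambda>n. (\<theta> n)\<^sup>2 * v / 2) \<longlonglongrightarrow> 0"
    by simp
  have "(\<lambda>n. (real (k n) * (\<theta> n)\<^sup>2) * (v / 2)) \<longlonglongrightarrow> \<tau> * (v / 2)"
    by (intro tendsto_mult k tendsto_const)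
  then have Lk: "(\<lambda>n. (?L n) ^ k n) \<longlonglongrightarrow> exp (- (v * \<tau> / 2))"
    using y0 v0 by (intro tendsto_one_minus_power) (auto simp: mult_ac)
  have a0: "a n 0 = cis (\<theta> n * \<Psi> \<one>) * of_real (?w n (N #> \<one>))" for n
    by (simp add: a_def)
  have "(\<lambda>n. cis (\<theta> n * \<Psi> \<one>) * of_real (?w n (N #> \<one>))) \<longlonglongrightarrow> cis (0 * \<Psi> \<one>) * of_real (1 + 0\<^sup>2 / 2 * h (N #> \<one>))"
    by (intro tendsto_intros \<theta>) auto
  then have a0lim: "(\<lambda>n. a n 0) \<longlonglongrightarrow> 1"
    unfolding a0 by simp
  \<comment> \<open>Once the eigenvalue has modulus at most one, the errors of the single steps add
    without being amplified.\<close>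
  have "eventually (\<lambda>n. (\<theta> n)\<^sup>2 * v / 2 < 1) sequentially"
    using y0 by (rule order_tendstoD) simp
  then have ev: "eventually (\<lambda>n. norm (a n (k n) - of_real (?L n) ^ k n * a n 0) \<le> (real (k n) * (\<theta> n)\<^sup>2) * \<Delta> n) sequentially"
  proof eventually_elim
    case (elim n)
    have L1: "norm (complex_of_real (?L n)) \<le> 1"
      using elim v0 unfolding norm_of_real by (simp add: abs_le_iff)
    have "norm (a n j - of_real (?L n) ^ j * a n 0) \<le> real j * ((\<theta> n)\<^sup>2 * \<Delta> n)" for j
    proof (induction j)
      case (Suc j)
      have eq: "a n (Suc j) - of_real (?L n) ^ Suc j * a n 0
        = (a n (Suc j) - of_real (?L n) * a n j) + of_real (?L n) * (a n j - of_real (?L n) ^ j * a n 0)"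
        by (simp add: algebra_simps)
      have "norm (of_real (?L n) * (a n j - of_real (?L n) ^ j * a n 0)) \<le> 1 * (real j * ((\<theta> n)\<^sup>2 * \<Delta> n))"
        unfolding norm_mult using Suc L1 by (intro mult_mono) auto
      then have "norm (a n (Suc j) - of_real (?L n) ^ Suc j * a n 0) \<le> (\<theta> n)\<^sup>2 * \<Delta> n + 1 * (real j * ((\<theta> n)\<^sup>2 * \<Delta> n))"
        unfolding eq by (intro norm_triangle_le add_mono rec)
      then show ?case
        by (simp only: of_nat_Suc distrib_right mult_1)
    qed simp
    then show ?case
      by (simp add: mult.assoc)
  qed
  have "(\<lambda>n. (real (k n) * (\<theta> n)\<^sup>2) * \<Delta> n) \<longlonglongrightarrow> \<tau> * 0"
    by (intro tendsto_mult k \<Delta>)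
  then have "(\<lambda>n. a n (k n) - of_real (?L n) ^ k n * a n 0) \<longlonglongrightarrow> 0"
    by (intro Lim_null_comparison[OF ev]) simp
  moreover have "(\<lambda>n. of_real (?L n) ^ k n * a n 0) \<longlonglongrightarrow> of_real (exp (- (v * \<tau> / 2))) * 1"
    unfolding of_real_power[symmetric] by (intro tendsto_mult tendsto_of_real Lk a0lim)
  ultimately have alim: "(\<lambda>n. a n (k n)) \<longlonglongrightarrow> of_real (exp (- (v * \<tau> / 2)))"
    using tendsto_add by fastforce
  \<comment> \<open>The weight is removed at the end, at a cost uniform over the cosets.\<close>
  have diff: "norm ((\<integral>g. cis (\<theta> n * (\<Psi> g - real (k n) * d)) \<partial>cp (k n)) - a n (k n)) \<le> (\<theta> n)\<^sup>2 / 2 * Hb" for n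
  proof -
    let ?c = "\<lambda>x. cis (\<theta> n * (\<Psi> x - real (k n) * d))"
    have i1: "integrable (cp (k n)) ?c"
      by (rule integrable_pmf_bounded[where B=1]) simp
    have i2: "integrable (cp (k n)) (\<lambda>x. ?c x * of_real (?w n (N #> x)))"
      by (rule integrable_pmf_bounded[where B="1 + (\<theta> n)\<^sup>2 / 2 * Hb"]) (use w_le[of n] in \<open>simp only: norm_mult norm_cis mult_1\<close>)
    have eq: "(\<integral>g. ?c g \<partial>cp (k n)) - a n (k n) = (\<integral>x. ?c x - ?c x * of_real (?w n (N #> x)) \<partial>cp (k n))"
      unfolding a_def by (rule Bochner_Integration.integral_diff[OF i1 i2, symmetric])
    have "norm ((\<integral>g. ?c g \<partial>cp (k n)) - a n (k n)) \<le> (\<integral>x. (\<theta> n)\<^sup>2 / 2 * Hb \<partial>cp (k n))"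
      unfolding eq
    proof (rule norm_integral_pmf_le)
      fix x
      have "?c x - ?c x * of_real (?w n (N #> x)) = - (?c x * of_real ((\<theta> n)\<^sup>2 / 2 * h (N #> x)))"
        by (simp add: algebra_simps)
      then have "norm (?c x - ?c x * of_real (?w n (N #> x))) = \<bar>(\<theta> n)\<^sup>2 / 2 * h (N #> x)\<bar>"
        by (simp only: norm_minus_cancel norm_mult norm_cis mult_1 norm_of_real)
      also have "\<dots> \<le> (\<theta> n)\<^sup>2 / 2 * Hb"
        using mult_left_mono[OF hb[of "N #> x"], of "(\<theta> n)\<^sup>2 / 2"] by (simp add: abs_mult)
      finally show "norm (?c x - ?c x * of_real (?w n (N #> x))) \<le> (\<theta> n)\<^sup>2 / 2 * Hb" .
    qed simp
    then show ?thesis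
      unfolding integral_pmf_const .
  qed
  have "(\<lambda>n. (\<theta> n)\<^sup>2 / 2 * Hb) \<longlonglongrightarrow> 0\<^sup>2 / 2 * Hb"
    by (intro tendsto_intros \<theta>) auto
  then have "(\<lambda>n. (\<integral>g. cis (\<theta> n * (\<Psi> g - real (k n) * d)) \<partial>cp (k n)) - a n (k n)) \<longlonglongrightarrow> 0"
    by (intro Lim_null_comparison[OF always_eventually[OF allI[OF diff]]]) simp
  from tendsto_add[OF this alim] show ?thesis
    by simp
qed

text \<open>Given the position \<open>x\<close> after \<open>k\<close> steps, the value of
  \<open>E\<close> at the next position is replaced by \<open>E x\<close>, at mean cost
  \<open>\<eta>\<close>; then \<open>h\<close> alone is averaged over the last step, which produces
  \<open>step h\<close>.\<close>

lemma weighted_step_le: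
  fixes E :: "'a \<Rightarrow> complex"
  assumes E: "\<And>x. norm (E x) \<le> 1" and h: "\<And>d. \<bar>h d\<bar> \<le> Hb"
    and \<eta>: "\<And>x. x \<in> carrier G \<Longrightarrow> (\<integral>s. norm (E (x \<otimes> s) - E x) \<partial>\<mu>) \<le> \<eta>"
  shows "norm ((\<integral>g. of_real (h (N #> g)) * E g \<partial>cp (Suc k)) - (\<integral>g. of_real (step h (N #> g)) * E g \<partial>cp k)) \<le> Hb * \<eta>"
proof -
  have Hb: "Hb \<ge> 0"
    using h[of undefined] by linarith
  have b1: "norm (of_real (h d) * E g) \<le> Hb" for d g
    unfolding norm_mult norm_of_real using mult_mono[OF h E Hb] by simp
  have "\<bar>step h d\<bar> \<le> Hb" for d
    unfolding step_def by (rule abs_integral_pmf_le) (rule h)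
  then have b2: "norm (of_real (step h d) * E g) \<le> Hb" for d g
    unfolding norm_mult norm_of_real using mult_mono[OF _ E Hb, of "\<bar>step h d\<bar>" g] by simp
  have i1: "integrable (cp k) (\<lambda>x. \<integral>s. of_real (h (N #> (x \<otimes> s))) * E (x \<otimes> s) \<partial>\<mu>)"
  proof (rule integrable_pmf_bounded[where B=Hb])
    fix x
    have "norm (\<integral>s. of_real (h (N #> (x \<otimes> s))) * E (x \<otimes> s) \<partial>\<mu>) \<le> (\<integral>s. Hb \<partial>\<mu>)"
      by (rule norm_integral_pmf_le) (use b1 in auto)
    then show "norm (\<integral>s. of_real (h (N #> (x \<otimes> s))) * E (x \<otimes> s) \<partial>\<mu>) \<le> Hb"
      unfolding integral_pmf_const .
  qed
  have i2: "integrable (cp k) (\<lambda>x. of_real (step h (N #> x)) * E x)"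
    by (rule integrable_pmf_bounded[where B=Hb]) (rule b2)
  have eq: "(\<integral>g. of_real (h (N #> g)) * E g \<partial>cp (Suc k)) - (\<integral>g. of_real (step h (N #> g)) * E g \<partial>cp k)
      = (\<integral>x. (\<integral>s. of_real (h (N #> (x \<otimes> s))) * E (x \<otimes> s) \<partial>\<mu>) - of_real (step h (N #> x)) * E x \<partial>cp k)"
    unfolding integral_cp_Suc_complex[where f="\<lambda>g. of_real (h (N #> g)) * E g", OF b1]
    by (rule Bochner_Integration.integral_diff[OF i1 i2, symmetric])
  have "norm ((\<integral>g. of_real (h (N #> g)) * E g \<partial>cp (Suc k)) - (\<integral>g. of_real (step h (N #> g)) * E g \<partial>cp k)) \<le> (\<integral>x. Hb * \<eta> \<partial>cp k)"
    unfolding eq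
  proof (rule norm_integral_pmf_le)
    fix x assume "x \<in> set_pmf (cp k)"
    then have x: "x \<in> carrier G"
      by (rule cp_carrier)
    have j1: "integrable (measure_pmf \<mu>) (\<lambda>s. of_real (h (N #> (x \<otimes> s))) * E (x \<otimes> s))"
      by (rule integrable_pmf_bounded[where B=Hb]) (rule b1)
    have j2: "integrable (measure_pmf \<mu>) (\<lambda>s. of_real (h ((N #> x) #> s)) * E x)"
      by (rule integrable_pmf_bounded[where B=Hb]) (rule b1)
    have nE: "norm (E (x \<otimes> s) - E x) \<le> 2" for s
      using norm_triangle_ineq4[of "E (x \<otimes> s)" "E x"] E[of "x \<otimes> s"] E[of x] by linarith
    have "of_real (step h (N #> x)) * E x = (\<integral>s. of_real (h ((N #> x) #> s)) * E x \<partial>\<mu>)"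
      unfolding step_def by simp
    then have eq2: "(\<integral>s. of_real (h (N #> (x \<otimes> s))) * E (x \<otimes> s) \<partial>\<mu>) - of_real (step h (N #> x)) * E x
       = (\<integral>s. of_real (h (N #> (x \<otimes> s))) * E (x \<otimes> s) - of_real (h ((N #> x) #> s)) * E x \<partial>\<mu>)"
      using Bochner_Integration.integral_diff[OF j1 j2] by simp
    have "norm ((\<integral>s. of_real (h (N #> (x \<otimes> s))) * E (x \<otimes> s) \<partial>\<mu>) - of_real (step h (N #> x)) * E x)
       \<le> (\<integral>s. Hb * norm (E (x \<otimes> s) - E x) \<partial>\<mu>)"
      unfolding eq2
    proof (rule norm_integral_pmf_le)
      fix s assume "s \<in> set_pmf \<mu>"
      then have s: "s \<in> carrier G"
        using set_pmf_subset by blast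
      have "of_real (h (N #> (x \<otimes> s))) * E (x \<otimes> s) - of_real (h ((N #> x) #> s)) * E x
        = of_real (h ((N #> x) #> s)) * (E (x \<otimes> s) - E x)"
        unfolding coset_mult[OF x s] by (simp only: right_diff_distrib)
      then show "norm (of_real (h (N #> (x \<otimes> s))) * E (x \<otimes> s) - of_real (h ((N #> x) #> s)) * E x) \<le> Hb * norm (E (x \<otimes> s) - E x)"
        by (simp only: norm_mult norm_of_real) (intro mult_right_mono h norm_ge_zero)
    next
      show "integrable (measure_pmf \<mu>) (\<lambda>s. Hb * norm (E (x \<otimes> s) - E x))"
        by (intro integrable_mult_right integrable_pmf_bounded[where B=2]) (simp add: nE)
    qed
    also have "\<dots> = Hb * (\<integral>s. norm (E (x \<otimes> s) - E x) \<partial>\<mu>)"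
      by simp
    also have "\<dots> \<le> Hb * \<eta>"
      by (intro mult_left_mono \<eta> x Hb)
    finally show "norm ((\<integral>s. of_real (h (N #> (x \<otimes> s))) * E (x \<otimes> s) \<partial>\<mu>) - of_real (step h (N #> x)) * E x) \<le> Hb * \<eta>" .
  qed simp
  then show ?thesis
    unfolding integral_pmf_const .
qed

text \<open>Real and imaginary parts are treated separately, whence the doubled constant. The values
  off the carrier, which the walk never meets, are cut to zero to fit \<open>bnd\<close>.\<close>

lemma complex_time_smoothing:
  "\<exists>K\<ge>0. \<forall>M B (f :: 'a \<Rightarrow> complex). (\<forall>x. norm (f x) \<le> B) \<longrightarrow>
    norm ((\<integral>g. f g \<partial>cp M) - (\<integral>g. f g \<partial>cp (M + period G \<mu>))) \<le> B * K / sqrt (real M + 1)"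
proof -
  obtain K where K: "K \<ge> 0" and smooth: "\<And>M b f. bnd (carrier G) b f \<Longrightarrow>
    \<bar>(\<integral>g. f g \<partial>cp M) - (\<integral>g. f g \<partial>cp (M + period G \<mu>))\<bar> \<le> b * K / sqrt (real M + 1)"
    using time_smoothing by blast
  have real: "\<bar>(\<integral>g. f g \<partial>cp M) - (\<integral>g. f g \<partial>cp (M + period G \<mu>))\<bar> \<le> B * K / sqrt (real M + 1)"
    if f: "\<And>x. \<bar>f x\<bar> \<le> B" for M B and f :: "'a \<Rightarrow> real"
  proof -
    define f' where "f' = (\<lambda>x. if x \<in> carrier G then f x else 0)"
    have "B \<ge> 0"
      using f[of undefined] by linarith
    then have "bnd (carrier G) B f'"
      using f by (simp add: bnd_def f'_def)
    from smooth[OF this, of M] show ?thesis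
      using integral_cp_cong[of f f'] by (simp add: f'_def)
  qed
  show ?thesis
  proof (intro exI[of _ "2 * K"] conjI allI impI)
    fix M B and f :: "'a \<Rightarrow> complex" assume f: "\<forall>x. norm (f x) \<le> B"
    have int: "integrable (measure_pmf p) f" for p
      by (rule integrable_pmf_bounded[where B=B]) (use f in simp)
    let ?d = "(\<integral>g. f g \<partial>cp M) - (\<integral>g. f g \<partial>cp (M + period G \<mu>))"
    have "\<bar>Re ?d\<bar> \<le> B * K / sqrt (real M + 1)"
      using real[of "\<lambda>x. Re (f x)" B M, OF order.trans[OF abs_Re_le_cmod f[rule_format]]]
      by (simp only: minus_complex.sel integral_Re[OF int])
    moreover have "\<bar>Im ?d\<bar> \<le> B * K / sqrt (real M + 1)"
      using real[of "\<lambda>x. Im (f x)" B M, OF order.trans[OF abs_Im_le_cmod f[rule_format]]]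
      by (simp only: minus_complex.sel integral_Im[OF int])
    moreover have "norm ?d \<le> \<bar>Re ?d\<bar> + \<bar>Im ?d\<bar>"
      by (rule cmod_le)
    ultimately have "norm ?d \<le> B * K / sqrt (real M + 1) + B * K / sqrt (real M + 1)"
      by linarith
    then show "norm ?d \<le> B * (2 * K) / sqrt (real M + 1)"
      by (simp add: mult_ac)
  qed (use K in simp)
qed

text \<open>If \<open>h - step h\<close> is the centred indicator of \<open>c\<close>, the difference telescopes over one period, up to
  the variation of \<open>E\<close> along one step; the boundary terms cancel by smoothness in time.\<close>

theorem class_equidistribution:
  fixes E :: "nat \<Rightarrow> 'a \<Rightarrow> complex" and M :: "nat \<Rightarrow> nat"
  assumes E: "\<And>n x. norm (E n x) \<le> 1"
    and \<eta>: "\<And>n x. x \<in> carrier G \<Longrightarrow> (\<integral>s. norm (E n (x \<otimes> s) - E n x) \<partial>\<mu>) \<le> \<eta> n" "\<eta> \<longlonglongrightarrow> 0"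
    and M: "filterlim M at_top sequentially" and c: "c \<in> C"
  shows "(\<lambda>n. (\<Sum>i<period G \<mu>. \<integral>g. of_bool (N #> g = c) * E n g \<partial>cp (M n + i))
    - (\<Sum>i<period G \<mu>. \<integral>g. E n g \<partial>cp (M n + i)) / of_nat (card C)) \<longlonglongrightarrow> 0"
proof -
  define q where "q = period G \<mu>"
  have "(\<Sum>d\<in>C. of_bool (d = c) - 1 / real (card C)) = 0"
    using c finite_cosets rcosets_nonempty[OF subgroup_N] by (simp add: sum_subtractf of_bool_def)
  then obtain h0 where h0: "\<And>d. d \<in> C \<Longrightarrow> h0 d - step h0 d = of_bool (d = c) - 1 / real (card C)"
    using poisson_equation[of "\<lambda>d. of_bool (d = c) - 1 / real (card C)"] by blast
  define h where "h = (\<lambda>c. if c \<in> C then h0 c else 0)"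
  have h: "h d - step h d = of_bool (d = c) - 1 / real (card C)" if "d \<in> C" for d
  proof -
    have "step h d = step h0 d"
      unfolding step_def by (intro integral_mu_cong) (simp add: h_def C_act that)
    then show ?thesis
      using h0[OF that] that by (simp add: h_def)
  qed
  define Hb where "Hb = (\<Sum>d\<in>C. \<bar>h0 d\<bar>)"
  have hb: "\<bar>h d\<bar> \<le> Hb" for d
  proof (cases "d \<in> C")
    case True
    then show ?thesis
      unfolding Hb_def h_def using member_le_sum[OF True, of "\<lambda>d. \<bar>h0 d\<bar>"] finite_cosets by simp
  qed (simp add: h_def Hb_def sum_nonneg)
  have Hb0: "Hb \<ge> 0"
    using hb[of undefined] by linarith
  obtain K where K: "K \<ge> 0" "\<And>M B (f :: 'a \<Rightarrow> complex). (\<And>x. norm (f x) \<le> B) \<Longrightarrow>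
    norm ((\<integral>g. f g \<partial>cp M) - (\<integral>g. f g \<partial>cp (M + q))) \<le> B * K / sqrt (real M + 1)"
    using complex_time_smoothing unfolding q_def by blast
  define A where "A = (\<lambda>n k. \<integral>g. of_real (h (N #> g)) * E n g \<partial>cp k)"
  define A' where "A' = (\<lambda>n k. \<integral>g. of_real (step h (N #> g)) * E n g \<partial>cp k)"
  have b1: "norm (of_real (h d) * E n g) \<le> Hb" for d g n
    unfolding norm_mult norm_of_real using mult_mono[OF hb E Hb0] by simp
  have "\<bar>step h d\<bar> \<le> Hb" for d
    unfolding step_def by (rule abs_integral_pmf_le) (rule hb)
  then have b2: "norm (of_real (step h d) * E n g) \<le> Hb" for d g n
    unfolding norm_mult norm_of_real using mult_mono[OF _ E Hb0, of "\<bar>step h d\<bar>" n g] by simp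
  have single: "(\<integral>g. of_bool (N #> g = c) * E n g \<partial>cp k) - (\<integral>g. E n g \<partial>cp k) / of_nat (card C) = A n k - A' n k" for n k
  proof -
    have i1: "integrable (cp k) (\<lambda>g. of_bool (N #> g = c) * E n g)"
      by (rule integrable_pmf_bounded[where B=1]) (use E in \<open>auto simp: norm_mult of_bool_def\<close>)
    have i2: "integrable (cp k) (\<lambda>g. E n g / of_nat (card C))"
      by (rule integrable_pmf_bounded[where B="1 / real (card C)"]) (use E in \<open>simp add: norm_divide divide_right_mono\<close>)
    have i3: "integrable (cp k) (\<lambda>g. of_real (h (N #> g)) * E n g)" "integrable (cp k) (\<lambda>g. of_real (step h (N #> g)) * E n g)"
      by (rule integrable_pmf_bounded[where B=Hb], rule b1 b2)+
    have "(\<integral>g. of_bool (N #> g = c) * E n g \<partial>cp k) - (\<integral>g. E n g \<partial>cp k) / of_nat (card C)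
        = (\<integral>g. of_bool (N #> g = c) * E n g - E n g / of_nat (card C) \<partial>cp k)"
      using Bochner_Integration.integral_diff[OF i1 i2] by simp
    also have "\<dots> = (\<integral>g. of_real (h (N #> g)) * E n g - of_real (step h (N #> g)) * E n g \<partial>cp k)"
    proof (intro integral_cong_AE AE_pmfI)
      fix g assume "g \<in> set_pmf (cp k)"
      then have "N #> g \<in> C"
        using cp_carrier coset_in_C by blast
      then have "complex_of_real (h (N #> g) - step h (N #> g)) = of_real (of_bool (N #> g = c) - 1 / real (card C))"
        using h by (simp only:)
      then have "(complex_of_real (h (N #> g)) - of_real (step h (N #> g))) * E n g = (of_bool (N #> g = c) - 1 / of_nat (card C)) * E n g"
        by simp
      then show "of_bool (N #> g = c) * E n g - E n g / of_nat (card C) = of_real (h (N #> g)) * E n g - of_real (step h (N #> g)) * E n g"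
        by (simp add: left_diff_distrib)
    qed simp_all
    also have "\<dots> = A n k - A' n k"
      unfolding A_def A'_def by (rule Bochner_Integration.integral_diff[OF i3])
    finally show ?thesis .
  qed
  have bound: "norm ((\<Sum>i<q. \<integral>g. of_bool (N #> g = c) * E n g \<partial>cp (M n + i))
    - (\<Sum>i<q. \<integral>g. E n g \<partial>cp (M n + i)) / of_nat (card C)) \<le> Hb * K / sqrt (real (M n) + 1) + real q * (Hb * \<eta> n)" for n
  proof -
    \<comment> \<open>Inserting the value of \<open>A\<close> one step later splits the sum into a
      telescoping part and defects that \<open>weighted_step_le\<close> controls.\<close>
    have eq: "(\<Sum>i<q. \<integral>g. of_bool (N #> g = c) * E n g \<partial>cp (M n + i))
      - (\<Sum>i<q. \<integral>g. E n g \<partial>cp (M n + i)) / of_nat (card C)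
      = (A n (M n) - A n (M n + q)) + (\<Sum>i<q. A n (Suc (M n + i)) - A' n (M n + i))"
    proof -
      have "(\<Sum>i<q. A n (M n + i) - A n (M n + Suc i)) = A n (M n) - A n (M n + q)"
        by (induction q) auto
      moreover have "(\<Sum>i<q. \<integral>g. of_bool (N #> g = c) * E n g \<partial>cp (M n + i))
        - (\<Sum>i<q. \<integral>g. E n g \<partial>cp (M n + i)) / of_nat (card C) = (\<Sum>i<q. A n (M n + i) - A' n (M n + i))"
        unfolding sum_divide_distrib sum_subtractf[symmetric] single ..
      moreover have "(\<Sum>i<q. A n (M n + i) - A' n (M n + i)) = (\<Sum>i<q. A n (M n + i) - A n (M n + Suc i)) + (\<Sum>i<q. A n (Suc (M n + i)) - A' n (M n + i))"
        by (simp add: sum.distrib[symmetric])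
      ultimately show ?thesis
        by simp
    qed
    have 1: "norm (A n (M n) - A n (M n + q)) \<le> Hb * K / sqrt (real (M n) + 1)"
      unfolding A_def by (rule K(2)) (rule b1)
    have 2: "norm (\<Sum>i<q. A n (Suc (M n + i)) - A' n (M n + i)) \<le> (\<Sum>i<q. Hb * \<eta> n)"
      unfolding A_def A'_def by (intro sum_norm_le weighted_step_le E hb \<eta>)
    show ?thesis
      unfolding eq using norm_triangle_le[OF add_mono[OF 1 2]] by simp
  qed
  have "filterlim (\<lambda>n. real (M n) + 1) at_top sequentially"
    by (rule filterlim_at_top_mono[OF filterlim_compose[OF filterlim_real_sequentially M]]) simp
  then have "(\<lambda>n. Hb * K / sqrt (real (M n) + 1)) \<longlonglongrightarrow> 0"
    by (intro real_tendsto_divide_at_top[OF tendsto_const] filterlim_compose[OF sqrt_at_top])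
  moreover have "(\<lambda>n. real q * (Hb * \<eta> n)) \<longlonglongrightarrow> real q * (Hb * 0)"
    by (intro tendsto_intros \<eta>)
  ultimately have "(\<lambda>n. Hb * K / sqrt (real (M n) + 1) + real q * (Hb * \<eta> n)) \<longlonglongrightarrow> 0 + real q * (Hb * 0)"
    by (rule tendsto_add)
  then show ?thesis
    unfolding q_def[symmetric] by (intro Lim_null_comparison[OF always_eventually[OF allI[OF bound]]]) simp
qed

end

section \<open>Virtually abelian groups\<close>

lemma real_vec_axis: "real_vec (axis i 1) = axis i 1"
  by (simp add: real_vec_def axis_def vec_eq_iff)

locale va_group = group G for G (structure) +
  fixes L D :: "'a set" and \<iota> :: "int ^ 'm \<Rightarrow> 'a"
  assumes normal_L: "normal L G" and finite_rcosets: "finite (rcosets L)"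
    and iso_iota: "\<iota> \<in> iso int_vec_group (G\<lparr>carrier := L\<rparr>)"
    and reps: "coset_representatives G L D"
begin

lemma subgroup_L: "subgroup L G"
  using normal_L by (rule normal_imp_subgroup)

lemma bij_iota: "bij_betw \<iota> UNIV L"
  using iso_iota by (simp add: iso_def int_vec_group_def)

lemma iota_in_L: "\<iota> v \<in> L"
  using bij_betw_apply[OF bij_iota] by simp

lemma iota_closed [simp]: "\<iota> v \<in> carrier G"
  using iota_in_L subgroup.subset[OF subgroup_L] by blast

lemma iota_add: "\<iota> (v + w) = \<iota> v \<otimes> \<iota> w"
  using iso_iota by (simp add: iso_def hom_def int_vec_group_def)

lemma iota_0 [simp]: "\<iota> 0 = \<one>"
proof -
  have "\<iota> 0 \<otimes> \<iota> 0 = \<iota> 0"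
    using iota_add[of 0 0] by simp
  then show ?thesis
    by (metis iota_closed r_cancel_one')
qed

lemma iota_minus: "\<iota> (- v) = inv (\<iota> v)"
proof -
  have "\<iota> (- v) \<otimes> \<iota> v = \<one>"
    using iota_add[of "- v" v] by simp
  then show ?thesis
    by (simp add: inv_equality)
qed

lemma iota_commute: "\<iota> v \<otimes> \<iota> w = \<iota> w \<otimes> \<iota> v"
  by (metis add.commute iota_add)

lemma iota_eq_iff: "\<iota> v = \<iota> w \<longleftrightarrow> v = w"
  using bij_iota by (auto simp: bij_betw_def inj_on_def)

lemma L_iota: "l \<in> L \<Longrightarrow> \<exists>v. l = \<iota> v"
  using bij_iota by (auto simp: bij_betw_def)

lemma D_carrier: "x \<in> D \<Longrightarrow> x \<in> carrier G"
  using reps by (auto simp: coset_representatives_def)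

lemma coset_iota: "g \<in> carrier G \<Longrightarrow> L #> (\<iota> v \<otimes> g) = L #> g"
  using repr_independence[OF rcosI[OF iota_in_L subgroup.subset[OF subgroup_L]] _ subgroup_L] by metis

lemma coset_eq_iota:
  assumes "g \<in> carrier G" "h \<in> L #> g"
  shows "\<exists>v. h = \<iota> v \<otimes> g"
  using assms L_iota unfolding r_coset_def by blast

lemma ex_decomposition: "g \<in> carrier G \<Longrightarrow> \<exists>v. \<exists>x\<in>D. g = \<iota> v \<otimes> x"
  using reps coset_eq_iota D_carrier unfolding coset_representatives_def by blast

lemma D_coset_inj: "x \<in> D \<Longrightarrow> y \<in> D \<Longrightarrow> L #> x = L #> y \<Longrightarrow> x = y"
  using reps rcos_self[OF D_carrier subgroup_L, of x] unfolding coset_representatives_def disjoint_family_on_def by blast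

lemma decomposition_unique:
  assumes "x \<in> D" "y \<in> D" "\<iota> v \<otimes> x = \<iota> w \<otimes> y"
  shows "v = w" "x = y"
proof -
  have "L #> x = L #> y"
    using assms coset_iota[OF D_carrier] by metis
  then show "x = y"
    by (rule D_coset_inj[OF assms(1,2)])
  then show "v = w"
    using assms D_carrier iota_eq_iff by simp
qed

abbreviation \<Phi> :: "'a \<Rightarrow> int ^ 'm" where "\<Phi> \<equiv> potential G \<iota> D"

lemma potential_iota_rep:
  assumes "x \<in> D"
  shows "\<Phi> (\<iota> v \<otimes> x) = v"
  unfolding potential_def using assms decomposition_unique by (intro the_equality) blast+

lemma potential_iota:
  assumes "g \<in> carrier G"
  shows "\<Phi> (\<iota> w \<otimes> g) = w + \<Phi> g"
proof -
  obtain v x where g: "x \<in> D" "g = \<iota> v \<otimes> x"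
    using ex_decomposition[OF assms] by blast
  have "\<iota> w \<otimes> g = \<iota> (w + v) \<otimes> x"
    using g D_carrier by (simp add: iota_add m_assoc)
  then show ?thesis
    using g potential_iota_rep by simp
qed

lemma bij_D_rcosets: "bij_betw (\<lambda>x. L #> x) D (rcosets L)"
proof (rule bij_betw_imageI)
  show "inj_on (\<lambda>x. L #> x) D"
    using D_coset_inj by (auto simp: inj_on_def)
  show "(\<lambda>x. L #> x) ` D = rcosets L"
  proof (intro subset_antisym subsetI)
    fix c assume "c \<in> (\<lambda>x. L #> x) ` D"
    then show "c \<in> rcosets L"
      using D_carrier unfolding RCOSETS_def by auto
  next
    fix c assume "c \<in> rcosets L"
    then obtain g where g: "g \<in> carrier G" "c = L #> g"
      unfolding RCOSETS_def by auto
    obtain v x where "x \<in> D" "g = \<iota> v \<otimes> x"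
      using ex_decomposition[OF g(1)] by blast
    then show "c \<in> (\<lambda>x. L #> x) ` D"
      using g coset_iota[OF D_carrier] by auto
  qed
qed

lemma finite_D: "finite D" and card_D: "card D = card (rcosets L)"
  using bij_betw_finite[OF bij_D_rcosets] bij_betw_same_card[OF bij_D_rcosets] finite_rcosets by auto

abbreviation U :: "'a set \<Rightarrow> 'a \<Rightarrow> real ^ 'm" where
  "U c s \<equiv> edge_potential G \<iota> D (c, s)"

text \<open>Another representative of the coset differs by some \<open>\<iota> v\<close> on the
  left, which shifts both potentials by \<open>v\<close>; so the choice made by \<open>SOME\<close>
  cancels in the difference.\<close>

lemma edge_potential_eq:
  assumes g: "g \<in> carrier G" and s: "s \<in> carrier G"
  shows "U (L #> g) s = real_vec (\<Phi> (g \<otimes> s)) - real_vec (\<Phi> g)"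
proof -
  define g' where "g' = (SOME h. h \<in> L #> g)"
  have "g' \<in> L #> g"
    unfolding g'_def using rcos_self[OF g subgroup_L] by (rule someI)
  then obtain v where v: "g' = \<iota> v \<otimes> g"
    using coset_eq_iota[OF g] by blast
  have "U (L #> g) s = real_vec (\<Phi> (g' \<otimes> s) - \<Phi> g')"
    by (simp add: edge_potential_def edge_org_def g'_def Let_def)
  also have "\<Phi> (g' \<otimes> s) - \<Phi> g' = \<Phi> (g \<otimes> s) - \<Phi> g"
    using g s v by (simp add: m_assoc potential_iota)
  finally show ?thesis
    by (simp add: real_vec_diff)
qed

lemma edge_potential_inv:
  assumes c: "c \<in> rcosets L" and s: "s \<in> carrier G"
  shows "U (c #> s) (inv s) = - U c s"
proof -
  obtain g where g: "g \<in> carrier G" "c = L #> g"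
    using c unfolding RCOSETS_def by auto
  have "c #> s = L #> (g \<otimes> s)"
    using g s subgroup.subset[OF subgroup_L] by (simp add: coset_mult_assoc)
  then show ?thesis
    using g s edge_potential_eq[of "g \<otimes> s" "inv s"] edge_potential_eq[of g s] by (simp add: m_assoc)
qed

lemma conj_iota:
  assumes x: "x \<in> carrier G"
  shows "inv x \<otimes> \<iota> (v + w) \<otimes> x = (inv x \<otimes> \<iota> v \<otimes> x) \<otimes> (inv x \<otimes> \<iota> w \<otimes> x)"
proof -
  have "(inv x \<otimes> \<iota> v \<otimes> x) \<otimes> (inv x \<otimes> \<iota> w \<otimes> x) = inv x \<otimes> (\<iota> v \<otimes> ((x \<otimes> inv x) \<otimes> (\<iota> w \<otimes> x)))"
    using x by (simp only: m_assoc iota_closed inv_closed m_closed)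
  also have "\<dots> = inv x \<otimes> \<iota> (v + w) \<otimes> x"
    using x by (simp add: iota_add m_assoc)
  finally show ?thesis ..
qed

text \<open>Conjugation is a homomorphism, so the powers provided by
  \<open>common_return_time\<close> are conjugates of translations by \<open>r w\<close>.\<close>

lemma conj_iota_pow:
  assumes x: "x \<in> carrier G"
  shows "(inv x \<otimes> \<iota> w \<otimes> x) [^] (r :: nat) = inv x \<otimes> \<iota> (int r *s w) \<otimes> x"
proof (induction r)
  case 0
  then show ?case
    using x by (simp add: l_inv)
next
  case (Suc r)
  have eq: "int (Suc r) *s w = int r *s w + w"
    by (simp add: vec_eq_iff algebra_simps)
  have "(inv x \<otimes> \<iota> w \<otimes> x) [^] Suc r = (inv x \<otimes> \<iota> (int r *s w) \<otimes> x) \<otimes> (inv x \<otimes> \<iota> w \<otimes> x)"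
    unfolding nat_pow_Suc Suc ..
  then show ?case
    unfolding eq conj_iota[OF x] .
qed

text \<open>The lattice part of \<open>x\<close> commutes with \<open>\<iota> w\<close> and drops
  out.\<close>

lemma conj_iota_rep:
  assumes x: "x \<in> carrier G"
  shows "\<exists>y\<in>D. inv x \<otimes> \<iota> w \<otimes> x = inv y \<otimes> \<iota> w \<otimes> y"
proof -
  obtain v y where y: "y \<in> D" "x = \<iota> v \<otimes> y"
    using ex_decomposition[OF x] by blast
  have yc: "y \<in> carrier G"
    using y D_carrier by blast
  have "inv x \<otimes> \<iota> w \<otimes> x = inv y \<otimes> (inv (\<iota> v) \<otimes> (\<iota> w \<otimes> \<iota> v) \<otimes> y)"
    using yc unfolding y by (simp add: inv_mult_group m_assoc)
  also have "inv (\<iota> v) \<otimes> (\<iota> w \<otimes> \<iota> v) = \<iota> w"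
    unfolding iota_commute[of w v] by (simp add: m_assoc[symmetric])
  also have "inv y \<otimes> (\<iota> w \<otimes> y) = inv y \<otimes> \<iota> w \<otimes> y"
    using yc by (simp add: m_assoc)
  finally show ?thesis
    using y(1) by blast
qed

lemma ex_word:
  assumes "A \<subseteq> carrier G" "g \<in> generate G A"
  shows "\<exists>ws. set ws \<subseteq> A \<union> m_inv G ` A \<and> word_prod G ws = g"
  using assms(2)
proof (induction rule: generate.induct)
  case one
  then show ?case
    by (intro exI[of _ "[]"]) (simp add: word_prod_def)
next
  case (incl h)
  then show ?case
    using assms(1) by (intro exI[of _ "[h]"]) (auto simp: word_prod_def)
next
  case (inv h)
  then show ?case
    using assms(1) by (intro exI[of _ "[inv h]"]) (auto simp: word_prod_def)
next
  case (eng h1 h2)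
  then obtain ws1 ws2 where ws: "set ws1 \<subseteq> A \<union> m_inv G ` A" "word_prod G ws1 = h1"
    "set ws2 \<subseteq> A \<union> m_inv G ` A" "word_prod G ws2 = h2"
    by blast
  have closed: "word_prod G ws \<in> carrier G" if "set ws \<subseteq> carrier G" for ws
    using that by (induction ws) (auto simp: word_prod_def)
  have app: "word_prod G (ws @ ws') = word_prod G ws \<otimes> word_prod G ws'" if "set ws \<subseteq> carrier G" "set ws' \<subseteq> carrier G" for ws ws'
    using that by (induction ws) (auto simp: word_prod_def m_assoc closed[unfolded word_prod_def])
  have "A \<union> m_inv G ` A \<subseteq> carrier G"
    using assms(1) by auto
  then show ?case
    using ws app[of ws1 ws2] by (intro exI[of _ "ws1 @ ws2"]) auto
qed

text \<open>The increment along a generator depends only on the coset, so finitely many values occur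
  and the potential is Lipschitz for the word metric. This is how the second moment of
  \<open>\<mu>\<close> reaches the edge forms.\<close>

lemma potential_increment_le:
  assumes A: "finite A" "A \<subseteq> carrier G" "generate G A = carrier G"
  shows "\<exists>B\<ge>0. \<forall>c\<in>rcosets L. \<forall>s\<in>carrier G. norm (U c s) \<le> B * real (word_length G A s)"
proof -
  let ?A = "A \<union> m_inv G ` A"
  have A': "finite ?A" "?A \<subseteq> carrier G"
    using A by auto
  define B where "B = (\<Sum>c\<in>rcosets L. \<Sum>a\<in>?A. norm (U c a))"
  have B: "norm (U c a) \<le> B" if "c \<in> rcosets L" "a \<in> ?A" for c a
  proof -
    have "norm (U c a) \<le> (\<Sum>a\<in>?A. norm (U c a))"
      using that A' by (intro member_le_sum) auto
    also have "\<dots> \<le> B"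
      unfolding B_def using that finite_rcosets
      by (intro member_le_sum[where f="\<lambda>c. \<Sum>a\<in>?A. norm (U c a)"]) (auto intro: sum_nonneg)
    finally show ?thesis .
  qed
  have B0: "B \<ge> 0"
    unfolding B_def by (intro sum_nonneg norm_ge_zero)
  have closed: "word_prod G ws \<in> carrier G" if "set ws \<subseteq> carrier G" for ws
    using that by (induction ws) (auto simp: word_prod_def)
  have word: "norm (real_vec (\<Phi> (g \<otimes> word_prod G ws)) - real_vec (\<Phi> g)) \<le> B * real (length ws)"
    if "set ws \<subseteq> ?A" "g \<in> carrier G" for g ws
    using that
  proof (induction ws arbitrary: g)
    case Nil
    then show ?case
      by (simp add: word_prod_def)
  next
    case (Cons a ws)
    have a: "a \<in> carrier G" "a \<in> ?A" and ws: "set ws \<subseteq> ?A" "word_prod G ws \<in> carrier G"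
      using Cons.prems A' closed[of ws] by auto
    have "norm (real_vec (\<Phi> ((g \<otimes> a) \<otimes> word_prod G ws)) - real_vec (\<Phi> (g \<otimes> a))) \<le> B * real (length ws)"
      using Cons.prems a ws by (intro Cons.IH) auto
    moreover have "norm (real_vec (\<Phi> (g \<otimes> a)) - real_vec (\<Phi> g)) \<le> B"
      using B[of "L #> g" a] a Cons.prems edge_potential_eq[of g a]
      by (auto simp: rcosetsI[OF subgroup.subset[OF subgroup_L]])
    moreover have "g \<otimes> word_prod G (a # ws) = (g \<otimes> a) \<otimes> word_prod G ws"
      using Cons.prems a ws by (simp add: word_prod_def m_assoc)
    ultimately show ?case
      using norm_triangle_ineq[of "real_vec (\<Phi> ((g \<otimes> a) \<otimes> word_prod G ws)) - real_vec (\<Phi> (g \<otimes> a))"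
          "real_vec (\<Phi> (g \<otimes> a)) - real_vec (\<Phi> g)"]
      by (simp add: algebra_simps)
  qed
  show ?thesis
  proof (intro exI[of _ B] conjI ballI B0)
    fix c s assume c: "c \<in> rcosets L" and s: "s \<in> carrier G"
    obtain g where g: "g \<in> carrier G" "c = L #> g"
      using c unfolding RCOSETS_def by auto
    have "\<exists>ws. set ws \<subseteq> ?A \<and> word_prod G ws = s"
      using A s by (intro ex_word) auto
    then have "\<exists>n ws. length ws = n \<and> set ws \<subseteq> ?A \<and> word_prod G ws = s"
      by blast
    then have "\<exists>ws. length ws = word_length G A s \<and> set ws \<subseteq> ?A \<and> word_prod G ws = s"
      unfolding word_length_def by (rule LeastI_ex)
    then obtain ws where ws: "length ws = word_length G A s" "set ws \<subseteq> ?A" "word_prod G ws = s"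
      by blast
    show "norm (U c s) \<le> B * real (word_length G A s)"
      using word[OF ws(2) g(1)] ws g s edge_potential_eq[OF g(1) s] by simp
  qed
qed

end

section \<open>Sums over the edges of the diagram as integrals over the step\<close>

lemma integrable_pmf_count_space:
  fixes f :: "'c \<Rightarrow> 'd::{banach, second_countable_topology}"
  shows "integrable (measure_pmf p) f \<longleftrightarrow> integrable (count_space UNIV) (\<lambda>x. pmf p x *\<^sub>R f x)"
  unfolding measure_pmf_eq_density by (subst integrable_density) simp_all

text \<open>The passage from the Bochner integral to the unordered sums in which the notions of the
  diagram are stated. Terms outside the support are zero, so any superset \<open>S\<close> gives the
  same sum.\<close>

lemma has_sum_integral_pmf:
  fixes f :: "'c \<Rightarrow> 'd::{banach, second_countable_topology}"
  assumes int: "integrable (measure_pmf p) f" and S: "set_pmf p \<subseteq> S"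
  shows "((\<lambda>x. pmf p x *\<^sub>R f x) has_sum (\<integral>x. f x \<partial>measure_pmf p)) S"
proof -
  let ?g = "\<lambda>x. pmf p x *\<^sub>R f x"
  have abs: "Infinite_Set_Sum.abs_summable_on ?g UNIV"
    using int unfolding integrable_pmf_count_space by (simp add: Infinite_Set_Sum.abs_summable_on_def)
  have "(\<integral>x. f x \<partial>measure_pmf p) = infsetsum ?g UNIV"
    unfolding infsetsum_def measure_pmf_eq_density by (subst integral_density) simp_all
  also have "\<dots> = infsum ?g UNIV"
    by (rule infsetsum_infsum[OF abs])
  finally have "(?g has_sum (\<integral>x. f x \<partial>measure_pmf p)) UNIV"
    using abs_summable_summable[OF abs[folded abs_summable_equivalent]] by simp
  then show ?thesis
    by (subst has_sum_cong_neutral[where T=UNIV and g="?g"]) (use S in \<open>auto simp: set_pmf_iff\<close>)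
qed

lemma integrable_pmf_summable_on:
  fixes f :: "'c \<Rightarrow> real"
  assumes "(\<lambda>x. f x * pmf p x) summable_on S" and S: "set_pmf p \<subseteq> S" and "\<And>x. f x \<ge> 0"
  shows "integrable (measure_pmf p) f"
proof -
  have "(\<lambda>x. norm (pmf p x *\<^sub>R f x)) summable_on UNIV"
    using assms by (subst summable_on_cong_neutral[where T=S and g="\<lambda>x. f x * pmf p x"])
      (auto simp: set_pmf_iff abs_mult mult.commute)
  then have "Infinite_Set_Sum.abs_summable_on (\<lambda>x. pmf p x *\<^sub>R f x) UNIV"
    by (simp only: abs_summable_equivalent)
  then show ?thesis
    unfolding integrable_pmf_count_space by (simp add: Infinite_Set_Sum.abs_summable_on_def)
qed

locale va_walk = va_group G L D \<iota> + irreducible_walk G \<mu>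
  for G (structure) and L D and \<iota> :: "int ^ 'm \<Rightarrow> 'a" and \<mu> +
  assumes second_moment: "finite_second_moment G \<mu>"

sublocale va_walk \<subseteq> base: coset_walk G \<mu> L
  by (intro coset_walk.intro irreducible_walk_axioms coset_walk_axioms.intro subgroup_L finite_rcosets)

context va_walk
begin

abbreviation V :: "'a set set" where "V \<equiv> rcosets L"

lemma mu_carrier: "s \<in> set_pmf \<mu> \<Longrightarrow> s \<in> carrier G"
  using set_pmf_subset by blast

lemma integrable_U_square:
  assumes c: "c \<in> V"
  shows "integrable (measure_pmf \<mu>) (\<lambda>s. (norm (U c s))\<^sup>2)"
proof -
  obtain A where A: "finite A" "A \<subseteq> carrier G" "generate G A = carrier G"
    and sm: "(\<lambda>g. (real (word_length G A g))\<^sup>2 * pmf \<mu> g) summable_on carrier G"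
    using second_moment unfolding finite_second_moment_def by blast
  obtain B where B: "B \<ge> 0" "\<And>c s. c \<in> V \<Longrightarrow> s \<in> carrier G \<Longrightarrow> norm (U c s) \<le> B * real (word_length G A s)"
    using potential_increment_le[OF A] by blast
  show ?thesis
  proof (rule Bochner_Integration.integrable_bound)
    show "integrable (measure_pmf \<mu>) (\<lambda>s. B\<^sup>2 * (real (word_length G A s))\<^sup>2)"
      using integrable_pmf_summable_on[OF sm set_pmf_subset] by simp
    show "AE s in \<mu>. norm ((norm (U c s))\<^sup>2) \<le> norm (B\<^sup>2 * (real (word_length G A s))\<^sup>2)"
    proof (rule AE_pmfI)
      fix s assume "s \<in> set_pmf \<mu>"
      from B(2)[OF c mu_carrier[OF this]]
      have "(norm (U c s))\<^sup>2 \<le> (B * real (word_length G A s))\<^sup>2"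
        by (intro power_mono) auto
      then show "norm ((norm (U c s))\<^sup>2) \<le> norm (B\<^sup>2 * (real (word_length G A s))\<^sup>2)"
        by (simp add: power_mult_distrib)
    qed
  qed simp
qed

lemma integrable_U_norm: "c \<in> V \<Longrightarrow> integrable (measure_pmf \<mu>) (\<lambda>s. norm (U c s))"
  by (rule measure_pmf.square_integrable_imp_integrable[OF _ integrable_U_square]) simp

lemma integrable_U: "c \<in> V \<Longrightarrow> integrable (measure_pmf \<mu>) (U c)"
  by (rule Bochner_Integration.integrable_bound[OF integrable_U_norm]) auto

abbreviation E :: "('a set \<times> 'a) set" where "E \<equiv> diag_E G L \<mu>"

abbreviation S' :: "'a set" where "S' \<equiv> set_pmf \<mu> \<union> m_inv G ` set_pmf \<mu>"

lemma S'_carrier: "s \<in> S' \<Longrightarrow> s \<in> carrier G"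
  using set_pmf_subset by auto

lemma E_eq: "E = V \<times> S'"
  by (simp add: diag_E_def diag_V_def)

lemma edge_weight_eq: "edge_weight G L \<mu> (c, s) = pmf \<mu> s / real (card V)"
  by (simp add: edge_weight_def vertex_weight_def diag_V_def)

text \<open>The edges at a vertex are indexed by the symmetrised support \<open>S'\<close>; those
  whose label is not itself in the support carry weight zero, so the integral over
  \<open>\<mu>\<close> misses nothing.\<close>

lemma edge_has_sum_vertex:
  fixes k :: "'a set \<times> 'a \<Rightarrow> 'd::{banach, second_countable_topology}"
  assumes "integrable (measure_pmf \<mu>) (\<lambda>s. k (c, s))"
  shows "((\<lambda>e. edge_weight G L \<mu> e *\<^sub>R k e) has_sum ((1 / real (card V)) *\<^sub>R (\<integral>s. k (c, s) \<partial>\<mu>))) ({c} \<times> S')"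
proof -
  have "((\<lambda>s. pmf \<mu> s *\<^sub>R k (c, s)) has_sum (\<integral>s. k (c, s) \<partial>\<mu>)) S'"
    by (rule has_sum_integral_pmf[OF assms]) simp
  then have "((\<lambda>s. (1 / real (card V)) *\<^sub>R (pmf \<mu> s *\<^sub>R k (c, s))) has_sum ((1 / real (card V)) *\<^sub>R (\<integral>s. k (c, s) \<partial>\<mu>))) S'"
    by (rule has_sum_scaleR)
  then have "((\<lambda>e. edge_weight G L \<mu> e *\<^sub>R k e) \<circ> Pair c has_sum ((1 / real (card V)) *\<^sub>R (\<integral>s. k (c, s) \<partial>\<mu>))) S'"
    by (simp add: comp_def edge_weight_eq)
  note sum = this
  have img: "Pair c ` S' = {c} \<times> S'" and inj: "inj_on (Pair c) S'"
    by (auto simp: inj_on_def)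
  show ?thesis
    unfolding img[symmetric] has_sum_reindex[OF inj] by (rule sum)
qed

lemma edge_has_sum:
  fixes k :: "'a set \<times> 'a \<Rightarrow> 'd::{banach, second_countable_topology}"
  assumes "\<And>c. c \<in> V \<Longrightarrow> integrable (measure_pmf \<mu>) (\<lambda>s. k (c, s))"
  shows "((\<lambda>e. edge_weight G L \<mu> e *\<^sub>R k e) has_sum ((1 / real (card V)) *\<^sub>R (\<Sum>c\<in>V. \<integral>s. k (c, s) \<partial>\<mu>))) E"
proof -
  have "((\<lambda>e. edge_weight G L \<mu> e *\<^sub>R k e) has_sum ((1 / real (card V)) *\<^sub>R (\<Sum>c\<in>W. \<integral>s. k (c, s) \<partial>\<mu>))) (W \<times> S')"
    if "finite W" "W \<subseteq> V" for W
    using that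
  proof (induction W rule: finite_induct)
    case (insert c W)
    have "((\<lambda>e. edge_weight G L \<mu> e *\<^sub>R k e) has_sum
        ((1 / real (card V)) *\<^sub>R (\<integral>s. k (c, s) \<partial>\<mu>) + (1 / real (card V)) *\<^sub>R (\<Sum>c\<in>W. \<integral>s. k (c, s) \<partial>\<mu>))) ({c} \<times> S' \<union> W \<times> S')"
      using insert by (intro has_sum_Un_disjoint edge_has_sum_vertex assms insert.IH) auto
    moreover have "{c} \<times> S' \<union> W \<times> S' = insert c W \<times> S'"
      by auto
    ultimately show ?case
      using insert by (simp add: scaleR_add_right)
  qed simp
  then show ?thesis
    unfolding E_eq using finite_rcosets by blast
qed

abbreviation \<zeta> :: "real ^ 'm" where "\<zeta> \<equiv> drift G L \<mu> \<iota> D"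

lemma drift_eq: "\<zeta> = (1 / real (card V)) *\<^sub>R (\<Sum>c\<in>V. \<integral>s. U c s \<partial>\<mu>)"
  unfolding drift_def using edge_has_sum[of "edge_potential G \<iota> D"] integrable_U by (intro infsumI) auto

text \<open>The right-hand sides have mean zero over the vertices because the drift is the average
  of the local mean increments. The Poisson equation is solved for each basis vector, and linearity
  in \<open>v\<close> glues the solutions to a vector-valued function.\<close>

lemma ex_corrector:
  "\<exists>F. \<forall>c\<in>V. \<forall>v. v \<bullet> F c - base.step (\<lambda>c. v \<bullet> F c) c = v \<bullet> \<zeta> - (\<integral>s. v \<bullet> U c s \<partial>\<mu>)"
proof -
  have "\<forall>b\<in>Basis. \<exists>h. \<forall>c\<in>V. h c - base.step h c = b \<bullet> \<zeta> - (\<integral>s. b \<bullet> U c s \<partial>\<mu>)"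
  proof
    fix b :: "real ^ 'm"
    have "(\<Sum>c\<in>V. b \<bullet> \<zeta> - (\<integral>s. b \<bullet> U c s \<partial>\<mu>)) = 0"
      using base.card_C integrable_U
      by (simp add: drift_eq sum_subtractf inner_sum_right integral_inner_right)
    then show "\<exists>h. \<forall>c\<in>V. h c - base.step h c = b \<bullet> \<zeta> - (\<integral>s. b \<bullet> U c s \<partial>\<mu>)"
      by (rule base.poisson_equation)
  qed
  from bchoice[OF this] obtain h where h: "\<forall>b\<in>Basis. \<forall>c\<in>V. h b c - base.step (h b) c = b \<bullet> \<zeta> - (\<integral>s. b \<bullet> U c s \<partial>\<mu>)"
    by blast
  define F where "F = (\<lambda>c. \<Sum>b\<in>Basis. h b c *\<^sub>R b)"
  have "v \<bullet> F c - base.step (\<lambda>c. v \<bullet> F c) c = v \<bullet> \<zeta> - (\<integral>s. v \<bullet> U c s \<partial>\<mu>)" if c: "c \<in> V" for c v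
  proof -
    have "base.step (\<lambda>c. v \<bullet> F c) c = (\<integral>s. (\<Sum>b\<in>Basis. h b (c #> s) * (v \<bullet> b)) \<partial>\<mu>)"
      by (simp add: base.step_def F_def inner_sum_right)
    also have "\<dots> = (\<Sum>b\<in>Basis. \<integral>s. h b (c #> s) * (v \<bullet> b) \<partial>\<mu>)"
      using base.integrable_C[OF c] by (intro Bochner_Integration.integral_sum) auto
    also have "\<dots> = (\<Sum>b\<in>Basis. base.step (h b) c * (v \<bullet> b))"
      by (simp add: base.step_def)
    finally have "v \<bullet> F c - base.step (\<lambda>c. v \<bullet> F c) c = (\<Sum>b\<in>Basis. (h b c - base.step (h b) c) * (v \<bullet> b))"
      by (simp add: F_def inner_sum_right sum_subtractf left_diff_distrib)
    also have "\<dots> = (\<Sum>b\<in>Basis. (b \<bullet> (\<zeta> - (\<integral>s. U c s \<partial>\<mu>))) * (v \<bullet> b))"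
      using h c integrable_U[OF c] by (intro sum.cong) (auto simp: inner_diff_right integral_inner_right)
    also have "\<dots> = v \<bullet> (\<zeta> - (\<integral>s. U c s \<partial>\<mu>))"
      by (subst (2) euclidean_inner) (simp add: inner_commute mult.commute)
    finally show ?thesis
      using integrable_U[OF c] by (simp add: inner_diff_right integral_inner_right)
  qed
  then show ?thesis
    by blast
qed

definition corrector :: "'a set \<Rightarrow> real ^ 'm" where
  "corrector = (SOME F. \<forall>c\<in>V. \<forall>v. v \<bullet> F c - base.step (\<lambda>c. v \<bullet> F c) c = v \<bullet> \<zeta> - (\<integral>s. v \<bullet> U c s \<partial>\<mu>))"

lemma corrector: "c \<in> V \<Longrightarrow> v \<bullet> corrector c - base.step (\<lambda>c. v \<bullet> corrector c) c = v \<bullet> \<zeta> - (\<integral>s. v \<bullet> U c s \<partial>\<mu>)"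
  using someI_ex[OF ex_corrector] unfolding corrector_def by blast

text \<open>The increment along an edge of the potential minus the corrector. Its inner product with
  \<open>v\<close> turns out to be the harmonic part of the form \<open>hat_form\<close> of
  \<open>v\<close>.\<close>

definition Xi :: "'a set \<Rightarrow> 'a \<Rightarrow> real ^ 'm" where
  "Xi c s = U c s - (corrector (c #> s) - corrector c)"

lemma integrable_corrector:
  assumes c: "c \<in> V"
  shows "integrable (measure_pmf \<mu>) (\<lambda>s. corrector (c #> s))"
proof -
  have "integrable (measure_pmf \<mu>) (\<lambda>s. norm (corrector (c #> s)))"
    using base.integrable_C[OF c, of "\<lambda>d. norm (corrector d)"] .
  then show ?thesis
    by (rule Bochner_Integration.integrable_bound) auto
qed

lemma integrable_Xi: "c \<in> V \<Longrightarrow> integrable (measure_pmf \<mu>) (Xi c)"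
  unfolding Xi_def[abs_def] using integrable_U integrable_corrector by auto

lemma integrable_Xi_square:
  assumes c: "c \<in> V"
  shows "integrable (measure_pmf \<mu>) (\<lambda>s. (norm (Xi c s))\<^sup>2)"
proof (rule Bochner_Integration.integrable_bound)
  show "integrable (measure_pmf \<mu>) (\<lambda>s. 2 * (norm (U c s))\<^sup>2 + 2 * (norm (corrector (c #> s) - corrector c))\<^sup>2)"
    using integrable_U_square[OF c] base.integrable_C[OF c, of "\<lambda>d. (norm (corrector d - corrector c))\<^sup>2"] by auto
  show "AE s in \<mu>. norm ((norm (Xi c s))\<^sup>2) \<le> norm (2 * (norm (U c s))\<^sup>2 + 2 * (norm (corrector (c #> s) - corrector c))\<^sup>2)"
  proof (rule AE_I2)
    fix s
    have "(norm (Xi c s))\<^sup>2 \<le> (norm (U c s) + norm (corrector (c #> s) - corrector c))\<^sup>2"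
      unfolding Xi_def by (intro power_mono norm_triangle_ineq4) auto
    also have "\<dots> \<le> 2 * (norm (U c s))\<^sup>2 + 2 * (norm (corrector (c #> s) - corrector c))\<^sup>2"
      using sum_squares_bound[of "norm (U c s)" "norm (corrector (c #> s) - corrector c)"] by (simp add: power2_sum)
    finally show "norm ((norm (Xi c s))\<^sup>2) \<le> norm (2 * (norm (U c s))\<^sup>2 + 2 * (norm (corrector (c #> s) - corrector c))\<^sup>2)"
      by simp
  qed
qed simp

lemma integrable_Xi_mult:
  assumes c: "c \<in> V"
  shows "integrable (measure_pmf \<mu>) (\<lambda>s. (v \<bullet> Xi c s) * (w \<bullet> Xi c s))"
proof (rule Bochner_Integration.integrable_bound)
  show "integrable (measure_pmf \<mu>) (\<lambda>s. (norm v * norm w) * (norm (Xi c s))\<^sup>2)"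
    using integrable_Xi_square[OF c] by simp
  show "AE s in \<mu>. norm ((v \<bullet> Xi c s) * (w \<bullet> Xi c s)) \<le> norm ((norm v * norm w) * (norm (Xi c s))\<^sup>2)"
  proof (rule AE_I2)
    fix s
    have "\<bar>v \<bullet> Xi c s\<bar> * \<bar>w \<bullet> Xi c s\<bar> \<le> (norm v * norm (Xi c s)) * (norm w * norm (Xi c s))"
      by (intro mult_mono Cauchy_Schwarz_ineq2) auto
    then show "norm ((v \<bullet> Xi c s) * (w \<bullet> Xi c s)) \<le> norm ((norm v * norm w) * (norm (Xi c s))\<^sup>2)"
      by (simp add: abs_mult power2_eq_square mult_ac)
  qed
qed simp

text \<open>By the equation that the corrector solves, the mean increment is the drift from every
  single vertex and not just on average; this is harmonicity.\<close>

lemma integral_Xi: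
  assumes c: "c \<in> V"
  shows "(\<integral>s. v \<bullet> Xi c s \<partial>\<mu>) = v \<bullet> \<zeta>"
proof -
  have i: "integrable (measure_pmf \<mu>) (\<lambda>s. v \<bullet> U c s)" "integrable (measure_pmf \<mu>) (\<lambda>s. v \<bullet> corrector (c #> s))"
    using integrable_U[OF c] integrable_corrector[OF c] by auto
  have "(\<integral>s. v \<bullet> Xi c s \<partial>\<mu>) = (\<integral>s. v \<bullet> U c s - (v \<bullet> corrector (c #> s) - v \<bullet> corrector c) \<partial>\<mu>)"
    by (simp add: Xi_def inner_diff_right)
  also have "\<dots> = (\<integral>s. v \<bullet> U c s \<partial>\<mu>) - (base.step (\<lambda>c. v \<bullet> corrector c) c - v \<bullet> corrector c)"
    unfolding base.step_def using i by simp
  finally show ?thesis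
    using corrector[OF c, of v] by simp
qed

lemma form_chi_eq:
  assumes "\<And>c. c \<in> V \<Longrightarrow> integrable (measure_pmf \<mu>) (\<lambda>s. u (c, s))"
  shows "form_chi G L \<mu> u = (\<Sum>c\<in>V. \<integral>s. u (c, s) \<partial>\<mu>) / real (card V)"
  unfolding form_chi_def using edge_has_sum[OF assms] by (intro infsumI) (simp add: mult.commute)

lemma form_d_star_eq:
  assumes c: "c \<in> V" and "integrable (measure_pmf \<mu>) (\<lambda>s. u (c, s))"
  shows "form_d_star G L \<mu> u c = - (\<integral>s. u (c, s) \<partial>\<mu>)"
proof -
  have "{e \<in> E. edge_org e = c} = {c} \<times> S'"
    using c by (auto simp: E_eq edge_org_def)
  then have "(\<Sum>\<^sub>\<infinity>e\<in>{e \<in> E. edge_org e = c}. edge_weight G L \<mu> e * u e) = (\<integral>s. u (c, s) \<partial>\<mu>) / real (card V)"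
    using edge_has_sum_vertex[OF assms(2)] by (intro infsumI) simp
  then show ?thesis
    using base.card_C by (simp add: form_d_star_def vertex_weight_def diag_V_def)
qed

lemma edge_rev_in_E: "e \<in> E \<Longrightarrow> edge_rev G e \<in> E"
  using rcosets_act[OF subgroup_L] set_pmf_subset by (auto simp: E_eq edge_rev_def edge_ter_def)

lemma hat_form_eq: "hat_form G \<iota> D v (c, s) = v \<bullet> U c s"
  by (simp add: hat_form_def)

lemma edge_integral_cong:
  fixes u :: "'a set \<times> 'a \<Rightarrow> real"
  assumes "\<And>s. s \<in> S' \<Longrightarrow> u (c, s) = k s"
  shows "(\<integral>s. u (c, s) \<partial>\<mu>) = (\<integral>s. k s \<partial>\<mu>)"
  by (rule integral_cong_AE) (simp_all add: AE_measure_pmf_iff assms)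

lemma edge_integrable_cong:
  fixes u :: "'a set \<times> 'a \<Rightarrow> real"
  assumes k: "integrable (measure_pmf \<mu>) k" and eq: "\<And>s. s \<in> S' \<Longrightarrow> u (c, s) = k s"
  shows "integrable (measure_pmf \<mu>) (\<lambda>s. u (c, s))"
proof (rule integrable_cong_AE_imp[OF k])
  show "AE s in \<mu>. k s = u (c, s)"
    by (rule AE_pmfI) (simp add: eq)
qed simp

text \<open>Existence: with the corrector as primitive, the integral at each vertex is
  \<open>v \<bullet> \<zeta>\<close>, so the codifferential is constant and cancels
  \<open>form_chi\<close>. Uniqueness: two candidates differ by an exact form whose primitive is
  harmonic for the step, hence constant. The identities hold on the whole edge set, including the
  edges of weight zero.\<close>

theorem harmonic_part_hat_form:
  assumes "c \<in> V" "s \<in> S'"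
  shows "harmonic_part G L \<mu> (hat_form G \<iota> D v) (c, s) = v \<bullet> Xi c s"
proof -
  define u0 where "u0 = restrict (\<lambda>(c, s). v \<bullet> Xi c s) E"
  let ?P = "\<lambda>u. u \<in> extensional E \<and> harmonic_form G L \<mu> u \<and> (\<exists>f. \<forall>e\<in>E. hat_form G \<iota> D v e = u e + form_d G f e)"
  have u0: "u0 (c, s) = v \<bullet> Xi c s" if "c \<in> V" "s \<in> S'" for c s
    using that by (simp add: u0_def E_eq)
  have i0: "integrable (measure_pmf \<mu>) (\<lambda>s. u0 (c, s))" "(\<integral>s. u0 (c, s) \<partial>\<mu>) = v \<bullet> \<zeta>" if c: "c \<in> V" for c
    using edge_integrable_cong[of "\<lambda>s. v \<bullet> Xi c s" u0 c, OF _ u0[OF c]] edge_integral_cong[of u0 c, OF u0[OF c]]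
      integrable_Xi[OF c] integral_Xi[OF c, of v] by simp_all
  have "form_chi G L \<mu> u0 = (\<Sum>c\<in>V. \<integral>s. u0 (c, s) \<partial>\<mu>) / real (card V)"
    by (rule form_chi_eq) (rule i0(1))
  then have chi0: "form_chi G L \<mu> u0 = v \<bullet> \<zeta>"
    using base.card_C by (simp add: i0(2))
  have "?P u0"
  proof (intro conjI exI ballI)
    show "u0 \<in> extensional E"
      by (simp add: u0_def)
    show "harmonic_form G L \<mu> u0"
      unfolding harmonic_form_def l2_form_def
    proof (intro conjI ballI)
      fix e assume e: "e \<in> E"
      then obtain c s where cs: "e = (c, s)" "c \<in> V" "s \<in> S'" "s \<in> carrier G"
        using S'_carrier by (auto simp: E_eq)
      have "u0 (edge_rev G e) = v \<bullet> Xi (c #> s) (inv s)"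
        using edge_rev_in_E[OF e] unfolding cs(1) by (simp add: u0_def edge_rev_def edge_ter_def)
      moreover have "(c #> s) #> inv s = c"
        using cs by (simp add: rcosets_act_mult[OF subgroup_L] rcosets_act_one[OF subgroup_L])
      ultimately show "u0 (edge_rev G e) = - u0 e"
        using cs edge_potential_inv[OF cs(2,4)] by (simp add: u0 Xi_def inner_diff_right)
    next
      have "integrable (measure_pmf \<mu>) (\<lambda>s. (u0 (c, s))\<^sup>2)" if c: "c \<in> V" for c
        using integrable_Xi_mult[OF c, of v v] u0[OF c]
        by (intro edge_integrable_cong[of "\<lambda>s. (v \<bullet> Xi c s) * (v \<bullet> Xi c s)"]) (simp_all add: power2_eq_square)
      from edge_has_sum[where k="\<lambda>e. (u0 e)\<^sup>2", OF this]
      show "(\<lambda>e. (u0 e)\<^sup>2 * edge_weight G L \<mu> e) summable_on E"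
        by (auto simp: mult.commute intro: has_sum_imp_summable)
    next
      fix c assume "c \<in> diag_V G L"
      then have c: "c \<in> V"
        by (simp add: diag_V_def)
      show "form_d_star G L \<mu> u0 c + form_chi G L \<mu> u0 = 0"
        unfolding form_d_star_eq[OF c i0(1)[OF c]] chi0 i0(2)[OF c] by simp
    qed
    fix e assume "e \<in> E"
    then show "hat_form G \<iota> D v e = u0 e + form_d G (\<lambda>c. v \<bullet> corrector c) e"
      by (cases e) (auto simp: E_eq u0 hat_form_eq Xi_def form_d_def edge_ter_def edge_org_def inner_diff_right)
  qed
  moreover have "u = u0" if P: "?P u" for u
  proof -
    from P obtain f where ext: "u \<in> extensional E" and harm: "harmonic_form G L \<mu> u"
      and f: "\<forall>e\<in>E. hat_form G \<iota> D v e = u e + form_d G f e"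
      by blast
    have u: "u (c, s) = v \<bullet> U c s - (f (c #> s) - f c)" if "c \<in> V" "s \<in> S'" for c s
      using f[rule_format, of "(c, s)"] that by (simp add: E_eq hat_form_eq form_d_def edge_ter_def edge_org_def)
    have i: "integrable (measure_pmf \<mu>) (\<lambda>s. v \<bullet> U c s - (f (c #> s) - f c))"
      "(\<integral>s. v \<bullet> U c s - (f (c #> s) - f c) \<partial>\<mu>) = (\<integral>s. v \<bullet> U c s \<partial>\<mu>) - (base.step f c - f c)" if "c \<in> V" for c
      unfolding base.step_def using integrable_U[OF that] base.integrable_C[OF that, of f] by auto
    have iu: "integrable (measure_pmf \<mu>) (\<lambda>s. u (c, s))" "(\<integral>s. u (c, s) \<partial>\<mu>) = (\<integral>s. v \<bullet> U c s \<partial>\<mu>) - (base.step f c - f c)" if c: "c \<in> V" for c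
      using edge_integrable_cong[of _ u c, OF i(1)[OF c] u[OF c]] edge_integral_cong[of u c, OF u[OF c]] i(2)[OF c] by simp_all
    \<comment> \<open>By stationarity the exact part has total integral zero, so
      \<open>form_chi\<close> takes the same value for every candidate.\<close>
    have "(\<Sum>c\<in>V. \<integral>s. u (c, s) \<partial>\<mu>) = (\<Sum>c\<in>V. \<integral>s. v \<bullet> U c s \<partial>\<mu>)"
      using base.sum_step[of f] by (simp add: iu(2) sum_subtractf)
    moreover have "form_chi G L \<mu> u = (\<Sum>c\<in>V. \<integral>s. u (c, s) \<partial>\<mu>) / real (card V)"
      by (rule form_chi_eq) (rule iu(1))
    ultimately have chi: "form_chi G L \<mu> u = v \<bullet> \<zeta>"
      using integrable_U by (simp add: drift_eq inner_sum_right integral_inner_right)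
    have "base.step (\<lambda>c. v \<bullet> corrector c - f c) c = v \<bullet> corrector c - f c" if c: "c \<in> V" for c
    proof -
      have "form_d_star G L \<mu> u c + form_chi G L \<mu> u = 0"
        using harm c by (simp add: harmonic_form_def diag_V_def)
      then have "(\<integral>s. v \<bullet> U c s \<partial>\<mu>) - (base.step f c - f c) = v \<bullet> \<zeta>"
        unfolding form_d_star_eq[OF c iu(1)[OF c]] chi iu(2)[OF c] by simp
      then have "v \<bullet> corrector c - base.step (\<lambda>c. v \<bullet> corrector c) c = f c - base.step f c"
        using corrector[OF c, of v] by simp
      moreover have "base.step (\<lambda>c. v \<bullet> corrector c - f c) c = base.step (\<lambda>c. v \<bullet> corrector c) c - base.step f c"
        unfolding base.step_def
        using base.integrable_C[OF c, of "\<lambda>c. v \<bullet> corrector c"] base.integrable_C[OF c, of f] by simp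
      ultimately show ?thesis
        by simp
    qed
    from base.harmonic_constant[OF this]
    have const: "v \<bullet> corrector c - f c = v \<bullet> corrector d - f d" if "c \<in> V" "d \<in> V" for c d
      using that by blast
    show "u = u0"
    proof (rule extensionalityI[OF ext])
      show "u0 \<in> extensional E"
        by (simp add: u0_def)
      fix e assume "e \<in> E"
      then obtain c s where cs: "e = (c, s)" "c \<in> V" "s \<in> S'"
        by (auto simp: E_eq)
      have "c #> s \<in> V"
        using cs S'_carrier rcosets_act[OF subgroup_L] by blast
      from const[OF this cs(2)] show "u e = u0 e"
        unfolding cs(1) u[OF cs(2,3)] u0[OF cs(2,3)] by (simp add: Xi_def inner_diff_right)
    qed
  qed
  ultimately have "harmonic_part G L \<mu> (hat_form G \<iota> D v) = u0"
    unfolding harmonic_part_def by (rule the_equality)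
  then show ?thesis
    using u0[OF assms] by simp
qed

end

lemma matrix_mult_nth: "(A ** B) $ i $ j = (\<Sum>k\<in>UNIV. A $ i $ k * B $ k $ j)"
  by (simp add: matrix_matrix_mult_def)

section \<open>The covariance matrix\<close>

text \<open>Gram-Schmidt for the inner product defined by \<open>M\<close>: while there are fewer
  vectors than the dimension, some \<open>x\<close> lies outside their span, and what remains of it
  after projection can be normalised.\<close>

lemma pos_def_orthonormal_set:
  fixes M :: "real ^ 'm ^ 'm"
  assumes M: "pos_def_matrix M" and k: "k \<le> CARD('m)"
  shows "\<exists>S. finite S \<and> card S = k \<and> (\<forall>x\<in>S. \<forall>y\<in>S. x \<bullet> (M *v y) = of_bool (x = y))"
  using k
proof (induction k)
  case 0
  show ?case
    by (intro exI[of _ "{}"]) simp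
next
  case (Suc k)
  then obtain S where S: "finite S" "card S = k" "\<And>x y. x \<in> S \<Longrightarrow> y \<in> S \<Longrightarrow> x \<bullet> (M *v y) = of_bool (x = y)"
    by auto
  have sym: "x \<bullet> (M *v y) = y \<bullet> (M *v x)" for x y
    using M unfolding pos_def_matrix_def
    by (metis dot_lmul_matrix inner_commute transpose_matrix_vector)
  have "dim (span S) \<le> card S"
    using S(1) by (simp add: dim_le_card')
  then have "span S \<noteq> UNIV"
    using Suc.prems S(2) by (metis DIM_cart DIM_real Suc_n_not_le_n dim_UNIV le_trans mult.right_neutral)
  then obtain x where x: "x \<notin> span S"
    by blast
  define y where "y = x - (\<Sum>s\<in>S. (s \<bullet> (M *v x)) *\<^sub>R s)"
  have "(\<Sum>s\<in>S. (s \<bullet> (M *v x)) *\<^sub>R s) \<in> span S"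
    by (intro span_sum span_scale span_base)
  then have "y \<noteq> 0"
    using x by (auto simp: y_def)
  then have By: "y \<bullet> (M *v y) > 0"
    using M by (simp add: pos_def_matrix_def)
  have orth: "t \<bullet> (M *v y) = 0" if t: "t \<in> S" for t
  proof -
    have "t \<bullet> (M *v y) = t \<bullet> (M *v x) - (\<Sum>s\<in>S. (s \<bullet> (M *v x)) * (t \<bullet> (M *v s)))"
      by (simp add: y_def matrix_vector_mult_diff_distrib inner_diff_right linear_sum[OF matrix_vector_mul_linear]
          inner_sum_right matrix_vector_mult_scaleR)
    also have "(\<Sum>s\<in>S. (s \<bullet> (M *v x)) * (t \<bullet> (M *v s))) = (\<Sum>s\<in>S. if s = t then t \<bullet> (M *v x) else 0)"
      using S(3)[OF t] by (intro sum.cong) auto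
    also have "\<dots> = t \<bullet> (M *v x)"
      using S(1) t by simp
    finally show ?thesis
      by simp
  qed
  define z where "z = (1 / sqrt (y \<bullet> (M *v y))) *\<^sub>R y"
  have Bz: "z \<bullet> (M *v z) = 1"
    using By by (simp add: z_def matrix_vector_mult_scaleR real_sqrt_mult_self)
  have oz: "t \<bullet> (M *v z) = 0" "z \<bullet> (M *v t) = 0" if "t \<in> S" for t
    using orth[OF that] sym[of z t] by (simp_all add: z_def matrix_vector_mult_scaleR)
  have "z \<notin> S"
    using oz Bz by force
  then show ?case
    using S Bz oz by (intro exI[of _ "insert z S"]) auto
qed

text \<open>The rows of \<open>H\<close> form an orthonormal basis for the inner product of
  \<open>M\<close>. In probabilistic terms, \<open>H\<close> maps a vector with covariance
  \<open>M\<close> to one with identity covariance.\<close>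

lemma pos_def_whitening:
  fixes M :: "real ^ 'm ^ 'm"
  assumes "pos_def_matrix M"
  shows "\<exists>H :: real ^ 'm ^ 'm. H ** M ** transpose H = mat 1"
proof -
  obtain S where S: "finite S" "card S = CARD('m)" "\<And>x y. x \<in> S \<Longrightarrow> y \<in> S \<Longrightarrow> x \<bullet> (M *v y) = of_bool (x = y)"
    using pos_def_orthonormal_set[OF assms order.refl] by blast
  obtain h where h: "bij_betw h (UNIV :: 'm set) S"
    using S finite_same_card_bij[of "UNIV :: 'm set" S] by auto
  define H where "H = (\<chi> i. h i)"
  have "(H ** M ** transpose H) $ i $ j = h i \<bullet> (M *v h j)" for i j
  proof -
    have "(H ** M ** transpose H) $ i $ j = (H ** (M ** transpose H)) $ i $ j"
      by (simp add: matrix_mul_assoc)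
    also have "\<dots> = h i \<bullet> (M *v h j)"
      by (simp add: matrix_mult_nth inner_vec_def matrix_vector_mult_def H_def transpose_def)
    finally show ?thesis .
  qed
  moreover have "h i \<bullet> (M *v h j) = of_bool (i = j)" for i j
    using S(3)[of "h i" "h j"] bij_betw_apply[OF h] bij_betw_imp_inj_on[OF h] by (auto simp: inj_on_eq_iff)
  ultimately have "H ** M ** transpose H = mat 1"
    by (simp add: vec_eq_iff mat_def)
  then show ?thesis
    by blast
qed

lemma matrix_inv_eqI:
  fixes A B :: "real ^ 'n ^ 'n"
  assumes "A ** B = mat 1" "B ** A = mat 1"
  shows "matrix_inv A = B"
proof -
  have "A ** matrix_inv A = mat 1 \<and> matrix_inv A ** A = mat 1"
    unfolding matrix_inv_def using assms by (intro someI[of "\<lambda>A'. A ** A' = mat 1 \<and> A' ** A = mat 1"]) simp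
  then have "matrix_inv A = matrix_inv A ** (A ** B)" "(matrix_inv A ** A) ** B = B"
    using assms by simp_all
  then show ?thesis
    by (simp add: matrix_mul_assoc)
qed

locale whitening =
  fixes M H :: "real ^ 'm ^ 'm"
  assumes whiten: "H ** M ** transpose H = mat 1"
begin

lemma inverse_M: "M ** (transpose H ** H) = mat 1" "(transpose H ** H) ** M = mat 1"
proof -
  have "(M ** transpose H) ** H = mat 1"
    using whiten by (metis matrix_left_right_inverse matrix_mul_assoc)
  then show "M ** (transpose H ** H) = mat 1"
    by (simp add: matrix_mul_assoc)
  then show "(transpose H ** H) ** M = mat 1"
    by (simp add: matrix_left_right_inverse)
qed

lemma inj_H: "inj (\<lambda>x. H *v x)"
proof -
  have "(M ** transpose H) ** H = mat 1"
    using whiten by (metis matrix_left_right_inverse matrix_mul_assoc)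
  then have "(M ** transpose H) *v (H *v x) = x" for x
    by (simp add: matrix_vector_mul_assoc)
  then show ?thesis
    by (metis injI)
qed

lemma norm_H: "x \<bullet> ((transpose H ** H) *v x) = (norm (H *v x))\<^sup>2"
proof -
  have "x \<bullet> ((transpose H ** H) *v x) = x \<bullet> (transpose H *v (H *v x))"
    by (simp add: matrix_vector_mul_assoc)
  also have "\<dots> = (H *v x) \<bullet> (H *v x)"
    by (metis dot_lmul_matrix inner_commute transpose_matrix_vector)
  finally show ?thesis
    by (simp add: power2_norm_eq_inner)
qed

lemma transpose_H_inner: "(transpose H *v t) \<bullet> x = t \<bullet> (H *v x)"
  by (metis dot_lmul_matrix transpose_matrix_vector)

lemma quadratic_transpose_H: "(transpose H *v t) \<bullet> (M *v (transpose H *v t)) = (norm t)\<^sup>2"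
proof -
  have "(transpose H *v t) \<bullet> (M *v (transpose H *v t)) = t \<bullet> ((H ** M ** transpose H) *v t)"
    unfolding transpose_H_inner by (simp add: matrix_vector_mul_assoc matrix_mul_assoc del: transpose_matrix_vector)
  then show ?thesis
    by (simp add: whiten power2_norm_eq_inner)
qed

text \<open>The inverse of \<open>M\<close> is the product of \<open>transpose H\<close> and
  \<open>H\<close>, so the quadratic form becomes the Euclidean norm after applying
  \<open>H\<close>. The constant \<open>K\<close> stays implicit because it cancels in the
  normalised Gaussian, provided that it is nonzero.\<close>

lemma gauss_density_eq:
  assumes "n > 0"
  shows "\<exists>K. K \<noteq> 0 \<and> (\<forall>x. gauss_density (n *\<^sub>R M) x = K * gauss (sqrt n) (H *v x))"
proof -
  have prod: "(n *\<^sub>R M) ** ((1 / n) *\<^sub>R (transpose H ** H)) = mat 1" "((1 / n) *\<^sub>R (transpose H ** H)) ** (n *\<^sub>R M) = mat 1"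
    using assms inverse_M
    by (simp_all add: matrix_matrix_mult_def vec_eq_iff mat_def)
  have inv: "matrix_inv (n *\<^sub>R M) = (1 / n) *\<^sub>R (transpose H ** H)"
    by (rule matrix_inv_eqI[OF prod])
  have "invertible (n *\<^sub>R M)"
    unfolding invertible_def using prod by blast
  then have det: "det (n *\<^sub>R M) \<noteq> 0"
    by (simp add: invertible_det_nz)
  define K where "K = (2 * pi) powr (- (real CARD('m) / 2)) * det (n *\<^sub>R M) powr (- (1 / 2)) * (sqrt (2 * pi) * sqrt n) ^ CARD('m)"
  have "gauss_density (n *\<^sub>R M) x = K * gauss (sqrt n) (H *v x)" for x
  proof -
    have "x \<bullet> (matrix_inv (n *\<^sub>R M) *v x) = (norm (H *v x))\<^sup>2 / n"
      unfolding inv by (simp add: scaleR_matrix_vector_assoc[symmetric] norm_H)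
    then show ?thesis
      using assms by (simp add: gauss_density_def gauss_def K_def)
  qed
  moreover have "K \<noteq> 0"
    using det assms by (simp add: K_def)
  ultimately show ?thesis
    by blast
qed

end

section \<open>The covariance of the corrected increments and its nondegeneracy\<close>

context va_walk
begin

definition cov :: "real ^ 'm ^ 'm" where
  "cov = (\<chi> i j. (\<Sum>c\<in>V. \<integral>s. Xi c s $ i * Xi c s $ j \<partial>\<mu>) / real (card V) - \<zeta> $ i * \<zeta> $ j)"

lemma cov_inner:
  "v \<bullet> (cov *v w) = (\<Sum>c\<in>V. \<integral>s. (v \<bullet> Xi c s) * (w \<bullet> Xi c s) \<partial>\<mu>) / real (card V) - (v \<bullet> \<zeta>) * (w \<bullet> \<zeta>)"
proof -
  have int: "integrable (measure_pmf \<mu>) (\<lambda>s. Xi c s $ i * Xi c s $ j)" if "c \<in> V" for c i j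
    using integrable_Xi_mult[OF that, of "axis i 1" "axis j 1"] by (simp add: inner_axis')
  have expand: "(v \<bullet> x) * (w \<bullet> x) = (\<Sum>i\<in>UNIV. \<Sum>j\<in>UNIV. (v $ i * w $ j) * (x $ i * x $ j))" for x :: "real ^ 'm"
    by (simp add: inner_vec_def sum_product mult_ac)
  have "(\<integral>s. (v \<bullet> Xi c s) * (w \<bullet> Xi c s) \<partial>\<mu>) = (\<Sum>i\<in>UNIV. \<Sum>j\<in>UNIV. (v $ i * w $ j) * (\<integral>s. Xi c s $ i * Xi c s $ j \<partial>\<mu>))"
    if c: "c \<in> V" for c
    unfolding expand using int[OF c] by (simp add: Bochner_Integration.integral_sum)
  then have "(\<Sum>c\<in>V. \<integral>s. (v \<bullet> Xi c s) * (w \<bullet> Xi c s) \<partial>\<mu>)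
      = (\<Sum>c\<in>V. \<Sum>i\<in>UNIV. \<Sum>j\<in>UNIV. (v $ i * w $ j) * (\<integral>s. Xi c s $ i * Xi c s $ j \<partial>\<mu>))"
    by simp
  also have "\<dots> = (\<Sum>i\<in>UNIV. \<Sum>j\<in>UNIV. (v $ i * w $ j) * (\<Sum>c\<in>V. \<integral>s. Xi c s $ i * Xi c s $ j \<partial>\<mu>))"
    by (subst sum.swap, intro sum.cong refl, subst sum.swap) (simp add: sum_distrib_left)
  finally have 1: "(\<Sum>c\<in>V. \<integral>s. (v \<bullet> Xi c s) * (w \<bullet> Xi c s) \<partial>\<mu>) = \<dots>" .
  have split: "(\<Sum>i\<in>UNIV. \<Sum>j\<in>UNIV. a i j * (b i j / k - z i j))
      = (\<Sum>i\<in>UNIV. \<Sum>j\<in>UNIV. a i j * b i j) / k - (\<Sum>i\<in>UNIV. \<Sum>j\<in>UNIV. a i j * z i j)"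
    for a b z :: "'m \<Rightarrow> 'm \<Rightarrow> real" and k
    by (simp add: right_diff_distrib sum_subtractf sum_divide_distrib)
  have "v \<bullet> (cov *v w) = (\<Sum>i\<in>UNIV. \<Sum>j\<in>UNIV. (v $ i * w $ j) * (cov $ i $ j))"
    by (simp add: inner_vec_def matrix_vector_mult_def sum_distrib_left mult_ac)
  also have "\<dots> = (\<Sum>i\<in>UNIV. \<Sum>j\<in>UNIV. (v $ i * w $ j) * (\<Sum>c\<in>V. \<integral>s. Xi c s $ i * Xi c s $ j \<partial>\<mu>)) / real (card V)
      - (\<Sum>i\<in>UNIV. \<Sum>j\<in>UNIV. (v $ i * w $ j) * (\<zeta> $ i * \<zeta> $ j))"
    unfolding cov_def vec_lambda_beta by (rule split)
  finally show ?thesis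
    unfolding 1 expand[of \<zeta>] .
qed

text \<open>Since the mean increment is the same at every vertex, the global second moment minus the
  squared drift is an average of local variances.\<close>

lemma cov_quadratic:
  "v \<bullet> (cov *v v) = (\<Sum>c\<in>V. \<integral>s. (v \<bullet> Xi c s - v \<bullet> \<zeta>)\<^sup>2 \<partial>\<mu>) / real (card V)"
proof -
  have "(\<integral>s. (v \<bullet> Xi c s - v \<bullet> \<zeta>)\<^sup>2 \<partial>\<mu>) = (\<integral>s. (v \<bullet> Xi c s) * (v \<bullet> Xi c s) \<partial>\<mu>) - (v \<bullet> \<zeta>)\<^sup>2" if c: "c \<in> V" for c
  proof -
    have i: "integrable (measure_pmf \<mu>) (\<lambda>s. (v \<bullet> Xi c s) * (v \<bullet> Xi c s))" "integrable (measure_pmf \<mu>) (\<lambda>s. v \<bullet> Xi c s)"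
      using integrable_Xi_mult[OF c] integrable_Xi[OF c] by auto
    have "(\<integral>s. (v \<bullet> Xi c s - v \<bullet> \<zeta>)\<^sup>2 \<partial>\<mu>) = (\<integral>s. (v \<bullet> Xi c s) * (v \<bullet> Xi c s) - (2 * (v \<bullet> \<zeta>)) * (v \<bullet> Xi c s) + (v \<bullet> \<zeta>)\<^sup>2 \<partial>\<mu>)"
      by (intro Bochner_Integration.integral_cong) (auto simp: power2_eq_square algebra_simps)
    also have "\<dots> = (\<integral>s. (v \<bullet> Xi c s) * (v \<bullet> Xi c s) \<partial>\<mu>) - (2 * (v \<bullet> \<zeta>)) * (\<integral>s. v \<bullet> Xi c s \<partial>\<mu>) + (v \<bullet> \<zeta>)\<^sup>2"
      using i by simp
    finally show ?thesis
      unfolding integral_Xi[OF c] by (simp add: power2_eq_square)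
  qed
  then have "(\<Sum>c\<in>V. \<integral>s. (v \<bullet> Xi c s - v \<bullet> \<zeta>)\<^sup>2 \<partial>\<mu>) = (\<Sum>c\<in>V. \<integral>s. (v \<bullet> Xi c s) * (v \<bullet> Xi c s) \<partial>\<mu>) - real (card V) * (v \<bullet> \<zeta>)\<^sup>2"
    by (simp add: sum_subtractf)
  then show ?thesis
    unfolding cov_inner using base.card_C by (simp add: diff_divide_distrib power2_eq_square)
qed

lemma Xi_coset:
  assumes "g \<in> carrier G" "s \<in> carrier G"
  shows "Xi (L #> g) s = (real_vec (\<Phi> (g \<otimes> s)) - corrector (L #> (g \<otimes> s))) - (real_vec (\<Phi> g) - corrector (L #> g))"
  unfolding Xi_def edge_potential_eq[OF assms] base.coset_mult[OF assms] by simp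

lemma integrable_centered_square:
  "c \<in> V \<Longrightarrow> integrable (measure_pmf \<mu>) (\<lambda>s. (v \<bullet> Xi c s - v \<bullet> \<zeta>)\<^sup>2)"
  unfolding power2_diff using integrable_Xi_mult[of c v v] integrable_Xi[of c]
  by (auto simp: power2_eq_square)

text \<open>If the variance in direction \<open>v\<close> vanishes, the corrected potential along
  \<open>v\<close> grows by exactly \<open>v \<bullet> \<zeta>\<close> per step on every path. A
  return to the identity forces \<open>v \<bullet> \<zeta> = 0\<close>. Reaching a basis
  translation, which lies in the coset of the identity and so has the same corrector, then forces
  the corresponding component of \<open>v\<close> to vanish.\<close>

theorem cov_pos_def: "pos_def_matrix cov"
  unfolding pos_def_matrix_def
proof (intro conjI allI impI)
  show "transpose cov = cov"
    by (simp add: cov_def transpose_def vec_eq_iff mult.commute)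
  fix v :: "real ^ 'm" assume v: "v \<noteq> 0"
  have nn: "(\<integral>s. (v \<bullet> Xi c s - v \<bullet> \<zeta>)\<^sup>2 \<partial>\<mu>) \<ge> 0" for c
    by (intro integral_nonneg_AE) auto
  have "v \<bullet> (cov *v v) \<ge> 0"
    unfolding cov_quadratic using nn by (intro divide_nonneg_nonneg sum_nonneg) auto
  moreover have "v \<bullet> (cov *v v) \<noteq> 0"
  proof
    assume "v \<bullet> (cov *v v) = 0"
    then have "(\<Sum>c\<in>V. \<integral>s. (v \<bullet> Xi c s - v \<bullet> \<zeta>)\<^sup>2 \<partial>\<mu>) = 0"
      unfolding cov_quadratic using base.card_C by simp
    then have z: "(\<integral>s. (v \<bullet> Xi c s - v \<bullet> \<zeta>)\<^sup>2 \<partial>\<mu>) = 0" if "c \<in> V" for c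
      using that nn finite_rcosets by (subst (asm) sum_nonneg_eq_0_iff) auto
    have eq: "v \<bullet> Xi c s = v \<bullet> \<zeta>" if c: "c \<in> V" and s: "s \<in> set_pmf \<mu>" for c s
    proof -
      have "AE s in \<mu>. (v \<bullet> Xi c s - v \<bullet> \<zeta>)\<^sup>2 = 0"
        using z[OF c] integral_nonneg_eq_0_iff_AE[OF integrable_centered_square[OF c, of v]] by simp
      then show ?thesis
        using s by (simp add: AE_measure_pmf_iff)
    qed
    define \<Psi> where "\<Psi> = (\<lambda>g. v \<bullet> (real_vec (\<Phi> g) - corrector (L #> g)))"
    have path: "\<Psi> g = \<Psi> \<one> + real n * (v \<bullet> \<zeta>)" if "g \<in> set_pmf (cp n)" for n g
      using that
    proof (induction n arbitrary: g)
      case (Suc n)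
      then obtain x s where x: "x \<in> set_pmf (cp n)" and s: "s \<in> set_pmf \<mu>" and g: "g = x \<otimes> s"
        by auto
      have "\<Psi> g = \<Psi> x + v \<bullet> Xi (L #> x) s"
        unfolding g Xi_coset[OF cp_carrier[OF x] mu_carrier[OF s]] \<Psi>_def by (simp add: inner_diff_right)
      also have "\<dots> = \<Psi> \<one> + real n * (v \<bullet> \<zeta>) + v \<bullet> \<zeta>"
        unfolding Suc.IH[OF x] eq[OF base.coset_in_C[OF cp_carrier[OF x]] s] ..
      finally show ?case
        by (simp add: algebra_simps)
    qed simp
    obtain n where n: "n > 0" "\<one> \<in> set_pmf (cp n)"
      using reachable[OF one_closed] by (auto simp: set_pmf_iff)
    have z0: "v \<bullet> \<zeta> = 0"
      using path[OF n(2)] n(1) by simp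
    have "v $ i = 0" for i
    proof -
      obtain n where n: "\<iota> (axis i 1) \<in> set_pmf (cp n)"
        using reachable[OF iota_closed] by (metis less_irrefl set_pmf_iff)
      have "\<Phi> (\<iota> (axis i 1)) = axis i 1 + \<Phi> \<one>"
        using potential_iota[OF one_closed, of "axis i 1"] by simp
      moreover have "L #> \<iota> (axis i 1) = L #> \<one>"
        using coset_iota[OF one_closed, of "axis i 1"] by simp
      ultimately have "v \<bullet> axis i 1 = 0"
        using path[OF n] z0 by (simp add: \<Psi>_def real_vec_add real_vec_axis inner_add_right inner_diff_right)
      then show ?thesis
        by (simp add: inner_axis)
    qed
    then show False
      using v by (simp add: vec_eq_iff)
  qed
  ultimately show "0 < v \<bullet> (cov *v v)"
    by simp
qed

theorem cov_harmonic:
  fixes v1 v2 :: "real ^ 'm"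
  defines "u1 \<equiv> harmonic_part G L \<mu> (hat_form G \<iota> D v1)" and "u2 \<equiv> harmonic_part G L \<mu> (hat_form G \<iota> D v2)"
  shows "v1 \<bullet> (cov *v v2) = (\<Sum>\<^sub>\<infinity>e\<in>E. u1 e * u2 e * edge_weight G L \<mu> e)
      - (\<Sum>\<^sub>\<infinity>e\<in>E. u1 e * edge_weight G L \<mu> e) * (\<Sum>\<^sub>\<infinity>e\<in>E. u2 e * edge_weight G L \<mu> e)"
proof -
  have u: "u1 e = v1 \<bullet> Xi (fst e) (snd e)" "u2 e = v2 \<bullet> Xi (fst e) (snd e)" if "e \<in> E" for e
    using that harmonic_part_hat_form by (auto simp: E_eq u1_def u2_def)
  have s1: "(\<Sum>\<^sub>\<infinity>e\<in>E. (v \<bullet> Xi (fst e) (snd e)) * edge_weight G L \<mu> e) = v \<bullet> \<zeta>" for v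
  proof -
    have "((\<lambda>e. edge_weight G L \<mu> e *\<^sub>R (v \<bullet> Xi (fst e) (snd e))) has_sum
        ((1 / real (card V)) *\<^sub>R (\<Sum>c\<in>V. \<integral>s. v \<bullet> Xi (fst (c, s)) (snd (c, s)) \<partial>\<mu>))) E"
      by (rule edge_has_sum) (use integrable_Xi in auto)
    moreover have "(1 / real (card V)) *\<^sub>R (\<Sum>c\<in>V. \<integral>s. v \<bullet> Xi (fst (c, s)) (snd (c, s)) \<partial>\<mu>) = v \<bullet> \<zeta>"
      using base.card_C by (simp add: integral_Xi)
    ultimately show ?thesis
      by (intro infsumI) (simp add: mult.commute)
  qed
  have s2: "(\<Sum>\<^sub>\<infinity>e\<in>E. ((v1 \<bullet> Xi (fst e) (snd e)) * (v2 \<bullet> Xi (fst e) (snd e))) * edge_weight G L \<mu> e)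
     = (\<Sum>c\<in>V. \<integral>s. (v1 \<bullet> Xi c s) * (v2 \<bullet> Xi c s) \<partial>\<mu>) / real (card V)"
  proof -
    have "((\<lambda>e. edge_weight G L \<mu> e *\<^sub>R ((v1 \<bullet> Xi (fst e) (snd e)) * (v2 \<bullet> Xi (fst e) (snd e)))) has_sum
        ((1 / real (card V)) *\<^sub>R (\<Sum>c\<in>V. \<integral>s. (v1 \<bullet> Xi (fst (c, s)) (snd (c, s))) * (v2 \<bullet> Xi (fst (c, s)) (snd (c, s))) \<partial>\<mu>))) E"
      by (rule edge_has_sum) (use integrable_Xi_mult in auto)
    then show ?thesis
      by (intro infsumI) (simp add: mult.commute)
  qed
  have "(\<Sum>\<^sub>\<infinity>e\<in>E. u1 e * u2 e * edge_weight G L \<mu> e)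
      = (\<Sum>\<^sub>\<infinity>e\<in>E. ((v1 \<bullet> Xi (fst e) (snd e)) * (v2 \<bullet> Xi (fst e) (snd e))) * edge_weight G L \<mu> e)"
    by (rule infsum_cong) (simp add: u)
  moreover have "(\<Sum>\<^sub>\<infinity>e\<in>E. u1 e * edge_weight G L \<mu> e) = v1 \<bullet> \<zeta>" "(\<Sum>\<^sub>\<infinity>e\<in>E. u2 e * edge_weight G L \<mu> e) = v2 \<bullet> \<zeta>"
    unfolding s1[symmetric] by (rule infsum_cong, simp add: u)+
  ultimately show ?thesis
    unfolding s2 cov_inner by simp
qed

end

lemma infsum_le_nn_integral:
  fixes f :: "'c \<Rightarrow> ennreal"
  shows "infsum f A \<le> (\<integral>\<^sup>+x. f x \<partial>count_space A)"
proof (rule infsum_le_finite_sums)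
  show "f summable_on A"
    by (rule nonneg_summable_on_complete) simp
  fix F assume F: "finite F" "F \<subseteq> A"
  have "sum f F = (\<integral>\<^sup>+x. f x \<partial>count_space F)"
    using F(1) by (simp add: nn_integral_count_space_finite)
  also have "\<dots> = (\<integral>\<^sup>+x. f x * indicator F x \<partial>count_space UNIV)"
    by (rule nn_integral_count_space_indicator) simp
  also have "\<dots> \<le> (\<integral>\<^sup>+x. f x * indicator A x \<partial>count_space UNIV)"
    using F(2) by (intro nn_integral_mono) (auto simp: indicator_def)
  also have "\<dots> = (\<integral>\<^sup>+x. f x \<partial>count_space A)"
    by (rule nn_integral_count_space_indicator[symmetric]) simp
  finally show "sum f F \<le> (\<integral>\<^sup>+x. f x \<partial>count_space A)" .
qed

section \<open>Decomposition of the group into classes modulo the multiples of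
  \<open>r\<close>\<close>

context va_group
begin

definition emb :: "nat \<Rightarrow> 'a \<Rightarrow> int ^ 'm \<Rightarrow> 'a" where
  "emb r y v = \<iota> (int r *s v) \<otimes> y"

definition sublat :: "nat \<Rightarrow> 'a set" where
  "sublat r = range (\<lambda>v. \<iota> (int r *s v))"

definition box :: "nat \<Rightarrow> (int ^ 'm) set" where
  "box r = {w. \<forall>i. 0 \<le> w $ i \<and> w $ i < int r}"

text \<open>Representatives of the right cosets of \<open>sublat r\<close>: a residue vector modulo
  \<open>r\<close> times an element of \<open>D\<close>. The case \<open>r = 1\<close> gives back
  \<open>D\<close>.\<close>

definition Rep :: "nat \<Rightarrow> 'a set" where
  "Rep r = (\<lambda>(w, x). \<iota> w \<otimes> x) ` (box r \<times> D)"

lemma Rep_1: "Rep 1 = D"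
proof -
  have "box 1 = {0}"
  proof (intro subset_antisym subsetI)
    fix w :: "int ^ 'm" assume "w \<in> box 1"
    then have "w $ i = 0" for i
      unfolding box_def mem_Collect_eq by (metis of_nat_1 order_antisym zless_add1_eq add_0 linorder_not_less)
    then show "w \<in> {0}"
      by (simp add: vec_eq_iff)
  qed (simp add: box_def)
  then show ?thesis
    using D_carrier by (auto simp: Rep_def image_iff)
qed

lemma finite_box: "finite (box r)"
proof -
  have "box r \<subseteq> (\<lambda>f. \<chi> i. f i) ` (PiE UNIV (\<lambda>_. {0..<int r}))"
  proof
    fix w :: "int ^ 'm" assume "w \<in> box r"
    then have "(\<lambda>i. w $ i) \<in> PiE UNIV (\<lambda>_. {0..<int r})"
      by (auto simp: box_def)
    then show "w \<in> (\<lambda>f. \<chi> i. f i) ` (PiE UNIV (\<lambda>_. {0..<int r}))"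
      by (rule rev_image_eqI) (simp add: vec_eq_iff)
  qed
  then show ?thesis
    by (rule finite_subset) (intro finite_imageI finite_PiE, auto)
qed

lemma finite_Rep: "finite (Rep r)"
  unfolding Rep_def using finite_box finite_D by auto

lemma Rep_carrier: "y \<in> Rep r \<Longrightarrow> y \<in> carrier G"
  using D_carrier by (auto simp: Rep_def)

lemma emb_carrier: "y \<in> carrier G \<Longrightarrow> emb r y v \<in> carrier G"
  by (simp add: emb_def)

lemma int_smult_add: "int r *s (v + w) = int r *s v + int r *s w"
  by (simp add: vec_eq_iff algebra_simps)

lemma emb_shift: "y \<in> carrier G \<Longrightarrow> \<iota> (int r *s w) \<otimes> emb r y v = emb r y (w + v)"
  by (simp add: emb_def iota_add int_smult_add m_assoc)

lemma inj_emb: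
  assumes "r > 0" "y \<in> carrier G"
  shows "inj (emb r y)"
proof (rule injI)
  fix v w assume "emb r y v = emb r y w"
  then have "int r *s v = int r *s w"
    using assms by (simp add: emb_def iota_eq_iff)
  then show "v = w"
    using assms by (simp add: vec_eq_iff)
qed

lemma potential_emb: "y \<in> carrier G \<Longrightarrow> real_vec (\<Phi> (emb r y v)) = real r *\<^sub>R real_vec v + real_vec (\<Phi> y)"
  by (simp add: emb_def potential_iota real_vec_add) (simp add: real_vec_def vec_eq_iff)

lemma ex_emb:
  assumes r: "r > 0" and g: "g \<in> carrier G"
  shows "\<exists>y\<in>Rep r. g \<in> range (emb r y)"
proof -
  obtain u x where u: "x \<in> D" "g = \<iota> u \<otimes> x"
    using ex_decomposition[OF g] by blast
  define v w where "v = (\<chi> i. u $ i div int r)" and "w = (\<chi> i. u $ i mod int r)"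
  have "u = int r *s v + w"
    by (simp add: v_def w_def vec_eq_iff)
  moreover have "w \<in> box r"
    using r by (simp add: box_def w_def)
  ultimately have "\<iota> w \<otimes> x \<in> Rep r" "g = emb r (\<iota> w \<otimes> x) v"
    using u D_carrier by (auto simp: Rep_def emb_def iota_add m_assoc)
  then show ?thesis
    by blast
qed

lemma emb_unique:
  assumes r: "r > 0" and y: "y \<in> Rep r" "y' \<in> Rep r" and eq: "emb r y v = emb r y' v'"
  shows "y = y'"
proof -
  obtain w x where w: "w \<in> box r" "x \<in> D" "y = \<iota> w \<otimes> x"
    using y by (auto simp: Rep_def)
  obtain w' x' where w': "w' \<in> box r" "x' \<in> D" "y' = \<iota> w' \<otimes> x'"
    using y by (auto simp: Rep_def)
  have "\<iota> (int r *s v + w) \<otimes> x = \<iota> (int r *s v' + w') \<otimes> x'"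
    using eq w w' D_carrier by (simp add: emb_def iota_add m_assoc)
  from decomposition_unique[OF w(2) w'(2) this]
  have e: "int r *s v + w = int r *s v' + w'" and x: "x = x'" .
  have "w $ i = w' $ i" for i
  proof -
    have "(int r *s v + w) $ i mod int r = w $ i" "(int r *s v' + w') $ i mod int r = w' $ i"
      using w(1) w'(1) by (auto simp: box_def)
    then show ?thesis
      unfolding e by (rule trans[OF sym])
  qed
  then have "w = w'"
    by (simp add: vec_eq_iff)
  then show ?thesis
    using w w' x by simp
qed

lemma nn_integral_carrier:
  assumes r: "r > 0"
  shows "(\<integral>\<^sup>+g. h g \<partial>count_space (carrier G)) = (\<Sum>y\<in>Rep r. \<integral>\<^sup>+v. h (emb r y v) \<partial>count_space UNIV)"
proof -
  have one: "h g = (\<Sum>y\<in>Rep r. h g * indicator (range (emb r y)) g)" if g: "g \<in> carrier G" for g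
  proof -
    obtain y where y: "y \<in> Rep r" "g \<in> range (emb r y)"
      using ex_emb[OF r g] by blast
    have "(\<Sum>y'\<in>Rep r. h g * indicator (range (emb r y')) g) = (\<Sum>y'\<in>Rep r. if y' = y then h g else 0)"
      using y emb_unique[OF r y(1)] by (intro sum.cong) (auto simp: indicator_def)
    then show ?thesis
      using y(1) finite_Rep by simp
  qed
  have "(\<integral>\<^sup>+g. h g \<partial>count_space (carrier G)) = (\<integral>\<^sup>+g. (\<Sum>y\<in>Rep r. h g * indicator (range (emb r y)) g) \<partial>count_space (carrier G))"
    using one by (intro nn_integral_cong) simp
  also have "\<dots> = (\<Sum>y\<in>Rep r. \<integral>\<^sup>+g. h g * indicator (range (emb r y)) g \<partial>count_space (carrier G))"
    by (intro nn_integral_sum) simp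
  also have "\<dots> = (\<Sum>y\<in>Rep r. \<integral>\<^sup>+v. h (emb r y v) \<partial>count_space UNIV)"
  proof (intro sum.cong refl)
    fix y assume y: "y \<in> Rep r"
    have sub: "range (emb r y) \<subseteq> carrier G"
      using emb_carrier Rep_carrier[OF y] by auto
    have "(\<integral>\<^sup>+g. h g * indicator (range (emb r y)) g \<partial>count_space (carrier G)) = (\<integral>\<^sup>+g. h g \<partial>count_space (range (emb r y)))"
    proof -
      have "(\<integral>\<^sup>+g. h g * indicator (range (emb r y)) g \<partial>count_space (carrier G))
          = (\<integral>\<^sup>+g. h g * indicator (range (emb r y)) g * indicator (carrier G) g \<partial>count_space UNIV)"
        by (rule nn_integral_count_space_indicator) simp
      also have "\<dots> = (\<integral>\<^sup>+g. h g * indicator (range (emb r y)) g \<partial>count_space UNIV)"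
        using sub by (intro nn_integral_cong) (auto simp: indicator_def)
      also have "\<dots> = (\<integral>\<^sup>+g. h g \<partial>count_space (range (emb r y)))"
        by (rule nn_integral_count_space_indicator[symmetric]) simp
      finally show ?thesis .
    qed
    also have "\<dots> = (\<integral>\<^sup>+v. h (emb r y v) \<partial>count_space UNIV)"
      by (rule nn_integral_bij_count_space[symmetric]) (use inj_emb[OF r Rep_carrier[OF y]] in \<open>simp add: bij_betw_def\<close>)
    finally show "(\<integral>\<^sup>+g. h g * indicator (range (emb r y)) g \<partial>count_space (carrier G)) = \<dots>" .
  qed
  finally show ?thesis .
qed

lemma subgroup_sublat: "subgroup (sublat r) G"
proof (rule subgroupI)
  show "sublat r \<subseteq> carrier G" "sublat r \<noteq> {}"
    by (auto simp: sublat_def)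
  fix a assume "a \<in> sublat r"
  then obtain v where v: "a = \<iota> (int r *s v)"
    by (auto simp: sublat_def)
  have "inv a = \<iota> (int r *s (- v))"
    unfolding v iota_minus[symmetric] by (rule arg_cong[where f=\<iota>]) (simp add: vec_eq_iff)
  then show "inv a \<in> sublat r"
    unfolding sublat_def by (rule range_eqI)
  fix b assume "b \<in> sublat r"
  then obtain w where w: "b = \<iota> (int r *s w)"
    by (auto simp: sublat_def)
  show "a \<otimes> b \<in> sublat r"
    unfolding v w iota_add[symmetric] int_smult_add[symmetric] unfolding sublat_def by (rule rangeI)
qed

lemma sublat_coset: "sublat r #> y = range (emb r y)"
  by (auto simp: sublat_def emb_def r_coset_def)

lemma sublat_coset_eq_iff:
  assumes y: "y \<in> carrier G" and g: "g \<in> carrier G"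
  shows "sublat r #> g = sublat r #> y \<longleftrightarrow> g \<in> range (emb r y)"
proof
  assume "sublat r #> g = sublat r #> y"
  then show "g \<in> range (emb r y)"
    using rcos_self[OF g subgroup_sublat, of r] by (simp only: sublat_coset)
next
  assume "g \<in> range (emb r y)"
  then have "g \<in> sublat r #> y"
    by (simp add: sublat_coset)
  then show "sublat r #> g = sublat r #> y"
    using repr_independence[OF _ y subgroup_sublat] by simp
qed

lemma bij_Rep_rcosets:
  assumes r: "r > 0"
  shows "bij_betw (\<lambda>y. sublat r #> y) (Rep r) (rcosets (sublat r))"
proof (rule bij_betw_imageI)
  show "inj_on (\<lambda>y. sublat r #> y) (Rep r)"
  proof (rule inj_onI)
    fix y y' assume y: "y \<in> Rep r" "y' \<in> Rep r" "sublat r #> y = sublat r #> y'"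
    then obtain v' where v': "y = emb r y' v'"
      using sublat_coset_eq_iff[OF Rep_carrier Rep_carrier] by blast
    have "emb r y 0 = y"
      using Rep_carrier[OF y(1)] by (simp add: emb_def)
    then show "y = y'"
      using emb_unique[OF r y(1,2), of 0 v'] v' by simp
  qed
  show "(\<lambda>y. sublat r #> y) ` Rep r = rcosets (sublat r)"
  proof (intro subset_antisym subsetI)
    fix c assume "c \<in> (\<lambda>y. sublat r #> y) ` Rep r"
    then show "c \<in> rcosets (sublat r)"
      using Rep_carrier unfolding RCOSETS_def by auto
  next
    fix c assume "c \<in> rcosets (sublat r)"
    then obtain g where g: "g \<in> carrier G" "c = sublat r #> g"
      unfolding RCOSETS_def by auto
    obtain y where y: "y \<in> Rep r" "g \<in> range (emb r y)"
      using ex_emb[OF r g(1)] by blast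
    then have "c = sublat r #> y"
      using g(2) sublat_coset_eq_iff[OF Rep_carrier[OF y(1)] g(1)] by blast
    then show "c \<in> (\<lambda>y. sublat r #> y) ` Rep r"
      using y(1) by blast
  qed
qed

text \<open>The bridge from the walk to \<open>euclidean_lattice\<close>, where measures are
  functions of integer vectors: the class of \<open>y\<close> is the injective image of
  \<open>emb r y\<close>.\<close>

lemma class_integral:
  fixes h :: "'a \<Rightarrow> 'd::{banach, second_countable_topology}"
  assumes r: "r > 0" and y: "y \<in> carrier G" and B: "\<And>g. norm (h g) \<le> B"
    and zero: "\<And>g. g \<in> set_pmf p \<Longrightarrow> g \<notin> range (emb r y) \<Longrightarrow> h g = 0"
  shows "integrable (count_space UNIV) (\<lambda>v. pmf p (emb r y v) *\<^sub>R h (emb r y v))"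
    and "(\<integral>v. pmf p (emb r y v) *\<^sub>R h (emb r y v) \<partial>count_space UNIV) = (\<integral>g. h g \<partial>measure_pmf p)"
proof -
  let ?k = "\<lambda>g. pmf p g *\<^sub>R h g"
  have bij: "bij_betw (emb r y) UNIV (range (emb r y))"
    using inj_emb[OF r y] by (simp add: bij_betw_def)
  have "integrable (measure_pmf p) h"
    by (rule integrable_pmf_bounded[where B=B]) (rule B)
  then have abs: "Infinite_Set_Sum.abs_summable_on ?k UNIV"
    unfolding integrable_pmf_count_space by (simp add: Infinite_Set_Sum.abs_summable_on_def)
  then have "Infinite_Set_Sum.abs_summable_on ?k (range (emb r y))"
    by (rule abs_summable_on_subset) simp
  then have "integrable (count_space (range (emb r y))) ?k"
    by (simp add: Infinite_Set_Sum.abs_summable_on_def)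
  then show "integrable (count_space UNIV) (\<lambda>v. pmf p (emb r y v) *\<^sub>R h (emb r y v))"
    by (rule integrable_bij_count_space[OF bij, THEN iffD2])
  have "(\<integral>v. pmf p (emb r y v) *\<^sub>R h (emb r y v) \<partial>count_space UNIV) = infsetsum ?k (range (emb r y))"
    unfolding infsetsum_def by (rule integral_bij_count_space[OF bij])
  also have "\<dots> = infsetsum ?k UNIV"
    by (rule infsetsum_cong_neutral) (use zero in \<open>auto simp: set_pmf_iff\<close>)
  also have "\<dots> = (\<integral>g. h g \<partial>measure_pmf p)"
    unfolding infsetsum_def measure_pmf_eq_density by (subst integral_density) simp_all
  finally show "(\<integral>v. pmf p (emb r y v) *\<^sub>R h (emb r y v) \<partial>count_space UNIV) = (\<integral>g. h g \<partial>measure_pmf p)" .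
qed

end

section \<open>Almost invariance under translations as a length on the group\<close>

context group_walk
begin

text \<open>The dual form of an \<open>\<ell>1\<close> bound on the difference of
  \<open>cp M\<close> and its translate by \<open>a\<close>. The number \<open>\<delta>\<close>
  behaves like a length of \<open>a\<close>: zero at the identity, subadditive, symmetric. Bounds
  for the basis translations therefore give one that is linear in the coordinates.\<close>

definition smooth_under :: "'a \<Rightarrow> real \<Rightarrow> bool" where
  "smooth_under a \<delta> \<longleftrightarrow> (\<forall>M b f. bnd (carrier G) b f \<longrightarrow>
    \<bar>(\<integral>g. f g \<partial>cp M) - (\<integral>g. f (a \<otimes> g) \<partial>cp M)\<bar> \<le> b * \<delta> / sqrt (real M + 1))"

lemma smooth_underD: "smooth_under a \<delta> \<Longrightarrow> bnd (carrier G) b f \<Longrightarrow>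
    \<bar>(\<integral>g. f g \<partial>cp M) - (\<integral>g. f (a \<otimes> g) \<partial>cp M)\<bar> \<le> b * \<delta> / sqrt (real M + 1)"
  unfolding smooth_under_def by blast

lemma bnd_translate:
  assumes "bnd (carrier G) b f"
  shows "bnd (carrier G) b (\<lambda>g. if g \<in> carrier G then f (a \<otimes> g) else 0)"
  using assms bnd_nonneg[OF assms] by (simp add: bnd_def)

lemma smooth_under_one: "smooth_under \<one> 0"
  unfolding smooth_under_def
proof (intro allI impI)
  fix M b and f :: "'a \<Rightarrow> real"
  have "(\<integral>g. f (\<one> \<otimes> g) \<partial>cp M) = (\<integral>g. f g \<partial>cp M)"
    by (rule integral_cp_cong) simp
  then show "\<bar>(\<integral>g. f g \<partial>cp M) - (\<integral>g. f (\<one> \<otimes> g) \<partial>cp M)\<bar> \<le> b * 0 / sqrt (real M + 1)"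
    by simp
qed

lemma smooth_under_mult:
  assumes a: "smooth_under a \<delta>" "a \<in> carrier G" and b: "smooth_under b \<delta>'" "b \<in> carrier G"
  shows "smooth_under (a \<otimes> b) (\<delta> + \<delta>')"
  unfolding smooth_under_def
proof (intro allI impI)
  fix M B and f :: "'a \<Rightarrow> real" assume f: "bnd (carrier G) B f"
  let ?f = "\<lambda>g. if g \<in> carrier G then f (a \<otimes> g) else 0"
  have "(\<integral>g. ?f g \<partial>cp M) = (\<integral>g. f (a \<otimes> g) \<partial>cp M)" "(\<integral>g. ?f (b \<otimes> g) \<partial>cp M) = (\<integral>g. f (a \<otimes> b \<otimes> g) \<partial>cp M)"
    using a b by (auto intro!: integral_cp_cong simp: m_assoc)
  then have "\<bar>(\<integral>g. f (a \<otimes> g) \<partial>cp M) - (\<integral>g. f (a \<otimes> b \<otimes> g) \<partial>cp M)\<bar> \<le> B * \<delta>' / sqrt (real M + 1)"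
    using smooth_underD[OF b(1) bnd_translate[OF f, of a], of M] by simp
  then show "\<bar>(\<integral>g. f g \<partial>cp M) - (\<integral>g. f (a \<otimes> b \<otimes> g) \<partial>cp M)\<bar> \<le> B * (\<delta> + \<delta>') / sqrt (real M + 1)"
    using smooth_underD[OF a(1) f, of M] by (simp add: distrib_left add_divide_distrib)
qed

lemma smooth_under_inv:
  assumes a: "smooth_under a \<delta>" "a \<in> carrier G"
  shows "smooth_under (inv a) \<delta>"
  unfolding smooth_under_def
proof (intro allI impI)
  fix M B and f :: "'a \<Rightarrow> real" assume f: "bnd (carrier G) B f"
  let ?f = "\<lambda>g. if g \<in> carrier G then f (inv a \<otimes> g) else 0"
  have "(\<integral>g. ?f g \<partial>cp M) = (\<integral>g. f (inv a \<otimes> g) \<partial>cp M)" "(\<integral>g. ?f (a \<otimes> g) \<partial>cp M) = (\<integral>g. f g \<partial>cp M)"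
    using a by (auto intro!: integral_cp_cong simp: m_assoc[symmetric])
  then show "\<bar>(\<integral>g. f g \<partial>cp M) - (\<integral>g. f (inv a \<otimes> g) \<partial>cp M)\<bar> \<le> B * \<delta> / sqrt (real M + 1)"
    using smooth_underD[OF a(1) bnd_translate[OF f, of "inv a"], of M] by (simp add: abs_minus_commute)
qed

end

context va_walk
begin

text \<open>A translation of the starting point by \<open>a\<close> is a right increment \<open>inv x \<otimes> a \<otimes> x\<close> at \<open>x\<close>. Since \<open>L\<close> is
  abelian there are finitely many such conjugates, and \<open>r\<close>-th powers of all of them are reached with
  positive probability at a common return time.\<close>

lemma ex_lattice_smoothing:
  "\<exists>r>0. \<exists>C\<ge>0. \<forall>w. smooth_under (\<iota> (int r *s w)) (C * (\<Sum>i\<in>UNIV. \<bar>real_of_int (w $ i)\<bar>))"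
proof -
  define A where "A = (\<lambda>(x, i). inv x \<otimes> \<iota> (axis i 1) \<otimes> x) ` (D \<times> UNIV)"
  have A: "finite A" "A \<subseteq> carrier G"
    using finite_D D_carrier by (auto simp: A_def)
  obtain r K where r: "r > 0" and K: "K > 0" and one: "pmf (cp K) \<one> > 0"
    and pos: "\<And>a. a \<in> A \<Longrightarrow> pmf (cp K) (a [^] (r :: nat)) > 0"
    using common_return_time[OF A] by blast
  \<comment> \<open>The minimum runs over finitely many positive numbers, so one constant serves the
    identity and all conjugates.\<close>
  define c where "c = Min (insert (pmf (cp K) \<one>) ((\<lambda>a. pmf (cp K) (a [^] r)) ` A))"
  have c: "c > 0" "c \<le> pmf (cp K) \<one>" "\<And>a. a \<in> A \<Longrightarrow> c \<le> pmf (cp K) (a [^] r)"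
    unfolding c_def using A one pos by (auto intro: Min_le)
  have "\<exists>C\<ge>0. smooth_under (\<iota> (int r *s axis i 1)) C" for i
    unfolding smooth_under_def
  proof (rule walk_translation_smoothing[OF iota_closed K c(1,2)])
    fix x assume x: "x \<in> carrier G"
    obtain y where y: "y \<in> D" "inv x \<otimes> \<iota> (axis i 1) \<otimes> x = inv y \<otimes> \<iota> (axis i 1) \<otimes> y"
      using conj_iota_rep[OF x] by blast
    have "inv y \<otimes> \<iota> (axis i 1) \<otimes> y \<in> A"
      using y(1) by (auto simp: A_def)
    from c(3)[OF this] show "c \<le> pmf (cp K) (inv x \<otimes> \<iota> (int r *s axis i 1) \<otimes> x)"
      unfolding y(2)[symmetric] conj_iota_pow[OF x] .
  qed
  then obtain C' where C': "\<And>i. C' i \<ge> 0" "\<And>i. smooth_under (\<iota> (int r *s axis i 1)) (C' i)"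
    by metis
  define C where "C = (\<Sum>i\<in>UNIV. C' i)"
  have C0: "C \<ge> 0"
    unfolding C_def by (intro sum_nonneg C')
  have mono: "smooth_under a \<delta>'" if "smooth_under a \<delta>" "\<delta> \<le> \<delta>'" for a \<delta> \<delta>'
    unfolding smooth_under_def
  proof (intro allI impI)
    fix M b f assume f: "bnd (carrier G) b f"
    have "b * \<delta> / sqrt (real M + 1) \<le> b * \<delta>' / sqrt (real M + 1)"
      using bnd_nonneg[OF f] that(2) by (intro divide_right_mono mult_left_mono) auto
    then show "\<bar>(\<integral>g. f g \<partial>cp M) - (\<integral>g. f (a \<otimes> g) \<partial>cp M)\<bar> \<le> b * \<delta>' / sqrt (real M + 1)"
      using smooth_underD[OF that(1) f, of M] by linarith
  qed
  have nat: "smooth_under (\<iota> (int r *s axis i (int k))) (C * real k)" for i k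
  proof (induction k)
    case 0
    have eq: "int r *s axis i 0 = (0 :: int ^ 'm)"
      by (simp add: vec_eq_iff axis_def)
    show ?case
      unfolding of_nat_0 eq using smooth_under_one by simp
  next
    case (Suc k)
    have "C' i \<le> C"
      unfolding C_def using C' by (intro member_le_sum) auto
    then have 1: "smooth_under (\<iota> (int r *s axis i 1)) C"
      using mono[OF C'(2)] by blast
    have "axis i (int (Suc k)) = axis i (int k) + axis i 1"
      by (simp add: vec_eq_iff axis_def)
    then have "\<iota> (int r *s axis i (int (Suc k))) = \<iota> (int r *s axis i (int k)) \<otimes> \<iota> (int r *s axis i 1)"
      by (simp only: int_smult_add iota_add)
    then show ?case
      using smooth_under_mult[OF Suc iota_closed 1 iota_closed] by (simp add: algebra_simps)
  qed
  have int: "smooth_under (\<iota> (int r *s axis i k)) (C * \<bar>real_of_int k\<bar>)" for i k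
  proof (cases "k \<ge> 0")
    case True
    then show ?thesis
      using nat[of i "nat k"] by simp
  next
    case False
    have "\<iota> (int r *s axis i k) = inv (\<iota> (int r *s axis i (int (nat (- k)))))"
      unfolding iota_minus[symmetric] using False by (intro arg_cong[where f=\<iota>]) (simp add: vec_eq_iff axis_def)
    then show ?thesis
      using smooth_under_inv[OF nat[of i "nat (- k)"] iota_closed] False by simp
  qed
  have "smooth_under (\<iota> (int r *s (\<Sum>i\<in>I. axis i (w $ i)))) (C * (\<Sum>i\<in>I. \<bar>real_of_int (w $ i)\<bar>))" if "finite I" for I w
    using that
  proof (induction I rule: finite_induct)
    case empty
    have eq: "int r *s (0 :: int ^ 'm) = 0"
      by (simp add: vec_eq_iff)
    show ?case
      unfolding sum.empty eq using smooth_under_one by simp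
  next
    case (insert j I)
    have "smooth_under (\<iota> (int r *s axis j (w $ j)) \<otimes> \<iota> (int r *s (\<Sum>i\<in>I. axis i (w $ i))))
        (C * \<bar>real_of_int (w $ j)\<bar> + C * (\<Sum>i\<in>I. \<bar>real_of_int (w $ i)\<bar>))"
      by (intro smooth_under_mult int insert.IH iota_closed)
    then show ?case
      using insert.hyps by (simp add: iota_add int_smult_add distrib_left)
  qed
  then have "smooth_under (\<iota> (int r *s (\<Sum>i\<in>UNIV. axis i (w $ i)))) (C * (\<Sum>i\<in>UNIV. \<bar>real_of_int (w $ i)\<bar>))" for w
    by simp
  moreover have "(\<Sum>i\<in>UNIV. axis i (w $ i)) = w" for w :: "int ^ 'm"
    by (simp add: vec_eq_iff axis_def)
  ultimately show ?thesis
    using r C0 by auto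
qed

end

lemma norm_cis_diff_le: "norm (cis x - cis y) \<le> \<bar>x - y\<bar>"
proof -
  have "cis x - cis y = cis y * (cis (x - y) - 1)"
    by (simp add: right_diff_distrib cis_mult)
  then show ?thesis
    using norm_cis_minus_one_le[of "x - y"] by (simp add: norm_mult)
qed

lemma infsum_count_space:
  fixes f :: "'c \<Rightarrow> real"
  assumes "integrable (count_space UNIV) f"
  shows "infsum f UNIV = (\<integral>x. f x \<partial>count_space UNIV)"
proof -
  have "Infinite_Set_Sum.abs_summable_on f UNIV"
    using assms by (simp add: Infinite_Set_Sum.abs_summable_on_def)
  from infsetsum_infsum[OF this] show ?thesis
    by (simp add: infsetsum_def)
qed

section \<open>The local limit theorem\<close>

text \<open>Fixes the choices whose existence is known by now: a whitening matrix of the covariance,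
  the modulus \<open>r\<close> of the admissible translations and the smoothing constant.\<close>

locale va_limit = va_walk G L D \<iota> \<mu>
  for G (structure) and L D and \<iota> :: "int ^ 'm \<Rightarrow> 'a" and \<mu> +
  fixes H :: "real ^ 'm ^ 'm" and r :: nat and Cs :: real
  assumes whiten: "H ** cov ** transpose H = mat 1" and r: "r > 0" and Cs: "Cs \<ge> 0"
    and smooth: "\<And>w. smooth_under (\<iota> (int r *s w)) (Cs * (\<Sum>i\<in>UNIV. \<bar>real_of_int (w $ i)\<bar>))"
begin

sublocale wh: whitening cov H
  by (rule whitening.intro) (rule whiten)

declare One_nat_def [simp del]

text \<open>The whitened position of the lattice vector \<open>k x\<close>. The modulus
  \<open>k = r\<close> serves the walk inside a class, \<open>k = 1\<close> the normalising sum of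
  the Gaussian, which runs over all integer vectors.\<close>

definition Hr :: "nat \<Rightarrow> real ^ 'm \<Rightarrow> real ^ 'm" where
  "Hr k x = H *v (real k *\<^sub>R x)"

lemma lattice_Hr:
  assumes "k > 0"
  shows "euclidean_lattice (Hr k)"
proof (rule euclidean_lattice.intro)
  have "Hr k = (\<lambda>x. real k *\<^sub>R (H *v x))"
    by (simp add: Hr_def matrix_vector_mult_scaleR fun_eq_iff)
  then show "linear (Hr k)"
    by (simp add: linear_compose_scale_right matrix_vector_mul_linear)
  show "inj (Hr k)"
  proof (rule injI)
    fix x y assume "Hr k x = Hr k y"
    then have "real k *\<^sub>R x = real k *\<^sub>R y"
      unfolding Hr_def by (rule injD[OF wh.inj_H])
    then show "x = y"
      using assms by simp
  qed
qed

sublocale lat: euclidean_lattice "Hr r"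
  by (rule lattice_Hr[OF r])

sublocale lat1: euclidean_lattice "Hr 1"
  by (rule lattice_Hr) simp

sublocale cls: coset_walk G \<mu> "sublat r"
proof (intro coset_walk.intro irreducible_walk_axioms coset_walk_axioms.intro subgroup_sublat)
  show "finite (rcosets (sublat r))"
    using bij_betw_finite[OF bij_Rep_rcosets[OF r]] finite_Rep by simp
qed

lemma card_Rep: "card (Rep r) = card (rcosets (sublat r))"
  by (rule bij_betw_same_card[OF bij_Rep_rcosets[OF r]])

abbreviation q :: nat where "q \<equiv> period G \<mu>"

lemma q_pos: "q > 0"
  by (rule period_difference)

definition scale :: "nat \<Rightarrow> real" where
  "scale n = sqrt (real (q * n))"

definition avg :: "nat \<Rightarrow> 'a \<Rightarrow> real" where
  "avg n g = (1 / real q) * (\<Sum>i<q. pmf (cp (q * n + i)) g)"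

text \<open>Centre for the index \<open>v\<close> inside the class of \<open>y\<close>: the position
  of \<open>emb r y v\<close> is that of \<open>r v\<close> shifted by the potential of
  \<open>y\<close>, which is therefore subtracted here.\<close>

definition center :: "nat \<Rightarrow> 'a \<Rightarrow> real ^ 'm" where
  "center n y = H *v (real (q * n) *\<^sub>R \<zeta> - real_vec (\<Phi> y))"

definition dev :: "nat \<Rightarrow> 'a \<Rightarrow> real ^ 'm" where
  "dev n g = real_vec (\<Phi> g) - real (q * n) *\<^sub>R \<zeta>"

lemma pos_center: "y \<in> carrier G \<Longrightarrow> lat.pos v - center n y = H *v dev n (emb r y v)"
  unfolding lat.pos_def Hr_def center_def dev_def potential_emb
  by (simp add: matrix_vector_mult_diff_distrib[symmetric] algebra_simps)

lemma filterlim_scale: "filterlim scale at_top sequentially"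
proof -
  have "filterlim (\<lambda>n. real (q * n)) at_top sequentially"
    using q_pos by (intro filterlim_compose[OF filterlim_real_sequentially] filterlim_subseq) (simp add: strict_mono_def)
  then show ?thesis
    unfolding scale_def[abs_def] by (rule filterlim_compose[OF sqrt_at_top])
qed

lemma inverse_scale: "(\<lambda>n. 1 / scale n) \<longlonglongrightarrow> 0"
  by (rule real_tendsto_divide_at_top[OF tendsto_const filterlim_scale])

lemma times_inverse_scale: "(\<lambda>n. real (q * n + i) * (1 / scale n)\<^sup>2) \<longlonglongrightarrow> 1"
proof -
  have "(\<lambda>n. 1 + real i * (1 / scale n)\<^sup>2) \<longlonglongrightarrow> 1 + real i * 0\<^sup>2"
    by (intro tendsto_intros inverse_scale)
  then have "(\<lambda>n. 1 + real i * (1 / scale n)\<^sup>2) \<longlonglongrightarrow> 1"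
    by simp
  moreover have "eventually (\<lambda>n. 1 + real i * (1 / scale n)\<^sup>2 = real (q * n + i) * (1 / scale n)\<^sup>2) sequentially"
    using eventually_gt_at_top[of 0]
  proof eventually_elim
    case (elim n)
    define x where "x = real (q * n)"
    have x: "x > 0"
      using elim q_pos by (simp add: x_def)
    have sq: "(1 / scale n)\<^sup>2 = 1 / x"
      using x unfolding scale_def x_def[symmetric] by (simp add: power_divide)
    show ?case
      unfolding sq of_nat_add x_def[symmetric] using x by (simp add: field_simps)
  qed
  ultimately show ?thesis
    by (rule Lim_transform_eventually)
qed

text \<open>\<open>walk_central_limit\<close> is applied to the potential minus the corrector.
  Passing back to \<open>dev\<close> changes the phase by a bounded amount divided by
  \<open>scale n\<close>.\<close>

lemma central_limit:
  "(\<lambda>n. \<integral>g. cis ((1 / scale n) * (s \<bullet> dev n g)) \<partial>cp (q * n + i)) \<longlonglongrightarrow> of_real (exp (- (s \<bullet> (cov *v s)) / 2))"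
proof -
  let ?\<Psi> = "\<lambda>g. s \<bullet> (real_vec (\<Phi> g) - corrector (L #> g))"
  let ?k = "\<lambda>n. q * n + i"
  let ?c = "\<lambda>n g. cis ((1 / scale n) * (?\<Psi> g - real (?k n) * (s \<bullet> \<zeta>)))"
  have "(\<lambda>n. \<integral>g. ?c n g \<partial>cp (?k n))
      \<longlonglongrightarrow> of_real (exp (- ((\<Sum>c\<in>V. \<integral>x. (s \<bullet> Xi c x - s \<bullet> \<zeta>)\<^sup>2 \<partial>\<mu>) / real (card V) * 1 / 2)))"
  proof (rule base.walk_central_limit)
    fix x g assume "x \<in> carrier G" "g \<in> carrier G"
    then show "?\<Psi> (x \<otimes> g) - ?\<Psi> x - s \<bullet> \<zeta> = s \<bullet> Xi (L #> x) g - s \<bullet> \<zeta>"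
      unfolding Xi_coset[OF \<open>x \<in> carrier G\<close> \<open>g \<in> carrier G\<close>] by (simp add: inner_diff_right)
  next
    fix c assume c: "c \<in> V"
    show "integrable (measure_pmf \<mu>) (\<lambda>x. (s \<bullet> Xi c x - s \<bullet> \<zeta>)\<^sup>2)"
      by (rule integrable_centered_square[OF c])
    show "(\<integral>x. s \<bullet> Xi c x - s \<bullet> \<zeta> \<partial>\<mu>) = 0"
      using integrable_Xi[OF c] integral_Xi[OF c, of s] by simp
  next
    show "(\<lambda>n. 1 / scale n) \<longlonglongrightarrow> 0" "(\<lambda>n. real (?k n) * (1 / scale n)\<^sup>2) \<longlonglongrightarrow> 1"
      by (rule inverse_scale times_inverse_scale)+
  qed
  then have lim: "(\<lambda>n. \<integral>g. ?c n g \<partial>cp (?k n)) \<longlonglongrightarrow> of_real (exp (- (s \<bullet> (cov *v s)) / 2))"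
    unfolding cov_quadratic by simp
  \<comment> \<open>The corrector takes finitely many values on \<open>V\<close>. The term with
    \<open>i\<close> appears because \<open>dev\<close> is centred at time \<open>q n\<close> for
    all the times \<open>q n + i\<close> of the period.\<close>
  define B where "B = norm s * (\<Sum>c\<in>V. norm (corrector c)) + real i * \<bar>s \<bullet> \<zeta>\<bar>"
  have diff: "norm ((\<integral>g. cis ((1 / scale n) * (s \<bullet> dev n g)) \<partial>cp (?k n)) - (\<integral>g. ?c n g \<partial>cp (?k n))) \<le> \<bar>1 / scale n\<bar> * B" for n
  proof -
    have i1: "integrable (cp (?k n)) (\<lambda>g. cis ((1 / scale n) * (s \<bullet> dev n g)))" "integrable (cp (?k n)) (?c n)"
      by (rule integrable_pmf_bounded[where B=1], simp)+
    have "norm (\<integral>g. cis ((1 / scale n) * (s \<bullet> dev n g)) - ?c n g \<partial>cp (?k n)) \<le> (\<integral>g. \<bar>1 / scale n\<bar> * B \<partial>cp (?k n))"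
    proof (rule norm_integral_pmf_le)
      fix g assume "g \<in> set_pmf (cp (?k n))"
      then have c: "L #> g \<in> V"
        using cp_carrier base.coset_in_C by blast
      have "s \<bullet> dev n g - (?\<Psi> g - real (?k n) * (s \<bullet> \<zeta>)) = s \<bullet> corrector (L #> g) + real i * (s \<bullet> \<zeta>)"
        by (simp add: dev_def inner_diff_right algebra_simps)
      also have "\<bar>\<dots>\<bar> \<le> norm s * norm (corrector (L #> g)) + real i * \<bar>s \<bullet> \<zeta>\<bar>"
        using Cauchy_Schwarz_ineq2[of s "corrector (L #> g)"] abs_triangle_ineq[of "s \<bullet> corrector (L #> g)" "real i * (s \<bullet> \<zeta>)"]
        by (simp add: abs_mult)
      also have "\<dots> \<le> B"
        unfolding B_def using member_le_sum[OF c, of "\<lambda>c. norm (corrector c)"] finite_rcosets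
        by (intro add_mono mult_left_mono) auto
      finally have d: "\<bar>s \<bullet> dev n g - (?\<Psi> g - real (?k n) * (s \<bullet> \<zeta>))\<bar> \<le> B" .
      have "norm (cis ((1 / scale n) * (s \<bullet> dev n g)) - ?c n g) \<le> \<bar>(1 / scale n) * (s \<bullet> dev n g) - (1 / scale n) * (?\<Psi> g - real (?k n) * (s \<bullet> \<zeta>))\<bar>"
        by (rule norm_cis_diff_le)
      also have "\<dots> = \<bar>1 / scale n\<bar> * \<bar>s \<bullet> dev n g - (?\<Psi> g - real (?k n) * (s \<bullet> \<zeta>))\<bar>"
        unfolding right_diff_distrib[symmetric] abs_mult ..
      also have "\<dots> \<le> \<bar>1 / scale n\<bar> * B"
        by (intro mult_left_mono d) simp
      finally show "norm (cis ((1 / scale n) * (s \<bullet> dev n g)) - ?c n g) \<le> \<bar>1 / scale n\<bar> * B" .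
    qed simp
    then show ?thesis
      unfolding integral_pmf_const Bochner_Integration.integral_diff[OF i1] .
  qed
  have "(\<lambda>n. \<bar>1 / scale n\<bar> * B) \<longlonglongrightarrow> \<bar>0\<bar> * B"
    by (intro tendsto_intros inverse_scale)
  then have "(\<lambda>n. (\<integral>g. cis ((1 / scale n) * (s \<bullet> dev n g)) \<partial>cp (?k n)) - (\<integral>g. ?c n g \<partial>cp (?k n))) \<longlonglongrightarrow> 0"
    by (intro Lim_null_comparison[OF always_eventually[OF allI[OF diff]]]) simp
  from tendsto_add[OF this lim] show ?thesis
    by simp
qed

text \<open>One step changes the phase by \<open>u\<close> times an increment with finite first
  moment; for small \<open>u\<close> the phase is thus slowly varying in the sense of
  \<open>class_equidistribution\<close>.\<close>

lemma cis_dev_increment: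
  assumes x: "x \<in> carrier G"
  shows "(\<integral>g. norm (cis (u * (s \<bullet> dev n (x \<otimes> g))) - cis (u * (s \<bullet> dev n x))) \<partial>\<mu>) \<le> \<bar>u\<bar> * (norm s * (\<Sum>c\<in>V. \<integral>g. norm (U c g) \<partial>\<mu>))"
proof -
  have c: "L #> x \<in> V"
    by (rule base.coset_in_C[OF x])
  have "(\<integral>g. norm (cis (u * (s \<bullet> dev n (x \<otimes> g))) - cis (u * (s \<bullet> dev n x))) \<partial>\<mu>) \<le> (\<integral>g. \<bar>u\<bar> * norm s * norm (U (L #> x) g) \<partial>\<mu>)"
  proof (rule integral_mono_AE)
    show "integrable (measure_pmf \<mu>) (\<lambda>g. norm (cis (u * (s \<bullet> dev n (x \<otimes> g))) - cis (u * (s \<bullet> dev n x))))"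
    proof (rule integrable_pmf_bounded[where B=2])
      fix g
      show "norm (norm (cis (u * (s \<bullet> dev n (x \<otimes> g))) - cis (u * (s \<bullet> dev n x)))) \<le> 2"
        using norm_triangle_ineq4[of "cis (u * (s \<bullet> dev n (x \<otimes> g)))" "cis (u * (s \<bullet> dev n x))"] by simp
    qed
    show "integrable (measure_pmf \<mu>) (\<lambda>g. \<bar>u\<bar> * norm s * norm (U (L #> x) g))"
      using integrable_U_norm[OF c] by simp
    show "AE g in \<mu>. norm (cis (u * (s \<bullet> dev n (x \<otimes> g))) - cis (u * (s \<bullet> dev n x))) \<le> \<bar>u\<bar> * norm s * norm (U (L #> x) g)"
    proof (rule AE_pmfI)
      fix g assume "g \<in> set_pmf \<mu>"
      then have g: "g \<in> carrier G"
        by (rule mu_carrier)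
      have "u * (s \<bullet> dev n (x \<otimes> g)) - u * (s \<bullet> dev n x) = u * (s \<bullet> U (L #> x) g)"
        unfolding edge_potential_eq[OF x g] by (simp add: dev_def inner_diff_right algebra_simps)
      then have "norm (cis (u * (s \<bullet> dev n (x \<otimes> g))) - cis (u * (s \<bullet> dev n x))) \<le> \<bar>u\<bar> * \<bar>s \<bullet> U (L #> x) g\<bar>"
        using norm_cis_diff_le[of "u * (s \<bullet> dev n (x \<otimes> g))" "u * (s \<bullet> dev n x)"] by (simp add: abs_mult)
      also have "\<dots> \<le> \<bar>u\<bar> * (norm s * norm (U (L #> x) g))"
        by (intro mult_left_mono Cauchy_Schwarz_ineq2) simp
      finally show "norm (cis (u * (s \<bullet> dev n (x \<otimes> g))) - cis (u * (s \<bullet> dev n x))) \<le> \<bar>u\<bar> * norm s * norm (U (L #> x) g)"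
        by (simp add: mult.assoc)
    qed
  qed
  also have "\<dots> = \<bar>u\<bar> * (norm s * (\<integral>g. norm (U (L #> x) g) \<partial>\<mu>))"
    by (simp add: mult.assoc)
  also have "\<dots> \<le> \<bar>u\<bar> * (norm s * (\<Sum>c\<in>V. \<integral>g. norm (U c g) \<partial>\<mu>))"
    using finite_rcosets by (intro mult_left_mono member_le_sum[OF c]) auto
  finally show ?thesis .
qed

lemma avg_class_integral:
  fixes h :: "'a \<Rightarrow> 'd::{banach, second_countable_topology}"
  assumes y: "y \<in> carrier G" and B: "\<And>g. norm (h g) \<le> B"
    and zero: "\<And>g. g \<in> carrier G \<Longrightarrow> g \<notin> range (emb r y) \<Longrightarrow> h g = 0"
  shows "integrable (count_space UNIV) (\<lambda>v. avg n (emb r y v) *\<^sub>R h (emb r y v))"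
    and "(\<integral>v. avg n (emb r y v) *\<^sub>R h (emb r y v) \<partial>count_space UNIV) = (1 / real q) *\<^sub>R (\<Sum>i<q. \<integral>g. h g \<partial>cp (q * n + i))"
proof -
  have z: "g \<in> set_pmf (cp k) \<Longrightarrow> g \<notin> range (emb r y) \<Longrightarrow> h g = 0" for g k
    using zero cp_carrier by blast
  have ci: "integrable (count_space UNIV) (\<lambda>v. pmf (cp k) (emb r y v) *\<^sub>R h (emb r y v))"
    "(\<integral>v. pmf (cp k) (emb r y v) *\<^sub>R h (emb r y v) \<partial>count_space UNIV) = (\<integral>g. h g \<partial>cp k)" for k
    using class_integral[OF r y, where h=h and B=B and p="cp k", OF B z[where k=k]] by auto
  have eq: "avg n (emb r y v) *\<^sub>R h (emb r y v) = (1 / real q) *\<^sub>R (\<Sum>i<q. pmf (cp (q * n + i)) (emb r y v) *\<^sub>R h (emb r y v))" for v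
    by (simp only: avg_def scaleR_scaleR[symmetric] scaleR_sum_left)
  show "integrable (count_space UNIV) (\<lambda>v. avg n (emb r y v) *\<^sub>R h (emb r y v))"
    unfolding eq by (intro integrable_scaleR_right Bochner_Integration.integrable_sum ci)
  show "(\<integral>v. avg n (emb r y v) *\<^sub>R h (emb r y v) \<partial>count_space UNIV) = (1 / real q) *\<^sub>R (\<Sum>i<q. \<integral>g. h g \<partial>cp (q * n + i))"
    unfolding eq integral_scaleR_right
    by (subst Bochner_Integration.integral_sum) (simp_all add: ci)
qed

lemma avg_nonneg: "avg n g \<ge> 0"
  unfolding avg_def by (intro mult_nonneg_nonneg sum_nonneg) auto

lemma integrable_avg:
  assumes y: "y \<in> carrier G"
  shows "integrable (count_space UNIV) (\<lambda>v. avg n (emb r y v))"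
proof -
  have "integrable (count_space UNIV) (\<lambda>v. avg n (emb r y v) *\<^sub>R (of_bool (emb r y v \<in> range (emb r y)) :: real))"
    by (rule avg_class_integral(1)[OF y, of _ 1]) auto
  then show ?thesis
    by simp
qed

lemma chf_avg:
  assumes y: "y \<in> carrier G"
  shows "lat.chf (\<lambda>v. avg n (emb r y v)) (scale n) (center n y) t =
    (1 / real q) *\<^sub>R (\<Sum>i<q. \<integral>g. of_bool (sublat r #> g = sublat r #> y) * cis ((1 / scale n) * ((transpose H *v t) \<bullet> dev n g)) \<partial>cp (q * n + i))"
proof -
  let ?h = "\<lambda>g. of_bool (sublat r #> g = sublat r #> y) * cis ((1 / scale n) * ((transpose H *v t) \<bullet> dev n g))"
  have "lat.chf (\<lambda>v. avg n (emb r y v)) (scale n) (center n y) t = (\<integral>v. avg n (emb r y v) *\<^sub>R ?h (emb r y v) \<partial>count_space UNIV)"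
    unfolding lat.chf_def
  proof (intro Bochner_Integration.integral_cong refl)
    fix v
    have coset: "sublat r #> emb r y v = sublat r #> y"
      using sublat_coset_eq_iff[OF y emb_carrier[OF y]] by simp
    have eq: "t \<bullet> ((1 / scale n) *\<^sub>R (lat.pos v - center n y)) = (1 / scale n) * ((transpose H *v t) \<bullet> dev n (emb r y v))"
      unfolding pos_center[OF y] wh.transpose_H_inner by simp
    show "avg n (emb r y v) *\<^sub>R cis (t \<bullet> ((1 / scale n) *\<^sub>R (lat.pos v - center n y))) = avg n (emb r y v) *\<^sub>R ?h (emb r y v)"
      unfolding eq coset by simp
  qed
  also have "\<dots> = (1 / real q) *\<^sub>R (\<Sum>i<q. \<integral>g. ?h g \<partial>cp (q * n + i))"
  proof (rule avg_class_integral(2)[OF y])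
    show "norm (?h g) \<le> 1" for g
      by (simp add: norm_mult)
    show "?h g = 0" if "g \<in> carrier G" "g \<notin> range (emb r y)" for g
      using sublat_coset_eq_iff[OF y that(1)] that(2) by simp
  qed
  finally show ?thesis .
qed

text \<open>By equidistribution, with the phase as slowly varying factor, a single class has
  asymptotically the full characteristic function divided by the number of classes. The limit is
  isotropic because \<open>H\<close> whitens the covariance.\<close>

lemma chf_avg_limit:
  assumes y: "y \<in> carrier G"
  shows "(\<lambda>n. lat.chf (\<lambda>v. avg n (emb r y v)) (scale n) (center n y) t)
    \<longlonglongrightarrow> of_real (1 / real (card (rcosets (sublat r))) * exp (- (norm t)\<^sup>2 / 2))"
proof -
  let ?s = "transpose H *v t"
  let ?E = "\<lambda>n g. cis ((1 / scale n) * (?s \<bullet> dev n g))"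
  let ?X = "\<lambda>n. \<Sum>i<q. \<integral>g. of_bool (sublat r #> g = sublat r #> y) * ?E n g \<partial>cp (q * n + i)"
  let ?Y = "\<lambda>n. (\<Sum>i<q. \<integral>g. ?E n g \<partial>cp (q * n + i)) / of_nat (card (rcosets (sublat r)))"
  have "(\<lambda>n. ?X n - ?Y n) \<longlonglongrightarrow> 0"
  proof (rule cls.class_equidistribution)
    show "norm (?E n x) \<le> 1" for n x
      by simp
    show "(\<integral>g. norm (?E n (x \<otimes> g) - ?E n x) \<partial>\<mu>) \<le> \<bar>1 / scale n\<bar> * (norm ?s * (\<Sum>c\<in>V. \<integral>g. norm (U c g) \<partial>\<mu>))" if "x \<in> carrier G" for n x
      by (rule cis_dev_increment[OF that])
    have "(\<lambda>n. \<bar>1 / scale n\<bar> * (norm ?s * (\<Sum>c\<in>V. \<integral>g. norm (U c g) \<partial>\<mu>))) \<longlonglongrightarrow> \<bar>0\<bar> * (norm ?s * (\<Sum>c\<in>V. \<integral>g. norm (U c g) \<partial>\<mu>))"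
      by (intro tendsto_intros inverse_scale)
    then show "(\<lambda>n. \<bar>1 / scale n\<bar> * (norm ?s * (\<Sum>c\<in>V. \<integral>g. norm (U c g) \<partial>\<mu>))) \<longlonglongrightarrow> 0"
      by simp
    show "filterlim (\<lambda>n. q * n) at_top sequentially"
      using q_pos by (intro filterlim_subseq) (simp add: strict_mono_def)
    show "sublat r #> y \<in> rcosets (sublat r)"
      by (rule cls.coset_in_C[OF y])
  qed
  moreover have "?Y \<longlonglongrightarrow> (\<Sum>i<q. of_real (exp (- (norm t)\<^sup>2 / 2))) / of_nat (card (rcosets (sublat r)))"
  proof (intro tendsto_divide tendsto_sum tendsto_const)
    fix i
    show "(\<lambda>n. \<integral>g. ?E n g \<partial>cp (q * n + i)) \<longlonglongrightarrow> of_real (exp (- (norm t)\<^sup>2 / 2))"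
      using central_limit[where s="?s" and i=i] unfolding wh.quadratic_transpose_H .
    show "complex_of_nat (card (rcosets (sublat r))) \<noteq> 0"
      using cls.card_C by simp
  qed
  ultimately have "(\<lambda>n. (?X n - ?Y n) + ?Y n) \<longlonglongrightarrow> 0 + (\<Sum>i<q. of_real (exp (- (norm t)\<^sup>2 / 2))) / of_nat (card (rcosets (sublat r)))"
    by (rule tendsto_add)
  then have "(\<lambda>n. (1 / real q) *\<^sub>R ?X n) \<longlonglongrightarrow> (1 / real q) *\<^sub>R ((\<Sum>i<q. of_real (exp (- (norm t)\<^sup>2 / 2))) / of_nat (card (rcosets (sublat r))))"
    by (intro tendsto_scaleR tendsto_const) simp
  also have "(1 / real q) *\<^sub>R ((\<Sum>i<q. complex_of_real (exp (- (norm t)\<^sup>2 / 2))) / of_nat (card (rcosets (sublat r))))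
      = of_real (1 / real (card (rcosets (sublat r))) * exp (- (norm t)\<^sup>2 / 2))"
    using q_pos by (simp add: scaleR_conv_of_real)
  finally show ?thesis
    unfolding chf_avg[OF y] .
qed

text \<open>The norm is attained by testing against the sign \<open>\<sigma>\<close> of the
  difference. Carried over to the class of \<open>y\<close>, it becomes a function on the group
  bounded by one; shifting the index by \<open>w\<close> is left multiplication by
  \<open>\<iota> (r w)\<close>, which preserves the class.\<close>

lemma avg_shift_le:
  assumes y: "y \<in> carrier G"
  shows "(\<integral>v. \<bar>avg n (emb r y (v - w)) - avg n (emb r y v)\<bar> \<partial>count_space UNIV)
    \<le> Cs * (\<Sum>i\<in>UNIV. \<bar>real_of_int (w $ i)\<bar>) / sqrt (real (q * n) + 1)"
proof -
  let ?F = "\<lambda>v. avg n (emb r y v)"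
  let ?a = "\<iota> (int r *s w)"
  define \<sigma> where "\<sigma> = (\<lambda>v. sgn (?F (v - w) - ?F v))"
  define \<phi> where "\<phi> = (\<lambda>g. if g \<in> range (emb r y) then \<sigma> (inv_into UNIV (emb r y) g) else 0)"
  have \<phi>: "\<phi> (emb r y v) = \<sigma> v" for v
    by (simp add: \<phi>_def inv_f_f[OF inj_emb[OF r y]])
  have \<sigma>1: "\<bar>\<sigma> v\<bar> \<le> 1" for v
    by (simp add: \<sigma>_def abs_sgn_eq)
  have \<phi>1: "\<bar>\<phi> g\<bar> \<le> 1" for g
    using \<sigma>1 by (simp add: \<phi>_def)
  have \<phi>0: "\<phi> g = 0" if "g \<in> carrier G" "g \<notin> range (emb r y)" for g
    using that by (simp add: \<phi>_def)
  have bnd: "bnd (carrier G) 1 \<phi>"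
    using \<phi>1 emb_carrier[OF y] by (auto simp: bnd_def \<phi>_def)
  have A: "integrable (count_space UNIV) (\<lambda>v. ?F v * \<sigma> v)" "(\<integral>v. ?F v * \<sigma> v \<partial>count_space UNIV) = (1 / real q) * (\<Sum>i<q. \<integral>g. \<phi> g \<partial>cp (q * n + i))"
    using avg_class_integral[OF y, of \<phi> 1 n, OF \<phi>1[folded real_norm_def] \<phi>0] by (simp_all add: \<phi>)
  have zero: "\<phi> (?a \<otimes> g) = 0" if g: "g \<in> carrier G" "g \<notin> range (emb r y)" for g
  proof -
    have "?a \<otimes> g \<notin> range (emb r y)"
    proof
      assume "?a \<otimes> g \<in> range (emb r y)"
      then obtain v where v: "?a \<otimes> g = emb r y v"
        by blast
      also have "emb r y v = ?a \<otimes> emb r y (v - w)"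
        unfolding emb_shift[OF y] by simp
      finally have "g = emb r y (v - w)"
        using g(1) emb_carrier[OF y] iota_closed by simp
      then show False
        using g(2) by blast
    qed
    then show ?thesis
      by (simp add: \<phi>_def)
  qed
  have B: "integrable (count_space UNIV) (\<lambda>v. ?F v * \<sigma> (w + v))"
    "(\<integral>v. ?F v * \<sigma> (w + v) \<partial>count_space UNIV) = (1 / real q) * (\<Sum>i<q. \<integral>g. \<phi> (?a \<otimes> g) \<partial>cp (q * n + i))"
    using avg_class_integral[OF y, of "\<lambda>g. \<phi> (?a \<otimes> g)" 1 n, OF \<phi>1[folded real_norm_def] zero] by (simp_all add: \<phi> emb_shift[OF y])
  have B': "integrable (count_space UNIV) (\<lambda>v. ?F (v - w) * \<sigma> v)"
    "(\<integral>v. ?F (v - w) * \<sigma> v \<partial>count_space UNIV) = (\<integral>v. ?F v * \<sigma> (w + v) \<partial>count_space UNIV)"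
    using lat.integrable_cs_shift[OF B(1), of w] lat.integral_cs_shift[of "\<lambda>v. ?F v * \<sigma> (w + v)" w] by simp_all
  have "(\<integral>v. \<bar>?F (v - w) - ?F v\<bar> \<partial>count_space UNIV) = (\<integral>v. ?F (v - w) * \<sigma> v - ?F v * \<sigma> v \<partial>count_space UNIV)"
    by (intro Bochner_Integration.integral_cong) (simp_all add: \<sigma>_def abs_sgn left_diff_distrib)
  also have "\<dots> = (1 / real q) * (\<Sum>i<q. (\<integral>g. \<phi> (?a \<otimes> g) \<partial>cp (q * n + i)) - (\<integral>g. \<phi> g \<partial>cp (q * n + i)))"
    unfolding Bochner_Integration.integral_diff[OF B'(1) A(1)] B'(2) B(2) A(2) by (simp add: sum_subtractf right_diff_distrib)
  also have "\<dots> \<le> (1 / real q) * (\<Sum>i<q. Cs * (\<Sum>i\<in>UNIV. \<bar>real_of_int (w $ i)\<bar>) / sqrt (real (q * n) + 1))"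
  proof (intro mult_left_mono sum_mono)
    fix i
    let ?S = "Cs * (\<Sum>i\<in>UNIV. \<bar>real_of_int (w $ i)\<bar>)"
    have S: "?S \<ge> 0"
      using Cs by (intro mult_nonneg_nonneg sum_nonneg) auto
    have "(\<integral>g. \<phi> (?a \<otimes> g) \<partial>cp (q * n + i)) - (\<integral>g. \<phi> g \<partial>cp (q * n + i)) \<le> 1 * ?S / sqrt (real (q * n + i) + 1)"
      using smooth_underD[OF smooth bnd, of "q * n + i" w] by linarith
    also have "\<dots> \<le> ?S / sqrt (real (q * n) + 1)"
      unfolding mult_1 by (rule divide_left_mono[OF _ S]) (auto intro!: mult_pos_pos add_nonneg_pos)
    finally show "(\<integral>g. \<phi> (?a \<otimes> g) \<partial>cp (q * n + i)) - (\<integral>g. \<phi> g \<partial>cp (q * n + i)) \<le> ?S / sqrt (real (q * n) + 1)" .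
  qed simp
  also have "\<dots> = Cs * (\<Sum>i\<in>UNIV. \<bar>real_of_int (w $ i)\<bar>) / sqrt (real (q * n) + 1)"
    using q_pos by simp
  finally show ?thesis .
qed

text \<open>The coordinates of \<open>w\<close> are bounded by a multiple of the norm of its
  position, so a displacement of length \<open>\<delta> scale n\<close> costs at most a multiple of
  \<open>\<delta>\<close>: the factor \<open>scale n\<close> is cancelled by the rate.\<close>

lemma avg_smooth:
  assumes y: "y \<in> carrier G" and e: "\<epsilon> > 0"
  shows "\<exists>\<delta>>0. \<forall>\<^sub>F n in sequentially. \<forall>w. norm (lat.pos w) \<le> \<delta> * scale n \<longrightarrow>
    (\<integral>v. \<bar>avg n (emb r y (v - w)) - avg n (emb r y v)\<bar> \<partial>count_space UNIV) \<le> \<epsilon>"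
proof -
  obtain K where K: "linear K" "\<And>x. K (Hr r x) = x"
    using lat.obtain_inverse by metis
  obtain B where B: "B > 0" "\<And>x. norm (K x) \<le> B * norm x"
    using linear_bounded_pos[OF K(1)] by blast
  have comp: "(\<Sum>i\<in>UNIV. \<bar>real_of_int (w $ i)\<bar>) \<le> real CARD('m) * (B * norm (lat.pos w))" for w
  proof -
    have "\<bar>real_of_int (w $ i)\<bar> \<le> B * norm (lat.pos w)" for i
    proof -
      have "\<bar>real_vec w $ i\<bar> \<le> norm (real_vec w)"
        by (rule component_le_norm_cart)
      also have "\<dots> = norm (K (lat.pos w))"
        by (simp only: lat.pos_def K(2))
      also have "\<dots> \<le> B * norm (lat.pos w)"
        by (rule B)
      finally show ?thesis
        by (simp add: real_vec_def)
    qed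
    from sum_mono[OF this] show ?thesis
      by simp
  qed
  \<comment> \<open>The added \<open>1\<close> keeps the denominator positive when \<open>Cs\<close>
    vanishes.\<close>
  define \<delta> where "\<delta> = \<epsilon> / (Cs * real CARD('m) * B + 1)"
  have den: "Cs * real CARD('m) * B \<ge> 0"
    using Cs B by simp
  then have \<delta>: "\<delta> > 0"
    using e by (simp add: \<delta>_def add_nonneg_pos)
  have "(\<integral>v. \<bar>avg n (emb r y (v - w)) - avg n (emb r y v)\<bar> \<partial>count_space UNIV) \<le> \<epsilon>"
    if w: "norm (lat.pos w) \<le> \<delta> * scale n" for n w
  proof -
    have "(\<integral>v. \<bar>avg n (emb r y (v - w)) - avg n (emb r y v)\<bar> \<partial>count_space UNIV)
        \<le> Cs * (\<Sum>i\<in>UNIV. \<bar>real_of_int (w $ i)\<bar>) / sqrt (real (q * n) + 1)"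
      by (rule avg_shift_le[OF y])
    also have "\<dots> \<le> Cs * (real CARD('m) * (B * (\<delta> * scale n))) / sqrt (real (q * n) + 1)"
    proof (intro divide_right_mono mult_left_mono Cs)
      have "real CARD('m) * (B * norm (lat.pos w)) \<le> real CARD('m) * (B * (\<delta> * scale n))"
        using w B by (intro mult_left_mono) auto
      then show "(\<Sum>i\<in>UNIV. \<bar>real_of_int (w $ i)\<bar>) \<le> real CARD('m) * (B * (\<delta> * scale n))"
        using comp[of w] by linarith
    qed simp
    also have "\<dots> = (Cs * real CARD('m) * B * \<delta>) * (scale n / sqrt (real (q * n) + 1))"
      by simp
    also have "\<dots> \<le> (Cs * real CARD('m) * B * \<delta>) * 1"
    proof (rule mult_left_mono)
      have "scale n \<le> sqrt (real (q * n) + 1)" "sqrt (real (q * n) + 1) > 0"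
        by (simp_all add: scale_def add_nonneg_pos del: of_nat_mult)
      then show "scale n / sqrt (real (q * n) + 1) \<le> 1"
        by (rule divide_le_eq_1_pos[THEN iffD2, rotated])
    qed (use den \<delta> in simp)
    also have "\<dots> \<le> \<epsilon>"
    proof -
      have "(Cs * real CARD('m) * B) * \<delta> \<le> (Cs * real CARD('m) * B + 1) * \<delta>"
        using \<delta> by (intro mult_right_mono) auto
      also have "\<dots> = \<epsilon>"
        using den by (simp add: \<delta>_def)
      finally show ?thesis
        by simp
    qed
    finally show ?thesis .
  qed
  then show ?thesis
    using \<delta> by (intro exI[of _ \<delta>]) auto
qed

text \<open>The share of one class times the covolume of its lattice, that is, the weight of a
  single group element in front of the limiting density. It does not depend on \<open>r\<close>, as
  \<open>\<kappa>_eq\<close> shows.\<close>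

definition \<kappa> :: real where
  "\<kappa> = 1 / real (card (rcosets (sublat r))) * lat.covol"

lemma class_local_limit:
  assumes y: "y \<in> carrier G"
  shows "(\<lambda>n. \<integral>v. \<bar>avg n (emb r y v) - \<kappa> * gauss (scale n) (H *v dev n (emb r y v))\<bar> \<partial>count_space UNIV) \<longlonglongrightarrow> 0"
proof -
  have "(\<lambda>n. \<integral>v. \<bar>avg n (emb r y v) - 1 / real (card (rcosets (sublat r))) * lat.covol * gauss (scale n) (lat.pos v - center n y)\<bar> \<partial>count_space UNIV) \<longlonglongrightarrow> 0"
    by (rule lat.lattice_local_limit[OF integrable_avg[OF y] avg_nonneg filterlim_scale chf_avg_limit[OF y] avg_smooth[OF y]])
  then show ?thesis
    unfolding pos_center[OF y] \<kappa>_def .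
qed

lemma nn_integral_gauss_carrier:
  assumes "k > 0" "s > 0"
  shows "(\<integral>\<^sup>+g. ennreal (gauss s (H *v real_vec (\<Phi> g))) \<partial>count_space (carrier G))
    = ennreal (\<Sum>y\<in>Rep k. euclidean_lattice.gsum (Hr k) s (- (H *v real_vec (\<Phi> y))) / euclidean_lattice.covol (Hr k))"
proof -
  interpret l: euclidean_lattice "Hr k"
    by (rule lattice_Hr) fact
  have "(\<integral>\<^sup>+v. ennreal (gauss s (H *v real_vec (\<Phi> (emb k y v)))) \<partial>count_space UNIV) = ennreal (l.gsum s (- (H *v real_vec (\<Phi> y))) / l.covol)"
    if y: "y \<in> Rep k" for y
  proof -
    have "H *v real_vec (\<Phi> (emb k y v)) = l.pos v - (- (H *v real_vec (\<Phi> y)))" for v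
      unfolding potential_emb[OF Rep_carrier[OF y]] l.pos_def Hr_def by (simp add: matrix_vector_right_distrib)
    then have "(\<integral>\<^sup>+v. ennreal (gauss s (H *v real_vec (\<Phi> (emb k y v)))) \<partial>count_space UNIV)
       = (\<integral>\<^sup>+v. ennreal (1 / l.covol) * ennreal (gauss s (l.pos v - (- (H *v real_vec (\<Phi> y)))) * l.covol) \<partial>count_space UNIV)"
      using l.covol_pos assms by (intro nn_integral_cong) (simp add: ennreal_mult[symmetric] gauss_nonneg)
    also have "\<dots> = ennreal (1 / l.covol) * ennreal (l.gsum s (- (H *v real_vec (\<Phi> y))))"
      by (subst nn_integral_cmult) (simp_all only: l.nn_integral_gsum[OF assms(2)] borel_measurable_count_space)
    also have "\<dots> = ennreal (l.gsum s (- (H *v real_vec (\<Phi> y))) / l.covol)"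
      using l.covol_pos l.gsum_nonneg[OF assms(2)] by (simp add: ennreal_mult[symmetric])
    finally show ?thesis .
  qed
  then show ?thesis
    unfolding nn_integral_carrier[OF assms(1)]
    using l.covol_pos l.gsum_nonneg[OF assms(2)] by (simp add: sum_ennreal)
qed

text \<open>A covolume identity obtained by counting: the same Gaussian sum over the group, split
  once modulo \<open>r\<close> and once modulo \<open>1\<close>, is asymptotically the number of
  classes divided by the covolume.\<close>

lemma \<kappa>_eq: "\<kappa> = lat1.covol / real (card V)"
proof -
  define T where "T = (\<lambda>k s. \<Sum>y\<in>Rep k. euclidean_lattice.gsum (Hr k) s (- (H *v real_vec (\<Phi> y))) / euclidean_lattice.covol (Hr k))"
  have lim: "(\<lambda>n. T k (1 * real n)) \<longlonglongrightarrow> real (card (Rep k)) / euclidean_lattice.covol (Hr k)" if k: "k > 0" for k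
  proof -
    interpret l: euclidean_lattice "Hr k"
      by (rule lattice_Hr[OF k])
    have "(\<lambda>n. T k (1 * real n)) \<longlonglongrightarrow> (\<Sum>y\<in>Rep k. 1 / l.covol)"
      unfolding T_def using l.covol_pos
      by (intro tendsto_sum tendsto_divide l.tendsto_gsum[OF filterlim_real_sequentially] tendsto_const) auto
    then show ?thesis
      by simp
  qed
  have "T r s = T 1 s" if s: "s > 0" for s
  proof -
    have "ennreal (T r s) = ennreal (T 1 s)"
      unfolding T_def nn_integral_gauss_carrier[OF r s, symmetric] nn_integral_gauss_carrier[OF zero_less_one s, symmetric] ..
    moreover have "T r s \<ge> 0" "T 1 s \<ge> 0"
      unfolding T_def using lat.covol_pos lat1.covol_pos lat.gsum_nonneg[OF s] lat1.gsum_nonneg[OF s]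
      by (auto intro!: sum_nonneg divide_nonneg_nonneg)
    ultimately show ?thesis
      by simp
  qed
  then have "eventually (\<lambda>n. T r (1 * real n) = T 1 (1 * real n)) sequentially"
    by (intro eventually_mono[OF eventually_gt_at_top[of "0::nat"]]) simp
  then have "(\<lambda>n. T 1 (1 * real n)) \<longlonglongrightarrow> real (card (Rep r)) / lat.covol"
    by (rule Lim_transform_eventually[OF lim[OF r]])
  then have "real (card (Rep r)) / lat.covol = real (card (Rep 1)) / lat1.covol"
    using lim[OF zero_less_one] LIMSEQ_unique by blast
  then show ?thesis
    unfolding \<kappa>_def Rep_1 card_D card_Rep using lat.covol_pos lat1.covol_pos cls.card_C base.card_C
    by (simp add: field_simps)
qed

text \<open>The implicit constant of \<open>gauss_density_eq\<close> cancels against the normalising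
  sum. What remains of that sum is a Riemann sum centred at \<open>0\<close>, which tends to
  one.\<close>

lemma gauss_group_eq:
  assumes n: "n > 0" and g: "g \<in> carrier G"
  shows "gauss_group G L \<iota> D (q * n) cov \<zeta> g = \<kappa> * gauss (scale n) (H *v dev n g) / lat1.gsum (scale n) 0"
proof -
  have qn: "real (q * n) > 0"
    using n q_pos by simp
  then have s: "scale n > 0"
    by (simp add: scale_def)
  obtain K where K: "K \<noteq> 0" "\<And>x. gauss_density (real (q * n) *\<^sub>R cov) x = K * gauss (scale n) (H *v x)"
    using wh.gauss_density_eq[OF qn] unfolding scale_def by blast
  have int: "integrable (count_space UNIV) (\<lambda>w. gauss (scale n) (lat1.pos w - 0))"
    by (rule lat1.integrable_lattice_gauss[OF s])
  have "(\<Sum>\<^sub>\<infinity>w. gauss_density (real (q * n) *\<^sub>R cov) (real_vec w)) = (\<integral>w. K * gauss (scale n) (lat1.pos w - 0) \<partial>count_space UNIV)"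
    unfolding K using int by (subst infsum_count_space) (simp_all add: lat1.pos_def Hr_def)
  also have "\<dots> = K * (lat1.gsum (scale n) 0 / lat1.covol)"
    using lat1.covol_pos by (simp add: lat1.gsum_def)
  finally have Z: "(\<Sum>\<^sub>\<infinity>w. gauss_density (real (q * n) *\<^sub>R cov) (real_vec w)) = \<dots>" .
  show ?thesis
    unfolding gauss_group_def Z unfolding K(2) \<kappa>_eq vertex_weight_def diag_V_def dev_def[symmetric]
    using K(1) by simp
qed

text \<open>The group is a finite union of classes, and each contributes two errors: the one of the
  local limit, and the deviation of the normalising sum from its limit, measured by
  \<open>1 - 1 / Z n\<close>.\<close>

theorem tv_limit:
  "(\<lambda>n. tv_norm (carrier G) (\<lambda>g. (1 / real q) * (\<Sum>i<q. pmf (cp (q * n + i)) g) - gauss_group G L \<iota> D (q * n) cov \<zeta> g))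
    \<longlonglongrightarrow> 0"
proof -
  define Z where "Z = (\<lambda>n. lat1.gsum (scale n) 0)"
  define B where "B = (\<lambda>n. \<Sum>y\<in>Rep r. (\<integral>v. \<bar>avg n (emb r y v) - \<kappa> * gauss (scale n) (H *v dev n (emb r y v))\<bar> \<partial>count_space UNIV)
      + \<bar>1 - 1 / Z n\<bar> * (\<kappa> / lat.covol) * lat.gsum (scale n) (center n y))"
  have gs: "(\<lambda>n. lat.gsum (scale n) (b n)) \<longlonglongrightarrow> 1" for b
    using lat.tendsto_gsum[OF filterlim_scale zero_less_one, of b] by simp
  have Z: "Z \<longlonglongrightarrow> 1"
    unfolding Z_def using lat1.tendsto_gsum[OF filterlim_scale zero_less_one, of "\<lambda>_. 0"] by simp
  have "B \<longlonglongrightarrow> (\<Sum>y\<in>Rep r. 0 + \<bar>1 - 1 / 1\<bar> * (\<kappa> / lat.covol) * 1)"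
    unfolding B_def by (intro tendsto_sum tendsto_add class_local_limit Rep_carrier tendsto_mult tendsto_rabs tendsto_diff tendsto_divide tendsto_const Z gs) auto
  then have "B \<longlonglongrightarrow> 0"
    by simp
  then have B0: "(\<lambda>n. ennreal (B n)) \<longlonglongrightarrow> 0"
    using tendsto_ennrealI by fastforce
  have \<kappa>0: "\<kappa> \<ge> 0"
    unfolding \<kappa>_def using lat.covol_pos by simp
  have "eventually (\<lambda>n. tv_norm (carrier G) (\<lambda>g. (1 / real q) * (\<Sum>i<q. pmf (cp (q * n + i)) g) - gauss_group G L \<iota> D (q * n) cov \<zeta> g) \<le> ennreal (B n)) sequentially"
    \<comment> \<open>At \<open>n = 0\<close> the scale is zero and the Gaussian
      degenerates.\<close>
    using eventually_gt_at_top[of 0]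
  proof eventually_elim
    case (elim n)
    have s: "scale n > 0"
      using elim q_pos by (simp add: scale_def)
    let ?N = "gauss_group G L \<iota> D (q * n) cov \<zeta>"
    let ?g = "\<lambda>g. gauss (scale n) (H *v dev n g)"
    have int: "integrable (count_space UNIV) (\<lambda>v. ?g (emb r y v))" "(\<integral>v. ?g (emb r y v) \<partial>count_space UNIV) = lat.gsum (scale n) (center n y) / lat.covol"
      if y: "y \<in> carrier G" for y
    proof -
      show "integrable (count_space UNIV) (\<lambda>v. ?g (emb r y v))"
        unfolding pos_center[OF y, symmetric] by (rule lat.integrable_lattice_gauss[OF s])
      show "(\<integral>v. ?g (emb r y v) \<partial>count_space UNIV) = lat.gsum (scale n) (center n y) / lat.covol"
        unfolding pos_center[OF y, symmetric] using lat.covol_pos by (simp add: lat.gsum_def)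
    qed
    have cls: "(\<integral>\<^sup>+v. ennreal \<bar>avg n (emb r y v) - ?N (emb r y v)\<bar> \<partial>count_space UNIV)
       \<le> ennreal ((\<integral>v. \<bar>avg n (emb r y v) - \<kappa> * ?g (emb r y v)\<bar> \<partial>count_space UNIV)
      + \<bar>1 - 1 / Z n\<bar> * (\<kappa> / lat.covol) * lat.gsum (scale n) (center n y))" if "y \<in> Rep r" for y
    proof -
      have y: "y \<in> carrier G"
        using Rep_carrier[OF that] .
      have i1: "integrable (count_space UNIV) (\<lambda>v. \<bar>avg n (emb r y v) - \<kappa> * ?g (emb r y v)\<bar>)"
        using integrable_avg[OF y] int[OF y] by auto
      have i2: "integrable (count_space UNIV) (\<lambda>v. \<bar>1 - 1 / Z n\<bar> * \<kappa> * ?g (emb r y v))"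
        using int[OF y] by auto
      have "(\<integral>\<^sup>+v. ennreal \<bar>avg n (emb r y v) - ?N (emb r y v)\<bar> \<partial>count_space UNIV)
        \<le> (\<integral>\<^sup>+v. ennreal (\<bar>avg n (emb r y v) - \<kappa> * ?g (emb r y v)\<bar> + \<bar>1 - 1 / Z n\<bar> * \<kappa> * ?g (emb r y v)) \<partial>count_space UNIV)"
      proof (intro nn_integral_mono ennreal_leI)
        fix v
        have "avg n (emb r y v) - ?N (emb r y v) = (avg n (emb r y v) - \<kappa> * ?g (emb r y v)) + (1 - 1 / Z n) * (\<kappa> * ?g (emb r y v))"
          unfolding gauss_group_eq[OF elim emb_carrier[OF y]] by (simp add: Z_def algebra_simps)
        moreover have "\<bar>(1 - 1 / Z n) * (\<kappa> * ?g (emb r y v))\<bar> = \<bar>1 - 1 / Z n\<bar> * \<kappa> * ?g (emb r y v)"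
          using \<kappa>0 gauss_nonneg[OF s, of "H *v dev n (emb r y v)"] by (simp add: abs_mult)
        ultimately show "\<bar>avg n (emb r y v) - ?N (emb r y v)\<bar> \<le> \<bar>avg n (emb r y v) - \<kappa> * ?g (emb r y v)\<bar> + \<bar>1 - 1 / Z n\<bar> * \<kappa> * ?g (emb r y v)"
          using abs_triangle_ineq[of "avg n (emb r y v) - \<kappa> * ?g (emb r y v)" "(1 - 1 / Z n) * (\<kappa> * ?g (emb r y v))"] by linarith
      qed
      also have "\<dots> = ennreal (\<integral>v. \<bar>avg n (emb r y v) - \<kappa> * ?g (emb r y v)\<bar> + \<bar>1 - 1 / Z n\<bar> * \<kappa> * ?g (emb r y v) \<partial>count_space UNIV)"
        using \<kappa>0 gauss_nonneg[OF s] by (intro nn_integral_eq_integral Bochner_Integration.integrable_add i1 i2 AE_I2 add_nonneg_nonneg mult_nonneg_nonneg) auto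
      also have "(\<integral>v. \<bar>avg n (emb r y v) - \<kappa> * ?g (emb r y v)\<bar> + \<bar>1 - 1 / Z n\<bar> * \<kappa> * ?g (emb r y v) \<partial>count_space UNIV)
        = (\<integral>v. \<bar>avg n (emb r y v) - \<kappa> * ?g (emb r y v)\<bar> \<partial>count_space UNIV) + \<bar>1 - 1 / Z n\<bar> * (\<kappa> / lat.covol) * lat.gsum (scale n) (center n y)"
        unfolding Bochner_Integration.integral_add[OF i1 i2] by (simp add: int(2)[OF y])
      finally show ?thesis .
    qed
    \<comment> \<open>The factor one half in the norm is given away.\<close>
    have "tv_norm (carrier G) (\<lambda>g. avg n g - ?N g) \<le> (\<Sum>\<^sub>\<infinity>g\<in>carrier G. ennreal \<bar>avg n g - ?N g\<bar>)"
      unfolding tv_norm_def by (rule divide_le_posI_ennreal) (simp_all add: mult_2)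
    also have "\<dots> \<le> (\<integral>\<^sup>+g. ennreal \<bar>avg n g - ?N g\<bar> \<partial>count_space (carrier G))"
      by (rule infsum_le_nn_integral)
    also have "\<dots> = (\<Sum>y\<in>Rep r. \<integral>\<^sup>+v. ennreal \<bar>avg n (emb r y v) - ?N (emb r y v)\<bar> \<partial>count_space UNIV)"
      by (rule nn_integral_carrier[OF r])
    also have "\<dots> \<le> (\<Sum>y\<in>Rep r. ennreal ((\<integral>v. \<bar>avg n (emb r y v) - \<kappa> * ?g (emb r y v)\<bar> \<partial>count_space UNIV)
      + \<bar>1 - 1 / Z n\<bar> * (\<kappa> / lat.covol) * lat.gsum (scale n) (center n y)))"
      by (intro sum_mono cls)
    also have "\<dots> = ennreal (B n)"
      unfolding B_def using \<kappa>0 lat.covol_pos lat.gsum_nonneg[OF s]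
      by (intro sum_ennreal add_nonneg_nonneg mult_nonneg_nonneg divide_nonneg_nonneg) auto
    finally show ?case
      unfolding avg_def .
  qed
  then show ?thesis
    by (rule tendsto_sandwich[OF always_eventually[OF allI[OF zero_le]] _ tendsto_const B0])
qed

end

theorem theorem4p7:
  fixes G :: "('a, 'b) monoid_scheme"
    and L D :: "'a set"
    and \<iota> :: "int ^ 'm \<Rightarrow> 'a"
    and \<mu> :: "'a pmf"
    and q :: nat
  assumes "group G"
    and "infinite (carrier G)"
    and "finitely_generated_group G"
    and "normal L G"
    and "finite (rcosets\<^bsub>G\<^esub> L)"
    and "\<iota> \<in> iso int_vec_group (G\<lparr>carrier := L\<rparr>)"
    and "coset_representatives G L D"
    and "one G \<in> D"
    and "set_pmf \<mu> \<subseteq> carrier G"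
    and "finite_second_moment G \<mu>"
    and "semigroup_generates G (set_pmf \<mu>)"
    and "q = period G \<mu>"
  shows "\<exists>Sig :: real ^ 'm ^ 'm.
    pos_def_matrix Sig \<and>
    (\<forall>v1 v2. let u1 = harmonic_part G L \<mu> (hat_form G \<iota> D v1);
                 u2 = harmonic_part G L \<mu> (hat_form G \<iota> D v2)
       in inner v1 (Sig *v v2) =
            (\<Sum>\<^sub>\<infinity>e\<in>diag_E G L \<mu>. u1 e * u2 e * edge_weight G L \<mu> e)
            - (\<Sum>\<^sub>\<infinity>e\<in>diag_E G L \<mu>. u1 e * edge_weight G L \<mu> e)
              * (\<Sum>\<^sub>\<infinity>e\<in>diag_E G L \<mu>. u2 e * edge_weight G L \<mu> e)) \<and>
    (\<lambda>n. tv_norm (carrier G)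
            (\<lambda>g. (1 / real q) * (\<Sum>i<q. pmf (conv_power G \<mu> (q * n + i)) g)
                 - gauss_group G L \<iota> D (q * n) Sig (drift G L \<mu> \<iota> D) g))
      \<longlonglongrightarrow> 0"
proof -
  interpret va_walk G L D \<iota> \<mu>
    using assms
    by (intro va_walk.intro va_group.intro va_group_axioms.intro irreducible_walk.intro group_walk.intro
        group_walk_axioms.intro irreducible_walk_axioms.intro va_walk_axioms.intro)
  obtain H :: "real ^ 'm ^ 'm" where H: "H ** cov ** transpose H = mat 1"
    using pos_def_whitening[OF cov_pos_def] by blast
  obtain r C where "r > 0" "C \<ge> 0" "\<And>w. smooth_under (\<iota> (int r *s w)) (C * (\<Sum>i\<in>UNIV. \<bar>real_of_int (w $ i)\<bar>))"
    using ex_lattice_smoothing by blast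
  with H interpret va_limit G L D \<iota> \<mu> H r C
    by unfold_locales
  show ?thesis
    using cov_pos_def cov_harmonic tv_limit unfolding \<open>q = period G \<mu>\<close> Let_def
    by (intro exI[of _ cov]) blast
qed

end
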